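(* For all fixed $m$ and $k$, regex $k$-UCQs with up to $m$ string equalities can be evaluated with polynomial delay: there is an algorithm that, given a regex $k$-UCQ $q$ with up to $m$ string equalities and a string $\mathbf{s}\in\Sigma^*$, enumerates $[\![q]\!](\mathbf{s})$, each tuple exactly once, with delay polynomial in the size of $(q,\mathbf{s})$.
   Context: Strings and spans. $\Sigma$ is a finite alphabet with $|\Sigma|\ge 2$. A span of $\mathbf{s}=\sigma_1\cdots\sigma_\ell\in\Sigma^*$ is an expression $[i,j\rangle$ with $1\le i\le j\le \ell+1$; $\mathbf{s}_{[i,j\rangle}=\sigma_i\cdots\sigma_{j-1}$. $\mathsf{Vars}$ is an infinite set of variables, disjoint from $\Sigma$. For finite $V\subset\mathsf{Vars}$, a $(V,\mathbf{s})$-tuple is a function from $V$ to the spans of $\mathbf{s}$. Ref-words. For finite $V\subset\mathsf{Vars}$ let $\Gamma_V=\{x{\vdash},\ {\dashv}x \mid x\in V\}$, disjoint from $\Sigma$. A word $\mathbf{r}\in(\Sigma\cup\Gamma_V)^*$ is valid for $V$ if for each $x\in V$ it contains exactly one $x{\vdash}$ and exactly one ${\dashv}x$, the former to the left of the latter. $\mathsf{clr}$ is the morphism erasing $\Gamma_V$ and fixing $\Sigma$. A valid $\mathbf{r}$ with $\mathsf{clr}(\mathbf{r})=\mathbf{s}$ defines the $(V,\mathbf{s})$-tuple $\mu^{\mathbf{r}}$: writing $\mathbf{r}=\mathbf{r}'_x\, x{\vdash}\,\mathbf{r}_x\,{\dashv}x\,\mathbf{r}''_x$, $\mu^{\mathbf{r}}(x)=[i,j\rangle$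 with $i=|\mathsf{clr}(\mathbf{r}'_x)|+1$, $j=i+|\mathsf{clr}(\mathbf{r}_x)|$. Regex formulas. Syntax: $\alpha ::= \emptyset\mid\epsilon\mid\sigma\mid(\alpha\vee\alpha)\mid(\alpha\cdot\alpha)\mid\alpha^*\mid x\{\alpha\}$ with $\sigma\in\Sigma$, $x\in\mathsf{Vars}$. $\mathsf{Vars}(\alpha)$ is the set of variables occurring in $\alpha$. $\mathcal{R}(\alpha)$ is defined as the language of a regular expression, with $\mathcal{R}(x\{\beta\})=x{\vdash}\,\mathcal{R}(\beta)\,{\dashv}x$. $[\![\alpha]\!](\mathbf{s})=\{\mu^{\mathbf{r}}\mid \mathbf{r}\in\mathcal{R}(\alpha)\text{ valid for }\mathsf{Vars}(\alpha),\ \mathsf{clr}(\mathbf{r})=\mathbf{s}\}$. Regex formulas are assumed functional: every word in $\mathcal{R}(\alpha)$ is valid for $\mathsf{Vars}(\alpha)$. Queries. A regex CQ with string equalities is $q=\pi_Y\bigl(\zeta^{=}_{x_1,y_1}\cdots\zeta^{=}_{x_p,y_p}(\alpha_1\bowtie\cdots\bowtie\alpha_l)\bigr)$ with $l\ge1$, $p\ge0$, regex formulas $\alpha_i$, and $Y$ and all $x_j,y_j$ contained in $W=\bigcup_i\mathsf{Vars}(\alpha_i)$. $[\![q]\!](\mathbf{s})$ is the set of restrictions to $Y$ of those $(W,\mathbf{s})$-tuples $\mu$ with $\mu|_{\mathsf{Vars}(\alpha_i)}\in[\![\alpha_i]\!](\mathbf{s})$ for all $i$ and $\mathbf{s}_{\mu(x_j)}=\mathbf{s}_{\mu(y_j)}$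 for all $j$. A regex $k$-UCQ with up to $m$ string equalities is a union (any number of disjuncts) of regex CQs with string equalities, all with the same output variables $Y$, each having at most $k$ regex formulas ($l\le k$) and at most $m$ binary string equality selections ($p\le m$); its semantics is the union of the semantics of the disjuncts. The delay is the time between every two consecutive answers (including the time before the first answer and after the last). *)

theory Defs
  imports Complex_Main "HOL-Computational_Algebra.Polynomial"
begin

section \<open>Spans and tuples\<close>

text \<open>The pair \<open>(i, j)\<close> is the span \<open>[i, j\<rangle>\<close>, with 1-based positions.  A \<open>(V, s)\<close>-tuple is a
  partial map with domain exactly \<open>V\<close>.\<close>

type_synonym span = "nat \<times> nat"

definition is_span :: "'a list \<Rightarrow> span \<Rightarrow> bool" where
  "is_span s sp \<longleftrightarrow> 1 \<le> fst sp \<and> fst sp \<le> snd sp \<and> snd sp \<le> length s + 1"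

definition subword :: "'a list \<Rightarrow> span \<Rightarrow> 'a list" where
  "subword s sp = take (snd sp - fst sp) (drop (fst sp - 1) s)"

definition is_tuple :: "'v set \<Rightarrow> 'a list \<Rightarrow> ('v \<rightharpoonup> span) \<Rightarrow> bool" where
  "is_tuple V s \<mu> \<longleftrightarrow> dom \<mu> = V \<and> (\<forall>sp\<in>ran \<mu>. is_span s sp)"


section \<open>Ref-words\<close>

datatype ('a, 'v) refsym = Letter 'a | Open 'v | Close 'v

type_synonym ('a, 'v) refword = "('a, 'v) refsym list"

fun clr :: "('a, 'v) refword \<Rightarrow> 'a list" where
  "clr [] = []"
| "clr (Letter a # r) = a # clr r"
| "clr (Open x # r) = clr r"
| "clr (Close x # r) = clr r"

definition valid :: "'v set \<Rightarrow> ('a, 'v) refword \<Rightarrow> bool" where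
  "valid V r \<longleftrightarrow>
     (\<forall>x. Open x \<in> set r \<or> Close x \<in> set r \<longrightarrow> x \<in> V) \<and>
     (\<forall>x\<in>V. count_list r (Open x) = 1 \<and> count_list r (Close x) = 1 \<and>
        (\<exists>r1 r2 r3. r = r1 @ Open x # r2 @ Close x # r3))"

text \<open>For \<open>r = r1 @ Open x # r2 @ Close x # r3\<close> valid, \<open>before x r = r1\<close> and \<open>inside x r = r2\<close>.\<close>

definition before :: "'v \<Rightarrow> ('a, 'v) refword \<Rightarrow> ('a, 'v) refword" where
  "before x r = takeWhile (\<lambda>c. c \<noteq> Open x) r"

definition inside :: "'v \<Rightarrow> ('a, 'v) refword \<Rightarrow> ('a, 'v) refword" where
  "inside x r = takeWhile (\<lambda>c. c \<noteq> Close x) (tl (dropWhile (\<lambda>c. c \<noteq> Open x) r))"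

definition tuple_of :: "'v set \<Rightarrow> ('a, 'v) refword \<Rightarrow> ('v \<rightharpoonup> span)" where
  "tuple_of V r = (\<lambda>x. if x \<in> V
     then (let i = length (clr (before x r)) + 1 in Some (i, i + length (clr (inside x r))))
     else None)"


section \<open>Regex formulas\<close>

datatype ('a, 'v) rgx =
    Empty
  | Eps
  | Sym 'a
  | Alt "('a, 'v) rgx" "('a, 'v) rgx"
  | Cat "('a, 'v) rgx" "('a, 'v) rgx"
  | Star "('a, 'v) rgx"
  | Bind 'v "('a, 'v) rgx"

primrec vars :: "('a, 'v) rgx \<Rightarrow> 'v set" where
  "vars Empty = {}"
| "vars Eps = {}"
| "vars (Sym a) = {}"
| "vars (Alt \<alpha> \<beta>) = vars \<alpha> \<union> vars \<beta>"
| "vars (Cat \<alpha> \<beta>) = vars \<alpha> \<union> vars \<beta>"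
| "vars (Star \<alpha>) = vars \<alpha>"
| "vars (Bind x \<alpha>) = insert x (vars \<alpha>)"

primrec ref_lang :: "('a, 'v) rgx \<Rightarrow> ('a, 'v) refword set" where
  "ref_lang Empty = {}"
| "ref_lang Eps = {[]}"
| "ref_lang (Sym a) = {[Letter a]}"
| "ref_lang (Alt \<alpha> \<beta>) = ref_lang \<alpha> \<union> ref_lang \<beta>"
| "ref_lang (Cat \<alpha> \<beta>) = {u @ v | u v. u \<in> ref_lang \<alpha> \<and> v \<in> ref_lang \<beta>}"
| "ref_lang (Star \<alpha>) = {concat us | us. set us \<subseteq> ref_lang \<alpha>}"
| "ref_lang (Bind x \<alpha>) = {Open x # u @ [Close x] | u. u \<in> ref_lang \<alpha>}"

definition functional :: "('a, 'v) rgx \<Rightarrow> bool" where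
  "functional \<alpha> \<longleftrightarrow> (\<forall>r\<in>ref_lang \<alpha>. valid (vars \<alpha>) r)"

definition sem_rgx :: "('a, 'v) rgx \<Rightarrow> 'a list \<Rightarrow> ('v \<rightharpoonup> span) set" where
  "sem_rgx \<alpha> s = {tuple_of (vars \<alpha>) r | r. r \<in> ref_lang \<alpha> \<and> valid (vars \<alpha>) r \<and> clr r = s}"


section \<open>Queries\<close>

text \<open>The set \<open>Y\<close> of output variables is written down as a duplicate-free list \<open>outs\<close>; \<open>eqs\<close> lists
  the selections \<open>\<zeta>\<^sup>=\<close>, and \<open>atoms\<close> the joined regex formulas.\<close>

datatype ('a, 'v) cq =
  CQ (outs: "'v list") (eqs: "('v \<times> 'v) list") (atoms: "('a, 'v) rgx list")

definition vars_cq :: "('a, 'v) cq \<Rightarrow> 'v set" where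
  "vars_cq q = (\<Union>\<alpha>\<in>set (atoms q). vars \<alpha>)"

definition wf_cq :: "('a, 'v) cq \<Rightarrow> bool" where
  "wf_cq q \<longleftrightarrow> atoms q \<noteq> [] \<and> (\<forall>\<alpha>\<in>set (atoms q). functional \<alpha>) \<and>
     distinct (outs q) \<and> set (outs q) \<subseteq> vars_cq q \<and>
     (\<forall>(x, y)\<in>set (eqs q). x \<in> vars_cq q \<and> y \<in> vars_cq q)"

definition sem_cq :: "('a, 'v) cq \<Rightarrow> 'a list \<Rightarrow> ('v \<rightharpoonup> span) set" where
  "sem_cq q s = {\<mu> |` set (outs q) | \<mu>.
     is_tuple (vars_cq q) s \<mu> \<and>
     (\<forall>\<alpha>\<in>set (atoms q). \<mu> |` vars \<alpha> \<in> sem_rgx \<alpha> s) \<and>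
     (\<forall>(x, y)\<in>set (eqs q). subword s (the (\<mu> x)) = subword s (the (\<mu> y)))}"

text \<open>A union of regex CQs is the list of its disjuncts.  The disjuncts have the same set of output
  variables, possibly listed in different orders.\<close>

type_synonym ('a, 'v) ucq = "('a, 'v) cq list"

definition wf_ucq :: "nat \<Rightarrow> nat \<Rightarrow> ('a, 'v) ucq \<Rightarrow> bool" where
  "wf_ucq k m Q \<longleftrightarrow>
     (\<forall>q\<in>set Q. wf_cq q \<and> length (atoms q) \<le> k \<and> length (eqs q) \<le> m) \<and>
     (\<forall>q\<in>set Q. \<forall>q'\<in>set Q. set (outs q) = set (outs q'))"

definition sem_ucq :: "('a, 'v) ucq \<Rightarrow> 'a list \<Rightarrow> ('v \<rightharpoonup> span) set" where
  "sem_ucq Q s = (\<Union>q\<in>set Q. sem_cq q s)"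


section \<open>Machine model\<close>

text \<open>A random access machine in the style of Cook and Reckhow with a read-only input tape, a
  write-only output tape and indirect addressing.  The arithmetic is restricted to successor and
  predecessor, so that after \<open>t\<close> steps no register or address exceeds \<open>t\<close> plus a constant depending on
  the program and the input; unit cost is therefore a realistic time measure, even for the
  exponentially long runs that occur in enumeration.  Such machines are simulated step by step by
  RAMs with addition, and with polynomial overhead by Turing machines.\<close>

datatype instr =
    Const nat nat   \<comment> \<open>\<open>X\<^sub>i := c\<close>\<close>
  | Move nat nat    \<comment> \<open>\<open>X\<^sub>i := X\<^sub>j\<close>\<close>
  | Succ nat        \<comment> \<open>\<open>X\<^sub>i := X\<^sub>i + 1\<close>\<close>
  | Pred nat        \<comment> \<open>\<open>X\<^sub>i := X\<^sub>i - 1\<close>, truncated at 0\<close>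
  | Load nat nat    \<comment> \<open>\<open>X\<^sub>i := X\<close> at address \<open>X\<^sub>j\<close>\<close>
  | Store nat nat   \<comment> \<open>\<open>X\<close> at address \<open>X\<^sub>i\<close> \<open>:= X\<^sub>j\<close>\<close>
  | JumpPos nat nat \<comment> \<open>continue at instruction \<open>l\<close> if \<open>X\<^sub>i > 0\<close>\<close>
  | Read nat        \<comment> \<open>\<open>X\<^sub>i :=\<close> next input symbol, or 0 at the end of the input\<close>
  | Print nat       \<comment> \<open>append \<open>X\<^sub>i\<close> to the output tape\<close>

type_synonym ram_program = "instr list"

record ram =
  pc :: nat
  regs :: "nat \<Rightarrow> nat"
  inp :: "nat list"

fun exec :: "instr \<Rightarrow> ram \<Rightarrow> ram" where
  "exec (Const i c) M = M\<lparr>pc := pc M + 1, regs := (regs M)(i := c)\<rparr>"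
| "exec (Move i j) M = M\<lparr>pc := pc M + 1, regs := (regs M)(i := regs M j)\<rparr>"
| "exec (Succ i) M = M\<lparr>pc := pc M + 1, regs := (regs M)(i := regs M i + 1)\<rparr>"
| "exec (Pred i) M = M\<lparr>pc := pc M + 1, regs := (regs M)(i := regs M i - 1)\<rparr>"
| "exec (Load i j) M = M\<lparr>pc := pc M + 1, regs := (regs M)(i := regs M (regs M j))\<rparr>"
| "exec (Store i j) M = M\<lparr>pc := pc M + 1, regs := (regs M)(regs M i := regs M j)\<rparr>"
| "exec (JumpPos i l) M = M\<lparr>pc := (if regs M i > 0 then l else pc M + 1)\<rparr>"
| "exec (Read i) M = M\<lparr>pc := pc M + 1,
     regs := (regs M)(i := (case inp M of [] \<Rightarrow> 0 | c # _ \<Rightarrow> c)), inp := tl (inp M)\<rparr>"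
| "exec (Print i) M = M\<lparr>pc := pc M + 1\<rparr>"

definition halted :: "ram_program \<Rightarrow> ram \<Rightarrow> bool" where
  "halted P M \<longleftrightarrow> pc M \<ge> length P"

definition step :: "ram_program \<Rightarrow> ram \<Rightarrow> ram" where
  "step P M = (if halted P M then M else exec (P ! pc M) M)"

definition init :: "nat list \<Rightarrow> ram" where
  "init w = \<lparr>pc = 0, regs = (\<lambda>_. 0), inp = w\<rparr>"

definition run :: "ram_program \<Rightarrow> nat list \<Rightarrow> nat \<Rightarrow> ram" where
  "run P w t = (step P ^^ t) (init w)"

definition halts_at :: "ram_program \<Rightarrow> nat list \<Rightarrow> nat \<Rightarrow> bool" where
  "halts_at P w T \<longleftrightarrow> halted P (run P w T) \<and> (\<forall>t<T. \<not> halted P (run P w t))"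

definition printed :: "ram_program \<Rightarrow> ram \<Rightarrow> nat option" where
  "printed P M = (if halted P M then None
     else (case P ! pc M of Print i \<Rightarrow> Some (regs M i) | _ \<Rightarrow> None))"

definition output_tape :: "ram_program \<Rightarrow> nat list \<Rightarrow> nat \<Rightarrow> nat list" where
  "output_tape P w T = List.map_filter (\<lambda>t. printed P (run P w t)) [0..<T]"

text \<open>An answer is a word of positive numbers followed by the end marker 0, and it counts as produced
  once that 0 has been printed.\<close>

definition answer_times :: "ram_program \<Rightarrow> nat list \<Rightarrow> nat \<Rightarrow> nat list" where
  "answer_times P w T = map Suc (filter (\<lambda>t. printed P (run P w t) = Some 0) [0..<T])"

text \<open>On input \<open>w\<close>, program \<open>P\<close> enumerates the set \<open>A\<close> without repetitions, with delay at most \<open>d\<close>, and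
  halts, where \<open>enc\<close> says how answers are written.  The times \<open>0\<close> and \<open>T\<close> in the last line account for
  the delay before the first and after the last answer.\<close>

definition enumerates :: "ram_program \<Rightarrow> nat list \<Rightarrow> ('b \<Rightarrow> nat list) \<Rightarrow> 'b set \<Rightarrow> nat \<Rightarrow> bool" where
  "enumerates P w enc A d \<longleftrightarrow> (\<exists>T as.
     halts_at P w T \<and>
     distinct as \<and> set as = A \<and>
     output_tape P w T = concat (map (\<lambda>a. enc a @ [0]) as) \<and>
     successively (\<lambda>t t'. t' \<le> t + d) (0 # answer_times P w T @ [T]))"


section \<open>Input and output encoding\<close>

text \<open>Inputs are words over the fixed token set \<open>{0..11}\<close>.  Letters and variables are named by bit
  strings, given by \<open>ltr\<close> and \<open>name\<close>, so that the length of the encoding is the usual size of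
  \<open>(q, s)\<close>, in which the length of variable names counts.\<close>

definition enc_bits :: "bool list \<Rightarrow> nat list" where
  "enc_bits bs = map (\<lambda>b. if b then 1 else 0) bs @ [2]"

definition enc_list :: "('b \<Rightarrow> nat list) \<Rightarrow> 'b list \<Rightarrow> nat list" where
  "enc_list f xs = concat (map (\<lambda>x. 3 # f x) xs) @ [4]"

primrec enc_rgx ::
  "('a \<Rightarrow> bool list) \<Rightarrow> ('v \<Rightarrow> bool list) \<Rightarrow> ('a, 'v) rgx \<Rightarrow> nat list" where
  "enc_rgx ltr name Empty = [5]"
| "enc_rgx ltr name Eps = [6]"
| "enc_rgx ltr name (Sym a) = 7 # enc_bits (ltr a)"
| "enc_rgx ltr name (Alt \<alpha> \<beta>) = 8 # enc_rgx ltr name \<alpha> @ enc_rgx ltr name \<beta>"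
| "enc_rgx ltr name (Cat \<alpha> \<beta>) = 9 # enc_rgx ltr name \<alpha> @ enc_rgx ltr name \<beta>"
| "enc_rgx ltr name (Star \<alpha>) = 10 # enc_rgx ltr name \<alpha>"
| "enc_rgx ltr name (Bind x \<alpha>) = 11 # enc_bits (name x) @ enc_rgx ltr name \<alpha>"

definition enc_cq ::
  "('a \<Rightarrow> bool list) \<Rightarrow> ('v \<Rightarrow> bool list) \<Rightarrow> ('a, 'v) cq \<Rightarrow> nat list" where
  "enc_cq ltr name q =
     enc_list (\<lambda>x. enc_bits (name x)) (outs q) @
     enc_list (\<lambda>(x, y). enc_bits (name x) @ enc_bits (name y)) (eqs q) @
     enc_list (enc_rgx ltr name) (atoms q)"

definition enc_input ::
  "('a \<Rightarrow> bool list) \<Rightarrow> ('v \<Rightarrow> bool list) \<Rightarrow> ('a, 'v) ucq \<Rightarrow> 'a list \<Rightarrow> nat list" where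
  "enc_input ltr name Q s =
     enc_list (enc_cq ltr name) Q @ enc_list (\<lambda>a. enc_bits (ltr a)) s"

text \<open>An answer is written as the row of its span endpoints, in the order in which the first disjunct
  lists the output variables.  As endpoints are positive, the end marker 0 does not occur in a row.\<close>

definition row :: "'v list \<Rightarrow> ('v \<rightharpoonup> span) \<Rightarrow> nat list" where
  "row ys \<mu> = concat (map (\<lambda>y. [fst (the (\<mu> y)), snd (the (\<mu> y))]) ys)"

fun header :: "('a, 'v) ucq \<Rightarrow> 'v list" where
  "header [] = []"
| "header (q # _) = outs q"

end

theory Submission
  imports Defs "HOL-Library.List_Lexorder"
begin

text \<open>Answers are enumerated in lexicographic order of their rows: the successor of a row keeps the
  longest possible prefix, raises the next coordinate as little as possible, and completes the prefix
  greedily.  Each choice asks whether some answer has a given prefix.  Since the number of joined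
  formulas and of string equalities is bounded, this question is a fixed formula of first-order logic
  with reachability over tuples of positions of the input word: guess one disjunct, the spans of the
  variables in the equalities, and run the position automata of its regex formulas in parallel, where
  a state of a functional formula determines which variables have been opened and closed.
  Predicates of this form are closed under the connectives, quantifiers and reachability, and are
  decided by polynomial-time programs on the machine, with an array for every relation.\<close>

section \<open>While programs and a compiler to jump code, with traces that record time and
  output\<close>

section \<open>Structured programs for the machine\<close>

text \<open>Two disjuncts may share answers, and there may be exponentially many answers; passing to
  the least larger row excludes repetitions with no record of what was printed. The number of
  variables is unbounded, so a tuple as a whole cannot be guessed within a bounded number of
  registers. Variables outside the equalities are instead compared between the formulas at every
  boundary between letters; an endpoint is recovered from the boundaries at which its operation has
  already happened (\<open>thresholds_eq\<close>). This keeps the product at dimension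
  \<open>2 * k + 1\<close>, so its reachability table is polynomial for fixed \<open>k\<close>. The
  machine can only count, so addresses are formed digit by digit in base \<open>sz\<close>, with
  multiplication as repeated addition. The end of the input reads like token 0, so the reader finds
  it by counting list terminators. Every row gets a leading 1: it then exceeds the all-zero row of
  the initial memory, and the first answer is an ordinary successor, even if there are no output
  variables.\<close>

datatype prog =
    Prim instr
  | Seq prog prog  (infixr ";;" 60)
  | Cond nat prog prog
  | Loop nat prog

type_synonym mem = "nat \<Rightarrow> nat"

fun jump_free :: "instr \<Rightarrow> bool" where
  "jump_free (JumpPos i l) = False"
| "jump_free _ = True"

fun emit :: "instr \<Rightarrow> mem \<Rightarrow> nat option" where
  "emit (Print i) r = Some (r i)"
| "emit _ r = None"

fun eff :: "instr \<Rightarrow> mem \<times> nat list \<Rightarrow> mem \<times> nat list" where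
  "eff (Const i c) (r, w) = (r(i := c), w)"
| "eff (Move i j) (r, w) = (r(i := r j), w)"
| "eff (Succ i) (r, w) = (r(i := r i + 1), w)"
| "eff (Pred i) (r, w) = (r(i := r i - 1), w)"
| "eff (Load i j) (r, w) = (r(i := r (r j)), w)"
| "eff (Store i j) (r, w) = (r(r i := r j), w)"
| "eff (JumpPos i l) (r, w) = (r, w)"
| "eff (Read i) (r, w) = (r(i := (case w of [] \<Rightarrow> 0 | c # _ \<Rightarrow> c)), tl w)"
| "eff (Print i) (r, w) = (r, w)"

text \<open>Register 0 is overwritten by the unconditional jumps of the compiled code.  The list records,
  for every machine step, what the step prints.\<close>

inductive runs :: "prog \<Rightarrow> mem \<times> nat list \<Rightarrow> nat option list \<Rightarrow> mem \<times> nat list \<Rightarrow> bool"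
  and iter :: "nat \<Rightarrow> prog \<Rightarrow> mem \<times> nat list \<Rightarrow> nat option list \<Rightarrow> mem \<times> nat list \<Rightarrow> bool" where
  prim: "jump_free i \<Longrightarrow> runs (Prim i) S [emit i (fst S)] (eff i S)"
| seq: "runs c S tr S' \<Longrightarrow> runs d S' tr' S'' \<Longrightarrow> runs (c ;; d) S (tr @ tr') S''"
| cond_pos: "r x > 0 \<Longrightarrow> runs c (r, w) tr S' \<Longrightarrow> runs (Cond x c d) (r, w) (None # tr) S'"
| cond_zero: "r x = 0 \<Longrightarrow> runs d (r, w) tr (r', w') \<Longrightarrow>
    runs (Cond x c d) (r, w) (None # tr @ [None, None]) (r'(0 := 1), w')"
| loop: "iter x c (r(0 := 1), w) tr S' \<Longrightarrow> runs (Loop x c) (r, w) (None # None # tr) S'"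
| iter_end: "r x = 0 \<Longrightarrow> iter x c (r, w) [None] (r, w)"
| iter_step: "r x > 0 \<Longrightarrow> runs c (r, w) tr S' \<Longrightarrow> iter x c S' tr' S'' \<Longrightarrow>
    iter x c (r, w) (None # tr @ tr') S''"

fun code_len :: "prog \<Rightarrow> nat" where
  "code_len (Prim i) = 1"
| "code_len (c ;; d) = code_len c + code_len d"
| "code_len (Cond x c d) = code_len c + code_len d + 3"
| "code_len (Loop x c) = code_len c + 3"

text \<open>\<open>a\<close> is the address of the first instruction, needed since jumps are
  absolute. A conditional puts its else branch first, so that only this branch pays for a jump over
  the other one. A loop is entered by a jump to its closing test, so that a round costs one
  test.\<close>

fun compile :: "nat \<Rightarrow> prog \<Rightarrow> instr list" where
  "compile a (Prim i) = [i]"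
| "compile a (c ;; d) = compile a c @ compile (a + code_len c) d"
| "compile a (Cond x c d) =
     JumpPos x (a + code_len d + 3) # compile (a + 1) d @
     [Const 0 1, JumpPos 0 (a + code_len d + 3 + code_len c)] @ compile (a + code_len d + 3) c"
| "compile a (Loop x c) =
     [Const 0 1, JumpPos 0 (a + 2 + code_len c)] @ compile (a + 2) c @ [JumpPos x (a + 2)]"

lemma length_compile [simp]: "length (compile a c) = code_len c"
  by (induction a c rule: compile.induct) auto

definition mruns :: "ram_program \<Rightarrow> ram \<Rightarrow> nat option list \<Rightarrow> ram \<Rightarrow> bool" where
  "mruns P M tr M' \<longleftrightarrow> (step P ^^ length tr) M = M' \<and>
     (\<forall>i<length tr. \<not> halted P ((step P ^^ i) M) \<and> printed P ((step P ^^ i) M) = tr ! i)"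

lemma mruns_Nil: "mruns P M [] M"
  by (simp add: mruns_def)

lemma mruns_append:
  assumes "mruns P M tr M'" "mruns P M' tr' M''"
  shows "mruns P M (tr @ tr') M''"
  unfolding mruns_def
proof (intro conjI allI impI)
  have shift: "(step P ^^ (length tr + j)) M = (step P ^^ j) M'" for j
    using assms(1) by (subst add.commute) (simp add: funpow_add mruns_def)
  show "(step P ^^ length (tr @ tr')) M = M''"
    using assms(2) by (simp add: shift mruns_def)
  fix i assume i: "i < length (tr @ tr')"
  show "\<not> halted P ((step P ^^ i) M)" "printed P ((step P ^^ i) M) = (tr @ tr') ! i"
    using assms i shift[of "i - length tr"] by (cases "i < length tr"; auto simp: mruns_def nth_append)+
qed

lemma mruns_Cons:
  assumes "pc M < length P" "printed P M = x" "mruns P (exec (P ! pc M) M) tr M'"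
  shows "mruns P M (x # tr) M'"
proof -
  have "mruns P M [x] (exec (P ! pc M) M)"
    using assms(1,2) by (simp add: mruns_def step_def halted_def)
  from mruns_append[OF this assms(3)] show ?thesis by simp
qed

abbreviation cfg :: "nat \<Rightarrow> mem \<times> nat list \<Rightarrow> ram" where
  "cfg a S \<equiv> \<lparr>pc = a, regs = fst S, inp = snd S\<rparr>"

lemma exec_jump_free: "jump_free i \<Longrightarrow> exec i (cfg a S) = cfg (Suc a) (eff i S)"
  by (cases i; cases S) auto

text \<open>For \<open>iter\<close> the control is on the test behind the loop body: both the entry
  jump and every finished round arrive there. Hence the code is the body followed by the test, and
  the run starts at the end of the body.\<close>

lemma compile_correct:
  "runs c S tr S' \<Longrightarrow> P = pre @ compile (length pre) c @ post \<Longrightarrow>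
     mruns P (cfg (length pre) S) tr (cfg (length pre + code_len c) S')"
  "iter x c S tr S' \<Longrightarrow> P = pre @ compile (length pre) c @ JumpPos x (length pre) # post \<Longrightarrow>
     mruns P (cfg (length pre + code_len c) S) tr (cfg (length pre + code_len c + 1) S')"
proof (induction arbitrary: pre post and pre post rule: runs_iter.inducts)
  case (prim i S)
  have "printed P (cfg (length pre) S) = emit i (fst S)"
    using prim by (cases i) (auto simp: printed_def halted_def nth_append)
  then show ?case
    using prim by (intro mruns_Cons) (auto simp: exec_jump_free nth_append mruns_Nil)
next
  case (seq c S tr S' d tr' S'')
  have "mruns P (cfg (length pre) S) tr (cfg (length pre + code_len c) S')"
    using seq.prems by (intro seq.IH(1)) auto
  moreover have "mruns P (cfg (length (pre @ compile (length pre) c)) S') tr'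
      (cfg (length (pre @ compile (length pre) c) + code_len d) S'')"
    using seq.prems by (intro seq.IH(2)) auto
  ultimately show ?case
    by (auto intro: mruns_append simp: add.assoc)
next
  case (cond_pos r x c w tr S' d)
  let ?pre = "pre @ JumpPos x (length pre + code_len d + 3) # compile (length pre + 1) d @
     [Const 0 1, JumpPos 0 (length pre + code_len d + 3 + code_len c)]"
  have "mruns P (cfg (length ?pre) (r, w)) tr (cfg (length ?pre + code_len c) S')"
    using cond_pos.prems by (intro cond_pos.IH) (auto simp: numeral_3_eq_3)
  then show ?case
    using cond_pos.prems cond_pos.hyps
    by (intro mruns_Cons) (auto simp: nth_append printed_def halted_def numeral_3_eq_3 ac_simps)
next
  case (cond_zero r x d w tr r' w' c)
  let ?pre = "pre @ [JumpPos x (length pre + code_len d + 3)]"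
  have "mruns P (cfg (length ?pre) (r, w)) tr (cfg (length ?pre + code_len d) (r', w'))"
    using cond_zero.prems by (intro cond_zero.IH) (auto simp: numeral_3_eq_3 ac_simps fun_upd_def)
  moreover have "P ! (Suc (length pre + code_len d)) = Const 0 1"
     "P ! (Suc (Suc (length pre + code_len d))) =
        JumpPos 0 (length pre + code_len d + 3 + code_len c)"
    using cond_zero.prems by (auto simp: nth_append)
  then have "mruns P (cfg (length ?pre + code_len d) (r', w')) [None, None]
      (cfg (length pre + code_len (Cond x c d)) (r'(0 := 1), w'))"
    using cond_zero.prems
    by (intro mruns_Cons) (auto simp: printed_def halted_def mruns_Nil numeral_3_eq_3 ac_simps fun_upd_def)
  ultimately have "mruns P (cfg (length ?pre) (r, w)) (tr @ [None, None])
      (cfg (length pre + code_len (Cond x c d)) (r'(0 := 1), w'))"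
    by (rule mruns_append)
  then show ?case
    using cond_zero.prems cond_zero.hyps
    by (intro mruns_Cons) (auto simp: nth_append printed_def halted_def numeral_3_eq_3 ac_simps fun_upd_def)
next
  case (loop x c r w tr S')
  let ?pre = "pre @ [Const 0 1, JumpPos 0 (length pre + 2 + code_len c)]"
  have "mruns P (cfg (length ?pre + code_len c) (r(0 := 1), w)) tr
      (cfg (length ?pre + code_len c + 1) S')"
    using loop.prems by (intro loop.IH) auto
  moreover have "P ! length pre = Const 0 1"
     "P ! (Suc (length pre)) = JumpPos 0 (length pre + 2 + code_len c)"
    using loop.prems by (auto simp: nth_append)
  ultimately show ?case
    using loop.prems
    by (intro mruns_Cons) (auto simp: printed_def halted_def numeral_3_eq_3 ac_simps)
next
  case (iter_end r x c w)
  have "P ! (length pre + code_len c) = JumpPos x (length pre)"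
    using iter_end.prems by (auto simp: nth_append)
  then show ?case
    using iter_end by (intro mruns_Cons) (auto simp: printed_def halted_def mruns_Nil)
next
  case (iter_step r x c w tr S' tr' S'')
  have at: "P ! (length pre + code_len c) = JumpPos x (length pre)"
    using iter_step.prems by (auto simp: nth_append)
  have "mruns P (cfg (length pre) (r, w)) tr (cfg (length pre + code_len c) S')"
    using iter_step.prems by (intro iter_step.IH(1)) auto
  moreover have "mruns P (cfg (length pre + code_len c) S') tr' (cfg (length pre + code_len c + 1) S'')"
    using iter_step.prems by (intro iter_step.IH(2)) auto
  ultimately have "mruns P (cfg (length pre) (r, w)) (tr @ tr') (cfg (length pre + code_len c + 1) S'')"
    by (rule mruns_append)
  then show ?case
    using at iter_step.hyps(1) iter_step.prems
    by (intro mruns_Cons) (auto simp: printed_def halted_def)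
qed

text \<open>A trace has one entry per machine step, so its length is the halting time and its zeros
  give the answer times.\<close>

lemma runs_program:
  assumes "runs c ((\<lambda>_. 0), w) tr S'"
  shows "halts_at (compile 0 c) w (length tr)"
    and "output_tape (compile 0 c) w (length tr) = List.map_filter id tr"
    and "answer_times (compile 0 c) w (length tr) = map Suc (filter (\<lambda>t. tr ! t = Some 0) [0..<length tr])"
proof -
  let ?P = "compile 0 c"
  have m: "mruns ?P (init w) tr (cfg (code_len c) S')"
    using compile_correct(1)[OF assms, of ?P "[]" "[]"] by (simp add: init_def)
  then have pr: "printed ?P (run ?P w i) = tr ! i" if "i < length tr" for i
    using that by (simp add: mruns_def run_def)
  show "halts_at ?P w (length tr)"
    using m by (auto simp: halts_at_def mruns_def run_def halted_def)
  have "List.map_filter (\<lambda>t. printed ?P (run ?P w t)) [0..<length tr] = List.map_filter (\<lambda>t. tr ! t) [0..<length tr]"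
    unfolding List.map_filter_def using pr by (auto intro!: map_cong filter_cong)
  also have "\<dots> = List.map_filter id (map (\<lambda>t. tr ! t) [0..<length tr])"
    by (simp only: List.map_filter_def filter_map map_map comp_def id_apply)
  also have "\<dots> = List.map_filter id tr"
    by (simp only: map_nth)
  finally show "output_tape ?P w (length tr) = List.map_filter id tr"
    unfolding output_tape_def .
  show "answer_times ?P w (length tr) = map Suc (filter (\<lambda>t. tr ! t = Some 0) [0..<length tr])"
    unfolding answer_times_def using pr by (auto intro!: map_cong filter_cong)
qed

section \<open>Cost calculus for programs; radix addresses for arrays of any dimension\<close>

section \<open>Polynomially bounded programs\<close>

definition outputs :: "nat option list \<Rightarrow> nat list" where
  "outputs tr = List.map_filter id tr"

lemma outputs_simps [simp]:
  "outputs [] = []" "outputs (None # tr) = outputs tr" "outputs (Some v # tr) = v # outputs tr"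
  "outputs (tr @ tr') = outputs tr @ outputs tr'"
  by (simp_all add: outputs_def List.map_filter_def)

lemma concat_map_Nil [simp]: "concat (map (\<lambda>_. []) xs) = []"
  by (induction xs) auto

text \<open>The input tape is arbitrary and stays as it is, which fits everything done after the
  input has been read. Programs that read are treated with \<open>runs\<close> directly.\<close>

definition does :: "prog \<Rightarrow> mem \<Rightarrow> mem \<Rightarrow> nat list \<Rightarrow> nat \<Rightarrow> bool" where
  "does c r r' out B \<longleftrightarrow>
     (\<forall>w. \<exists>tr. runs c (r, w) tr (r', w) \<and> outputs tr = out \<and> length tr \<le> B)"

lemma does_mono: "does c r r' out B \<Longrightarrow> B \<le> B' \<Longrightarrow> does c r r' out B'"
  unfolding does_def by (meson order_trans)

lemma does_prim:
  assumes "jump_free i" "\<forall>j. i \<noteq> Read j"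
  shows "does (Prim i) r (fst (eff i (r, []))) (outputs [emit i r]) 1"
  unfolding does_def
proof
  fix w
  have "eff i (r, w) = (fst (eff i (r, [])), w)"
    using assms by (cases i) (auto simp: fun_eq_iff split: list.splits)
  then show "\<exists>tr. runs (Prim i) (r, w) tr (fst (eff i (r, [])), w) \<and>
      outputs tr = outputs [emit i r] \<and> length tr \<le> 1"
    using prim[OF assms(1), of "(r, w)"] by (intro exI[of _ "[emit i r]"]) simp
qed

lemma does_Const: "does (Prim (Const i c)) r (r(i := c)) [] 1"
  and does_Move: "does (Prim (Move i j)) r (r(i := r j)) [] 1"
  and does_Succ: "does (Prim (Succ i)) r (r(i := r i + 1)) [] 1"
  and does_Pred: "does (Prim (Pred i)) r (r(i := r i - 1)) [] 1"
  and does_Load: "does (Prim (Load i j)) r (r(i := r (r j))) [] 1"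
  and does_Store: "does (Prim (Store i j)) r (r(r i := r j)) [] 1"
  and does_Print: "does (Prim (Print i)) r r [r i] 1"
  using does_prim[of "Const i c" r] does_prim[of "Move i j" r] does_prim[of "Succ i" r]
    does_prim[of "Pred i" r] does_prim[of "Load i j" r] does_prim[of "Store i j" r]
    does_prim[of "Print i" r] by simp_all

lemma does_seq:
  assumes "does c r r1 out1 B1" "does d r1 r2 out2 B2"
  shows "does (c ;; d) r r2 (out1 @ out2) (B1 + B2)"
  unfolding does_def
proof
  fix w
  obtain tr1 tr2 where "runs c (r, w) tr1 (r1, w)" "outputs tr1 = out1" "length tr1 \<le> B1"
    "runs d (r1, w) tr2 (r2, w)" "outputs tr2 = out2" "length tr2 \<le> B2"
    using assms unfolding does_def by meson
  then show "\<exists>tr. runs (c ;; d) (r, w) tr (r2, w) \<and> outputs tr = out1 @ out2 \<and>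
      length tr \<le> B1 + B2"
    by (intro exI[of _ "tr1 @ tr2"]) (auto intro: seq)
qed

lemma does_seq0:
  assumes "does c r r1 [] B1" "does d r1 r2 out B2"
  shows "does (c ;; d) r r2 out (B1 + B2)"
  using does_seq[OF assms] by simp

lemma does_cond_pos:
  assumes "r x > 0" "does c r r' out B"
  shows "does (Cond x c d) r r' out (B + 1)"
  unfolding does_def
proof
  fix w
  obtain tr where "runs c (r, w) tr (r', w)" "outputs tr = out" "length tr \<le> B"
    using assms unfolding does_def by meson
  then show "\<exists>tr. runs (Cond x c d) (r, w) tr (r', w) \<and> outputs tr = out \<and> length tr \<le> B + 1"
    using assms(1) by (intro exI[of _ "None # tr"]) (auto intro: cond_pos)
qed

lemma does_cond_zero:
  assumes "r x = 0" "does d r r' out B"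
  shows "does (Cond x c d) r (r'(0 := 1)) out (B + 3)"
  unfolding does_def
proof
  fix w
  obtain tr where "runs d (r, w) tr (r', w)" "outputs tr = out" "length tr \<le> B"
    using assms unfolding does_def by meson
  then show "\<exists>tr. runs (Cond x c d) (r, w) tr (r'(0 := 1), w) \<and> outputs tr = out \<and>
      length tr \<le> B + 3"
    using assms(1) cond_zero[of r x d w tr r' w c]
    by (intro exI[of _ "None # tr @ [None, None]"]) simp
qed

text \<open>The bound counts two steps for the entry jump, one test per round, and the final
  test.\<close>

lemma does_loop:
  assumes start: "\<rho> 0 = r(0 := 1)"
    and body: "\<And>i. i < N \<Longrightarrow> \<rho> i x > 0 \<and> does c (\<rho> i) (\<rho> (Suc i)) (out i) B"
    and stop: "\<rho> N x = 0"
  shows "does (Loop x c) r (\<rho> N) (concat (map out [0..<N])) (3 + N * (B + 1))"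
  unfolding does_def
proof
  fix w
  have "\<exists>tr. iter x c (\<rho> i, w) tr (\<rho> N, w) \<and>
      outputs tr = concat (map out [i..<N]) \<and> length tr \<le> 1 + (N - i) * (B + 1)"
    if "i \<le> N" for i
    using that
  proof (induction i rule: inc_induct)
    case base
    show ?case
      using iter_end[of "\<rho> N" x c w] stop by (intro exI[of _ "[None]"]) simp
  next
    case (step i)
    obtain tr1 where tr1: "runs c (\<rho> i, w) tr1 (\<rho> (Suc i), w)" "outputs tr1 = out i"
      "length tr1 \<le> B"
      using body[of i] step.hyps unfolding does_def by meson
    obtain tr2 where tr2: "iter x c (\<rho> (Suc i), w) tr2 (\<rho> N, w)"
      "outputs tr2 = concat (map out [Suc i..<N])" "length tr2 \<le> 1 + (N - Suc i) * (B + 1)"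
      using step.IH by blast
    have "N - i = Suc (N - Suc i)"
      using step.hyps by simp
    then have len: "length tr1 + length tr2 + 1 \<le> 1 + (N - i) * (B + 1)"
      using tr1(3) tr2(3) by simp
    have out: "concat (map out [i..<N]) = out i @ concat (map out [Suc i..<N])"
      using step.hyps by (simp add: upt_conv_Cons)
    show ?case
      using iter_step[OF _ tr1(1) tr2(1)] body[of i] step.hyps tr1 tr2 len out
      by (intro exI[of _ "None # tr1 @ tr2"]) (auto)
  qed
  from this[of 0] obtain tr where "iter x c (r(0 := 1), w) tr (\<rho> N, w)"
    "outputs tr = concat (map out [0..<N])" "length tr \<le> 1 + N * (B + 1)"
    using start by auto
  then show "\<exists>tr. runs (Loop x c) (r, w) tr (\<rho> N, w) \<and>
      outputs tr = concat (map out [0..<N]) \<and> length tr \<le> 3 + N * (B + 1)"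
    by (intro exI[of _ "None # None # tr"]) (auto intro: loop)
qed

text \<open>For rounds that are known to end in some memory satisfying \<open>J\<close>, but without
  a closed form for it; dependent choice produces the sequence that \<open>does_loop\<close> asks
  for.\<close>

lemma does_loop_inv:
  assumes start: "J 0 (r(0 := 1))"
    and body: "\<And>i r. i < N \<Longrightarrow> J i r \<Longrightarrow> r x > 0 \<and> (\<exists>r'. does c r r' (out i) B \<and> J (Suc i) r')"
    and stop: "\<And>r. J N r \<Longrightarrow> r x = 0"
  shows "\<exists>r'. does (Loop x c) r r' (concat (map out [0..<N])) (3 + N * (B + 1)) \<and> J N r'"
proof -
  have "\<exists>\<rho>. \<forall>i. (i \<le> N \<longrightarrow> J i (\<rho> i)) \<and> (i = 0 \<longrightarrow> \<rho> i = r(0 := 1)) \<and>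
      (i < N \<longrightarrow> does c (\<rho> i) (\<rho> (Suc i)) (out i) B)"
    using dependent_nat_choice[of "\<lambda>i q. (i \<le> N \<longrightarrow> J i q) \<and> (i = 0 \<longrightarrow> q = r(0 := 1))"
        "\<lambda>i q q'. i < N \<longrightarrow> does c q q' (out i) B"] start body
    by (metis Suc_le_eq nat.distinct(1) less_imp_le)
  then obtain \<rho> where \<rho>: "\<And>i. i \<le> N \<Longrightarrow> J i (\<rho> i)" "\<rho> 0 = r(0 := 1)"
    "\<And>i. i < N \<Longrightarrow> does c (\<rho> i) (\<rho> (Suc i)) (out i) B"
    by blast
  have "does (Loop x c) r (\<rho> N) (concat (map out [0..<N])) (3 + N * (B + 1))"
    using \<rho> body stop by (intro does_loop) auto
  then show ?thesis
    using \<rho>(1) by blast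
qed


subsection \<open>Polynomial bounds\<close>

definition pb :: "(nat \<Rightarrow> nat) \<Rightarrow> bool" where
  "pb f \<longleftrightarrow> (\<exists>p :: nat poly. \<forall>n. f n \<le> poly p n)"

lemma pb_const [intro]: "pb (\<lambda>n. c)"
  unfolding pb_def by (intro exI[of _ "[:c:]"]) simp

lemma pb_id [intro]: "pb (\<lambda>n. n)"
  unfolding pb_def by (intro exI[of _ "[:0, 1:]"]) simp

lemma pb_add [intro]: "pb f \<Longrightarrow> pb g \<Longrightarrow> pb (\<lambda>n. f n + g n)"
  unfolding pb_def by (metis add_mono poly_add)

lemma pb_mult [intro]: "pb f \<Longrightarrow> pb g \<Longrightarrow> pb (\<lambda>n. f n * g n)"
  unfolding pb_def by (metis mult_le_mono poly_mult)

lemma pb_power [intro]: "pb f \<Longrightarrow> pb (\<lambda>n. f n ^ k)"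
  by (induction k) (auto intro: pb_const pb_mult)


subsection \<open>Addresses\<close>

text \<open>Horner's scheme for the number with base-\<open>n\<close> digits \<open>ks\<close>, most
  significant first; the machine forms it by the same fold.\<close>

definition hor :: "nat \<Rightarrow> nat list \<Rightarrow> nat" where
  "hor n ks = foldl (\<lambda>a x. a * n + x) 0 ks"

lemma hor_Nil [simp]: "hor n [] = 0"
  and hor_snoc [simp]: "hor n (ks @ [x]) = hor n ks * n + x"
  by (simp_all add: hor_def)

lemma hor_single [simp]: "hor n [x] = x"
  by (simp add: hor_def)

text \<open>A positive leading digit makes digit expansions of different lengths distinct, and a
  second digit lifts the number to at least \<open>n\<close>, clear of the registers.\<close>

definition vkey :: "nat \<Rightarrow> nat list \<Rightarrow> bool" where
  "vkey n ks \<longleftrightarrow> ks \<noteq> [] \<and> 0 < hd ks \<and> tl ks \<noteq> [] \<and> set ks \<subseteq> {..<n}"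

lemma hor_pos: "ks \<noteq> [] \<Longrightarrow> 0 < hd ks \<Longrightarrow> 0 < n \<Longrightarrow> 0 < hor n ks"
proof (induction ks rule: rev_induct)
  case (snoc x ks)
  then show ?case by (cases "ks = []") auto
qed simp

lemma hor_ge: "vkey n ks \<Longrightarrow> n \<le> hor n ks"
proof (cases ks rule: rev_cases)
  case (snoc ys y)
  assume "vkey n ks"
  then have "ys \<noteq> []" "0 < hd ys" "0 < n"
    using snoc by (cases ys; force simp: vkey_def)+
  then have "n * 1 \<le> n * hor n ys"
    by (intro mult_le_mono2) (use hor_pos[of ys n] in simp)
  then show ?thesis
    unfolding snoc hor_snoc by (simp only: mult.commute)
qed (simp add: vkey_def)

lemma hor_inj_aux:
  assumes "ks \<noteq> []" "ls \<noteq> []" "0 < hd ks" "0 < hd ls" "set ks \<subseteq> {..<n}" "set ls \<subseteq> {..<n}"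
    "hor n ks = hor n ls"
  shows "ks = ls"
  using assms
proof (induction ks arbitrary: ls rule: rev_induct)
  case (snoc x ks)
  obtain y ls' where ls: "ls = ls' @ [y]"
    using snoc.prems(2) by (cases ls rule: rev_cases) auto
  have lt: "x < n" "y < n"
    using snoc.prems ls by auto
  have eq: "hor n ks * n + x = hor n ls' * n + y"
    using snoc.prems ls by simp
  then have xy: "x = y"
    using lt by (metis mod_less mod_mult_self3)
  then have h: "hor n ks = hor n ls'"
    using eq lt by simp
  show ?case
  \<comment> \<open>An exhausted list has value 0, whereas a positive leading digit gives a positive
    number; so both lists end together.\<close>
  proof (cases "ks = [] \<or> ls' = []")
    case True
    then have "ks = [] \<and> ls' = []"
      using h hor_pos[of ks n] hor_pos[of ls' n] snoc.prems(3,4) lt ls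
      by (cases "ks = []"; cases "ls' = []") auto
    then show ?thesis using xy ls by simp
  next
    case False
    then have "ks = ls'"
      using snoc.prems ls h by (intro snoc.IH) auto
    then show ?thesis using xy ls by simp
  qed
qed simp

lemma hor_inj: "vkey n ks \<Longrightarrow> vkey n ls \<Longrightarrow> hor n ks = hor n ls \<longleftrightarrow> ks = ls"
  using hor_inj_aux[of ks ls n] by (auto simp: vkey_def)

lemma hor_le: "set xs \<subseteq> {..<n} \<Longrightarrow> hor n (k # xs) \<le> (k + 1) * n ^ length xs"
proof (induction xs rule: rev_induct)
  case Nil
  then show ?case by (simp add: hor_def)
next
  case (snoc x xs)
  \<comment> \<open>The claim must be sharpened by one to pass through the induction: a digit below
    \<open>n\<close> turns a number \<open>h\<close> into one below
    \<open>(h + 1) * n\<close>.\<close>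
  then have le: "hor n (k # xs) + 1 \<le> (k + 1) * n ^ length xs"
  proof -
    have "set xs \<subseteq> {..<n} \<Longrightarrow> hor n (k # xs) + 1 \<le> (k + 1) * n ^ length xs" for xs
    proof (induction xs rule: rev_induct)
      case Nil
      then show ?case by (simp add: hor_def)
    next
      case (snoc x xs)
      then have "hor n (k # xs) * n + n \<le> (k + 1) * n ^ length xs * n"
        by (metis add_mult_distrib mult_1 mult_le_mono1 set_append Un_subset_iff)
      moreover have "x < n"
        using snoc.prems by simp
      ultimately show ?case
        using hor_snoc[of n "k # xs" x] by (simp add: algebra_simps)
    qed
    then show ?thesis using snoc.prems by simp
  qed
  then have "hor n (k # xs) * n + n \<le> (k + 1) * n ^ length xs * n"
    by (metis add_mult_distrib mult_1 mult_le_mono1)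
  moreover have "x < n"
    using snoc.prems by simp
  ultimately show ?case
    using hor_snoc[of n "k # xs" x] by (simp add: algebra_simps)
qed

definition add_prog :: "nat \<Rightarrow> nat \<Rightarrow> nat \<Rightarrow> prog" where
  "add_prog t y z = Prim (Move z y) ;; Loop z (Prim (Succ t) ;; Prim (Pred z))"

lemma does_add:
  assumes "distinct [0, t, y, z]"
  shows "does (add_prog t y z) r (r(0 := 1, t := r t + r y, z := 0)) [] (4 + 3 * r y)"
proof -
  let ?\<rho> = "\<lambda>i. r(0 := 1, t := r t + i, z := r y - i)"
  have "does (Loop z (Prim (Succ t) ;; Prim (Pred z))) (r(z := r y)) (?\<rho> (r y))
     (concat (map (\<lambda>_. []) [0..<r y])) (3 + r y * ((1 + 1) + 1))"
  proof (rule does_loop[where \<rho> = ?\<rho>])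
    fix i assume i: "i < r y"
    have "(?\<rho> i)(t := ?\<rho> i t + 1, z := ((?\<rho> i)(t := ?\<rho> i t + 1)) z - 1) = ?\<rho> (Suc i)"
      using assms by (auto simp: fun_eq_iff)
    then show "0 < ?\<rho> i z \<and> does (Prim (Succ t) ;; Prim (Pred z)) (?\<rho> i) (?\<rho> (Suc i)) [] (1 + 1)"
      using does_seq[OF does_Succ[of t "?\<rho> i"] does_Pred[of z]] i by simp
  qed (use assms in \<open>auto simp: fun_eq_iff\<close>)
  from does_seq[OF does_Move[of z y r] this] show ?thesis
    by (auto simp: add_prog_def algebra_simps intro: does_mono)
qed

text \<open>One Horner step on register 3: multiply by the base in register 1, with register 4 as
  accumulator, and add the digit in register \<open>x\<close>. Repeated addition is affordable
  because the addresses are polynomial in the base.\<close>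

definition mul_prog :: "nat \<Rightarrow> prog" where
  "mul_prog x = Prim (Const 4 0) ;; Loop 3 (add_prog 4 1 5 ;; Prim (Pred 3)) ;;
     Prim (Move 3 4) ;; add_prog 3 x 5"

definition same_outside :: "nat set \<Rightarrow> mem \<Rightarrow> mem \<Rightarrow> bool" where
  "same_outside X r r' \<longleftrightarrow> (\<forall>x. x \<notin> X \<longrightarrow> r' x = r x)"

lemma same_outside_trans:
  "same_outside X r r' \<Longrightarrow> same_outside X r' r'' \<Longrightarrow> same_outside X r r''"
  by (simp add: same_outside_def)

lemma same_outside_mono: "same_outside X r r' \<Longrightarrow> X \<subseteq> Y \<Longrightarrow> same_outside Y r r'"
  by (auto simp: same_outside_def)

lemma does_mul:
  assumes "x \<notin> {0, 3, 4, 5}"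
  shows "\<exists>r'. does (mul_prog x) r r' [] (r 3 * (3 * r 1 + 6) + 3 * r x + 9) \<and>
    r' 3 = r 3 * r 1 + r x \<and> same_outside {0, 3, 4, 5} r r'"
proof -
  let ?r = "r(4 := 0)"
  have "\<exists>r'. does (Loop 3 (add_prog 4 1 5 ;; Prim (Pred 3))) ?r r' (concat (map (\<lambda>_. []) [0..<r 3]))
      (3 + r 3 * ((4 + 3 * r 1 + 1) + 1)) \<and>
      (r' 3 = r 3 - r 3 \<and> r' 4 = r 3 * r 1 \<and> same_outside {0, 3, 4, 5} r r')"
  proof (rule does_loop_inv[where J = "\<lambda>i r'. r' 3 = r 3 - i \<and> r' 4 = i * r 1 \<and> same_outside {0, 3, 4, 5} r r'"])
    fix i r' assume i: "i < r 3" and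
      J: "r' 3 = r 3 - i \<and> r' 4 = i * r 1 \<and> same_outside {0, 3, 4, 5} r r'"
    have eq: "r' 1 = r 1"
      using J by (simp add: same_outside_def)
    show "0 < r' 3 \<and> (\<exists>r''. does (add_prog 4 1 5 ;; Prim (Pred 3)) r' r'' [] (4 + 3 * r 1 + 1) \<and>
       r'' 3 = r 3 - Suc i \<and> r'' 4 = Suc i * r 1 \<and> same_outside {0, 3, 4, 5} r r'')"
      using does_seq[OF does_add[of 4 1 5 r'] does_Pred[of 3]] i J
      by (intro conjI exI[of _ "r'(0 := 1, 4 := r' 4 + r' 1, 5 := 0, 3 := r' 3 - 1)"])
        (auto simp: eq same_outside_def)
  qed (auto simp: same_outside_def)
  then obtain r' where r': "does (Loop 3 (add_prog 4 1 5 ;; Prim (Pred 3))) ?r r' []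
      (3 + r 3 * ((4 + 3 * r 1 + 1) + 1))" "r' 4 = r 3 * r 1" "same_outside {0, 3, 4, 5} r r'"
    by auto
  let ?r' = "r'(3 := r' 4)"
  have x: "?r' x = r x"
    using assms r'(3) by (auto simp: same_outside_def)
  have "does (mul_prog x) r (?r'(0 := 1, 3 := ?r' 3 + ?r' x, 5 := 0)) []
     (1 + ((3 + r 3 * ((4 + 3 * r 1 + 1) + 1)) + (1 + (4 + 3 * ?r' x))))"
    unfolding mul_prog_def
    by (intro does_seq0[OF does_Const] does_seq0[OF r'(1)] does_seq0[OF does_Move] does_add)
      (use assms in auto)
  then show ?thesis
    unfolding x
    by (intro exI conjI) (erule does_mono, use r' in \<open>auto simp: same_outside_def algebra_simps\<close>)
qed

lemma sum_step: "(d :: nat) \<le> t \<Longrightarrow> l \<le> u \<Longrightarrow> 1 + l + d \<le> 1 + (t + u)"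
  by simp

definition addr_prog :: "nat \<Rightarrow> nat list \<Rightarrow> prog" where
  "addr_prog k xs = foldl (\<lambda>c x. c ;; mul_prog x) (Prim (Const 3 k)) xs"

text \<open>Every Horner step is charged as much as the last one could cost, so the bound is the
  number of digits times a single term.\<close>

lemma does_addr:
  assumes "\<forall>x\<in>set xs. x \<notin> {0, 3, 4, 5} \<and> r x < r 1"
  shows "\<exists>r'. does (addr_prog k xs) r r' []
      (1 + length xs * ((k + 1) * r 1 ^ length xs * (3 * r 1 + 6) + 3 * r 1 + 9)) \<and>
    r' 3 = hor (r 1) (k # map r xs) \<and> same_outside {0, 3, 4, 5} r r'"
  using assms
proof (induction xs rule: rev_induct)
  case Nil
  have "addr_prog k [] = Prim (Const 3 k)"
    by (simp add: addr_prog_def)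
  moreover have "(r(3 := k)) 3 = hor (r 1) (k # map r [])" "same_outside {0, 3, 4, 5} r (r(3 := k))"
    by (simp_all add: hor_def same_outside_def)
  ultimately show ?case
    using does_Const[of 3 k r] by (metis add.right_neutral list.size(3) mult_zero_left)
next
  case (snoc x xs)
  let ?T = "\<lambda>l. (k + 1) * r 1 ^ l * (3 * r 1 + 6) + 3 * r 1 + 9"
  obtain r' where r': "does (addr_prog k xs) r r' [] (1 + length xs * ?T (length xs))"
    "r' 3 = hor (r 1) (k # map r xs)" "same_outside {0, 3, 4, 5} r r'"
    using snoc by auto
  obtain r'' where r'': "does (mul_prog x) r' r'' [] (r' 3 * (3 * r' 1 + 6) + 3 * r' x + 9)"
    "r'' 3 = r' 3 * r' 1 + r' x" "same_outside {0, 3, 4, 5} r' r''"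
    using does_mul[of x r'] snoc.prems by auto
  have eqs: "r' 1 = r 1" "r' x = r x" and lt: "r x < r 1"
    using r'(3) snoc.prems by (auto simp: same_outside_def)
  have "r' 3 \<le> (k + 1) * r 1 ^ length xs"
    unfolding r'(2) using hor_le[of "map r xs" "r 1" k] snoc.prems by auto
  moreover have mono: "(k + 1) * r 1 ^ length xs \<le> (k + 1) * r 1 ^ Suc (length xs)"
    using lt by (intro mult_le_mono2 power_increasing) auto
  ultimately have "r' 3 * (3 * r 1 + 6) \<le> (k + 1) * r 1 ^ Suc (length xs) * (3 * r 1 + 6)"
    by (intro mult_le_mono1) linarith
  then have "r' 3 * (3 * r' 1 + 6) + 3 * r' x + 9 \<le> ?T (Suc (length xs))"
    using lt unfolding eqs by linarith
  moreover have "?T (length xs) \<le> ?T (Suc (length xs))"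
    using mult_le_mono1[OF mono, of "3 * r 1 + 6"] by linarith
  then have "length xs * ?T (length xs) \<le> length xs * ?T (Suc (length xs))"
    by (rule mult_le_mono2)
  ultimately have "1 + length xs * ?T (length xs) + (r' 3 * (3 * r' 1 + 6) + 3 * r' x + 9) \<le>
     1 + length (xs @ [x]) * ?T (length (xs @ [x]))"
    unfolding length_append_singleton mult_Suc by (rule sum_step)
  moreover have "addr_prog k (xs @ [x]) = addr_prog k xs ;; mul_prog x"
    by (simp add: addr_prog_def)
  ultimately have "does (addr_prog k (xs @ [x])) r r'' []
     (1 + length (xs @ [x]) * ?T (length (xs @ [x])))"
    using does_seq0[OF r'(1) r''(1)] by (auto intro: does_mono)
  moreover have "r'' 3 = hor (r 1) (k # map r (xs @ [x]))"
    using r''(2) hor_snoc[of "r 1" "k # map r xs" "r x"] eqs r'(2) by simp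
  ultimately show ?case
    using same_outside_trans[OF r'(3) r''(3)] by blast
qed

section \<open>Closure of polynomial-time predicates under logic, bounded quantification and
  reachability\<close>

section \<open>Predicates decidable in polynomial time\<close>

record st =
  sz :: nat
  wd :: "nat list"
  arr :: "nat \<Rightarrow> nat \<Rightarrow> nat"
  rel :: "nat \<Rightarrow> nat list \<Rightarrow> bool"

definition W :: "nat list \<Rightarrow> nat \<Rightarrow> nat \<Rightarrow> bool" where
  "W w p c \<longleftrightarrow> p < length w \<and> w ! p = c"

text \<open>The shift by one makes a position behind the word, with value 0, differ from one that
  carries the token 0.\<close>

definition tokv :: "nat list \<Rightarrow> nat \<Rightarrow> nat" where
  "tokv w i = (if i < length w then Suc (w ! i) else 0)"

lemma W_tokv: "W w p c \<longleftrightarrow> tokv w p = Suc c"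
  by (auto simp: W_def tokv_def)

text \<open>Register 1 holds the size of the domain, registers 2 to 9 are scratch, and the \<open>d\<close> innermost
  values of the environment sit in registers \<open>10, \<dots>, 9 + d\<close>, innermost last.  The word is the array
  with id 1, ids 2 and 3 are numerical arrays, ids from 4 on are relations; the cell of array \<open>k\<close> at
  index tuple \<open>xs\<close> has the address with digits \<open>k # xs\<close> in base \<open>sz\<close>, which lies above all registers.
  Relations with id \<open>\<ge> S\<close> are free to be overwritten.\<close>

definition rep :: "nat \<Rightarrow> nat \<Rightarrow> st \<Rightarrow> (nat \<Rightarrow> nat) \<Rightarrow> mem \<Rightarrow> bool" where
  "rep S d st e r \<longleftrightarrow> r 1 = sz st \<and> 10 + d \<le> sz st \<and> 4 \<le> S \<and> S \<le> sz st \<and>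
     (\<forall>i<sz st. r (hor (sz st) [1, i]) = tokv (wd st) i \<and> tokv (wd st) i \<le> sz st) \<and>
     (\<forall>k\<in>{2, 3}. \<forall>i<sz st. r (hor (sz st) [k, i]) = arr st k i \<and> arr st k i < sz st) \<and>
     (\<forall>k xs. 4 \<le> k \<longrightarrow> k < S \<longrightarrow> vkey (sz st) (k # xs) \<longrightarrow>
        (0 < r (hor (sz st) (k # xs)) \<longleftrightarrow> rel st k xs)) \<and>
     (\<forall>i<d. e i < sz st \<and> r (10 + (d - 1 - i)) = e i)"

abbreviation push :: "nat \<Rightarrow> (nat \<Rightarrow> nat) \<Rightarrow> nat \<Rightarrow> nat" where
  "push v e \<equiv> case_nat v e"

lemma repD:
  assumes "rep S d st e r"
  shows "r 1 = sz st" "10 + d \<le> sz st" "4 \<le> S" "S \<le> sz st"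
    "i < sz st \<Longrightarrow> r (hor (sz st) [1, i]) = tokv (wd st) i"
    "i < sz st \<Longrightarrow> tokv (wd st) i \<le> sz st"
    "k = 2 \<or> k = 3 \<Longrightarrow> i < sz st \<Longrightarrow> r (hor (sz st) [k, i]) = arr st k i"
    "k = 2 \<or> k = 3 \<Longrightarrow> i < sz st \<Longrightarrow> arr st k i < sz st"
    "4 \<le> k \<Longrightarrow> k < S \<Longrightarrow> vkey (sz st) (k # xs) \<Longrightarrow>
      0 < r (hor (sz st) (k # xs)) \<longleftrightarrow> rel st k xs"
    "i < d \<Longrightarrow> e i < sz st" "i < d \<Longrightarrow> r (10 + (d - 1 - i)) = e i"
  using assms unfolding rep_def by auto

lemma rep_cong:
  assumes "rep S d st e r"
    and "\<And>x. x = 1 \<or> 10 \<le> x \<and> x < 10 + d \<or> sz st \<le> x \<Longrightarrow> r' x = r x"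
  shows "rep S d st e r'"
proof -
  have n: "10 + d \<le> sz st" "4 \<le> S" "S \<le> sz st"
    using repD[OF assms(1)] by auto
  have v: "vkey (sz st) [k, i]" if "k \<in> {1, 2, 3}" "i < sz st" for k i
    using that n by (auto simp: vkey_def)
  have h: "r' (hor (sz st) ks) = r (hor (sz st) ks)" if "vkey (sz st) ks" for ks
    using hor_ge[OF that] assms(2) by simp
  have "r' (10 + (d - 1 - i)) = r (10 + (d - 1 - i))" if "i < d" for i
    using that by (intro assms(2)) auto
  then show ?thesis
    using assms(1) h[OF v] h assms(2)[of 1] unfolding rep_def by simp
qed

lemma rep_push:
  assumes "rep S d st e r" "r (10 + d) = v" "v < sz st" "11 + d \<le> sz st"
  shows "rep S (Suc d) st (push v e) r"
proof -
  have "push v e i < sz st \<and> r (10 + (Suc d - 1 - i)) = push v e i" if "i < Suc d" for i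
    using repD(10,11)[OF assms(1), of "i - 1"] assms(2,3) that by (cases i) auto
  then show ?thesis
    using assms unfolding rep_def by simp
qed

lemma rep_pop: "rep S (Suc d) st (push v e) r \<Longrightarrow> rep S d st e r"
proof -
  assume r: "rep S (Suc d) st (push v e) r"
  have "e i < sz st \<and> r (10 + (d - 1 - i)) = e i" if "i < d" for i
    using repD(10,11)[OF r, of "Suc i"] that by simp
  then show ?thesis
    using r unfolding rep_def by simp
qed

lemma rep_push_top: "rep S (Suc d) st (push v e) r \<Longrightarrow> r (10 + d) = v"
  using repD(11)[of S "Suc d" st "push v e" r 0] by simp


subsection \<open>Values\<close>

text \<open>\<open>S\<close> is quantified inside because a value is computed without working
  arrays. The bound by \<open>sz\<close> limits the time of comparisons, which count down; the
  threshold \<open>n0\<close> leaves room for constants.\<close>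

definition val :: "nat \<Rightarrow> (st \<Rightarrow> (nat \<Rightarrow> nat) \<Rightarrow> nat) \<Rightarrow> bool" where
  "val d f \<longleftrightarrow> (\<exists>c B n0. pb B \<and> (\<forall>S st e r. n0 \<le> sz st \<longrightarrow> rep S d st e r \<longrightarrow>
     f st e \<le> sz st \<and> (\<exists>r'. does c r r' [] (B (sz st)) \<and> r' 3 = f st e \<and> same_outside {0, 3, 4, 5} r r')))"

text \<open>\<open>S\<close> is a parameter here, since a program for a reachability predicate
  overwrites relations from \<open>S\<close> on. The memory may change as long as it still
  represents the same state and environment.\<close>

definition dec :: "nat \<Rightarrow> nat \<Rightarrow> (st \<Rightarrow> (nat \<Rightarrow> nat) \<Rightarrow> bool) \<Rightarrow> bool" where
  "dec S d P \<longleftrightarrow> (\<exists>c B n0. pb B \<and> (\<forall>st e r. n0 \<le> sz st \<longrightarrow> rep S d st e r \<longrightarrow>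
     (\<exists>r'. does c r r' [] (B (sz st)) \<and> r' 2 = of_bool (P st e) \<and> rep S d st e r')))"

lemma val_I:
  assumes "pb B" "\<And>S st e r. n0 \<le> sz st \<Longrightarrow> rep S d st e r \<Longrightarrow> f st e \<le> sz st \<and>
    (\<exists>r'. does c r r' [] (B (sz st)) \<and> r' 3 = f st e \<and> same_outside {0, 3, 4, 5} r r')"
  shows "val d f"
  unfolding val_def using assms by blast

lemma D_I:
  assumes "pb B" "\<And>st e r. n0 \<le> sz st \<Longrightarrow> rep S d st e r \<Longrightarrow>
    (\<exists>r'. does c r r' [] (B (sz st)) \<and> r' 2 = of_bool (P st e) \<and> rep S d st e r')"
  shows "dec S d P"
  unfolding dec_def using assms by blast

lemma same_outside_upd: "x \<in> X \<Longrightarrow> same_outside X r (r(x := v))"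
  by (auto simp: same_outside_def)

lemma val_var:
  assumes "i < d" shows "val d (\<lambda>st e. e i)"
proof (rule val_I[of "\<lambda>_. 1" 0 _ _ "Prim (Move 3 (10 + (d - 1 - i)))"])
  fix S st e r assume r: "rep S d st e r"
  show "e i \<le> sz st \<and> (\<exists>r'. does (Prim (Move 3 (10 + (d - 1 - i)))) r r' [] 1 \<and> r' 3 = e i \<and>
      same_outside {0, 3, 4, 5} r r')"
    using repD(10,11)[OF r assms] does_Move[of 3 "10 + (d - 1 - i)" r]
    by (auto intro!: exI[of _ "r(3 := e i)"] simp: same_outside_upd)
qed auto

lemma val_Suc:
  assumes "i < d" shows "val d (\<lambda>st e. Suc (e i))"
proof (rule val_I[of "\<lambda>_. 1 + 1" 0 _ _ "Prim (Move 3 (10 + (d - 1 - i))) ;; Prim (Succ 3)"])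
  fix S st e r assume r: "rep S d st e r"
  have "does (Prim (Move 3 (10 + (d - 1 - i))) ;; Prim (Succ 3)) r
      (r(3 := r (10 + (d - 1 - i)), 3 := (r(3 := r (10 + (d - 1 - i)))) 3 + 1)) [] (1 + 1)"
    by (intro does_seq0[OF does_Move] does_Succ)
  then have "does (Prim (Move 3 (10 + (d - 1 - i))) ;; Prim (Succ 3)) r (r(3 := Suc (e i))) [] (1 + 1)"
    using repD(11)[OF r assms] by simp
  then show "Suc (e i) \<le> sz st \<and> (\<exists>r'. does (Prim (Move 3 (10 + (d - 1 - i))) ;; Prim (Succ 3)) r r' []
      (1 + 1) \<and> r' 3 = Suc (e i) \<and> same_outside {0, 3, 4, 5} r r')"
    using repD(10)[OF r assms] by (auto intro!: exI[of _ "r(3 := Suc (e i))"] simp: same_outside_upd)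
qed auto

lemma val_const: "val d (\<lambda>st e. c)"
proof (rule val_I[of "\<lambda>_. 1" c _ _ "Prim (Const 3 c)"])
  fix S and st :: st and e r assume "c \<le> sz st"
  then show "c \<le> sz st \<and> (\<exists>r'. does (Prim (Const 3 c)) r r' [] 1 \<and> r' 3 = c \<and> same_outside {0, 3, 4, 5} r r')"
    using does_Const[of 3 c r] by (auto intro!: exI[of _ "r(3 := c)"] simp: same_outside_upd)
qed auto

lemma does_lookup:
  assumes r: "rep S d st e r" and ix: "\<forall>i\<in>set ix. i < d"
  shows "\<exists>r'. does (addr_prog k (map (\<lambda>i. 10 + (d - 1 - i)) ix)) r r' []
      (1 + length ix * ((k + 1) * sz st ^ length ix * (3 * sz st + 6) + 3 * sz st + 9)) \<and>
    r' 3 = hor (sz st) (k # map e ix) \<and> same_outside {0, 3, 4, 5} r r'"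
proof -
  have "map r (map (\<lambda>i. 10 + (d - 1 - i)) ix) = map e ix"
    unfolding map_map by (rule map_cong) (use ix in \<open>auto simp only: comp_def repD(11)[OF r]\<close>)
  moreover have "\<forall>x\<in>set (map (\<lambda>i. 10 + (d - 1 - i)) ix). x \<notin> {0, 3, 4, 5} \<and> r x < r 1"
    using repD(1,10,11)[OF r] ix by auto
  ultimately show ?thesis
    using does_addr[of "map (\<lambda>i. 10 + (d - 1 - i)) ix" r k] unfolding repD(1)[OF r] length_map by metis
qed

lemma val_lookup:
  assumes ix: "\<forall>i\<in>set ix. i < d"
    and ok: "\<And>S st e r. rep S d st e r \<Longrightarrow> f st e = r (hor (sz st) (k # map e ix)) \<and> f st e \<le> sz st"
  shows "val d f"
proof (rule val_I[of "\<lambda>n. (1 + length ix * ((k + 1) * n ^ length ix * (3 * n + 6) + 3 * n + 9)) + 1" 6 _ _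
      "addr_prog k (map (\<lambda>i. 10 + (d - 1 - i)) ix) ;; Prim (Load 3 3)"])
  fix S st e r assume r: "rep S d st e r" and n: "6 \<le> sz st"
  let ?B = "1 + length ix * ((k + 1) * sz st ^ length ix * (3 * sz st + 6) + 3 * sz st + 9)"
  obtain r' where r': "does (addr_prog k (map (\<lambda>i. 10 + (d - 1 - i)) ix)) r r' [] ?B"
    "r' 3 = hor (sz st) (k # map e ix)" "same_outside {0, 3, 4, 5} r r'"
    using does_lookup[OF r ix] by blast
  have "rep S d st e r'"
    by (rule rep_cong[OF r]) (use r'(3) n in \<open>auto simp: same_outside_def\<close>)
  then have "r' (r' 3) = f st e" "f st e \<le> sz st"
    using ok r'(2) by metis+
  then show "f st e \<le> sz st \<and> (\<exists>r'. does (addr_prog k (map (\<lambda>i. 10 + (d - 1 - i)) ix) ;; Prim (Load 3 3))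
      r r' [] (?B + 1) \<and> r' 3 = f st e \<and> same_outside {0, 3, 4, 5} r r')"
    using does_seq0[OF r'(1) does_Load[of 3 3]] r'(3)
    by (auto intro!: exI[of _ "r'(3 := f st e)"] simp: same_outside_def)
qed (intro pb_add pb_mult pb_power pb_const pb_id)

lemma val_tokv: "i < d \<Longrightarrow> val d (\<lambda>st e. tokv (wd st) (e i))"
proof (rule val_lookup[of "[i]" _ _ 1])
  fix S st e r assume "i < d" and r: "rep S d st e r"
  then show "tokv (wd st) (e i) = r (hor (sz st) (1 # map e [i])) \<and> tokv (wd st) (e i) \<le> sz st"
    using repD(5,6)[OF r, of "e i"] repD(10)[OF r] by simp
qed simp

lemma val_arr:
  assumes "k = 2 \<or> k = 3" "i < d"
  shows "val d (\<lambda>st e. arr st k (e i))"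
proof (rule val_lookup[of "[i]" _ _ k])
  fix S st e r assume r: "rep S d st e r"
  show "arr st k (e i) = r (hor (sz st) (k # map e [i])) \<and> arr st k (e i) \<le> sz st"
    using repD(7,8)[OF r assms(1), of "e i"] repD(10)[OF r] assms by simp
qed (use assms in simp)


subsection \<open>Boolean combinations\<close>

lemma rep_scratch:
  assumes "rep S d st e r" "same_outside {0, 2, 3, 4, 5, 6, 7, 8, 9} r r'"
  shows "rep S d st e r'"
  by (rule rep_cong[OF assms(1)]) (use assms(2) repD(2)[OF assms(1)] in \<open>auto simp: same_outside_def\<close>)

lemma does_monus:
  assumes "distinct [0, x, y]"
  shows "\<exists>r'. does (Loop x (Prim (Pred y) ;; Prim (Pred x))) r r' [] (3 + 3 * r x) \<and>
    r' y = r y - r x \<and> same_outside {0, x, y} r r'"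
proof -
  let ?\<rho> = "\<lambda>i. r(0 := 1, y := r y - i, x := r x - i)"
  have "does (Loop x (Prim (Pred y) ;; Prim (Pred x))) r (?\<rho> (r x))
     (concat (map (\<lambda>_. []) [0..<r x])) (3 + r x * ((1 + 1) + 1))"
  proof (rule does_loop[where \<rho> = ?\<rho>])
    fix i assume i: "i < r x"
    have "(?\<rho> i)(y := ?\<rho> i y - 1, x := ((?\<rho> i)(y := ?\<rho> i y - 1)) x - 1) = ?\<rho> (Suc i)"
      using assms by (auto simp: fun_eq_iff)
    then show "0 < ?\<rho> i x \<and> does (Prim (Pred y) ;; Prim (Pred x)) (?\<rho> i) (?\<rho> (Suc i)) [] (1 + 1)"
      using does_seq[OF does_Pred[of y "?\<rho> i"] does_Pred[of x]] i by simp
  qed (use assms in \<open>auto simp: fun_eq_iff\<close>)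
  then show ?thesis
    using assms by (intro exI[of _ "?\<rho> (r x)"]) (auto simp: same_outside_def algebra_simps)
qed

lemma does_flag:
  assumes "x \<noteq> 0"
  shows "\<exists>r'. does (Cond x (Prim (Const 2 a)) (Prim (Const 2 b))) r r' [] 4 \<and>
    r' 2 = (if r x > 0 then a else b) \<and> same_outside {0, 2} r r'"
proof (cases "r x > 0")
  case True
  then show ?thesis
    using does_mono[OF does_cond_pos[OF True does_Const[of 2 a r]], of 4]
    by (intro exI[of _ "r(2 := a)"]) (auto simp: same_outside_upd)
next
  case False
  then show ?thesis
    using does_mono[OF does_cond_zero[OF _ does_Const[of 2 b r]], of x 4]
    by (intro exI[of _ "r(2 := b, 0 := 1)"]) (auto simp: same_outside_def)
qed

lemma D_less:
  assumes "val d f" "val d g"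
  shows "dec S d (\<lambda>st e. f st e < g st e)"
proof -
  obtain cf Bf nf where f: "pb Bf" "\<And>S st e r. nf \<le> sz st \<Longrightarrow> rep S d st e r \<Longrightarrow> f st e \<le> sz st \<and>
    (\<exists>r'. does cf r r' [] (Bf (sz st)) \<and> r' 3 = f st e \<and> same_outside {0, 3, 4, 5} r r')"
    using assms(1) unfolding val_def by blast
  obtain cg Bg ng where g: "pb Bg" "\<And>S st e r. ng \<le> sz st \<Longrightarrow> rep S d st e r \<Longrightarrow> g st e \<le> sz st \<and>
    (\<exists>r'. does cg r r' [] (Bg (sz st)) \<and> r' 3 = g st e \<and> same_outside {0, 3, 4, 5} r r')"
    using assms(2) unfolding val_def by blast
  \<comment> \<open>Register 8 survives the computation of \<open>g\<close>, which touches only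
    registers 0, 3, 4 and 5. Truncated subtraction then leaves something positive exactly if
    \<open>f st e < g st e\<close>.\<close>
  let ?c = "cf ;; Prim (Move 8 3) ;; cg ;; Loop 8 (Prim (Pred 3) ;; Prim (Pred 8)) ;;
     Cond 3 (Prim (Const 2 1)) (Prim (Const 2 0))"
  show ?thesis
  proof (rule D_I[of "\<lambda>n. Bf n + (1 + (Bg n + ((3 + 3 * n) + 4)))" "nf + ng" _ _ ?c])
    show "pb (\<lambda>n. Bf n + (1 + (Bg n + ((3 + 3 * n) + 4))))"
      by (intro pb_add pb_mult pb_const pb_id f g)
    fix st e r assume n: "nf + ng \<le> sz st" and r: "rep S d st e r"
    obtain r1 where r1: "does cf r r1 [] (Bf (sz st))" "r1 3 = f st e" "same_outside {0, 3, 4, 5} r r1"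
      using f(2)[OF _ r] n by auto
    let ?r1 = "r1(8 := r1 3)"
    have rep1: "rep S d st e ?r1"
      by (rule rep_scratch[OF r]) (use r1 in \<open>auto simp: same_outside_def\<close>)
    obtain r2 where r2: "does cg ?r1 r2 [] (Bg (sz st))" "r2 3 = g st e" "same_outside {0, 3, 4, 5} ?r1 r2"
      using g(2)[OF _ rep1] n by auto
    have r28: "r2 8 = f st e"
      using r2(3) r1(2) by (auto simp: same_outside_def)
    obtain r3 where r3: "does (Loop 8 (Prim (Pred 3) ;; Prim (Pred 8))) r2 r3 [] (3 + 3 * r2 8)"
      "r3 3 = r2 3 - r2 8" "same_outside {0, 8, 3} r2 r3"
      using does_monus[of 8 3 r2] by auto
    have le: "3 + 3 * r2 8 \<le> 3 + 3 * sz st"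
      using f(2)[OF _ r] n r28 by simp
    obtain r4 where r4: "does (Cond 3 (Prim (Const 2 1)) (Prim (Const 2 0))) r3 r4 [] 4"
      "r4 2 = (if r3 3 > 0 then 1 else 0)" "same_outside {0, 2} r3 r4"
      using does_flag[of 3 1 0 r3] by auto
    have "does ?c r r4 [] (Bf (sz st) + (1 + (Bg (sz st) + ((3 + 3 * sz st) + 4))))"
      by (intro does_seq0[OF r1(1)] does_seq0[OF does_Move] does_seq0[OF r2(1)]
          does_seq0[OF does_mono[OF r3(1) le]] r4(1))
    moreover have "r4 2 = of_bool (f st e < g st e)"
      using r4(2) r3(2) r2(2) r28 by auto
    moreover have "rep S d st e r4"
      by (rule rep_scratch[OF rep1]) (use r2(3) r3(3) r4(3) in \<open>auto simp: same_outside_def\<close>)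
    ultimately show "\<exists>r'. does ?c r r' [] (Bf (sz st) + (1 + (Bg (sz st) + ((3 + 3 * sz st) + 4)))) \<and>
        r' 2 = of_bool (f st e < g st e) \<and> rep S d st e r'"
      by blast
  qed
qed

lemma D_rel:
  assumes "4 \<le> k" "k < S" "ix \<noteq> []" "\<forall>i\<in>set ix. i < d"
  shows "dec S d (\<lambda>st e. rel st k (map e ix))"
proof (rule D_I[of "\<lambda>n. (1 + length ix * ((k + 1) * n ^ length ix * (3 * n + 6) + 3 * n + 9)) + (1 + 4)" 0 _ _
      "addr_prog k (map (\<lambda>i. 10 + (d - 1 - i)) ix) ;; Prim (Load 3 3) ;;
       Cond 3 (Prim (Const 2 1)) (Prim (Const 2 0))"])
  fix st e r assume r: "rep S d st e r"
  let ?B = "1 + length ix * ((k + 1) * sz st ^ length ix * (3 * sz st + 6) + 3 * sz st + 9)"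
  obtain r' where r': "does (addr_prog k (map (\<lambda>i. 10 + (d - 1 - i)) ix)) r r' [] ?B"
    "r' 3 = hor (sz st) (k # map e ix)" "same_outside {0, 3, 4, 5} r r'"
    using does_lookup[OF r assms(4)] by blast
  have rep': "rep S d st e r'"
    by (rule rep_scratch[OF r]) (use r'(3) in \<open>auto simp: same_outside_def\<close>)
  have "vkey (sz st) (k # map e ix)"
    using assms repD(4,10)[OF r] by (auto simp: vkey_def)
  then have val: "0 < r' (r' 3) \<longleftrightarrow> rel st k (map e ix)"
    using repD(9)[OF rep' assms(1,2)] r'(2) by simp
  obtain r4 where r4: "does (Cond 3 (Prim (Const 2 1)) (Prim (Const 2 0))) (r'(3 := r' (r' 3))) r4 [] 4"
      "r4 2 = (if (r'(3 := r' (r' 3))) 3 > 0 then 1 else 0)" "same_outside {0, 2} (r'(3 := r' (r' 3))) r4"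
    using does_flag[of 3 1 0 "r'(3 := r' (r' 3))"] by auto
  have "rep S d st e r4"
    by (rule rep_scratch[OF rep']) (use r4(3) in \<open>auto simp: same_outside_def\<close>)
  then show "\<exists>r'. does (addr_prog k (map (\<lambda>i. 10 + (d - 1 - i)) ix) ;; Prim (Load 3 3) ;;
       Cond 3 (Prim (Const 2 1)) (Prim (Const 2 0))) r r' [] (?B + (1 + 4)) \<and>
       r' 2 = of_bool (rel st k (map e ix)) \<and> rep S d st e r'"
    using does_seq0[OF r'(1) does_seq0[OF does_Load r4(1)]] r4(2) val
    by (intro exI[of _ r4]) simp
qed (intro pb_add pb_mult pb_power pb_const pb_id)

lemma D_const: "dec S d (\<lambda>st e. b)"
proof (rule D_I[of "\<lambda>_. 1" 0 _ _ "Prim (Const 2 (of_bool b))"])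
  fix st e r assume r: "rep S d st e r"
  then have "rep S d st e (r(2 := of_bool b))"
    by (rule rep_scratch) (auto simp: same_outside_def)
  then show "\<exists>r'. does (Prim (Const 2 (of_bool b))) r r' [] 1 \<and> r' 2 = of_bool b \<and> rep S d st e r'"
    using does_Const by (intro exI[of _ "r(2 := of_bool b)"]) simp
qed auto

lemma D_not:
  assumes "dec S d P"
  shows "dec S d (\<lambda>st e. \<not> P st e)"
proof -
  obtain c B n0 where c: "pb B" "\<And>st e r. n0 \<le> sz st \<Longrightarrow> rep S d st e r \<Longrightarrow>
    (\<exists>r'. does c r r' [] (B (sz st)) \<and> r' 2 = of_bool (P st e) \<and> rep S d st e r')"
    using assms unfolding dec_def by blast
  show ?thesis
  proof (rule D_I[of "\<lambda>n. B n + 4" n0 _ _ "c ;; Cond 2 (Prim (Const 2 0)) (Prim (Const 2 1))"])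
    fix st e r assume "n0 \<le> sz st" "rep S d st e r"
    then obtain r1 where r1: "does c r r1 [] (B (sz st))" "r1 2 = of_bool (P st e)" "rep S d st e r1"
      using c(2) by blast
    obtain r2 where r2: "does (Cond 2 (Prim (Const 2 0)) (Prim (Const 2 1))) r1 r2 [] 4"
      "r2 2 = (if r1 2 > 0 then 0 else 1)" "same_outside {0, 2} r1 r2"
      using does_flag[of 2 0 1 r1] by auto
    have "rep S d st e r2"
      by (rule rep_scratch[OF r1(3)]) (use r2 in \<open>auto simp: same_outside_def\<close>)
    then show "\<exists>r'. does (c ;; Cond 2 (Prim (Const 2 0)) (Prim (Const 2 1))) r r' [] (B (sz st) + 4) \<and>
        r' 2 = of_bool (\<not> P st e) \<and> rep S d st e r'"
      using does_seq0[OF r1(1) r2(1)] r1(2) r2(2) by (intro exI[of _ r2]) auto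
  qed (intro pb_add c pb_const)
qed

lemma D_conj:
  assumes "dec S d P" "dec S d Q"
  shows "dec S d (\<lambda>st e. P st e \<and> Q st e)"
proof -
  obtain c B n0 where c: "pb B" "\<And>st e r. n0 \<le> sz st \<Longrightarrow> rep S d st e r \<Longrightarrow>
    (\<exists>r'. does c r r' [] (B (sz st)) \<and> r' 2 = of_bool (P st e) \<and> rep S d st e r')"
    using assms(1) unfolding dec_def by blast
  obtain c' B' n0' where c': "pb B'" "\<And>st e r. n0' \<le> sz st \<Longrightarrow> rep S d st e r \<Longrightarrow>
    (\<exists>r'. does c' r r' [] (B' (sz st)) \<and> r' 2 = of_bool (Q st e) \<and> rep S d st e r')"
    using assms(2) unfolding dec_def by blast
  show ?thesis
  proof (rule D_I[of "\<lambda>n. B n + (B' n + 4)" "n0 + n0'" _ _ "c ;; Cond 2 c' (Prim (Const 2 0))"])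
    fix st e r assume n: "n0 + n0' \<le> sz st" and "rep S d st e r"
    then obtain r1 where r1: "does c r r1 [] (B (sz st))" "r1 2 = of_bool (P st e)" "rep S d st e r1"
      using c(2) by (meson add_leD1)
    show "\<exists>r'. does (c ;; Cond 2 c' (Prim (Const 2 0))) r r' [] (B (sz st) + (B' (sz st) + 4)) \<and>
        r' 2 = of_bool (P st e \<and> Q st e) \<and> rep S d st e r'"
    proof (cases "P st e")
      case True
      obtain r2 where r2: "does c' r1 r2 [] (B' (sz st))" "r2 2 = of_bool (Q st e)" "rep S d st e r2"
        using c'(2)[OF _ r1(3)] n by auto
      have "does (Cond 2 c' (Prim (Const 2 0))) r1 r2 [] (B' (sz st) + 4)"
        using does_mono[OF does_cond_pos[OF _ r2(1)], of 2] True r1(2) by simp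
      from does_seq0[OF r1(1) this] show ?thesis
        using r2 True by (intro exI[of _ r2]) auto
    next
      case False
      let ?r = "r1(2 := 0, 0 := 1)"
      have "does (Cond 2 c' (Prim (Const 2 0))) r1 ?r [] (B' (sz st) + 4)"
        using does_mono[OF does_cond_zero[OF _ does_Const[of 2 0 r1]], of 2] False r1(2) by simp
      moreover have "rep S d st e ?r"
        by (rule rep_scratch[OF r1(3)]) (auto simp: same_outside_def)
      ultimately show ?thesis
        using does_seq0[OF r1(1)] False by (intro exI[of _ ?r]) auto
    qed
  qed (intro pb_add c c' pb_const)
qed

lemma D_disj:
  assumes "dec S d P" "dec S d Q" shows "dec S d (\<lambda>st e. P st e \<or> Q st e)"
proof -
  have "dec S d (\<lambda>st e. \<not> (\<not> P st e \<and> \<not> Q st e))"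
    by (intro D_not D_conj assms)
  then show ?thesis by simp
qed

lemma D_imp:
  assumes "dec S d P" "dec S d Q" shows "dec S d (\<lambda>st e. P st e \<longrightarrow> Q st e)"
  unfolding imp_conv_disj by (intro D_disj D_not assms)

lemma D_iff:
  assumes "dec S d P" "dec S d Q" shows "dec S d (\<lambda>st e. P st e = Q st e)"
  unfolding iff_conv_conj_imp by (intro D_conj D_imp assms)

lemma D_le:
  assumes "val d f" "val d g" shows "dec S d (\<lambda>st e. f st e \<le> g st e)"
  unfolding not_less[symmetric] by (intro D_not D_less assms)

lemma D_eq:
  assumes "val d f" "val d g" shows "dec S d (\<lambda>st e. f st e = g st e)"
proof -
  have "dec S d (\<lambda>st e. f st e \<le> g st e \<and> g st e \<le> f st e)"
    by (intro D_conj D_le assms)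
  then show ?thesis by (simp add: order.eq_iff)
qed

lemma D_W: "i < d \<Longrightarrow> dec S d (\<lambda>st e. W (wd st) (e i) c)"
  unfolding W_tokv by (intro D_eq val_tokv val_const)

text \<open>The conjunction is unrolled in the program text, so \<open>k\<close> is a constant. It
  serves the indices bounded by the numbers of formulas and equalities, while quantifiers over the
  domain become loops.\<close>

lemma D_all_const:
  fixes k :: nat
  assumes "\<And>i. i < k \<Longrightarrow> dec S d (P i)"
  shows "dec S d (\<lambda>st e. \<forall>i<k. P i st e)"
  using assms
proof (induction k)
  case 0
  then show ?case using D_const[of S d True] by simp
next
  case (Suc k)
  then have "dec S d (\<lambda>st e. (\<forall>i<k. P i st e) \<and> P k st e)"
    by (intro D_conj) auto
  then show ?case
    by (simp add: less_Suc_eq all_conj_distrib imp_disjL conj_commute)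
qed

lemma D_ex_const:
  fixes k :: nat
  assumes "\<And>i. i < k \<Longrightarrow> dec S d (P i)"
  shows "dec S d (\<lambda>st e. \<exists>i<k. P i st e)"
proof -
  have "dec S d (\<lambda>st e. \<not> (\<forall>i<k. \<not> P i st e))"
    by (intro D_not D_all_const assms)
  then show ?thesis by simp
qed

subsection \<open>Loops over the domain\<close>

text \<open>The only test is for positivity, so register \<open>10 + d\<close> counts down to stop
  the loop while \<open>11 + d\<close> counts up as the index. Both become environment entries,
  which protects them from the body.\<close>

definition for_prog :: "nat \<Rightarrow> prog \<Rightarrow> prog" where
  "for_prog d c = Prim (Move (10 + d) 1) ;; Prim (Const (11 + d) 0) ;;
     Loop (10 + d) (Prim (Pred (10 + d)) ;; c ;; Prim (Succ (11 + d)))"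

text \<open>The invariant ranges over environments too, so that an accumulator kept in the
  environment may change from round to round. The two loop registers must lie below the arrays,
  hence \<open>12 + d \<le> n\<close>.\<close>

lemma for_loop:
  assumes body: "\<And>v st e r. v < n \<Longrightarrow> sz st = n \<Longrightarrow> Inv v st e \<Longrightarrow>
      rep S (Suc (Suc d)) st (push v (push (n - 1 - v) e)) r \<Longrightarrow>
      \<exists>r' st' e'. does c r r' (out v) B \<and> rep S (Suc (Suc d)) st' (push v (push (n - 1 - v) e')) r' \<and>
        sz st' = n \<and> Inv (Suc v) st' e'"
    and r: "rep S d st e r" and n: "sz st = n" "12 + d \<le> n" and Inv: "Inv 0 st e"
  shows "\<exists>r' st' e'. does (for_prog d c) r r' (concat (map out [0..<n])) (n * (B + 3) + 5) \<and>
      rep S d st' e' r' \<and> sz st' = n \<and> Inv n st' e'"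
proof -
  define J where "J i r \<longleftrightarrow> (\<exists>st e. rep S d st e r \<and> sz st = n \<and> Inv i st e \<and>
     r (10 + d) = n - i \<and> r (11 + d) = i)" for i r
  let ?r = "r(10 + d := r 1, 11 + d := 0)"
  let ?body = "Prim (Pred (10 + d)) ;; c ;; Prim (Succ (11 + d))"
  have "\<exists>r'. does (Loop (10 + d) ?body) ?r r' (concat (map out [0..<n])) (3 + n * ((1 + (B + 1)) + 1)) \<and> J n r'"
  proof (rule does_loop_inv[where J = J])
    have "rep S d st e (?r(0 := 1))"
      by (rule rep_cong[OF r]) (use n in auto)
    then show "J 0 (?r(0 := 1))"
      using n Inv repD(1)[OF r] unfolding J_def by auto
  next
    fix i r assume i: "i < n" and "J i r"
    then obtain st e where J: "rep S d st e r" "sz st = n" "Inv i st e" "r (10 + d) = n - i" "r (11 + d) = i"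
      unfolding J_def by blast
    let ?r = "r(10 + d := r (10 + d) - 1)"
    have "rep S d st e ?r"
      by (rule rep_cong[OF J(1)]) (use n J in auto)
    then have "rep S (Suc d) st (push (n - 1 - i) e) ?r"
      by (rule rep_push) (use i J n in auto)
    then have "rep S (Suc (Suc d)) st (push i (push (n - 1 - i) e)) ?r"
      by (rule rep_push) (use i J n in auto)
    from body[OF i J(2,3) this] obtain r' st' e' where
      r': "does c ?r r' (out i) B" "rep S (Suc (Suc d)) st' (push i (push (n - 1 - i) e')) r'"
      "sz st' = n" "Inv (Suc i) st' e'"
      by blast
    let ?r' = "r'(11 + d := r' (11 + d) + 1)"
    have regs: "r' (11 + d) = i" "r' (10 + d) = n - 1 - i"
      using rep_push_top[OF r'(2)] rep_push_top[OF rep_pop[OF r'(2)]] by simp_all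
    have "rep S d st' e' r'"
      using r'(2) rep_pop by blast
    then have "rep S d st' e' ?r'"
      by (rule rep_cong) (use n r' in auto)
    then have "J (Suc i) ?r'"
      unfolding J_def using r' regs by auto
    moreover have "does ?body r ?r' (out i) (1 + (B + 1))"
      using does_seq0[OF does_Pred does_seq[OF r'(1) does_Succ]] by simp
    ultimately show "0 < r (10 + d) \<and> (\<exists>r'. does ?body r r' (out i) (1 + (B + 1)) \<and> J (Suc i) r')"
      using i J by auto
  next
    fix r assume "J n r"
    then show "r (10 + d) = 0"
      unfolding J_def by auto
  qed
  then obtain r' where r': "does (Loop (10 + d) ?body) ?r r' (concat (map out [0..<n]))
     (3 + n * ((1 + (B + 1)) + 1))" "J n r'"
    by blast
  have "does (for_prog d c) r r' (concat (map out [0..<n])) (1 + (1 + (3 + n * ((1 + (B + 1)) + 1))))"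
    unfolding for_prog_def by (intro does_seq0[OF does_Move] does_seq0[OF does_Const] r'(1))
  then have "does (for_prog d c) r r' (concat (map out [0..<n])) (n * (B + 3) + 5)"
    by (rule does_mono) (simp add: algebra_simps)
  then show ?thesis
    using r'(2) unfolding J_def by blast
qed

text \<open>The shift is 3 because the innermost entries are the index and the counter of the loop
  and, below them, the flag that accumulates the result.\<close>

lemma D_ex:
  assumes "dec S (d + 3) (\<lambda>st e. P st (e 0) (\<lambda>i. e (i + 3)))"
  shows "dec S d (\<lambda>st e. \<exists>v<sz st. P st v e)"
proof -
  obtain c B n0 where c: "pb B" "\<And>st e r. n0 \<le> sz st \<Longrightarrow> rep S (d + 3) st e r \<Longrightarrow>
    (\<exists>r'. does c r r' [] (B (sz st)) \<and> r' 2 = of_bool (P st (e 0) (\<lambda>i. e (i + 3))) \<and> rep S (d + 3) st e r')"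
    using assms unfolding dec_def by blast
  let ?c = "c ;; Cond 2 (Prim (Const (10 + d) 1)) (Prim (Const 2 0))"
  show ?thesis
  proof (rule D_I[of "\<lambda>n. 1 + ((n * ((B n + 4) + 3) + 5) + 1)" "n0 + d + 20" _ _
        "Prim (Const (10 + d) 0) ;; for_prog (Suc d) ?c ;; Prim (Move 2 (10 + d))"])
    show "pb (\<lambda>n. 1 + ((n * ((B n + 4) + 3) + 5) + 1))"
      by (intro pb_add pb_mult pb_const pb_id c)
    fix st e r assume n: "n0 + d + 20 \<le> sz st" and r: "rep S d st e r"
    define n where "n = sz st"
    let ?r = "r(10 + d := 0)"
    have "rep S d st e ?r"
      by (rule rep_cong[OF r]) (use n in auto)
    then have r1: "rep S (Suc d) st (push 0 e) ?r"
      by (rule rep_push) (use n in auto)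
    \<comment> \<open>The flag is an environment entry, so the invariant fixes \<open>st'\<close>
      and lets \<open>e'\<close> vary.\<close>
    define Inv where "Inv v st' e' \<longleftrightarrow> st' = st \<and> e' = push (of_bool (\<exists>u<v. P st u e)) e"
      for v :: nat and st' e'
    have "\<exists>r' st' e'. does (for_prog (Suc d) ?c) ?r r' (concat (map (\<lambda>_. []) [0..<n])) (n * ((B n + 4) + 3) + 5) \<and>
      rep S (Suc d) st' e' r' \<and> sz st' = n \<and> Inv n st' e'"
    proof (rule for_loop[where e = "push 0 e" and st = st])
      fix v st1 e1 r
      assume v: "v < n" "Inv v st1 e1" and r: "rep S (Suc (Suc (Suc d))) st1 (push v (push (n - 1 - v) e1)) r"
      let ?b = "\<exists>u<v. P st u e"
      have eqs: "st1 = st" "e1 = push (of_bool ?b) e"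
        using v(2) by (auto simp: Inv_def)
      have sh: "(\<lambda>i. push v (push (n - 1 - v) (push b e)) (i + 3)) = e" for b
        by (auto simp: fun_eq_iff numeral_3_eq_3)
      have "rep S (d + 3) st (push v (push (n - 1 - v) e1)) r"
        using r eqs by (simp add: numeral_3_eq_3)
      then obtain r1 where r1: "does c r r1 [] (B n)" "r1 2 = of_bool (P st v e)"
        "rep S (d + 3) st (push v (push (n - 1 - v) (push (of_bool ?b) e))) r1"
        using c(2)[of st "push v (push (n - 1 - v) e1)" r] n n_def unfolding eqs sh by auto
      have r1': "rep S (Suc (Suc (Suc d))) st (push v (push (n - 1 - v) (push (of_bool ?b) e))) r1"
        using r1(3) by (simp add: numeral_3_eq_3)
      have regs: "r1 (12 + d) = v" "r1 (11 + d) = n - 1 - v"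
        using rep_push_top[OF r1'] rep_push_top[OF rep_pop[OF r1']] by simp_all
      have r1d: "rep S d st e r1"
        using r1' rep_pop by blast
      \<comment> \<open>Both branches change only scratch registers and the flag, so the
        representation is rebuilt entry by entry on top of the outer environment.\<close>
      have fin: "rep S (Suc (Suc (Suc d))) st (push v (push (n - 1 - v) (push b e))) r2"
        if r2: "r2 (10 + d) = b" "b \<le> 1" "\<And>x. x \<notin> {0, 2, 10 + d} \<Longrightarrow> r2 x = r1 x" for r2 b
      proof -
        have "rep S d st e r2"
          by (rule rep_cong[OF r1d]) (use r2 n in auto)
        then have "rep S (Suc d) st (push b e) r2"
          by (rule rep_push) (use r2 n in auto)
        then have "rep S (Suc (Suc d)) st (push (n - 1 - v) (push b e)) r2"
          by (rule rep_push) (use r2 n n_def regs v in auto)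
        then show ?thesis
          by (rule rep_push) (use r2 n n_def regs v in auto)
      qed
      have b0: "r1 (10 + d) = of_bool ?b"
        using rep_push_top[OF rep_pop[OF rep_pop[OF r1']]] by simp
      have less_Suc: "(\<exists>u<Suc v. P st u e) \<longleftrightarrow> ?b \<or> P st v e"
        by (auto simp: less_Suc_eq)
      show "\<exists>r' st' e'. does ?c r r' [] (B n + 4) \<and>
         rep S (Suc (Suc (Suc d))) st' (push v (push (n - 1 - v) e')) r' \<and> sz st' = n \<and> Inv (Suc v) st' e'"
      proof (cases "P st v e")
        case True
        let ?r2 = "r1(10 + d := 1)"
        have "does (Cond 2 (Prim (Const (10 + d) 1)) (Prim (Const 2 0))) r1 ?r2 [] 4"
          using does_mono[OF does_cond_pos[OF _ does_Const], of r1 2] True r1(2) by simp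
        from does_seq0[OF r1(1) this] show ?thesis
          using fin[of ?r2 1] True less_Suc n_def
          by (intro exI[of _ ?r2] exI[of _ st] exI[of _ "push 1 e"]) (simp add: Inv_def)
      next
        case False
        let ?r2 = "r1(2 := 0, 0 := 1)"
        have "does (Cond 2 (Prim (Const (10 + d) 1)) (Prim (Const 2 0))) r1 ?r2 [] 4"
          using does_mono[OF does_cond_zero[OF _ does_Const], of r1 2] False r1(2) by simp
        from does_seq0[OF r1(1) this] show ?thesis
          using fin[of ?r2 "of_bool ?b"] False less_Suc n_def b0
          by (intro exI[of _ ?r2] exI[of _ st] exI[of _ "push (of_bool ?b) e"]) (simp add: Inv_def)
      qed
    next
      show "rep S (Suc d) st (push 0 e) ?r" by (rule r1)
      show "sz st = n" "12 + Suc d \<le> n" "Inv 0 st (push 0 e)"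
        using n n_def by (auto simp: Inv_def)
    qed
    then obtain r' where r': "does (for_prog (Suc d) ?c) ?r r' [] (n * ((B n + 4) + 3) + 5)"
      "rep S (Suc d) st (push (of_bool (\<exists>u<n. P st u e)) e) r'"
      unfolding Inv_def by auto
    let ?r' = "r'(2 := r' (10 + d))"
    have "rep S d st e ?r'"
      by (rule rep_scratch[OF rep_pop[OF r'(2)]]) (auto simp: same_outside_def)
    moreover have "?r' 2 = of_bool (\<exists>u<n. P st u e)"
      using rep_push_top[OF r'(2)] by simp
    moreover have "does (Prim (Const (10 + d) 0) ;; for_prog (Suc d) ?c ;; Prim (Move 2 (10 + d))) r ?r' []
        (1 + ((n * ((B n + 4) + 3) + 5) + 1))"
      by (intro does_seq0[OF does_Const] does_seq0[OF r'(1)] does_Move)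
    ultimately show "\<exists>r'. does (Prim (Const (10 + d) 0) ;; for_prog (Suc d) ?c ;; Prim (Move 2 (10 + d))) r r' []
        (1 + ((sz st * ((B (sz st) + 4) + 3) + 5) + 1)) \<and>
        r' 2 = of_bool (\<exists>v<sz st. P st v e) \<and> rep S d st e r'"
      unfolding n_def by blast
  qed
qed

lemma D_all:
  assumes "dec S (d + 3) (\<lambda>st e. P st (e 0) (\<lambda>i. e (i + 3)))"
  shows "dec S d (\<lambda>st e. \<forall>v<sz st. P st v e)"
proof -
  have "dec S d (\<lambda>st e. \<not> (\<exists>v<sz st. \<not> P st v e))"
    by (intro D_not D_ex[where P = "\<lambda>st v e. \<not> P st v e"] assms)
  then show ?thesis by simp
qed


subsection \<open>State transformers\<close>

definition cmd :: "nat \<Rightarrow> nat \<Rightarrow> (st \<Rightarrow> (nat \<Rightarrow> nat) \<Rightarrow> st) \<Rightarrow> bool" where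
  "cmd S d F \<longleftrightarrow> (\<forall>st e. sz (F st e) = sz st) \<and>
     (\<exists>c B n0. pb B \<and> (\<forall>st e r. n0 \<le> sz st \<longrightarrow> rep S d st e r \<longrightarrow>
       (\<exists>r'. does c r r' [] (B (sz st)) \<and> rep S d (F st e) e r')))"

lemma cmd_I:
  assumes "\<And>st e. sz (F st e) = sz st" "pb B" "\<And>st e r. n0 \<le> sz st \<Longrightarrow> rep S d st e r \<Longrightarrow>
    (\<exists>r'. does c r r' [] (B (sz st)) \<and> rep S d (F st e) e r')"
  shows "cmd S d F"
  unfolding cmd_def using assms by blast

lemma cmd_skip: "cmd S d (\<lambda>st e. st)"
proof (rule cmd_I[of _ "\<lambda>_. 1" 0 _ _ "Prim (Const 2 0)"])
  fix st e r assume "rep S d st e r"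
  then have "rep S d st e (r(2 := 0))"
    by (rule rep_scratch) (auto simp: same_outside_def)
  then show "\<exists>r'. does (Prim (Const 2 0)) r r' [] 1 \<and> rep S d st e r'"
    using does_Const by blast
qed auto

lemma cmd_seq:
  assumes "cmd S d F" "cmd S d G"
  shows "cmd S d (\<lambda>st e. G (F st e) e)"
proof -
  have sz: "\<And>st e. sz (F st e) = sz st" "\<And>st e. sz (G st e) = sz st"
    using assms unfolding cmd_def by auto
  obtain c B n0 where c: "pb B" "\<And>st e r. n0 \<le> sz st \<Longrightarrow> rep S d st e r \<Longrightarrow>
    (\<exists>r'. does c r r' [] (B (sz st)) \<and> rep S d (F st e) e r')"
    using assms unfolding cmd_def by blast
  obtain c' B' n0' where c': "pb B'" "\<And>st e r. n0' \<le> sz st \<Longrightarrow> rep S d st e r \<Longrightarrow>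
    (\<exists>r'. does c' r r' [] (B' (sz st)) \<and> rep S d (G st e) e r')"
    using assms unfolding cmd_def by blast
  show ?thesis
  proof (rule cmd_I[of _ "\<lambda>n. B n + B' n" "n0 + n0'" _ _ "c ;; c'"])
    fix st e r assume n: "n0 + n0' \<le> sz st" and r: "rep S d st e r"
    obtain r1 where r1: "does c r r1 [] (B (sz st))" "rep S d (F st e) e r1"
      using c(2)[OF _ r] n by auto
    obtain r2 where r2: "does c' r1 r2 [] (B' (sz st))" "rep S d (G (F st e) e) e r2"
      using c'(2)[OF _ r1(2)] n sz by auto
    show "\<exists>r'. does (c ;; c') r r' [] (B (sz st) + B' (sz st)) \<and> rep S d (G (F st e) e) e r'"
      using does_seq0[OF r1(1) r2(1)] r2(2) by blast
  qed (simp add: sz, intro pb_add c c')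
qed

lemma cmd_if:
  assumes "dec S d P" "cmd S d F" "cmd S d G"
  shows "cmd S d (\<lambda>st e. if P st e then F st e else G st e)"
proof -
  have sz: "\<And>st e. sz (F st e) = sz st" "\<And>st e. sz (G st e) = sz st"
    using assms unfolding cmd_def by auto
  obtain cP BP nP where cP: "pb BP" "\<And>st e r. nP \<le> sz st \<Longrightarrow> rep S d st e r \<Longrightarrow>
    (\<exists>r'. does cP r r' [] (BP (sz st)) \<and> r' 2 = of_bool (P st e) \<and> rep S d st e r')"
    using assms unfolding dec_def by blast
  obtain c B n0 where c: "pb B" "\<And>st e r. n0 \<le> sz st \<Longrightarrow> rep S d st e r \<Longrightarrow>
    (\<exists>r'. does c r r' [] (B (sz st)) \<and> rep S d (F st e) e r')"
    using assms unfolding cmd_def by blast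
  obtain c' B' n0' where c': "pb B'" "\<And>st e r. n0' \<le> sz st \<Longrightarrow> rep S d st e r \<Longrightarrow>
    (\<exists>r'. does c' r r' [] (B' (sz st)) \<and> rep S d (G st e) e r')"
    using assms unfolding cmd_def by blast
  show ?thesis
  proof (rule cmd_I[of _ "\<lambda>n. BP n + (B n + B' n + 3)" "nP + n0 + n0'" _ _ "cP ;; Cond 2 c c'"])
    fix st e r assume n: "nP + n0 + n0' \<le> sz st" and r: "rep S d st e r"
    obtain r1 where r1: "does cP r r1 [] (BP (sz st))" "r1 2 = of_bool (P st e)" "rep S d st e r1"
      using cP(2)[OF _ r] n by auto
    show "\<exists>r'. does (cP ;; Cond 2 c c') r r' [] (BP (sz st) + (B (sz st) + B' (sz st) + 3)) \<and>
        rep S d (if P st e then F st e else G st e) e r'"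
    proof (cases "P st e")
      case True
      obtain r2 where r2: "does c r1 r2 [] (B (sz st))" "rep S d (F st e) e r2"
        using c(2)[OF _ r1(3)] n by auto
      have "does (Cond 2 c c') r1 r2 [] (B (sz st) + B' (sz st) + 3)"
        using does_mono[OF does_cond_pos[OF _ r2(1)], of 2] True r1(2) by simp
      from does_seq0[OF r1(1) this] show ?thesis
        using r2 True by auto
    next
      case False
      obtain r2 where r2: "does c' r1 r2 [] (B' (sz st))" "rep S d (G st e) e r2"
        using c'(2)[OF _ r1(3)] n by auto
      have "does (Cond 2 c c') r1 (r2(0 := 1)) [] (B (sz st) + B' (sz st) + 3)"
        using does_mono[OF does_cond_zero[OF _ r2(1)], of 2] False r1(2) by simp
      from does_seq0[OF r1(1) this] have
        "does (cP ;; Cond 2 c c') r (r2(0 := 1)) [] (BP (sz st) + (B (sz st) + B' (sz st) + 3))" .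
      moreover have "rep S d (G st e) e (r2(0 := 1))"
        by (rule rep_scratch[OF r2(2)]) (auto simp: same_outside_def)
      ultimately show ?thesis
        unfolding if_not_P[OF False] by (intro exI[of _ "r2(0 := 1)"] conjI)
    qed
  qed (simp add: sz, intro pb_add pb_const cP c c')
qed

lemma cmd_for:
  assumes "cmd S (d + 2) (\<lambda>st e. F st (e 0) (\<lambda>i. e (i + 2)))"
    and szF: "\<And>st v e. sz (F st v e) = sz st"
  shows "cmd S d (\<lambda>st e. fold (\<lambda>v st. F st v e) [0..<sz st] st)"
proof -
  obtain c B n0 where c: "pb B" "\<And>st e r. n0 \<le> sz st \<Longrightarrow> rep S (d + 2) st e r \<Longrightarrow>
    (\<exists>r'. does c r r' [] (B (sz st)) \<and> rep S (d + 2) (F st (e 0) (\<lambda>i. e (i + 2))) e r')"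
    using assms unfolding cmd_def by blast
  have szf: "sz (fold (\<lambda>v st. F st v e) vs st) = sz st" for vs st e
    by (induction vs arbitrary: st) (auto simp: szF)
  show ?thesis
  proof (rule cmd_I[of _ "\<lambda>n. n * (B n + 3) + 5" "n0 + d + 12" _ _ "for_prog d c"])
    fix st e r assume n: "n0 + d + 12 \<le> sz st" and r: "rep S d st e r"
    define n where "n = sz st"
    define Inv where "Inv v st' e' \<longleftrightarrow> e' = e \<and> st' = fold (\<lambda>v st. F st v e) [0..<v] st"
      for v :: nat and st' e'
    have "\<exists>r' st' e'. does (for_prog d c) r r' (concat (map (\<lambda>_. []) [0..<n])) (n * (B n + 3) + 5) \<and>
      rep S d st' e' r' \<and> sz st' = n \<and> Inv n st' e'"
    proof (rule for_loop[where e = e and st = st])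
      fix v st1 e1 r1
      assume v: "v < n" "sz st1 = n" "Inv v st1 e1" and
        r1: "rep S (Suc (Suc d)) st1 (push v (push (n - 1 - v) e1)) r1"
      have e1: "e1 = e"
        using v(3) by (simp add: Inv_def)
      have sh: "(\<lambda>i. push v (push (n - 1 - v) e) (i + 2)) = e"
        by auto
      obtain r2 where r2: "does c r1 r2 [] (B n)"
        "rep S (Suc (Suc d)) (F st1 v e) (push v (push (n - 1 - v) e1)) r2"
        using c(2)[of st1 "push v (push (n - 1 - v) e1)" r1] r1 v n unfolding e1 sh n_def by auto
      show "\<exists>r' st' e'. does c r1 r' [] (B n) \<and> rep S (Suc (Suc d)) st' (push v (push (n - 1 - v) e')) r' \<and>
         sz st' = n \<and> Inv (Suc v) st' e'"
        using r2 v by (intro exI[of _ r2] exI[of _ "F st1 v e"] exI[of _ e]) (auto simp: Inv_def szF)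
    qed (use r n n_def in \<open>auto simp: Inv_def\<close>)
    then show "\<exists>r'. does (for_prog d c) r r' [] (sz st * (B (sz st) + 3) + 5) \<and>
        rep S d (fold (\<lambda>v st. F st v e) [0..<sz st] st) e r'"
      unfolding Inv_def n_def by auto
  qed (simp add: szf, intro pb_add pb_mult pb_const pb_id c)
qed

definition set_rel :: "nat \<Rightarrow> nat list \<Rightarrow> bool \<Rightarrow> st \<Rightarrow> st" where
  "set_rel k xs b st = st\<lparr>rel := (rel st)(k := (rel st k)(xs := b))\<rparr>"

definition set_arr :: "nat \<Rightarrow> nat \<Rightarrow> nat \<Rightarrow> st \<Rightarrow> st" where
  "set_arr k i v st = st\<lparr>arr := (arr st)(k := (arr st k)(i := v))\<rparr>"

text \<open>By injectivity of \<open>hor\<close> on valid keys a store changes one array cell and no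
  register, so it suffices to describe the new state at this key. \<open>tok\<close> protects the
  word.\<close>

lemma rep_cell:
  assumes r: "rep S d st e r" and vk: "vkey (sz st) key"
    and st': "sz st' = sz st" "wd st' = wd st"
    and tok: "\<And>i. key \<noteq> [1, i]"
    and arr: "\<And>k i. k = 2 \<or> k = 3 \<Longrightarrow> i < sz st \<Longrightarrow> arr st' k i = (if key = [k, i] then v else arr st k i) \<and> arr st' k i < sz st"
    and rel: "\<And>k xs. 4 \<le> k \<Longrightarrow> k < S \<Longrightarrow> rel st' k xs = (if key = k # xs then 0 < v else rel st k xs)"
  shows "rep S d st' e (r(hor (sz st) key := v))"
proof -
  let ?r = "r(hor (sz st) key := v)"
  have n: "10 + d \<le> sz st" "4 \<le> S" "S \<le> sz st"
    using repD[OF r] by auto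
  have big: "sz st \<le> hor (sz st) key"
    using hor_ge[OF vk] .
  have vk2: "vkey (sz st) [k, i]" if "k \<in> {1, 2, 3}" "i < sz st" for k i
    using that n by (auto simp: vkey_def)
  have look: "?r (hor (sz st) ks) = (if key = ks then v else r (hor (sz st) ks))" if "vkey (sz st) ks" for ks
    using hor_inj[OF that vk] by auto
  have small: "?r x = r x" if "x < sz st" for x
    using that big by auto
  show ?thesis
    unfolding rep_def st'
  proof (intro conjI allI ballI impI)
    show "?r 1 = sz st" "10 + d \<le> sz st" "4 \<le> S" "S \<le> sz st"
      using n small repD(1)[OF r] by auto
    fix i
    show "i < sz st \<Longrightarrow> ?r (hor (sz st) [1, i]) = tokv (wd st) i" "i < sz st \<Longrightarrow> tokv (wd st) i \<le> sz st"
      using look[OF vk2, of 1 i] tok repD(5,6)[OF r] by auto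
    fix k :: nat
    show "?r (hor (sz st) [k, i]) = arr st' k i" if "k \<in> {2, 3}" "i < sz st"
    proof -
      have "vkey (sz st) [k, i]"
        by (rule vk2) (use that in auto)
      from look[OF this] show ?thesis
        using arr[of k i] repD(7)[OF r, of k i] that by auto
    qed
    show "arr st' k i < sz st" if "k \<in> {2, 3}" "i < sz st"
      using arr[of k i] that by auto
  next
    fix k xs assume k: "4 \<le> k" "k < S" "vkey (sz st) (k # xs)"
    show "(0 < ?r (hor (sz st) (k # xs))) = rel st' k xs"
      using look[OF k(3)] rel[OF k(1,2), of xs] repD(9)[OF r k] by auto
  next
    fix i assume i: "i < d"
    have "10 + (d - 1 - i) < sz st"
      using n i by auto
    then show "e i < sz st" "?r (10 + (d - 1 - i)) = e i"
      using small repD(10,11)[OF r i] by auto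
  qed
qed

lemma cmd_set_rel:
  assumes k: "4 \<le> k" "k < S" and ix: "ix \<noteq> []" "\<forall>i\<in>set ix. i < d"
  shows "cmd S d (\<lambda>st e. set_rel k (map e ix) b st)"
proof (rule cmd_I[of _ "\<lambda>n. 1 + ((1 + length ix * ((k + 1) * n ^ length ix * (3 * n + 6) + 3 * n + 9)) + 1)" 0 _ _
      "Prim (Const 8 (of_bool b)) ;; addr_prog k (map (\<lambda>i. 10 + (d - 1 - i)) ix) ;; Prim (Store 3 8)"])
  fix st e r assume r: "rep S d st e r"
  let ?B = "1 + length ix * ((k + 1) * sz st ^ length ix * (3 * sz st + 6) + 3 * sz st + 9)"
  have r0: "rep S d st e (r(8 := of_bool b))"
    by (rule rep_scratch[OF r]) (auto simp: same_outside_def)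
  obtain r' where r': "does (addr_prog k (map (\<lambda>i. 10 + (d - 1 - i)) ix)) (r(8 := of_bool b)) r' [] ?B"
    "r' 3 = hor (sz st) (k # map e ix)" "same_outside {0, 3, 4, 5} (r(8 := of_bool b)) r'"
    using does_lookup[OF r0 ix(2)] by blast
  have rep': "rep S d st e r'"
    by (rule rep_scratch[OF r0]) (use r'(3) in \<open>auto simp: same_outside_def\<close>)
  have v: "r' 8 = of_bool b"
    using r'(3) by (auto simp: same_outside_def)
  have vk: "vkey (sz st) (k # map e ix)"
    using k ix repD(4,10)[OF r] by (auto simp: vkey_def)
  have "rep S d (set_rel k (map e ix) b st) e (r'(r' 3 := r' 8))"
    unfolding r'(2) v
    by (rule rep_cell[OF rep' vk]) (use k repD(8)[OF r] in \<open>auto simp: set_rel_def\<close>)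
  moreover have "does (Prim (Const 8 (of_bool b)) ;; addr_prog k (map (\<lambda>i. 10 + (d - 1 - i)) ix) ;; Prim (Store 3 8))
      r (r'(r' 3 := r' 8)) [] (1 + (?B + 1))"
    by (intro does_seq0[OF does_Const] does_seq0[OF r'(1)] does_Store)
  ultimately show "\<exists>r'. does (Prim (Const 8 (of_bool b)) ;; addr_prog k (map (\<lambda>i. 10 + (d - 1 - i)) ix) ;; Prim (Store 3 8))
      r r' [] (1 + (?B + 1)) \<and> rep S d (set_rel k (map e ix) b st) e r'"
    by blast
qed (simp add: set_rel_def, intro pb_add pb_mult pb_power pb_const pb_id)

lemma cmd_set_arr:
  assumes k: "k = 2 \<or> k = 3" and i: "i < d" and f: "val d f"
    and lt: "\<And>st e r. rep S d st e r \<Longrightarrow> f st e < sz st"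
  shows "cmd S d (\<lambda>st e. set_arr k (e i) (f st e) st)"
proof -
  obtain c B n0 where c: "pb B" "\<And>S st e r. n0 \<le> sz st \<Longrightarrow> rep S d st e r \<Longrightarrow> f st e \<le> sz st \<and>
    (\<exists>r'. does c r r' [] (B (sz st)) \<and> r' 3 = f st e \<and> same_outside {0, 3, 4, 5} r r')"
    using f unfolding val_def by blast
  let ?c = "c ;; Prim (Move 8 3) ;; addr_prog k (map (\<lambda>i. 10 + (d - 1 - i)) [i]) ;; Prim (Store 3 8)"
  show ?thesis
  proof (rule cmd_I[of _ "\<lambda>n. B n + (1 + ((1 + length [i] * ((k + 1) * n ^ length [i] * (3 * n + 6) + 3 * n + 9)) + 1))" n0 _ _ ?c])
    fix st e r assume n: "n0 \<le> sz st" and r: "rep S d st e r"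
    let ?B = "1 + length [i] * ((k + 1) * sz st ^ length [i] * (3 * sz st + 6) + 3 * sz st + 9)"
    obtain r1 where r1: "does c r r1 [] (B (sz st))" "r1 3 = f st e" "same_outside {0, 3, 4, 5} r r1"
      using c(2)[OF n r] by auto
    let ?r1 = "r1(8 := r1 3)"
    have rep1: "rep S d st e ?r1"
      by (rule rep_scratch[OF r]) (use r1 in \<open>auto simp: same_outside_def\<close>)
    obtain r' where r': "does (addr_prog k (map (\<lambda>i. 10 + (d - 1 - i)) [i])) ?r1 r' [] ?B"
      "r' 3 = hor (sz st) (k # map e [i])" "same_outside {0, 3, 4, 5} ?r1 r'"
      using does_lookup[OF rep1, of "[i]" k] i by auto
    have rep': "rep S d st e r'"
      by (rule rep_scratch[OF rep1]) (use r'(3) in \<open>auto simp: same_outside_def\<close>)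
    have v: "r' 8 = f st e"
      using r'(3) r1(2) by (auto simp: same_outside_def)
    have vk: "vkey (sz st) (k # map e [i])"
      using k i repD(3,4,10)[OF r] by (auto simp: vkey_def)
    have "rep S d (set_arr k (e i) (f st e) st) e (r'(r' 3 := r' 8))"
      unfolding r'(2) v
      by (rule rep_cell[OF rep' vk]) (use k repD(8)[OF r] lt[OF r] in \<open>auto simp: set_arr_def\<close>)
    moreover have "does ?c r (r'(r' 3 := r' 8)) [] (B (sz st) + (1 + (?B + 1)))"
      by (intro does_seq0[OF r1(1)] does_seq0[OF does_Move] does_seq0[OF r'(1)] does_Store)
    ultimately show "\<exists>r'. does ?c r r' [] (B (sz st) + (1 + (?B + 1))) \<and> rep S d (set_arr k (e i) (f st e) st) e r'"
      by blast
  qed (simp add: set_arr_def, intro pb_add pb_mult pb_power pb_const pb_id c)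
qed


subsection \<open>Loops over tuples\<close>

definition tuples :: "nat \<Rightarrow> nat \<Rightarrow> nat list list" where
  "tuples n r = product_lists (replicate r [0..<n])"

definition ok :: "nat \<Rightarrow> nat \<Rightarrow> nat list \<Rightarrow> bool" where
  "ok n r xs \<longleftrightarrow> length xs = r \<and> set xs \<subseteq> {..<n}"

lemma ok_0 [simp]: "ok n 0 xs \<longleftrightarrow> xs = []"
  by (auto simp: ok_def)

lemma ok_Suc: "ok n (Suc r) zs \<longleftrightarrow> (\<exists>v ys. zs = v # ys \<and> v < n \<and> ok n r ys)"
  by (cases zs) (auto simp: ok_def)

lemma set_tuples: "xs \<in> set (tuples n r) \<longleftrightarrow> ok n r xs"
proof (induction r arbitrary: xs)
  case 0
  then show ?case by (auto simp: tuples_def ok_def)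
next
  case (Suc r)
  then show ?case
    by (cases xs) (auto simp: tuples_def ok_def image_iff Bex_def)
qed

lemma fold_tuples_Suc:
  "fold f (tuples n (Suc r)) st = fold (\<lambda>v st. fold (\<lambda>xs st. f (v # xs) st) (tuples n r) st) [0..<n] st"
proof -
  have "fold f (concat (map (\<lambda>v. map (Cons v) xss) vs)) st =
     fold (\<lambda>v st. fold (\<lambda>xs st. f (v # xs) st) xss st) vs st" for xss vs
    by (induction vs arbitrary: st) (simp_all add: fold_map comp_def)
  then show ?thesis
    by (simp add: tuples_def)
qed

text \<open>Each \<open>cmd_for\<close> loop pushes two values, its index and a counter, so the indices of \<open>r\<close> nested
  loops are found at the even positions.\<close>

definition args :: "nat \<Rightarrow> (nat \<Rightarrow> nat) \<Rightarrow> nat list" where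
  "args r e = map (\<lambda>i. e (2 * (r - 1 - i))) [0..<r]"

lemma args_Suc: "args (Suc r) e = e (2 * r) # args r e"
  by (simp add: args_def upt_conv_Cons map_Suc_upt[symmetric] del: upt_Suc map_Suc_upt)

lemma nth_args [simp]: "i < r \<Longrightarrow> args r e ! i = e (2 * (r - 1 - i))"
  by (simp add: args_def)

lemma cmd_tuples:
  assumes "cmd S (d + 2 * r) (\<lambda>st e. F st (args r e) (\<lambda>i. e (i + 2 * r)))"
    and szF: "\<And>st xs e. sz (F st xs e) = sz st"
  shows "cmd S d (\<lambda>st e. fold (\<lambda>xs st. F st xs e) (tuples (sz st) r) st)"
  using assms
proof (induction r arbitrary: d F)
  case 0
  then show ?case by (simp add: tuples_def args_def)
next
  case (Suc r)
  have szf: "sz (fold (\<lambda>xs st. F st (v # xs) e) xss st) = sz st" for v xss st e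
    by (induction xss arbitrary: st) (auto simp: Suc.prems(2))
  have "cmd S (d + 2) (\<lambda>st e. fold (\<lambda>xs st. F st (e 0 # xs) (\<lambda>i. e (i + 2))) (tuples (sz st) r) st)"
  proof (rule Suc.IH)
    show "cmd S (d + 2 + 2 * r) (\<lambda>st e. F st (e (0 + 2 * r) # args r e) (\<lambda>i. e (i + 2 + 2 * r)))"
      using Suc.prems(1) by (simp add: args_Suc ac_simps)
  qed (rule Suc.prems(2))
  then have "cmd S d (\<lambda>st e. fold (\<lambda>v st. fold (\<lambda>xs st. F st (v # xs) e) (tuples (sz st) r) st) [0..<sz st] st)"
    by (rule cmd_for) (rule szf)
  \<comment> \<open>The nested loops take the range of the inner tuples from the current state, the
    unfolded fold from the initial one; the two agree because \<open>F\<close> keeps the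
    size.\<close>
  moreover have swap: "fold (\<lambda>v st. fold (\<lambda>xs st. F st (v # xs) e) (tuples (sz st) r) st) vs st' =
     fold (\<lambda>v st'. fold (\<lambda>xs st. F st (v # xs) e) (tuples (sz st) r) st') vs st'"
    if "sz st' = sz st" for vs st st' e
    using that by (induction vs arbitrary: st') (simp_all add: szf)
  have "(\<lambda>st e. fold (\<lambda>xs st. F st xs e) (tuples (sz st) (Suc r)) st) =
     (\<lambda>st e. fold (\<lambda>v st. fold (\<lambda>xs st. F st (v # xs) e) (tuples (sz st) r) st) [0..<sz st] st)"
    unfolding fold_tuples_Suc by (intro ext) (rule swap[OF refl, symmetric])
  ultimately show ?case
    by (simp only:)
qed

text \<open>One nested loop per list entry, with three environment entries each, which explains the
  multiples of 3. The length \<open>r\<close> enters the degree of the running time.\<close>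

lemma D_ex_list:
  assumes "dec S (d + 3 * r) (\<lambda>st e. P st (map (\<lambda>i. e (3 * (r - 1 - i))) [0..<r]) (\<lambda>i. e (i + 3 * r)))"
  shows "dec S d (\<lambda>st e. \<exists>ys. ok (sz st) r ys \<and> P st ys e)"
  using assms
proof (induction r arbitrary: d P)
  case 0
  then show ?case by (simp add: ok_def)
next
  case (Suc r)
  have "dec S (d + 3) (\<lambda>st e. \<exists>ys. ok (sz st) r ys \<and> P st (e 0 # ys) (\<lambda>i. e (i + 3)))"
  proof (rule Suc.IH)
    have "map (\<lambda>i. e (3 * (Suc r - 1 - i))) [0..<Suc r] = e (3 * r) # map (\<lambda>i. e (3 * (r - 1 - i))) [0..<r]"
      for e :: "nat \<Rightarrow> nat"
      by (simp add: upt_conv_Cons map_Suc_upt[symmetric] del: upt_Suc map_Suc_upt)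
    then show "dec S (d + 3 + 3 * r) (\<lambda>st e. P st (e (0 + 3 * r) # map (\<lambda>i. e (3 * (r - 1 - i))) [0..<r])
        (\<lambda>i. e (i + 3 + 3 * r)))"
      using Suc.prems by (simp add: ac_simps)
  qed
  then have "dec S d (\<lambda>st e. \<exists>v<sz st. \<exists>ys. ok (sz st) r ys \<and> P st (v # ys) e)"
    by (rule D_ex)
  moreover have "(\<lambda>st e. \<exists>ys. ok (sz st) (Suc r) ys \<and> P st ys e) =
     (\<lambda>st e. \<exists>v<sz st. \<exists>ys. ok (sz st) r ys \<and> P st (v # ys) e)"
    unfolding ok_Suc by (intro ext) blast
  ultimately show ?case
    by (simp only:)
qed


subsection \<open>Reachability\<close>

inductive reach :: "nat \<Rightarrow> nat \<Rightarrow> (nat list \<Rightarrow> bool) \<Rightarrow> (nat list \<Rightarrow> nat list \<Rightarrow> bool) \<Rightarrow> nat list \<Rightarrow> bool"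
  for n r I R where
  start: "I xs \<Longrightarrow> ok n r xs \<Longrightarrow> reach n r I R xs"
| step: "reach n r I R ys \<Longrightarrow> R ys xs \<Longrightarrow> ok n r xs \<Longrightarrow> reach n r I R xs"

lemma reach_ok: "reach n r I R xs \<Longrightarrow> ok n r xs"
  by (induction rule: reach.induct)

lemma fold_increasing:
  fixes X :: "'b :: order"
  assumes "\<And>x X. X \<le> f x X" shows "X \<le> fold f xs X"
proof (induction xs arbitrary: X)
  case (Cons x xs)
  show ?case using order_trans[OF assms Cons] by simp
qed simp

lemma fold_relate:
  assumes "\<And>x X Y. x \<in> set xs \<Longrightarrow> Q X Y \<Longrightarrow> Q (f x X) (g x Y)" "Q X Y"
  shows "Q (fold f xs X) (fold g xs Y)"
  using assms by (induction xs arbitrary: X Y) auto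

definition relax :: "(nat list \<Rightarrow> nat list \<Rightarrow> bool) \<Rightarrow> nat list \<Rightarrow> nat list \<Rightarrow> (nat list \<Rightarrow> bool) \<Rightarrow> nat list \<Rightarrow> bool" where
  "relax R ys xs X = (if X ys \<and> R ys xs then X(xs := True) else X)"

text \<open>One sweep in the manner of Bellman and Ford over all pairs; relaxing in place, it may
  already use tuples added in the same sweep.\<close>

definition pass :: "nat list list \<Rightarrow> (nat list \<Rightarrow> nat list \<Rightarrow> bool) \<Rightarrow> (nat list \<Rightarrow> bool) \<Rightarrow> nat list \<Rightarrow> bool" where
  "pass ts R X = fold (\<lambda>ys. fold (relax R ys) ts) ts X"

lemma relax_increasing: "X \<le> relax R ys xs X"
  by (auto simp: relax_def le_fun_def)

lemma pass_invariant:
  assumes "X \<le> Y" "\<And>ys xs. ys \<in> set ts \<Longrightarrow> xs \<in> set ts \<Longrightarrow> Y ys \<Longrightarrow> R ys xs \<Longrightarrow> Y xs"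
  shows "pass ts R X \<le> Y"
  unfolding pass_def
proof (rule fold_relate[where Q = "\<lambda>X _. X \<le> Y" and g = "\<lambda>_ u. u" and Y = "()"])
  fix ys X and u :: unit assume "ys \<in> set ts" "X \<le> Y"
  then show "fold (relax R ys) ts X \<le> Y"
    by (intro fold_relate[where Q = "\<lambda>X _. X \<le> Y" and g = "\<lambda>_ u. u" and Y = "()"])
      (use assms(2) in \<open>auto simp: relax_def le_fun_def\<close>)
qed (rule assms(1))

lemma pass_mono: "X \<le> pass ts R X"
  unfolding pass_def by (intro fold_increasing relax_increasing)

lemma pass_step:
  assumes "X ys" "R ys xs" "ys \<in> set ts" "xs \<in> set ts"
  shows "pass ts R X xs"
proof -
  \<comment> \<open>The sweep is split at the moment when the pair \<open>ys\<close>,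
    \<open>xs\<close> is relaxed: what holds initially persists until then, and what is added
    persists to the end.\<close>
  obtain as bs where ts: "ts = as @ ys # bs"
    using assms(3) by (meson split_list)
  obtain as' bs' where ts': "ts = as' @ xs # bs'"
    using assms(4) by (meson split_list)
  let ?f = "\<lambda>ys. fold (relax R ys) ts"
  have le: "Z \<le> fold (relax R ys) xss Z" "Z \<le> fold ?f xss Z" for Z xss ys
    by (intro fold_increasing relax_increasing)+
  define Z where "Z = fold ?f as X"
  have "Z ys"
    using le(2)[of X as] assms(1) by (auto simp: le_fun_def Z_def)
  then have "fold (relax R ys) as' Z ys"
    using le(1)[of Z ys as'] by (auto simp: le_fun_def)
  then have "relax R ys xs (fold (relax R ys) as' Z) xs"
    using assms(2) by (simp add: relax_def)
  then have "?f ys Z xs"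
    using le(1)[of "relax R ys xs (fold (relax R ys) as' Z)" ys bs'] by (auto simp: le_fun_def ts')
  moreover have "?f ys Z \<le> fold ?f bs (?f ys Z)"
    by (rule le(2))
  ultimately have "fold ?f bs (?f ys Z) xs"
    by (auto simp: le_fun_def)
  then have "fold ?f (as @ ys # bs) X xs"
    by (simp add: Z_def)
  then show ?thesis
    using ts by (simp add: pass_def)
qed

text \<open>As long as a step is not stationary it adds an element of \<open>U\<close>; so after
  \<open>card U\<close> steps either the iteration has stopped or \<open>U\<close> is
  exhausted.\<close>

lemma pass_iterate:
  assumes fin: "finite U" and X: "X0 \<le> (\<lambda>xs. xs \<in> U)"
    and bd: "\<And>X. X \<le> (\<lambda>xs. xs \<in> U) \<Longrightarrow> f X \<le> (\<lambda>xs. xs \<in> U)" and inc: "\<And>X. X \<le> f X"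
    and N: "card U \<le> N"
  shows "f ((f ^^ N) X0) = (f ^^ N) X0"
proof -
  have b: "(f ^^ i) X0 \<le> (\<lambda>xs. xs \<in> U)" for i
    by (induction i) (auto simp: X bd)
  have "f ((f ^^ i) X0) = (f ^^ i) X0 \<or> i \<le> card {x. (f ^^ i) X0 x}" for i
  proof (induction i)
    case (Suc i)
    show ?case
    proof (cases "f ((f ^^ i) X0) = (f ^^ i) X0")
      case False
      then have "(f ^^ i) X0 < f ((f ^^ i) X0)"
        using inc by (simp add: order_less_le)
      then have "{x. (f ^^ i) X0 x} \<subset> {x. f ((f ^^ i) X0) x}"
        by (auto simp: less_le_not_le le_fun_def)
      moreover have "finite {x. f ((f ^^ i) X0) x}"
        by (rule finite_subset[OF _ fin]) (use b[of "Suc i"] in \<open>auto simp: le_fun_def\<close>)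
      ultimately have "card {x. (f ^^ i) X0 x} < card {x. f ((f ^^ i) X0) x}"
        by (rule psubset_card_mono[rotated])
      then show ?thesis
        using Suc False by auto
    qed simp
  qed simp
  from this[of N] show ?thesis
  proof
    assume "N \<le> card {x. (f ^^ N) X0 x}"
    moreover have "{x. (f ^^ N) X0 x} \<subseteq> U"
      using b[of N] by (auto simp: le_fun_def)
    ultimately have "{x. (f ^^ N) X0 x} = U"
      using N fin by (meson card_seteq le_trans)
    then have "(\<lambda>x. x \<in> U) \<le> (f ^^ N) X0"
      by (auto simp: le_fun_def)
    then show ?thesis
      using inc[of "(f ^^ N) X0"] b[of N] b[of "Suc N"] by (auto intro!: antisym elim: order_trans)
  qed
qed

text \<open>Sweeps stay within the reachable set, which is closed under \<open>R\<close>. Conversely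
  the fixed point contains the start tuples and, as a further sweep adds nothing, is closed under
  \<open>R\<close> too.\<close>

lemma reach_iterate:
  assumes "\<And>xs. X0 xs \<longleftrightarrow> ok n r xs \<and> I xs"
  shows "(pass (tuples n r) R ^^ length (tuples n r)) X0 = reach n r I R"
proof (rule antisym)
  let ?f = "pass (tuples n r) R"
  have "(?f ^^ i) X0 \<le> reach n r I R" for i
  proof (induction i)
    case (Suc i)
    then have "?f ((?f ^^ i) X0) \<le> reach n r I R"
      by (rule pass_invariant) (auto simp: set_tuples intro: reach.step)
    then show ?case by simp
  qed (auto simp: assms intro: reach.start)
  then show "(?f ^^ length (tuples n r)) X0 \<le> reach n r I R" .
  let ?X = "(?f ^^ length (tuples n r)) X0"
  have fixp: "?f ?X = ?X"
  proof (rule pass_iterate[where U = "set (tuples n r)"])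
    show "X0 \<le> (\<lambda>xs. xs \<in> set (tuples n r))"
      by (auto simp: assms set_tuples)
    show "pass (tuples n r) R X \<le> (\<lambda>xs. xs \<in> set (tuples n r))" if "X \<le> (\<lambda>xs. xs \<in> set (tuples n r))" for X
      using that by (intro pass_invariant) auto
  qed (simp_all add: pass_mono card_length)
  have mono: "X0 \<le> (?f ^^ i) X0" for i
  proof (induction i)
    case (Suc i)
    show ?case using order_trans[OF Suc pass_mono] by simp
  qed simp
  show "reach n r I R \<le> ?X"
  proof (rule predicate1I)
    fix xs assume "reach n r I R xs"
    then show "?X xs"
    proof induction
      case (start xs)
      then have "X0 xs"
        by (simp add: assms)
      then show ?case
        using mono by (auto simp: le_fun_def)
    next
      case (step ys xs)
      have "?f ?X xs"
        using step reach_ok[OF step.hyps(1)]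
        by (intro pass_step[of ?X ys R xs]) (auto simp: set_tuples)
      then show ?case
        by (simp add: fixp)
    qed
  qed
qed

definition with_rel :: "nat \<Rightarrow> (nat list \<Rightarrow> bool) \<Rightarrow> st \<Rightarrow> st" where
  "with_rel S X st = st\<lparr>rel := (rel st)(S := X)\<rparr>"

lemma with_rel_simps [simp]:
  "sz (with_rel S X st) = sz st" "wd (with_rel S X st) = wd st" "arr (with_rel S X st) = arr st"
  "rel (with_rel S X st) S = X" "with_rel S Y (with_rel S X st) = with_rel S Y st"
  "set_rel S xs b (with_rel S X st) = with_rel S (X(xs := b)) st"
  "with_rel S (rel st S) st = st"
  by (simp_all add: with_rel_def set_rel_def)

lemma fold_commute:
  assumes "\<And>x X. f x (g X) = g (h x X)"
  shows "fold f xs (g X) = g (fold h xs X)"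
  using assms by (induction xs arbitrary: X) auto

lemma fold_const: "fold (\<lambda>_. f) xs X = (f ^^ length xs) X"
  by (induction xs arbitrary: X) (auto simp: funpow_swap1)

lemma fold_set: "fold (\<lambda>xs X. X(xs := I xs)) ts X = (\<lambda>xs. if xs \<in> set ts then I xs else X xs)"
  by (induction ts arbitrary: X) (auto simp: fun_eq_iff)

text \<open>The array also has cells for tuples of other lengths, with arbitrary contents. A sweep
  neither reads nor writes them, so the actual table may be compared with an idealised one.\<close>

lemma pass_agree:
  assumes "\<And>xs. ok n r xs \<Longrightarrow> X xs \<longleftrightarrow> Y xs" "ok n r xs"
  shows "(pass (tuples n r) R ^^ i) X xs \<longleftrightarrow> (pass (tuples n r) R ^^ i) Y xs"
proof -
  define Q where "Q X Y \<longleftrightarrow> (\<forall>xs. ok n r xs \<longrightarrow> X xs = Y xs)" for X Y :: "nat list \<Rightarrow> bool"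
  have "Q (pass (tuples n r) R X) (pass (tuples n r) R Y)" if "Q X Y" for X Y
    unfolding pass_def
    by (intro fold_relate[where Q = Q] that) (auto simp: relax_def Q_def set_tuples)
  then have "Q ((pass (tuples n r) R ^^ i) X) ((pass (tuples n r) R ^^ i) Y)"
    using assms(1) by (induction i) (auto simp: Q_def)
  then show ?thesis
    using assms(2) by (simp add: Q_def)
qed

lemma args_map: "args r e = map e (map (\<lambda>i. 2 * (r - 1 - i)) [0..<r])"
  by (simp add: args_def)

text \<open>Relation \<open>S\<close> is the working array; so \<open>I\<close> and \<open>R\<close>
  are decided at \<open>Suc S\<close> and, by \<open>clI\<close> and \<open>clR\<close>, do not
  depend on it, and nested reachability climbs to higher ids. A loop over tuples takes
  \<open>2 * r\<close> entries, and \<open>R\<close> sits inside three of them: repetition, source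
  and target.\<close>

lemma D_reach:
  assumes S: "4 \<le> S" and ix: "ix \<noteq> []" "length ix = r" "\<forall>i\<in>set ix. i < d"
    and I: "dec (Suc S) (d + 2 * r) (\<lambda>st e. I st (\<lambda>i. e (i + 2 * r)) (args r e))"
    and R: "dec (Suc S) (d + 6 * r) (\<lambda>st e. R st (\<lambda>i. e (i + 6 * r)) (args r (\<lambda>i. e (i + 2 * r))) (args r e))"
    and clI: "\<And>X st e. I (with_rel S X st) e = I st e"
    and clR: "\<And>X st e. R (with_rel S X st) e = R st e"
  shows "dec S d (\<lambda>st e. reach (sz st) r (I st e) (R st e) (map e ix))"
proof -
  define init where "init st e = fold (\<lambda>xs st. if I st e xs then set_rel S xs True st else set_rel S xs False st)
     (tuples (sz st) r) st" for st e
  define inner where "inner st ys e = fold (\<lambda>xs st. if rel st S ys \<and> R st e ys xs then set_rel S xs True st else st)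
     (tuples (sz st) r) st" for st ys e
  define outer where "outer st e = fold (\<lambda>ys st. inner st ys e) (tuples (sz st) r) st" for st e
  \<comment> \<open>A loop whose index is ignored: it repeats the sweep as often as there are
    tuples, which saturates the table by \<open>reach_iterate\<close>.\<close>
  define rep_outer where "rep_outer st e = fold (\<lambda>_ st. outer st e) (tuples (sz st) r) st" for st e
  have [simp]: "sz (set_rel k xs b st) = sz st" for k xs b st
    by (simp add: set_rel_def)
  have szf: "sz (fold f xs st) = sz st" if "\<And>x st. sz (f x st) = sz st" for f :: "nat list \<Rightarrow> st \<Rightarrow> st" and xs st
    using that by (induction xs arbitrary: st) auto
  have [simp]: "sz (inner st ys e) = sz st" for st ys e
    unfolding inner_def by (rule szf) simp
  have [simp]: "sz (outer st e) = sz st" for st e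
    unfolding outer_def by (rule szf) simp
  have r: "r \<noteq> 0"
    using ix by auto
  have idx: "map (\<lambda>i. 2 * (r - 1 - i)) [0..<r] \<noteq> []" "\<forall>i\<in>set (map (\<lambda>i. 2 * (r - 1 - i)) [0..<r]). i < d' + 2 * r" for d'
    using r by auto
  have set: "cmd (Suc S) (d' + 2 * r) (\<lambda>st e. set_rel S (args r e) b st)" for b d'
    unfolding args_map by (rule cmd_set_rel) (use S idx in auto)
  have cinit: "cmd (Suc S) d init"
    unfolding init_def by (intro cmd_tuples cmd_if set I) simp
  have shift: "i + 2 * r + 2 * r + 2 * r = i + 6 * r" for i
    by simp
  have cinner: "cmd (Suc S) (d + 2 * r + 2 * r) (\<lambda>st e. inner st (args r e) (\<lambda>i. e (i + 2 * r + 2 * r)))"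
    unfolding inner_def
  proof (rule cmd_tuples[where F = "\<lambda>st xs e. if rel st S (args r e) \<and> R st (\<lambda>i. e (i + 2 * r + 2 * r)) (args r e) xs
      then set_rel S xs True st else st"])
    have "dec (Suc S) (d + 2 * r + 2 * r + 2 * r) (\<lambda>st e. rel st S (map e (map (\<lambda>i. 2 * (r - 1 - i) + 2 * r) [0..<r])))"
      by (rule D_rel) (use S r in auto)
    then have "dec (Suc S) (d + 2 * r + 2 * r + 2 * r) (\<lambda>st e. rel st S (args r (\<lambda>i. e (i + 2 * r))))"
      by (simp add: args_def comp_def)
    then show "cmd (Suc S) (d + 2 * r + 2 * r + 2 * r) (\<lambda>st e.
        if rel st S (args r (\<lambda>i. e (i + 2 * r))) \<and> R st (\<lambda>i. e (i + 2 * r + 2 * r + 2 * r)) (args r (\<lambda>i. e (i + 2 * r))) (args r e)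
        then set_rel S (args r e) True st else st)"
      using R set[of "d + 2 * r + 2 * r" True] unfolding shift by (intro cmd_if D_conj cmd_skip)
  qed simp
  have "cmd (Suc S) (d + 2 * r) (\<lambda>st e. outer st (\<lambda>i. e (i + 2 * r)))"
    unfolding outer_def
    by (rule cmd_tuples[where F = "\<lambda>st ys e. inner st ys (\<lambda>i. e (i + 2 * r))"]) (rule cinner, simp)
  then have crep: "cmd (Suc S) d rep_outer"
    unfolding rep_outer_def
    by (intro cmd_tuples[where F = "\<lambda>st ys e. outer st e"]) simp_all
  have sem: "\<exists>X'. rep_outer (init (with_rel S X st) e) e = with_rel S X' st \<and>
      (\<forall>xs. ok (sz st) r xs \<longrightarrow> X' xs = reach (sz st) r (I st e) (R st e) xs)" for X st e
  proof -
    let ?ts = "tuples (sz st) r"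
    let ?X0 = "\<lambda>xs. if xs \<in> set ?ts then I st e xs else X xs"
    have 1: "init (with_rel S X st) e = with_rel S ?X0 st"
      unfolding init_def with_rel_simps fold_set[symmetric]
      by (rule fold_commute[where g = "\<lambda>X. with_rel S X st"]) (auto simp: clI)
    have 2: "inner (with_rel S X st) ys e = with_rel S (fold (relax (R st e) ys) ?ts X) st" for X ys
      unfolding inner_def with_rel_simps
      by (rule fold_commute[where g = "\<lambda>X. with_rel S X st"]) (auto simp: clR relax_def)
    have 3: "outer (with_rel S X st) e = with_rel S (pass ?ts (R st e) X) st" for X
      unfolding outer_def pass_def with_rel_simps
      by (rule fold_commute[where g = "\<lambda>X. with_rel S X st"]) (rule 2)
    have 4: "rep_outer (with_rel S X st) e = with_rel S ((pass ?ts (R st e) ^^ length ?ts) X) st" for X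
      unfolding rep_outer_def with_rel_simps fold_const[symmetric]
      by (rule fold_commute[where g = "\<lambda>X. with_rel S X st"]) (rule 3)
    have "(pass ?ts (R st e) ^^ length ?ts) ?X0 xs = reach (sz st) r (I st e) (R st e) xs"
      if "ok (sz st) r xs" for xs
      using pass_agree[of "sz st" r ?X0 "\<lambda>xs. ok (sz st) r xs \<and> I st e xs" xs] that
        reach_iterate[of "\<lambda>xs. ok (sz st) r xs \<and> I st e xs" "sz st" r "I st e" "R st e"]
      by (simp add: set_tuples)
    then show ?thesis
      unfolding 1 4 by blast
  qed
  have "cmd (Suc S) d (\<lambda>st e. rep_outer (init st e) e)"
    by (rule cmd_seq[OF cinit crep])
  then obtain c B n0 where c: "pb B" "\<And>st e r. n0 \<le> sz st \<Longrightarrow> rep (Suc S) d st e r \<Longrightarrow>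
     (\<exists>r'. does c r r' [] (B (sz st)) \<and> rep (Suc S) d (rep_outer (init st e) e) e r')"
    unfolding cmd_def by blast
  have "dec (Suc S) d (\<lambda>st e. rel st S (map e ix))"
    by (rule D_rel) (use S ix in auto)
  then obtain c' B' n0' where c': "pb B'" "\<And>st e r. n0' \<le> sz st \<Longrightarrow> rep (Suc S) d st e r \<Longrightarrow>
    (\<exists>r'. does c' r r' [] (B' (sz st)) \<and> r' 2 = of_bool (rel st S (map e ix)) \<and> rep (Suc S) d st e r')"
    unfolding dec_def by blast
  show ?thesis
  proof (rule D_I[of "\<lambda>n. B n + B' n" "n0 + n0' + Suc S" _ _ "c ;; c'"])
    fix st e m assume n: "n0 + n0' + Suc S \<le> sz st" and m: "rep S d st e m"
    \<comment> \<open>The array holds leftovers of earlier computations. \<open>X\<close> reads them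
      off, so that the memory represents a state in which relation \<open>S\<close> has a meaning
      before it is initialised.\<close>
    define X where "X xs \<longleftrightarrow> 0 < m (hor (sz st) (S # xs))" for xs
    have "rep (Suc S) d (with_rel S X st) e m"
      using m n unfolding rep_def by (auto simp: less_Suc_eq with_rel_def X_def)
    then obtain m1 where m1: "does c m m1 [] (B (sz st))"
      "rep (Suc S) d (rep_outer (init (with_rel S X st) e) e) e m1"
      using c(2)[of "with_rel S X st" e m] n by auto
    obtain X' where X': "rep_outer (init (with_rel S X st) e) e = with_rel S X' st"
      "\<And>xs. ok (sz st) r xs \<Longrightarrow> X' xs = reach (sz st) r (I st e) (R st e) xs"
      using sem by blast
    obtain m2 where m2: "does c' m1 m2 [] (B' (sz st))" "m2 2 = of_bool (X' (map e ix))"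
      "rep (Suc S) d (with_rel S X' st) e m2"
      using c'(2)[of "with_rel S X' st" e m1] m1(2) n X'(1) by auto
    have "ok (sz st) r (map e ix)"
      using ix repD(10)[OF m] by (auto simp: ok_def)
    then have "m2 2 = of_bool (reach (sz st) r (I st e) (R st e) (map e ix))"
      using m2(2) X'(2) by simp
    moreover have "rep S d st e m2"
      using m2(3) S n unfolding rep_def by (auto simp: with_rel_def)
    ultimately show "\<exists>r'. does (c ;; c') m r' [] (B (sz st) + B' (sz st)) \<and>
        r' 2 = of_bool (reach (sz st) r (I st e) (R st e) (map e ix)) \<and> rep S d st e r'"
      using does_seq0[OF m1(1) m2(1)] by blast
  qed (intro pb_add c c')
qed

section \<open>Thompson automata whose states are positions in the encoded formula\<close>

section \<open>Position automata of regex formulas\<close>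

type_synonym state = "nat \<times> nat"
type_synonym ('a, 'v) edge = "state \<times> ('a, 'v) refword \<times> state"

text \<open>The states \<open>(p, 0)\<close> and \<open>(p, 1)\<close> are the entry and the exit of the subformula whose encoding
  starts at position \<open>p\<close>.\<close>

fun edges :: "('a \<Rightarrow> bool list) \<Rightarrow> ('v \<Rightarrow> bool list) \<Rightarrow> ('a, 'v) rgx \<Rightarrow> nat \<Rightarrow> ('a, 'v) edge set" where
  "edges ltr name Empty p = {}"
| "edges ltr name Eps p = {((p, 0), [], (p, 1))}"
| "edges ltr name (Sym a) p = {((p, 0), [Letter a], (p, 1))}"
| "edges ltr name (Alt \<alpha> \<beta>) p =
    (let c = Suc p; d = Suc p + length (enc_rgx ltr name \<alpha>) in
     {((p, 0), [], (c, 0)), ((p, 0), [], (d, 0)), ((c, 1), [], (p, 1)), ((d, 1), [], (p, 1))})"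
| "edges ltr name (Cat \<alpha> \<beta>) p =
    (let c = Suc p; d = Suc p + length (enc_rgx ltr name \<alpha>) in
     {((p, 0), [], (c, 0)), ((c, 1), [], (d, 0)), ((d, 1), [], (p, 1))})"
| "edges ltr name (Star \<alpha>) p =
    {((p, 0), [], (p, 1)), ((p, 0), [], (Suc p, 0)), ((Suc p, 1), [], (p, 0))}"
| "edges ltr name (Bind x \<alpha>) p =
    (let c = Suc p + length (enc_bits (name x)) in
     {((p, 0), [Open x], (c, 0)), ((c, 1), [Close x], (p, 1))})"

fun nodes :: "('a \<Rightarrow> bool list) \<Rightarrow> ('v \<Rightarrow> bool list) \<Rightarrow> ('a, 'v) rgx \<Rightarrow> nat \<Rightarrow> (nat \<times> ('a, 'v) rgx) set" where
  "nodes ltr name Empty p = {(p, Empty)}"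
| "nodes ltr name Eps p = {(p, Eps)}"
| "nodes ltr name (Sym a) p = {(p, Sym a)}"
| "nodes ltr name (Alt \<alpha> \<beta>) p = insert (p, Alt \<alpha> \<beta>)
    (nodes ltr name \<alpha> (Suc p) \<union> nodes ltr name \<beta> (Suc p + length (enc_rgx ltr name \<alpha>)))"
| "nodes ltr name (Cat \<alpha> \<beta>) p = insert (p, Cat \<alpha> \<beta>)
    (nodes ltr name \<alpha> (Suc p) \<union> nodes ltr name \<beta> (Suc p + length (enc_rgx ltr name \<alpha>)))"
| "nodes ltr name (Star \<alpha>) p = insert (p, Star \<alpha>) (nodes ltr name \<alpha> (Suc p))"
| "nodes ltr name (Bind x \<alpha>) p = insert (p, Bind x \<alpha>)
    (nodes ltr name \<alpha> (Suc p + length (enc_bits (name x))))"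

definition delta :: "('a \<Rightarrow> bool list) \<Rightarrow> ('v \<Rightarrow> bool list) \<Rightarrow> ('a, 'v) rgx \<Rightarrow> nat \<Rightarrow> ('a, 'v) edge set" where
  "delta ltr name \<alpha> p = (\<Union>(q, \<beta>)\<in>nodes ltr name \<alpha> p. edges ltr name \<beta> q)"

lemma delta_simps:
  "delta ltr name Empty p = {}"
  "delta ltr name Eps p = edges ltr name Eps p"
  "delta ltr name (Sym a) p = edges ltr name (Sym a) p"
  "delta ltr name (Alt \<alpha> \<beta>) p = edges ltr name (Alt \<alpha> \<beta>) p \<union> delta ltr name \<alpha> (Suc p) \<union>
     delta ltr name \<beta> (Suc p + length (enc_rgx ltr name \<alpha>))"
  "delta ltr name (Cat \<alpha> \<beta>) p = edges ltr name (Cat \<alpha> \<beta>) p \<union> delta ltr name \<alpha> (Suc p) \<union>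
     delta ltr name \<beta> (Suc p + length (enc_rgx ltr name \<alpha>))"
  "delta ltr name (Star \<alpha>) p = edges ltr name (Star \<alpha>) p \<union> delta ltr name \<alpha> (Suc p)"
  "delta ltr name (Bind x \<alpha>) p = edges ltr name (Bind x \<alpha>) p \<union>
     delta ltr name \<alpha> (Suc p + length (enc_bits (name x)))"
  unfolding delta_def by auto

inductive pth :: "('a, 'v) edge set \<Rightarrow> state \<Rightarrow> ('a, 'v) refword \<Rightarrow> state \<Rightarrow> bool" for T where
  pth_refl: "pth T s [] s"
| pth_step: "(s, l, s') \<in> T \<Longrightarrow> pth T s' r s'' \<Longrightarrow> pth T s (l @ r) s''"

lemma pth_append: "pth T s u s' \<Longrightarrow> pth T s' v s'' \<Longrightarrow> pth T s (u @ v) s''"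
  by (induction rule: pth.induct) (auto intro: pth_step)

lemma pth_edge: "(s, l, s') \<in> T \<Longrightarrow> pth T s l s'"
  using pth_step[OF _ pth_refl, of s l s' T] by simp

lemma pth_mono: "pth T s u s' \<Longrightarrow> T \<subseteq> T' \<Longrightarrow> pth T' s u s'"
  by (induction rule: pth.induct) (auto intro: pth.intros)

lemma length_enc_rgx_pos: "0 < length (enc_rgx ltr name \<alpha>)"
  by (cases \<alpha>) auto

lemma nodes_range:
  "(q, \<beta>) \<in> nodes ltr name \<alpha> p \<Longrightarrow> p \<le> q \<and> q + length (enc_rgx ltr name \<beta>) \<le> p + length (enc_rgx ltr name \<alpha>)"
  by (induction \<alpha> arbitrary: p) (fastforce simp: Let_def)+

lemma edges_range:
  "(s, l, s') \<in> edges ltr name \<beta> q \<Longrightarrow>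
     q \<le> fst s \<and> fst s < q + length (enc_rgx ltr name \<beta>) \<and> q \<le> fst s' \<and> fst s' < q + length (enc_rgx ltr name \<beta>)"
  using length_enc_rgx_pos[of ltr name] by (cases \<beta>) (auto simp: Let_def)

lemma delta_range:
  assumes "(s, l, s') \<in> delta ltr name \<alpha> p"
  shows "p \<le> fst s" "fst s < p + length (enc_rgx ltr name \<alpha>)"
    "p \<le> fst s'" "fst s' < p + length (enc_rgx ltr name \<alpha>)"
proof -
  obtain q \<beta> where "(q, \<beta>) \<in> nodes ltr name \<alpha> p" "(s, l, s') \<in> edges ltr name \<beta> q"
    using assms unfolding delta_def by blast
  then show "p \<le> fst s" "fst s < p + length (enc_rgx ltr name \<alpha>)"
    "p \<le> fst s'" "fst s' < p + length (enc_rgx ltr name \<alpha>)"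
    using nodes_range[of q \<beta> ltr name \<alpha> p] edges_range[of s l s' ltr name \<beta> q] by linarith+
qed

text \<open>The words that lead from a state to the exit of the formula.\<close>

fun cont :: "('a \<Rightarrow> bool list) \<Rightarrow> ('v \<Rightarrow> bool list) \<Rightarrow> ('a, 'v) rgx \<Rightarrow> nat \<Rightarrow> state \<Rightarrow> ('a, 'v) refword set" where
  "cont ltr name \<alpha> p s =
    (if s = (p, 1) then {[]} else if s = (p, 0) then ref_lang \<alpha> else
     case \<alpha> of
       Alt \<beta> \<gamma> \<Rightarrow> (let d = Suc p + length (enc_rgx ltr name \<beta>) in
         if fst s < d then cont ltr name \<beta> (Suc p) s else cont ltr name \<gamma> d s)
     | Cat \<beta> \<gamma> \<Rightarrow> (let d = Suc p + length (enc_rgx ltr name \<beta>) in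
         if fst s < d then {u @ v | u v. u \<in> cont ltr name \<beta> (Suc p) s \<and> v \<in> ref_lang \<gamma>}
         else cont ltr name \<gamma> d s)
     | Star \<beta> \<Rightarrow> {u @ v | u v. u \<in> cont ltr name \<beta> (Suc p) s \<and> v \<in> ref_lang (Star \<beta>)}
     | Bind x \<beta> \<Rightarrow> {u @ [Close x] | u. u \<in> cont ltr name \<beta> (Suc p + length (enc_bits (name x))) s}
     | _ \<Rightarrow> {})"

declare cont.simps [simp del]

lemma cont_exit: "cont ltr name \<alpha> p (p, Suc 0) = {[]}"
  and cont_entry: "cont ltr name \<alpha> p (p, 0) = ref_lang \<alpha>"
  by (subst cont.simps; simp)+

lemma ref_lang_Star_append: "u \<in> ref_lang \<alpha> \<Longrightarrow> v \<in> ref_lang (Star \<alpha>) \<Longrightarrow> u @ v \<in> ref_lang (Star \<alpha>)"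
proof -
  assume "u \<in> ref_lang \<alpha>" "v \<in> ref_lang (Star \<alpha>)"
  then obtain us where "v = concat us" "set us \<subseteq> ref_lang \<alpha>" "u \<in> ref_lang \<alpha>" by auto
  then show ?thesis
    by (auto intro!: exI[of _ "u # us"])
qed

lemma Nil_in_Star: "[] \<in> ref_lang (Star \<alpha>)"
  by (auto intro: exI[of _ "[]"])

text \<open>Soundness of the automaton edge by edge: prefixing the label maps continuations of the
  target to continuations of the source. Induction along a path then replaces cutting the path into
  its passes through subformulas, which would be awkward under \<open>Star\<close>.\<close>

lemma cont_edge:
  "(s, l, s') \<in> delta ltr name \<alpha> p \<Longrightarrow> v \<in> cont ltr name \<alpha> p s' \<Longrightarrow> l @ v \<in> cont ltr name \<alpha> p s"
proof (induction \<alpha> arbitrary: p s l s' v)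
  case (Alt \<beta> \<gamma>)
  let ?d = "Suc p + length (enc_rgx ltr name \<beta>)"
  have c: "cont ltr name (Alt \<beta> \<gamma>) p s = (if fst s < ?d then cont ltr name \<beta> (Suc p) s else cont ltr name \<gamma> ?d s)"
    if "p < fst s" for s
    using that by (subst cont.simps) (auto simp: Let_def)
  consider "(s, l, s') \<in> edges ltr name (Alt \<beta> \<gamma>) p" | "(s, l, s') \<in> delta ltr name \<beta> (Suc p)"
    | "(s, l, s') \<in> delta ltr name \<gamma> ?d"
    using Alt.prems(1) by (auto simp: delta_simps)
  then show ?case
  proof cases
    case 1
    then show ?thesis
      using Alt.prems(2) length_enc_rgx_pos[of ltr name \<beta>]
      by (auto simp: Let_def c cont_exit cont_entry)
  next
    case 2
    then show ?thesis
      using Alt.IH(1)[OF 2] Alt.prems(2) delta_range[OF 2] by (simp add: c)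
  next
    case 3
    then show ?thesis
      using Alt.IH(2)[OF 3] Alt.prems(2) delta_range[OF 3] by (simp add: c)
  qed
next
  case (Cat \<beta> \<gamma>)
  let ?d = "Suc p + length (enc_rgx ltr name \<beta>)"
  have c: "cont ltr name (Cat \<beta> \<gamma>) p s = (if fst s < ?d then
      {u @ v | u v. u \<in> cont ltr name \<beta> (Suc p) s \<and> v \<in> ref_lang \<gamma>} else cont ltr name \<gamma> ?d s)"
    if "p < fst s" for s
    using that by (subst cont.simps) (auto simp: Let_def)
  consider "(s, l, s') \<in> edges ltr name (Cat \<beta> \<gamma>) p" | "(s, l, s') \<in> delta ltr name \<beta> (Suc p)"
    | "(s, l, s') \<in> delta ltr name \<gamma> ?d"
    using Cat.prems(1) by (auto simp: delta_simps)
  then show ?case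
  proof cases
    case 1
    then show ?thesis
      using Cat.prems(2) length_enc_rgx_pos[of ltr name \<beta>]
      by (auto simp: Let_def c cont_exit cont_entry)
  next
    case 2
    then show ?thesis
      using Cat.IH(1)[OF 2] Cat.prems(2) delta_range[OF 2]
      by (simp add: c) (metis append.assoc)
  next
    case 3
    then show ?thesis
      using Cat.IH(2)[OF 3] Cat.prems(2) delta_range[OF 3] by (simp add: c)
  qed
next
  case (Star \<beta>)
  have c: "cont ltr name (Star \<beta>) p s =
      {u @ v | u v. u \<in> cont ltr name \<beta> (Suc p) s \<and> v \<in> ref_lang (Star \<beta>)}"
    if "p < fst s" for s
    using that by (subst cont.simps) auto
  consider "(s, l, s') \<in> edges ltr name (Star \<beta>) p" | "(s, l, s') \<in> delta ltr name \<beta> (Suc p)"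
    using Star.prems(1) by (auto simp: delta_simps)
  then show ?case
  proof cases
    case 1
    then show ?thesis
      using Star.prems(2) Nil_in_Star[of \<beta>] ref_lang_Star_append[of _ \<beta>]
      by (auto simp: c cont_exit cont_entry simp del: ref_lang.simps)
  next
    case 2
    then show ?thesis
      using Star.IH[OF 2] Star.prems(2) delta_range[OF 2]
      by (simp add: c del: ref_lang.simps) (metis append.assoc)
  qed
next
  case (Bind x \<beta>)
  let ?d = "Suc p + length (enc_bits (name x))"
  have c: "cont ltr name (Bind x \<beta>) p s = {u @ [Close x] | u. u \<in> cont ltr name \<beta> ?d s}"
    if "p < fst s" for s
    using that by (subst cont.simps) auto
  consider "(s, l, s') \<in> edges ltr name (Bind x \<beta>) p" | "(s, l, s') \<in> delta ltr name \<beta> ?d"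
    using Bind.prems(1) by (auto simp: delta_simps)
  then show ?case
  proof cases
    case 1
    then show ?thesis
      using Bind.prems(2) by (auto simp: Let_def c cont_exit cont_entry)
  next
    case 2
    then show ?thesis
      using Bind.IH[OF 2] Bind.prems(2) delta_range[OF 2]
      by (simp add: c) (metis append.assoc)
  qed
qed (auto simp: delta_simps cont_exit cont_entry)

lemma cont_pth: "pth (delta ltr name \<alpha> p) s u s' \<Longrightarrow> v \<in> cont ltr name \<alpha> p s' \<Longrightarrow> u @ v \<in> cont ltr name \<alpha> p s"
  by (induction rule: pth.induct) (auto intro: cont_edge)

lemma ref_lang_pth: "u \<in> ref_lang \<alpha> \<Longrightarrow> pth (delta ltr name \<alpha> p) (p, 0) u (p, 1)"
proof (induction \<alpha> arbitrary: p u)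
  case (Alt \<beta> \<gamma>)
  let ?T = "delta ltr name (Alt \<beta> \<gamma>) p"
  let ?d = "Suc p + length (enc_rgx ltr name \<beta>)"
  have e: "((p, 0), [], (Suc p, 0)) \<in> ?T" "((p, 0), [], (?d, 0)) \<in> ?T"
    "((Suc p, 1), [], (p, 1)) \<in> ?T" "((?d, 1), [], (p, 1)) \<in> ?T"
    by (auto simp: delta_simps Let_def)
  have sub: "delta ltr name \<beta> (Suc p) \<subseteq> ?T" "delta ltr name \<gamma> ?d \<subseteq> ?T"
    by (auto simp: delta_simps)
  from Alt.prems consider "u \<in> ref_lang \<beta>" | "u \<in> ref_lang \<gamma>" by auto
  then show ?case
  proof cases
    case 1
    from pth_append[OF pth_mono[OF Alt.IH(1)[OF 1] sub(1)] pth_edge[OF e(3)]] show ?thesis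
      using pth_step[OF e(1)] by fastforce
  next
    case 2
    from pth_append[OF pth_mono[OF Alt.IH(2)[OF 2] sub(2)] pth_edge[OF e(4)]] show ?thesis
      using pth_step[OF e(2)] by fastforce
  qed
next
  case (Cat \<beta> \<gamma>)
  let ?T = "delta ltr name (Cat \<beta> \<gamma>) p"
  let ?d = "Suc p + length (enc_rgx ltr name \<beta>)"
  have e: "((p, 0), [], (Suc p, 0)) \<in> ?T" "((Suc p, 1), [], (?d, 0)) \<in> ?T" "((?d, 1), [], (p, 1)) \<in> ?T"
    by (auto simp: delta_simps Let_def)
  have sub: "delta ltr name \<beta> (Suc p) \<subseteq> ?T" "delta ltr name \<gamma> ?d \<subseteq> ?T"
    by (auto simp: delta_simps)
  obtain u1 u2 where u: "u = u1 @ u2" "u1 \<in> ref_lang \<beta>" "u2 \<in> ref_lang \<gamma>"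
    using Cat.prems by auto
  have "pth ?T (p, 0) ([] @ u1 @ [] @ u2 @ []) (p, 1)"
    by (intro pth_append[OF pth_edge[OF e(1)]] pth_append[OF pth_mono[OF Cat.IH(1)[OF u(2)] sub(1)]]
        pth_append[OF pth_edge[OF e(2)]] pth_append[OF pth_mono[OF Cat.IH(2)[OF u(3)] sub(2)]] pth_edge[OF e(3)])
  then show ?case
    by (simp add: u)
next
  case (Star \<beta>)
  let ?T = "delta ltr name (Star \<beta>) p"
  have e: "((p, 0), [], (p, 1)) \<in> ?T" "((p, 0), [], (Suc p, 0)) \<in> ?T" "((Suc p, 1), [], (p, 0)) \<in> ?T"
    by (auto simp: delta_simps)
  have sub: "delta ltr name \<beta> (Suc p) \<subseteq> ?T"
    by (auto simp: delta_simps)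
  obtain us where us: "u = concat us" "set us \<subseteq> ref_lang \<beta>"
    using Star.prems by auto
  \<comment> \<open>The loop of a star leads from entry to entry, so the iterations are composed
    before the edge to the exit is taken.\<close>
  have "pth ?T (p, 0) (concat us) (p, 0)"
    using us(2)
  proof (induction us)
    case (Cons w us)
    then have w: "w \<in> ref_lang \<beta>" by simp
    have "pth ?T (p, 0) ([] @ w @ [] @ concat us) (p, 0)"
      by (intro pth_append[OF pth_edge[OF e(2)]] pth_append[OF pth_mono[OF Star.IH[OF w] sub]]
        pth_append[OF pth_edge[OF e(3)]] Cons.IH) (use Cons.prems in auto)
    then show ?case by simp
  qed (simp add: pth_refl)
  from pth_append[OF this pth_edge[OF e(1)]] show ?case
    by (simp add: us)
next
  case (Bind x \<beta>)
  let ?T = "delta ltr name (Bind x \<beta>) p"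
  let ?d = "Suc p + length (enc_bits (name x))"
  have e: "((p, 0), [Open x], (?d, 0)) \<in> ?T" "((?d, 1), [Close x], (p, 1)) \<in> ?T"
    by (auto simp: delta_simps Let_def)
  have sub: "delta ltr name \<beta> ?d \<subseteq> ?T"
    by (auto simp: delta_simps)
  obtain w where w: "u = Open x # w @ [Close x]" "w \<in> ref_lang \<beta>"
    using Bind.prems by auto
  have "pth ?T (p, 0) ([Open x] @ w @ [Close x]) (p, 1)"
    by (intro pth_append[OF pth_edge[OF e(1)]] pth_append[OF pth_mono[OF Bind.IH[OF w(2)] sub]] pth_edge[OF e(2)])
  then show ?case
    by (simp add: w)
qed (auto simp: delta_simps intro: pth_edge)

lemma pth_ref_lang: "pth (delta ltr name \<alpha> p) (p, 0) u (p, 1) \<longleftrightarrow> u \<in> ref_lang \<alpha>"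
  using ref_lang_pth cont_pth[of ltr name \<alpha> p "(p, 0)" u "(p, 1)" "[]"] by (auto simp: cont_exit cont_entry)


section \<open>Spans as thresholds along automaton runs\<close>

section \<open>Runs and tuples\<close>

definition opsym :: "nat \<Rightarrow> 'v \<Rightarrow> ('a, 'v) refsym" where
  "opsym f x = (if f = 0 then Open x else Close x)"

definition endp :: "nat \<Rightarrow> span \<Rightarrow> nat" where
  "endp f sp = (if f = 0 then fst sp else snd sp)"

definition posn :: "('a, 'v) refsym \<Rightarrow> ('a, 'v) refword \<Rightarrow> nat" where
  "posn c r = length (clr (takeWhile (\<lambda>d. d \<noteq> c) r)) + 1"

text \<open>A cut in front of a letter, or at the end of the word, leaves all operations of this
  boundary on the left.\<close>

definition letter_start :: "('a, 'v) refword \<Rightarrow> bool" where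
  "letter_start v \<longleftrightarrow> v = [] \<or> (\<exists>a v'. v = Letter a # v')"

text \<open>One path is enough here because in a functional formula all paths to a state that can
  reach the exit agree on the operations, see \<open>seen_iff\<close>.\<close>

definition seen :: "('a, 'v) edge set \<Rightarrow> state \<Rightarrow> state \<Rightarrow> ('a, 'v) refsym \<Rightarrow> bool" where
  "seen T s0 s c \<longleftrightarrow> (\<exists>u. pth T s0 u s \<and> c \<in> set u)"

lemma clr_append [simp]: "clr (u @ v) = clr u @ clr v"
  by (induction u rule: clr.induct) auto

lemma clr_takeWhile_le: "length (clr (takeWhile P u)) \<le> length (clr u)"
  by (metis clr_append le_add1 length_append takeWhile_dropWhile_id)

text \<open>An operation inside \<open>v\<close> comes after all letters of \<open>u\<close> and at
  least one more, since \<open>v\<close> starts with a letter; an operation inside \<open>u\<close>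
  comes after no more than the letters of \<open>u\<close>.\<close>

lemma posn_le_iff:
  assumes "c \<in> set (u @ v)" "letter_start v" "\<And>a. c \<noteq> Letter a"
  shows "posn c (u @ v) \<le> length (clr u) + 1 \<longleftrightarrow> c \<in> set u"
proof (cases "c \<in> set u")
  case True
  then have "takeWhile (\<lambda>d. d \<noteq> c) (u @ v) = takeWhile (\<lambda>d. d \<noteq> c) u"
    by (intro takeWhile_append1) auto
  then show ?thesis
    using True clr_takeWhile_le[of "\<lambda>d. d \<noteq> c" u] by (simp add: posn_def)
next
  case False
  then obtain a v' where v: "v = Letter a # v'"
    using assms(1,2) by (auto simp: letter_start_def)
  have "takeWhile (\<lambda>d. d \<noteq> c) (u @ v) = u @ takeWhile (\<lambda>d. d \<noteq> c) v"
    using False by (intro takeWhile_append2) auto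
  then show ?thesis
    using False assms(3)[of a] v by (simp add: posn_def)
qed

lemma posn_le: "posn c r \<le> length (clr r) + 1"
  using clr_takeWhile_le by (simp add: posn_def)

lemma count_list_zero: "count_list xs c = 0 \<longleftrightarrow> c \<notin> set xs"
  by (induction xs) auto

lemma takeWhile_until: "c \<notin> set u \<Longrightarrow> takeWhile (\<lambda>d. d \<noteq> c) (u @ c # v) = u"
  by (induction u) auto

lemma tuple_of_posn:
  assumes "valid U r" "x \<in> U"
  shows "tuple_of U r x = Some (posn (Open x) r, posn (Close x) r)"
    and "posn (Open x) r \<le> posn (Close x) r" and "Open x \<in> set r" "Close x \<in> set r"
proof -
  obtain r1 r2 r3 where r: "r = r1 @ Open x # r2 @ Close x # r3"
    and cnt: "count_list r (Open x) = 1" "count_list r (Close x) = 1"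
    using assms unfolding valid_def by blast
  have nin: "Open x \<notin> set r1" "Close x \<notin> set r1" "Close x \<notin> set r2"
    using cnt unfolding r by (auto simp: count_list_append simp flip: count_list_zero split: if_splits)
  have 1: "takeWhile (\<lambda>d. d \<noteq> Open x) r = r1"
    unfolding r by (rule takeWhile_until[OF nin(1)])
  have "takeWhile (\<lambda>d. d \<noteq> Close x) ((r1 @ Open x # r2) @ Close x # r3) = r1 @ Open x # r2"
    by (rule takeWhile_until) (use nin in auto)
  then have 2: "takeWhile (\<lambda>d. d \<noteq> Close x) r = r1 @ Open x # r2"
    by (simp add: r)
  have "dropWhile (\<lambda>d. d \<noteq> Open x) r = Open x # r2 @ Close x # r3"
    unfolding r using nin(1) by (induction r1) auto
  then have 3: "inside x r = r2"
    using takeWhile_until[OF nin(3)] by (simp add: inside_def)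
  show "tuple_of U r x = Some (posn (Open x) r, posn (Close x) r)"
    using assms(2) 1 2 3 by (simp add: tuple_of_def posn_def before_def Let_def)
  show "posn (Open x) r \<le> posn (Close x) r"
    using 1 2 by (simp add: posn_def)
  show "Open x \<in> set r" "Close x \<in> set r"
    by (auto simp: r)
qed

lemma endp_tuple_of:
  assumes "valid U r" "x \<in> U"
  shows "endp f (the (tuple_of U r x)) = posn (opsym f x) r" "opsym f x \<in> set r"
  using tuple_of_posn[OF assms] by (auto simp: endp_def opsym_def)

text \<open>Exchange of prefixes: \<open>u'\<close> and \<open>u\<close> are both completed by
  \<open>v\<close> to words of the language, and each of these has the operation exactly once. If
  \<open>u'\<close> contains it, then \<open>v\<close> does not, so \<open>u\<close> does. This is
  the essential use of functionality.\<close>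

lemma seen_iff:
  assumes fn: "functional \<alpha>" and x: "x \<in> vars \<alpha>"
    and u: "pth (delta ltr name \<alpha> p) (p, 0) u s" and v: "pth (delta ltr name \<alpha> p) s v (p, 1)"
  shows "seen (delta ltr name \<alpha> p) (p, 0) s (opsym f x) \<longleftrightarrow> opsym f x \<in> set u"
proof
  assume "seen (delta ltr name \<alpha> p) (p, 0) s (opsym f x)"
  then obtain u' where u': "pth (delta ltr name \<alpha> p) (p, 0) u' s" "opsym f x \<in> set u'"
    by (auto simp: seen_def)
  have "valid (vars \<alpha>) (u' @ v)" "valid (vars \<alpha>) (u @ v)"
    using fn pth_append[OF u'(1) v] pth_append[OF u v] unfolding pth_ref_lang functional_def by auto
  then have "count_list (u' @ v) (opsym f x) = 1" "count_list (u @ v) (opsym f x) = 1"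
    using x by (auto simp: valid_def opsym_def)
  moreover have "count_list u' (opsym f x) \<noteq> 0"
    using u'(2) by (simp add: count_list_zero)
  ultimately have "count_list u (opsym f x) \<noteq> 0"
    by (simp add: count_list_append)
  then show "opsym f x \<in> set u"
    by (simp add: count_list_zero)
qed (use u in \<open>auto simp: seen_def\<close>)

definition sil :: "('a, 'v) edge set \<Rightarrow> state \<Rightarrow> state \<Rightarrow> bool" where
  "sil T s s' \<longleftrightarrow> (\<exists>u. pth T s u s' \<and> clr u = [])"

text \<open>\<open>\<sigma> t\<close> is the state after reading the first \<open>t\<close> letters and all variable operations before the
  next letter.\<close>

definition rn :: "('a, 'v) edge set \<Rightarrow> state \<Rightarrow> state \<Rightarrow> 'a list \<Rightarrow> (nat \<Rightarrow> state) \<Rightarrow> bool" where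
  "rn T s0 e s \<sigma> \<longleftrightarrow> sil T s0 (\<sigma> 0) \<and> \<sigma> (length s) = e \<and>
     (\<forall>t<length s. \<exists>q. (\<sigma> t, [Letter (s ! t)], q) \<in> T \<and> sil T q (\<sigma> (Suc t)))"

definition splits :: "('a, 'v) edge set \<Rightarrow> state \<Rightarrow> state \<Rightarrow> ('a, 'v) refword \<Rightarrow> (nat \<Rightarrow> state) \<Rightarrow> nat \<Rightarrow> bool" where
  "splits T s0 e r \<sigma> t \<longleftrightarrow> (\<exists>u v. r = u @ v \<and> length (clr u) = t \<and> letter_start v \<and>
     pth T s0 u (\<sigma> t) \<and> pth T (\<sigma> t) v e)"

text \<open>One and the same word must be split at every \<open>t\<close>, so it is built backwards:
  the claim for \<open>t\<close> provides the suffix read from \<open>\<sigma> t\<close> together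
  with its cuts at all later boundaries.\<close>

lemma run_word:
  assumes "rn T s0 e s \<sigma>"
  shows "\<exists>r. pth T s0 r e \<and> clr r = s \<and> (\<forall>t\<le>length s. splits T s0 e r \<sigma> t)"
proof -
  let ?L = "length s"
  have "\<exists>v. letter_start v \<and> clr v = drop t s \<and> (\<forall>t'. t \<le> t' \<and> t' \<le> ?L \<longrightarrow>
      (\<exists>u' v'. v = u' @ v' \<and> length (clr u') = t' - t \<and> letter_start v' \<and> pth T (\<sigma> t) u' (\<sigma> t') \<and> pth T (\<sigma> t') v' e))"
    if "t \<le> ?L" for t
    using that
  proof (induction t rule: inc_induct)
    case base
    show ?case
      using assms by (intro exI[of _ "[]"]) (auto simp: rn_def letter_start_def intro: pth_refl)
  next
    case (step t)
    obtain q g where q: "(\<sigma> t, [Letter (s ! t)], q) \<in> T" "pth T q g (\<sigma> (Suc t))" "clr g = []"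
      using assms step.hyps by (auto simp: rn_def sil_def)
    obtain v where v: "letter_start v" "clr v = drop (Suc t) s"
      "\<And>t'. Suc t \<le> t' \<Longrightarrow> t' \<le> ?L \<Longrightarrow> \<exists>u' v'. v = u' @ v' \<and> length (clr u') = t' - Suc t \<and> letter_start v' \<and>
         pth T (\<sigma> (Suc t)) u' (\<sigma> t') \<and> pth T (\<sigma> t') v' e"
      using step.IH by blast
    let ?v = "Letter (s ! t) # g @ v"
    have pre: "pth T (\<sigma> t) (Letter (s ! t) # g) (\<sigma> (Suc t))"
      using pth_step[OF q(1,2)] by simp
    have "\<exists>u' v'. ?v = u' @ v' \<and> length (clr u') = t' - t \<and> letter_start v' \<and> pth T (\<sigma> t) u' (\<sigma> t') \<and> pth T (\<sigma> t') v' e"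
      if t': "t \<le> t'" "t' \<le> ?L" for t'
    proof (cases "t' = t")
      case True
      obtain u' v' where "v = u' @ v'" "pth T (\<sigma> (Suc t)) u' (\<sigma> ?L)" "pth T (\<sigma> ?L) v' e"
        using v(3)[of ?L] step.hyps by auto
      then have "pth T (\<sigma> t) ?v e"
        using pth_append[OF pre pth_append] by fastforce
      then show ?thesis
        using True by (intro exI[of _ "[]"] exI[of _ ?v]) (auto simp: letter_start_def intro: pth_refl)
    next
      case False
      then obtain u' v' where *: "v = u' @ v'" "length (clr u') = t' - Suc t" "letter_start v'"
        "pth T (\<sigma> (Suc t)) u' (\<sigma> t')" "pth T (\<sigma> t') v' e"
        using v(3)[of t'] t' by auto
      then show ?thesis
        using False t' pth_append[OF pre *(4)] q(3)
        by (intro exI[of _ "Letter (s ! t) # g @ u'"] exI[of _ v']) auto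
    qed
    moreover have "clr ?v = drop t s"
      using v(2) q(3) step.hyps by (simp add: Cons_nth_drop_Suc)
    ultimately show ?case
      by (intro exI[of _ ?v]) (auto simp: letter_start_def)
  qed
  from this[of 0] obtain v where v: "clr v = s" "\<And>t'. t' \<le> ?L \<Longrightarrow>
      (\<exists>u' v'. v = u' @ v' \<and> length (clr u') = t' \<and> letter_start v' \<and> pth T (\<sigma> 0) u' (\<sigma> t') \<and> pth T (\<sigma> t') v' e)"
    by auto
  obtain g where g: "pth T s0 g (\<sigma> 0)" "clr g = []"
    using assms by (auto simp: rn_def sil_def)
  have sp: "splits T s0 e (g @ v) \<sigma> t" if t: "t \<le> ?L" for t
  proof -
    obtain u' v' where *: "v = u' @ v'" "length (clr u') = t" "letter_start v'"
        "pth T (\<sigma> 0) u' (\<sigma> t)" "pth T (\<sigma> t) v' e"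
      using v(2)[OF t] by auto
    then show ?thesis
      unfolding splits_def using pth_append[OF g(1) *(4)] g(2)
      by (intro exI[of _ "g @ u'"] exI[of _ v']) auto
  qed
  moreover have "pth T s0 (g @ v) e"
    using sp[of 0] unfolding splits_def by (auto intro: pth_append)
  ultimately show ?thesis
    using v(1) g(2) by (intro exI[of _ "g @ v"]) auto
qed

text \<open>Induction on the path. A silent edge joins the operations before the first letter; a
  letter edge makes its source the new \<open>\<sigma> 0\<close> and shifts the run. Labels of
  length at most one ensure that an edge with a letter carries nothing else.\<close>

lemma word_run_aux:
  assumes T: "\<And>s l s'. (s, l, s') \<in> T \<Longrightarrow> length l \<le> 1" and "pth T s0 r e"
  shows "\<exists>\<sigma>. rn T s0 e (clr r) \<sigma> \<and> (\<forall>t\<le>length (clr r). splits T s0 e r \<sigma> t)"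
  using assms(2)
proof induction
  case (pth_refl s)
  then show ?case
    by (intro exI[of _ "\<lambda>_. s"])
      (auto simp: rn_def sil_def splits_def letter_start_def intro: pth.pth_refl)
next
  case (pth_step s l s' r s'')
  obtain \<sigma> where \<sigma>: "rn T s' s'' (clr r) \<sigma>" "\<And>t. t \<le> length (clr r) \<Longrightarrow> splits T s' s'' r \<sigma> t"
    using pth_step.IH by blast
  show ?case
  proof (cases "clr l")
    case Nil
    have "rn T s s'' (clr (l @ r)) \<sigma>"
      using \<sigma>(1) Nil pth.pth_step[OF pth_step.hyps(1)] unfolding rn_def sil_def by fastforce
    moreover have "splits T s s'' (l @ r) \<sigma> t" if t: "t \<le> length (clr r)" for t
    proof -
      obtain u v where "r = u @ v" "length (clr u) = t" "letter_start v" "pth T s' u (\<sigma> t)" "pth T (\<sigma> t) v s''"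
        using \<sigma>(2)[OF t] unfolding splits_def by blast
      then show ?thesis
        unfolding splits_def using Nil pth.pth_step[OF pth_step.hyps(1)]
        by (intro exI[of _ "l @ u"] exI[of _ v]) auto
    qed
    ultimately show ?thesis
      using Nil by auto
  next
    case (Cons a as)
    then obtain c where "l = [c]"
      using T[OF pth_step.hyps(1)] by (cases l) auto
    then have l: "l = [Letter a]" "as = []"
      using Cons by (cases c; auto)+
    let ?\<sigma> = "case_nat s \<sigma>"
    have "\<exists>q. (?\<sigma> t, [Letter (clr (l @ r) ! t)], q) \<in> T \<and> sil T q (?\<sigma> (Suc t))"
      if "t < length (clr (l @ r))" for t
    proof (cases t)
      case 0
      then show ?thesis
        using \<sigma>(1) pth_step.hyps(1) unfolding rn_def l by (intro exI[of _ s']) simp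
    next
      case (Suc t')
      then show ?thesis
        using \<sigma>(1) that unfolding rn_def l by simp
    qed
    moreover have "sil T s s"
      unfolding sil_def by (intro exI[of _ "[]"]) (simp add: pth.pth_refl)
    ultimately have "rn T s s'' (clr (l @ r)) ?\<sigma>"
      using \<sigma>(1) unfolding rn_def by (simp add: l)
    moreover have "splits T s s'' (l @ r) ?\<sigma> t" if t: "t \<le> length (clr (l @ r))" for t
    proof (cases t)
      case 0
      then show ?thesis
        unfolding splits_def l using pth.pth_step[OF pth_step.hyps] l
        by (intro exI[of _ "[]"] exI[of _ "[Letter a] @ r"]) (auto simp: letter_start_def intro: pth.pth_refl)
    next
      case (Suc t')
      then have "t' \<le> length (clr r)"
        using t l by simp
      then obtain u v where "r = u @ v" "length (clr u) = t'" "letter_start v" "pth T s' u (\<sigma> t')" "pth T (\<sigma> t') v s''"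
        using \<sigma>(2) unfolding splits_def by blast
      then show ?thesis
        unfolding splits_def using l Suc pth.pth_step[OF pth_step.hyps(1)]
        by (intro exI[of _ "l @ u"] exI[of _ v]) auto
    qed
    ultimately show ?thesis
      by blast
  qed
qed

lemma delta_label: "(s, l, s') \<in> delta ltr name \<alpha> p \<Longrightarrow> length l \<le> 1"
proof -
  have "(s, l, s') \<in> edges ltr name \<beta> q \<Longrightarrow> length l \<le> 1" for \<beta> q
    by (cases \<beta>) (auto simp: Let_def)
  then show "(s, l, s') \<in> delta ltr name \<alpha> p \<Longrightarrow> ?thesis"
    unfolding delta_def by auto
qed

abbreviation atom_run :: "('a \<Rightarrow> bool list) \<Rightarrow> ('v \<Rightarrow> bool list) \<Rightarrow> ('a, 'v) rgx \<Rightarrow> nat \<Rightarrow> 'a list \<Rightarrow> (nat \<Rightarrow> state) \<Rightarrow> bool" where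
  "atom_run ltr name \<alpha> p \<equiv> rn (delta ltr name \<alpha> p) (p, 0) (p, 1)"

abbreviation sees :: "('a \<Rightarrow> bool list) \<Rightarrow> ('v \<Rightarrow> bool list) \<Rightarrow> ('a, 'v) rgx \<Rightarrow> nat \<Rightarrow> state \<Rightarrow> nat \<Rightarrow> 'v \<Rightarrow> bool" where
  "sees ltr name \<alpha> p q f x \<equiv> seen (delta ltr name \<alpha> p) (p, 0) q (opsym f x)"

text \<open>\<open>seen_iff\<close> reads the operation off the prefix and
  \<open>posn_le_iff\<close> turns this into a position. So the states of a run reveal, boundary by
  boundary, where every endpoint of its tuple lies.\<close>

lemma splits_sees:
  assumes fn: "functional \<alpha>" and x: "x \<in> vars \<alpha>" and r: "r \<in> ref_lang \<alpha>"
    and sp: "splits (delta ltr name \<alpha> p) (p, 0) (p, 1) r \<sigma> t"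
  shows "sees ltr name \<alpha> p (\<sigma> t) f x \<longleftrightarrow> endp f (the (tuple_of (vars \<alpha>) r x)) \<le> t + 1"
proof -
  obtain u v where uv: "r = u @ v" "length (clr u) = t" "letter_start v"
    "pth (delta ltr name \<alpha> p) (p, 0) u (\<sigma> t)" "pth (delta ltr name \<alpha> p) (\<sigma> t) v (p, 1)"
    using sp unfolding splits_def by blast
  have "valid (vars \<alpha>) r"
    using fn r by (simp add: functional_def)
  then show ?thesis
    using seen_iff[OF fn x uv(4,5)] endp_tuple_of[of "vars \<alpha>" r x f] x
      posn_le_iff[of "opsym f x" u v] uv(1,2,3) by (auto simp: opsym_def)
qed

lemma tuple_of_is_tuple:
  assumes "valid U r" "clr r = s"
  shows "is_tuple U s (tuple_of U r)"
proof -
  have "is_span s sp" if "tuple_of U r x = Some sp" for x sp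
  proof -
    have "x \<in> U"
      using that by (auto simp: tuple_of_def split: if_splits)
    then show ?thesis
      using tuple_of_posn(1,2)[OF assms(1), of x] posn_le[of "Close x" r] that assms(2)
      by (auto simp: is_span_def posn_def)
  qed
  moreover have "dom (tuple_of U r) = U"
    by (auto simp: tuple_of_def dom_def Let_def)
  ultimately show ?thesis
    by (auto simp only: is_tuple_def ran_def)
qed

lemma sem_run:
  assumes fn: "functional \<alpha>" and \<nu>: "\<nu> \<in> sem_rgx \<alpha> s"
  shows "\<exists>\<sigma>. atom_run ltr name \<alpha> p s \<sigma> \<and> (\<forall>t\<le>length s. \<forall>f. \<forall>x\<in>vars \<alpha>.
     sees ltr name \<alpha> p (\<sigma> t) f x \<longleftrightarrow> endp f (the (\<nu> x)) \<le> t + 1)"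
proof -
  obtain r where r: "\<nu> = tuple_of (vars \<alpha>) r" "r \<in> ref_lang \<alpha>" "clr r = s"
    using \<nu> by (auto simp: sem_rgx_def)
  obtain \<sigma> where "atom_run ltr name \<alpha> p s \<sigma>"
    "\<And>t. t \<le> length s \<Longrightarrow> splits (delta ltr name \<alpha> p) (p, 0) (p, 1) r \<sigma> t"
    using word_run_aux[of "delta ltr name \<alpha> p", OF _ ref_lang_pth[OF r(2)]] delta_label r(3) by metis
  then show ?thesis
    using splits_sees[OF fn _ r(2)] r(1) by blast
qed

lemma run_sem:
  assumes fn: "functional \<alpha>" and "atom_run ltr name \<alpha> p s \<sigma>"
  shows "\<exists>\<nu>\<in>sem_rgx \<alpha> s. is_tuple (vars \<alpha>) s \<nu> \<and> (\<forall>t\<le>length s. \<forall>f. \<forall>x\<in>vars \<alpha>.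
     sees ltr name \<alpha> p (\<sigma> t) f x \<longleftrightarrow> endp f (the (\<nu> x)) \<le> t + 1)"
proof -
  obtain r where r: "r \<in> ref_lang \<alpha>" "clr r = s"
    "\<And>t. t \<le> length s \<Longrightarrow> splits (delta ltr name \<alpha> p) (p, 0) (p, 1) r \<sigma> t"
    using run_word[OF assms(2)] unfolding pth_ref_lang by blast
  have "valid (vars \<alpha>) r"
    using fn r by (simp add: functional_def)
  then show ?thesis
    using splits_sees[OF fn _ r(1) r(3)] tuple_of_is_tuple[of "vars \<alpha>" r s] r(1,2)
    by (intro bexI[of _ "tuple_of (vars \<alpha>) r"]) (auto simp: sem_rgx_def)
qed

section \<open>Definability of the encoding, the automata and their product\<close>

section \<open>First-order descriptions of the input\<close>

definition reach2 :: "nat \<Rightarrow> (nat \<Rightarrow> nat \<Rightarrow> bool) \<Rightarrow> (nat \<Rightarrow> nat \<Rightarrow> nat \<Rightarrow> nat \<Rightarrow> bool) \<Rightarrow> nat \<Rightarrow> nat \<Rightarrow> bool" where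
  "reach2 n I R a b \<longleftrightarrow> reach n 2 (\<lambda>xs. I (xs ! 0) (xs ! 1))
     (\<lambda>ys xs. R (ys ! 0) (ys ! 1) (xs ! 0) (xs ! 1)) [a, b]"

definition reach3 :: "nat \<Rightarrow> (nat \<Rightarrow> nat \<Rightarrow> nat \<Rightarrow> bool) \<Rightarrow>
    (nat \<Rightarrow> nat \<Rightarrow> nat \<Rightarrow> nat \<Rightarrow> nat \<Rightarrow> nat \<Rightarrow> bool) \<Rightarrow> nat \<Rightarrow> nat \<Rightarrow> nat \<Rightarrow> bool" where
  "reach3 n I R a b c \<longleftrightarrow> reach n 3 (\<lambda>xs. I (xs ! 0) (xs ! 1) (xs ! 2))
     (\<lambda>ys xs. R (ys ! 0) (ys ! 1) (ys ! 2) (xs ! 0) (xs ! 1) (xs ! 2)) [a, b, c]"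

lemma ok_2: "ok n 2 xs \<longleftrightarrow> (\<exists>a b. xs = [a, b] \<and> a < n \<and> b < n)"
  by (auto simp: numeral_2_eq_2 ok_Suc)

lemma ok_3: "ok n 3 xs \<longleftrightarrow> (\<exists>a b c. xs = [a, b, c] \<and> a < n \<and> b < n \<and> c < n)"
  by (auto simp: numeral_3_eq_3 ok_Suc)

lemma reach2_start: "I a b \<Longrightarrow> a < n \<Longrightarrow> b < n \<Longrightarrow> reach2 n I R a b"
  unfolding reach2_def by (rule reach.start) (auto simp: ok_2)

lemma reach2_step: "reach2 n I R a b \<Longrightarrow> R a b a' b' \<Longrightarrow> a' < n \<Longrightarrow> b' < n \<Longrightarrow> reach2 n I R a' b'"
  unfolding reach2_def by (rule reach.step) (auto simp: ok_2)

lemma reach2_induct [consumes 1, case_names start step]: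
  assumes "reach2 n I R a b"
    and "\<And>a b. I a b \<Longrightarrow> a < n \<Longrightarrow> b < n \<Longrightarrow> P a b"
    and "\<And>a b a' b'. reach2 n I R a b \<Longrightarrow> P a b \<Longrightarrow> R a b a' b' \<Longrightarrow> a' < n \<Longrightarrow> b' < n \<Longrightarrow> P a' b'"
  shows "P a b"
proof -
  have "\<forall>a b. xs = [a, b] \<longrightarrow> P a b" if "reach n 2 (\<lambda>xs. I (xs ! 0) (xs ! 1))
     (\<lambda>ys xs. R (ys ! 0) (ys ! 1) (xs ! 0) (xs ! 1)) xs" for xs
    using that
  proof induction
    case (start xs)
    then show ?case using assms(2) by (auto simp: ok_2)
  next
    case (step ys xs)
    then show ?case
      using assms(3) reach_ok[OF step.hyps(1)] by (fastforce simp: ok_2 reach2_def)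
  qed
  then show ?thesis
    using assms(1) by (auto simp: reach2_def)
qed

lemma reach3_start: "I a b c \<Longrightarrow> a < n \<Longrightarrow> b < n \<Longrightarrow> c < n \<Longrightarrow> reach3 n I R a b c"
  unfolding reach3_def by (rule reach.start) (auto simp: ok_3)

lemma reach3_step: "reach3 n I R a b c \<Longrightarrow> R a b c a' b' c' \<Longrightarrow> a' < n \<Longrightarrow> b' < n \<Longrightarrow> c' < n \<Longrightarrow> reach3 n I R a' b' c'"
  unfolding reach3_def by (rule reach.step) (auto simp: ok_3)

lemma reach3_induct [consumes 1, case_names start step]:
  assumes "reach3 n I R a b c"
    and "\<And>a b c. I a b c \<Longrightarrow> a < n \<Longrightarrow> b < n \<Longrightarrow> c < n \<Longrightarrow> P a b c"
    and "\<And>a b c a' b' c'. reach3 n I R a b c \<Longrightarrow> P a b c \<Longrightarrow> R a b c a' b' c' \<Longrightarrow> a' < n \<Longrightarrow> b' < n \<Longrightarrow> c' < n \<Longrightarrow>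
      P a' b' c'"
  shows "P a b c"
proof -
  have "\<forall>a b c. xs = [a, b, c] \<longrightarrow> P a b c" if "reach n 3 (\<lambda>xs. I (xs ! 0) (xs ! 1) (xs ! 2))
     (\<lambda>ys xs. R (ys ! 0) (ys ! 1) (ys ! 2) (xs ! 0) (xs ! 1) (xs ! 2)) xs" for xs
    using that
  proof induction
    case (start xs)
    then show ?case using assms(2) by (auto simp: ok_3)
  next
    case (step ys xs)
    obtain a b c where ys: "ys = [a, b, c]"
      using reach_ok[OF step.hyps(1)] by (auto simp: ok_3)
    show ?case
      using step assms(3)[of a b c] ys by (auto simp: ok_3 reach3_def)
  qed
  then show ?thesis
    using assms(1) by (auto simp: reach3_def)
qed

lemma args_2: "args 2 e = [e 2, e 0]" and args_3: "args 3 e = [e 4, e 2, e 0]"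
  by (simp_all add: args_def upt_rec)

lemma D_reach2:
  assumes "4 \<le> S" "i < d" "j < d"
    and "dec (Suc S) (d + 4) (\<lambda>st e. I st (\<lambda>i. e (i + 4)) (e 2) (e 0))"
    and "dec (Suc S) (d + 12) (\<lambda>st e. R st (\<lambda>i. e (i + 12)) (e 6) (e 4) (e 2) (e 0))"
    and "\<And>X st e. I (with_rel S X st) e = I st e" "\<And>X st e. R (with_rel S X st) e = R st e"
  shows "dec S d (\<lambda>st e. reach2 (sz st) (I st e) (R st e) (e i) (e j))"
proof -
  have "dec S d (\<lambda>st e. reach (sz st) 2 (\<lambda>xs. I st e (xs ! 0) (xs ! 1))
     (\<lambda>ys xs. R st e (ys ! 0) (ys ! 1) (xs ! 0) (xs ! 1)) (map e [i, j]))"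
    by (rule D_reach[where I = "\<lambda>st e xs. I st e (xs ! 0) (xs ! 1)" and
          R = "\<lambda>st e ys xs. R st e (ys ! 0) (ys ! 1) (xs ! 0) (xs ! 1)"])
      (use assms in \<open>simp_all add: args_2\<close>)
  then show ?thesis
    by (simp add: reach2_def)
qed

lemma D_reach3:
  assumes "4 \<le> S" "i < d" "j < d" "k < d"
    and "dec (Suc S) (d + 6) (\<lambda>st e. I st (\<lambda>i. e (i + 6)) (e 4) (e 2) (e 0))"
    and "dec (Suc S) (d + 18) (\<lambda>st e. R st (\<lambda>i. e (i + 18)) (e 10) (e 8) (e 6) (e 4) (e 2) (e 0))"
    and "\<And>X st e. I (with_rel S X st) e = I st e" "\<And>X st e. R (with_rel S X st) e = R st e"
  shows "dec S d (\<lambda>st e. reach3 (sz st) (I st e) (R st e) (e i) (e j) (e k))"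
proof -
  have "dec S d (\<lambda>st e. reach (sz st) 3 (\<lambda>xs. I st e (xs ! 0) (xs ! 1) (xs ! 2))
     (\<lambda>ys xs. R st e (ys ! 0) (ys ! 1) (ys ! 2) (xs ! 0) (xs ! 1) (xs ! 2)) (map e [i, j, k]))"
    by (rule D_reach[where I = "\<lambda>st e xs. I st e (xs ! 0) (xs ! 1) (xs ! 2)" and
          R = "\<lambda>st e ys xs. R st e (ys ! 0) (ys ! 1) (ys ! 2) (xs ! 0) (xs ! 1) (xs ! 2)"])
      (use assms in \<open>simp_all add: args_3\<close>)
  then show ?thesis
    by (simp add: reach3_def)
qed

named_theorems dec_intros
lemmas [dec_intros] = D_ex D_all D_conj D_disj D_imp D_iff D_not D_less D_le D_eq D_W D_reach2 D_reach3
  val_var val_Suc val_const val_arr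

subsection \<open>Names and subformulas\<close>

text \<open>Two pointers advance in step over equal bits and must stand on their end markers 2 at
  the same time.\<close>

definition nameq :: "nat \<Rightarrow> nat list \<Rightarrow> nat \<Rightarrow> nat \<Rightarrow> bool" where
  "nameq n w p p' \<longleftrightarrow> (\<exists>a<n. \<exists>b<n. W w a 2 \<and> W w b 2 \<and>
     reach2 n (\<lambda>a b. a = p \<and> b = p')
       (\<lambda>a b a' b'. (W w a 0 \<and> W w b 0 \<or> W w a 1 \<and> W w b 1) \<and> a' = Suc a \<and> b' = Suc b) a b)"

definition bitsend :: "nat \<Rightarrow> nat list \<Rightarrow> nat \<Rightarrow> nat \<Rightarrow> bool" where
  "bitsend n w p y \<longleftrightarrow> (\<exists>z<n. y = Suc z \<and> p \<le> z \<and> W w z 2 \<and>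
     (\<forall>u<n. p \<le> u \<and> u < z \<longrightarrow> W w u 0 \<or> W w u 1))"

text \<open>The second component counts the encodings of subformulas and names that are still to come.\<close>

definition rend_step :: "nat list \<Rightarrow> nat \<Rightarrow> nat \<Rightarrow> nat \<Rightarrow> nat \<Rightarrow> bool" where
  "rend_step w a c a' c' \<longleftrightarrow> 0 < c \<and> a' = Suc a \<and>
     ((W w a 2 \<or> W w a 5 \<or> W w a 6) \<and> c = Suc c' \<or>
      (W w a 8 \<or> W w a 9 \<or> W w a 11) \<and> c' = Suc c \<or>
      (W w a 0 \<or> W w a 1 \<or> W w a 7 \<or> W w a 10) \<and> c' = c)"

definition scan :: "nat \<Rightarrow> nat list \<Rightarrow> nat \<Rightarrow> nat \<Rightarrow> nat \<Rightarrow> bool" where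
  "scan n w p a c \<longleftrightarrow> reach2 n (\<lambda>a c. a = p \<and> c = 1) (rend_step w) a c"

text \<open>Formulas are written in Polish notation, so one formula is complete when the count drops
  to 0, where \<open>rend_step\<close> is stuck. The quantified \<open>z\<close> stands for the
  constant 0, since the closure rules take environment entries as arguments.\<close>

definition rend :: "nat \<Rightarrow> nat list \<Rightarrow> nat \<Rightarrow> nat \<Rightarrow> bool" where
  "rend n w p y \<longleftrightarrow> (\<exists>z<n. z = 0 \<and> scan n w p y z)"

text \<open>Within a formula the tokens 5 to 11 occur only as heads of subformulas, see
  \<open>nodes_head_token\<close>; so a subformula is recognised locally, without following the tree
  from \<open>a\<close> to \<open>p\<close>.\<close>

definition node :: "nat \<Rightarrow> nat list \<Rightarrow> nat \<Rightarrow> nat \<Rightarrow> bool" where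
  "node n w a p \<longleftrightarrow> a \<le> p \<and> (\<exists>y<n. rend n w a y \<and> p < y) \<and>
     (W w p 5 \<or> W w p 6 \<or> W w p 7 \<or> W w p 8 \<or> W w p 9 \<or> W w p 10 \<or> W w p 11)"

lemma D_nameq [dec_intros]:
  "4 \<le> S \<Longrightarrow> i < d \<Longrightarrow> j < d \<Longrightarrow> dec S d (\<lambda>st e. nameq (sz st) (wd st) (e i) (e j))"
  unfolding nameq_def by (intro dec_intros; simp)

lemma D_bitsend [dec_intros]:
  "i < d \<Longrightarrow> j < d \<Longrightarrow> dec S d (\<lambda>st e. bitsend (sz st) (wd st) (e i) (e j))"
  unfolding bitsend_def by (intro dec_intros; simp)

lemma D_rend [dec_intros]:
  "4 \<le> S \<Longrightarrow> i < d \<Longrightarrow> j < d \<Longrightarrow> dec S d (\<lambda>st e. rend (sz st) (wd st) (e i) (e j))"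
  unfolding rend_def scan_def rend_step_def[abs_def] by (intro dec_intros; simp)

lemma D_node [dec_intros]:
  "4 \<le> S \<Longrightarrow> i < d \<Longrightarrow> j < d \<Longrightarrow> dec S d (\<lambda>st e. node (sz st) (wd st) (e i) (e j))"
  unfolding node_def by (intro dec_intros; simp)


subsection \<open>Edges and runs\<close>

text \<open>\<open>c\<close> and \<open>d\<close> are the starts of the first and the second child;
  the tokens are 6 for \<open>Eps\<close>, 8 for \<open>Alt\<close>, 9 for \<open>Cat\<close> and 10
  for \<open>Star\<close>.\<close>

definition edge_eps :: "nat \<Rightarrow> nat list \<Rightarrow> nat \<Rightarrow> nat \<Rightarrow> nat \<Rightarrow> nat \<Rightarrow> nat \<Rightarrow> bool" where
  "edge_eps n w p q f q' f' \<longleftrightarrow> (\<exists>c<n. c = Suc p \<and>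
     ((W w p 6 \<or> W w p 10) \<and> q = p \<and> f = 0 \<and> q' = p \<and> f' = 1 \<or>
      (W w p 8 \<or> W w p 9 \<or> W w p 10) \<and> q = p \<and> f = 0 \<and> q' = c \<and> f' = 0 \<or>
      W w p 8 \<and> q = c \<and> f = 1 \<and> q' = p \<and> f' = 1 \<or>
      W w p 10 \<and> q = c \<and> f = 1 \<and> q' = p \<and> f' = 0 \<or>
      (\<exists>d<n. rend n w c d \<and>
        (W w p 8 \<and> q = p \<and> f = 0 \<and> q' = d \<and> f' = 0 \<or>
         (W w p 8 \<or> W w p 9) \<and> q = d \<and> f = 1 \<and> q' = p \<and> f' = 1 \<or>
         W w p 9 \<and> q = c \<and> f = 1 \<and> q' = d \<and> f' = 0))))"

definition edge_op :: "nat \<Rightarrow> nat list \<Rightarrow> nat \<Rightarrow> nat \<Rightarrow> nat \<Rightarrow> nat \<Rightarrow> nat \<Rightarrow> nat \<Rightarrow> bool" where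
  "edge_op n w p g q f q' f' \<longleftrightarrow> W w p 11 \<and> (\<exists>c<n. c = Suc p \<and> (\<exists>d<n. bitsend n w c d \<and>
     (g = 0 \<and> q = p \<and> f = 0 \<and> q' = d \<and> f' = 0 \<or> g = 1 \<and> q = d \<and> f = 1 \<and> q' = p \<and> f' = 1)))"

definition edge_let :: "nat list \<Rightarrow> nat \<Rightarrow> nat \<Rightarrow> nat \<Rightarrow> nat \<Rightarrow> nat \<Rightarrow> bool" where
  "edge_let w p q f q' f' \<longleftrightarrow> W w p 7 \<and> q = p \<and> f = 0 \<and> q' = p \<and> f' = 1"

definition step_sil :: "nat \<Rightarrow> nat list \<Rightarrow> nat \<Rightarrow> nat \<Rightarrow> nat \<Rightarrow> nat \<Rightarrow> nat \<Rightarrow> bool" where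
  "step_sil n w a q f q' f' \<longleftrightarrow> (\<exists>p<n. node n w a p \<and>
     (edge_eps n w p q f q' f' \<or> (\<exists>g<n. edge_op n w p g q f q' f')))"

definition step_any :: "nat \<Rightarrow> nat list \<Rightarrow> nat \<Rightarrow> nat \<Rightarrow> nat \<Rightarrow> nat \<Rightarrow> nat \<Rightarrow> bool" where
  "step_any n w a q f q' f' \<longleftrightarrow> (\<exists>p<n. node n w a p \<and>
     (edge_eps n w p q f q' f' \<or> (\<exists>g<n. edge_op n w p g q f q' f') \<or> edge_let w p q f q' f'))"

definition step_op :: "nat \<Rightarrow> nat list \<Rightarrow> nat \<Rightarrow> nat \<Rightarrow> nat \<Rightarrow> nat \<Rightarrow> nat \<Rightarrow> nat \<Rightarrow> nat \<Rightarrow> bool" where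
  "step_op n w a g x q f q' f' \<longleftrightarrow> (\<exists>p<n. node n w a p \<and>
     (\<exists>c<n. c = Suc p \<and> nameq n w c x) \<and> edge_op n w p g q f q' f')"

definition step_let :: "nat \<Rightarrow> nat list \<Rightarrow> nat \<Rightarrow> nat \<Rightarrow> nat \<Rightarrow> nat \<Rightarrow> nat \<Rightarrow> nat \<Rightarrow> bool" where
  "step_let n w a x q f q' f' \<longleftrightarrow> (\<exists>p<n. node n w a p \<and>
     (\<exists>c<n. c = Suc p \<and> nameq n w c x) \<and> edge_let w p q f q' f')"

definition seg :: "nat \<Rightarrow> nat list \<Rightarrow> nat \<Rightarrow> nat \<Rightarrow> nat \<Rightarrow> nat \<Rightarrow> nat \<Rightarrow> bool" where
  "seg n w a q f q' f' \<longleftrightarrow> reach2 n (\<lambda>b g. b = q \<and> g = f)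
     (\<lambda>b g b' g'. step_sil n w a b g b' g') q' f'"

text \<open>The third component remembers that the operation has been performed. Its edge may also
  be taken by \<open>step_any\<close> without raising the flag, which does no harm because only
  reachability with flag 1 is asked for.\<close>

definition seenp :: "nat \<Rightarrow> nat list \<Rightarrow> nat \<Rightarrow> nat \<Rightarrow> nat \<Rightarrow> nat \<Rightarrow> nat \<Rightarrow> bool" where
  "seenp n w a g x q f \<longleftrightarrow> (\<exists>h<n. h = 1 \<and> reach3 n (\<lambda>b f h. b = a \<and> f = 0 \<and> h = 0)
     (\<lambda>b f h b' f' h'. step_any n w a b f b' f' \<and> h' = h \<or> step_op n w a g x b f b' f' \<and> h' = 1) q f h)"

definition varin :: "nat \<Rightarrow> nat list \<Rightarrow> nat \<Rightarrow> nat \<Rightarrow> bool" where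
  "varin n w a x \<longleftrightarrow> (\<exists>p<n. node n w a p \<and> W w p 11 \<and> (\<exists>c<n. c = Suc p \<and> nameq n w c x))"

lemma D_edge_eps [dec_intros]:
  "4 \<le> S \<Longrightarrow> i < d \<Longrightarrow> j < d \<Longrightarrow> j' < d \<Longrightarrow> l < d \<Longrightarrow> l' < d \<Longrightarrow>
     dec S d (\<lambda>st e. edge_eps (sz st) (wd st) (e i) (e j) (e j') (e l) (e l'))"
  unfolding edge_eps_def by (intro dec_intros; simp)

lemma D_edge_op [dec_intros]:
  "i < d \<Longrightarrow> g < d \<Longrightarrow> j < d \<Longrightarrow> j' < d \<Longrightarrow> l < d \<Longrightarrow> l' < d \<Longrightarrow>
     dec S d (\<lambda>st e. edge_op (sz st) (wd st) (e i) (e g) (e j) (e j') (e l) (e l'))"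
  unfolding edge_op_def by (intro dec_intros; simp)

lemma D_edge_let [dec_intros]:
  "i < d \<Longrightarrow> j < d \<Longrightarrow> j' < d \<Longrightarrow> l < d \<Longrightarrow> l' < d \<Longrightarrow>
     dec S d (\<lambda>st e. edge_let (wd st) (e i) (e j) (e j') (e l) (e l'))"
  unfolding edge_let_def by (intro dec_intros; simp)

lemma D_step_sil [dec_intros]:
  "4 \<le> S \<Longrightarrow> i < d \<Longrightarrow> j < d \<Longrightarrow> j' < d \<Longrightarrow> l < d \<Longrightarrow> l' < d \<Longrightarrow>
     dec S d (\<lambda>st e. step_sil (sz st) (wd st) (e i) (e j) (e j') (e l) (e l'))"
  unfolding step_sil_def by (intro dec_intros; simp)

lemma D_step_any [dec_intros]:
  "4 \<le> S \<Longrightarrow> i < d \<Longrightarrow> j < d \<Longrightarrow> j' < d \<Longrightarrow> l < d \<Longrightarrow> l' < d \<Longrightarrow>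
     dec S d (\<lambda>st e. step_any (sz st) (wd st) (e i) (e j) (e j') (e l) (e l'))"
  unfolding step_any_def by (intro dec_intros; simp)

lemma D_step_op [dec_intros]:
  "4 \<le> S \<Longrightarrow> i < d \<Longrightarrow> g < d \<Longrightarrow> x < d \<Longrightarrow> j < d \<Longrightarrow> j' < d \<Longrightarrow> l < d \<Longrightarrow> l' < d \<Longrightarrow>
     dec S d (\<lambda>st e. step_op (sz st) (wd st) (e i) (e g) (e x) (e j) (e j') (e l) (e l'))"
  unfolding step_op_def by (intro dec_intros; simp)

lemma D_step_let [dec_intros]:
  "4 \<le> S \<Longrightarrow> i < d \<Longrightarrow> x < d \<Longrightarrow> j < d \<Longrightarrow> j' < d \<Longrightarrow> l < d \<Longrightarrow> l' < d \<Longrightarrow>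
     dec S d (\<lambda>st e. step_let (sz st) (wd st) (e i) (e x) (e j) (e j') (e l) (e l'))"
  unfolding step_let_def by (intro dec_intros; simp)

lemma D_seg [dec_intros]:
  "4 \<le> S \<Longrightarrow> i < d \<Longrightarrow> j < d \<Longrightarrow> j' < d \<Longrightarrow> l < d \<Longrightarrow> l' < d \<Longrightarrow>
     dec S d (\<lambda>st e. seg (sz st) (wd st) (e i) (e j) (e j') (e l) (e l'))"
  unfolding seg_def by (intro dec_intros; simp)

lemma D_seenp [dec_intros]:
  "4 \<le> S \<Longrightarrow> i < d \<Longrightarrow> g < d \<Longrightarrow> x < d \<Longrightarrow> j < d \<Longrightarrow> j' < d \<Longrightarrow>
     dec S d (\<lambda>st e. seenp (sz st) (wd st) (e i) (e g) (e x) (e j) (e j'))"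
  unfolding seenp_def by (intro dec_intros; simp)

lemma D_varin [dec_intros]:
  "4 \<le> S \<Longrightarrow> i < d \<Longrightarrow> x < d \<Longrightarrow> dec S d (\<lambda>st e. varin (sz st) (wd st) (e i) (e x))"
  unfolding varin_def by (intro dec_intros; simp)


subsection \<open>Lists\<close>

text \<open>\<open>E p y\<close> says that an item starting at \<open>p\<close> ends just before \<open>y\<close>.\<close>

definition icell :: "nat \<Rightarrow> nat list \<Rightarrow> (nat \<Rightarrow> nat \<Rightarrow> bool) \<Rightarrow> nat \<Rightarrow> nat \<Rightarrow> nat \<Rightarrow> bool" where
  "icell n w E p i y \<longleftrightarrow> reach2 n (\<lambda>i y. i = 0 \<and> y = p)
     (\<lambda>i y i' y'. i' = Suc i \<and> W w y 3 \<and> (\<exists>z<n. z = Suc y \<and> E z y')) i y"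

definition item :: "nat \<Rightarrow> nat list \<Rightarrow> (nat \<Rightarrow> nat \<Rightarrow> bool) \<Rightarrow> nat \<Rightarrow> nat \<Rightarrow> nat \<Rightarrow> bool" where
  "item n w E p i x \<longleftrightarrow> (\<exists>y<n. icell n w E p i y \<and> W w y 3 \<and> x = Suc y)"

definition lend :: "nat \<Rightarrow> nat list \<Rightarrow> (nat \<Rightarrow> nat \<Rightarrow> bool) \<Rightarrow> nat \<Rightarrow> nat \<Rightarrow> bool" where
  "lend n w E p z \<longleftrightarrow> (\<exists>i<n. \<exists>y<n. icell n w E p i y \<and> W w y 4 \<and> z = Suc y)"

text \<open>\<open>E\<close> has to be decidable for all \<open>S\<close> and \<open>d\<close> since
  it is used inside a reachability, that is, at a higher id and in a longer environment.\<close>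

lemma D_icell [dec_intros]:
  assumes "\<And>S d i j. 4 \<le> S \<Longrightarrow> i < d \<Longrightarrow> j < d \<Longrightarrow> dec S d (\<lambda>st e. E (sz st) (wd st) (e i) (e j))"
    "4 \<le> S" "i < d" "j < d" "l < d"
  shows "dec S d (\<lambda>st e. icell (sz st) (wd st) (E (sz st) (wd st)) (e i) (e j) (e l))"
  unfolding icell_def by (intro dec_intros assms(1); (insert assms(2-), simp))

lemma D_item [dec_intros]:
  assumes "\<And>S d i j. 4 \<le> S \<Longrightarrow> i < d \<Longrightarrow> j < d \<Longrightarrow> dec S d (\<lambda>st e. E (sz st) (wd st) (e i) (e j))"
    "4 \<le> S" "i < d" "j < d" "l < d"
  shows "dec S d (\<lambda>st e. item (sz st) (wd st) (E (sz st) (wd st)) (e i) (e j) (e l))"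
  unfolding item_def by (intro dec_intros D_icell[where E = E] assms(1); (insert assms(2-), simp))

lemma D_lend [dec_intros]:
  assumes "\<And>S d i j. 4 \<le> S \<Longrightarrow> i < d \<Longrightarrow> j < d \<Longrightarrow> dec S d (\<lambda>st e. E (sz st) (wd st) (e i) (e j))"
    "4 \<le> S" "i < d" "j < d"
  shows "dec S d (\<lambda>st e. lend (sz st) (wd st) (E (sz st) (wd st)) (e i) (e j))"
  unfolding lend_def by (intro dec_intros D_icell[where E = E] assms(1); (insert assms(2-), simp))

definition pairend :: "nat \<Rightarrow> nat list \<Rightarrow> nat \<Rightarrow> nat \<Rightarrow> bool" where
  "pairend n w p y \<longleftrightarrow> (\<exists>z<n. bitsend n w p z \<and> bitsend n w z y)"

lemma D_pairend [dec_intros]: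
  "i < d \<Longrightarrow> j < d \<Longrightarrow> dec S d (\<lambda>st e. pairend (sz st) (wd st) (e i) (e j))"
  unfolding pairend_def by (intro dec_intros; simp)

definition cqend :: "nat \<Rightarrow> nat list \<Rightarrow> nat \<Rightarrow> nat \<Rightarrow> bool" where
  "cqend n w p y \<longleftrightarrow> (\<exists>a<n. \<exists>b<n. lend n w (bitsend n w) p a \<and> lend n w (pairend n w) a b \<and>
     lend n w (rend n w) b y)"

lemma D_cqend [dec_intros]:
  "4 \<le> S \<Longrightarrow> i < d \<Longrightarrow> j < d \<Longrightarrow> dec S d (\<lambda>st e. cqend (sz st) (wd st) (e i) (e j))"
  unfolding cqend_def by (intro dec_intros; simp)

definition disjunct :: "nat \<Rightarrow> nat list \<Rightarrow> nat \<Rightarrow> bool" where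
  "disjunct n w q \<longleftrightarrow> (\<exists>z<n. z = 0 \<and> (\<exists>i<n. item n w (cqend n w) z i q))"

definition eqpair :: "nat \<Rightarrow> nat list \<Rightarrow> nat \<Rightarrow> nat \<Rightarrow> bool" where
  "eqpair n w q x \<longleftrightarrow> (\<exists>a<n. lend n w (bitsend n w) q a \<and> (\<exists>i<n. item n w (pairend n w) a i x))"

definition atom :: "nat \<Rightarrow> nat list \<Rightarrow> nat \<Rightarrow> nat \<Rightarrow> bool" where
  "atom n w q x \<longleftrightarrow> (\<exists>a<n. \<exists>b<n. lend n w (bitsend n w) q a \<and> lend n w (pairend n w) a b \<and>
     (\<exists>i<n. item n w (rend n w) b i x))"

text \<open>Letters are numbered from 0, and \<open>strend i\<close> holds for the length of the string.\<close>

definition letter :: "nat \<Rightarrow> nat list \<Rightarrow> nat \<Rightarrow> nat \<Rightarrow> bool" where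
  "letter n w i x \<longleftrightarrow> (\<exists>z<n. z = 0 \<and> (\<exists>y<n. lend n w (cqend n w) z y \<and> item n w (bitsend n w) y i x))"

definition strend :: "nat \<Rightarrow> nat list \<Rightarrow> nat \<Rightarrow> bool" where
  "strend n w i \<longleftrightarrow> (\<exists>z<n. z = 0 \<and> (\<exists>y<n. lend n w (cqend n w) z y \<and>
     (\<exists>x<n. icell n w (bitsend n w) y i x \<and> W w x 4)))"

text \<open>Coordinate 0 of a row is a dummy; coordinate \<open>1 + 2 i + f\<close> is the endpoint number \<open>f\<close> of the
  \<open>i\<close>-th output variable.\<close>

definition coord :: "nat \<Rightarrow> nat \<Rightarrow> nat \<Rightarrow> nat \<Rightarrow> bool" where
  "coord n i f j \<longleftrightarrow> reach3 n (\<lambda>i f j. i = 0 \<and> f = 0 \<and> j = 1)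
     (\<lambda>i f j i' f' j'. j' = Suc j \<and> (f = 0 \<and> f' = 1 \<and> i' = i \<or> f = 1 \<and> f' = 0 \<and> i' = Suc i)) i f j"

definition outvar :: "nat \<Rightarrow> nat list \<Rightarrow> nat \<Rightarrow> nat \<Rightarrow> nat \<Rightarrow> bool" where
  "outvar n w j f x \<longleftrightarrow> (\<exists>z<n. \<exists>y<n. z = 0 \<and> y = 1 \<and> W w z 3 \<and>
     (\<exists>i<n. coord n i f j \<and> item n w (bitsend n w) y i x))"

text \<open>The positions in spans are 1-based, while those in \<open>letter\<close> are 0-based.\<close>

definition subeq :: "nat \<Rightarrow> nat list \<Rightarrow> nat \<Rightarrow> nat \<Rightarrow> nat \<Rightarrow> nat \<Rightarrow> bool" where
  "subeq n w b c b' c' \<longleftrightarrow> reach2 n (\<lambda>u u'. u = b \<and> u' = b')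
     (\<lambda>u u' v v'. v = Suc u \<and> v' = Suc u' \<and> (\<exists>i<n. \<exists>i'<n. u = Suc i \<and> u' = Suc i' \<and>
        (\<exists>x<n. \<exists>x'<n. letter n w i x \<and> letter n w i' x' \<and> nameq n w x x'))) c c'"

lemma D_disjunct [dec_intros]: "4 \<le> S \<Longrightarrow> i < d \<Longrightarrow> dec S d (\<lambda>st e. disjunct (sz st) (wd st) (e i))"
  unfolding disjunct_def by (intro dec_intros; simp)

lemma D_eqpair [dec_intros]:
  "4 \<le> S \<Longrightarrow> i < d \<Longrightarrow> j < d \<Longrightarrow> dec S d (\<lambda>st e. eqpair (sz st) (wd st) (e i) (e j))"
  unfolding eqpair_def by (intro dec_intros; simp)

lemma D_atom [dec_intros]:
  "4 \<le> S \<Longrightarrow> i < d \<Longrightarrow> j < d \<Longrightarrow> dec S d (\<lambda>st e. atom (sz st) (wd st) (e i) (e j))"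
  unfolding atom_def by (intro dec_intros; simp)

lemma D_letter [dec_intros]:
  "4 \<le> S \<Longrightarrow> i < d \<Longrightarrow> j < d \<Longrightarrow> dec S d (\<lambda>st e. letter (sz st) (wd st) (e i) (e j))"
  unfolding letter_def by (intro dec_intros; simp)

lemma D_strend [dec_intros]: "4 \<le> S \<Longrightarrow> i < d \<Longrightarrow> dec S d (\<lambda>st e. strend (sz st) (wd st) (e i))"
  unfolding strend_def by (intro dec_intros; simp)

lemma D_coord [dec_intros]:
  "4 \<le> S \<Longrightarrow> i < d \<Longrightarrow> j < d \<Longrightarrow> l < d \<Longrightarrow> dec S d (\<lambda>st e. coord (sz st) (e i) (e j) (e l))"
  unfolding coord_def by (intro dec_intros; simp)

lemma D_outvar [dec_intros]:
  "4 \<le> S \<Longrightarrow> i < d \<Longrightarrow> j < d \<Longrightarrow> l < d \<Longrightarrow> dec S d (\<lambda>st e. outvar (sz st) (wd st) (e i) (e j) (e l))"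
  unfolding outvar_def by (intro dec_intros; simp)

lemma D_subeq [dec_intros]:
  "4 \<le> S \<Longrightarrow> i < d \<Longrightarrow> j < d \<Longrightarrow> i' < d \<Longrightarrow> j' < d \<Longrightarrow>
     dec S d (\<lambda>st e. subeq (sz st) (wd st) (e i) (e j) (e i') (e j'))"
  unfolding subeq_def by (intro dec_intros; simp)


subsection \<open>The extension predicate\<close>

definition nxt :: "nat \<Rightarrow> nat list \<Rightarrow> nat \<Rightarrow> nat \<Rightarrow> nat \<Rightarrow> nat \<Rightarrow> nat \<Rightarrow> nat \<Rightarrow> bool" where
  "nxt n w a t q f q' f' \<longleftrightarrow> (\<exists>x<n. letter n w t x \<and> (\<exists>b<n. \<exists>g<n. step_let n w a x q f b g \<and> seg n w a b g q' f'))"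

text \<open>\<open>us\<close> consists of \<open>m\<close> blocks \<open>[x, b, c, b', c']\<close>, which prescribe the spans \<open>(b, c)\<close> and \<open>(b', c')\<close>
  for the two variables of the equality at position \<open>x\<close>.\<close>

definition want :: "nat \<Rightarrow> nat list \<Rightarrow> (nat \<Rightarrow> nat) \<Rightarrow> nat \<Rightarrow> nat \<Rightarrow> nat \<Rightarrow> nat list \<Rightarrow> nat \<Rightarrow> nat \<Rightarrow> nat \<Rightarrow> bool" where
  "want n w A m j v us g x u \<longleftrightarrow>
     (\<exists>j'<n. \<exists>x'<n. outvar n w j' g x' \<and> nameq n w x' x \<and> (j' = j \<and> u = v \<or> j' < j \<and> u = A j')) \<or>
     (\<exists>i<m. nameq n w (us ! (5 * i)) x \<and> (g = 0 \<and> u = us ! (5 * i + 1) \<or> g = 1 \<and> u = us ! (5 * i + 2)) \<or>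
        (\<exists>y<n. bitsend n w (us ! (5 * i)) y \<and> nameq n w y x \<and>
           (g = 0 \<and> u = us ! (5 * i + 3) \<or> g = 1 \<and> u = us ! (5 * i + 4))))"

text \<open>In \<open>xs\<close>, a boundary \<open>xs ! 0\<close> between letters is followed by the \<open>k\<close> current states.\<close>

definition cons :: "nat \<Rightarrow> nat list \<Rightarrow> (nat \<Rightarrow> nat) \<Rightarrow> nat \<Rightarrow> nat \<Rightarrow> nat \<Rightarrow> nat \<Rightarrow> nat list \<Rightarrow> nat list \<Rightarrow> nat list \<Rightarrow> bool" where
  "cons n w A k m j v as us xs \<longleftrightarrow>
     (\<forall>i<k. \<forall>i'<k. \<forall>g<n. \<forall>x<n. g \<le> 1 \<and> varin n w (as ! i) x \<and> varin n w (as ! i') x \<longrightarrow>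
        seenp n w (as ! i) g x (xs ! (2 * i + 1)) (xs ! (2 * i + 2)) =
        seenp n w (as ! i') g x (xs ! (2 * i' + 1)) (xs ! (2 * i' + 2))) \<and>
     (\<forall>i<k. \<forall>g<n. \<forall>x<n. g \<le> 1 \<and> varin n w (as ! i) x \<longrightarrow> (\<forall>u<n. want n w A m j v us g x u \<longrightarrow>
        seenp n w (as ! i) g x (xs ! (2 * i + 1)) (xs ! (2 * i + 2)) = (u \<le> Suc (xs ! 0))))"

text \<open>All \<open>k\<close> automata read the letters synchronously, one boundary per step, and
  \<open>cons\<close> is checked at every boundary. In the dimension \<open>2 * k + 1\<close> the
  bound on the number of formulas pays off.\<close>

definition prod_reach :: "nat \<Rightarrow> nat list \<Rightarrow> (nat \<Rightarrow> nat) \<Rightarrow> nat \<Rightarrow> nat \<Rightarrow> nat \<Rightarrow> nat \<Rightarrow> nat list \<Rightarrow> nat list \<Rightarrow> nat list \<Rightarrow> bool" where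
  "prod_reach n w A k m j v as us = reach n (2 * k + 1)
     (\<lambda>xs. xs ! 0 = 0 \<and> cons n w A k m j v as us xs \<and>
        (\<forall>i<k. \<exists>z<n. z = 0 \<and> seg n w (as ! i) (as ! i) z (xs ! (2 * i + 1)) (xs ! (2 * i + 2))))
     (\<lambda>ys xs. xs ! 0 = Suc (ys ! 0) \<and> cons n w A k m j v as us xs \<and>
        (\<forall>i<k. nxt n w (as ! i) (ys ! 0) (ys ! (2 * i + 1)) (ys ! (2 * i + 2)) (xs ! (2 * i + 1)) (xs ! (2 * i + 2))))"

text \<open>The positions \<open>as\<close> may repeat, which covers queries with fewer than
  \<open>k\<close> formulas; likewise surplus blocks of \<open>us\<close> may be filled with
  dummies. Guessed endpoints are required to be positive so that \<open>thresholds_eq\<close>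
  identifies them.\<close>

definition accepted :: "nat \<Rightarrow> nat list \<Rightarrow> (nat \<Rightarrow> nat) \<Rightarrow> nat \<Rightarrow> nat \<Rightarrow> nat \<Rightarrow> nat \<Rightarrow> nat \<Rightarrow> bool" where
  "accepted n w A k m j v q \<longleftrightarrow> (\<exists>as. ok n k as \<and>
     (\<forall>i<k. atom n w q (as ! i)) \<and> (\<forall>a<n. atom n w q a \<longrightarrow> (\<exists>i<k. as ! i = a)) \<and>
     (\<exists>us. ok n (5 * m) us \<and>
       (\<forall>i<m. 1 \<le> us ! (5 * i + 1) \<and> 1 \<le> us ! (5 * i + 2) \<and> 1 \<le> us ! (5 * i + 3) \<and> 1 \<le> us ! (5 * i + 4)) \<and>
       (\<forall>x<n. eqpair n w q x \<longrightarrow> (\<exists>i<m. us ! (5 * i) = x \<and>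
          subeq n w (us ! (5 * i + 1)) (us ! (5 * i + 2)) (us ! (5 * i + 3)) (us ! (5 * i + 4)))) \<and>
       (\<exists>L<n. strend n w L \<and> (\<exists>ys. ok n (2 * k + 1) ys \<and> prod_reach n w A k m j v as us ys \<and>
          ys ! 0 = L \<and> (\<forall>i<k. ys ! (2 * i + 1) = as ! i \<and> ys ! (2 * i + 2) = 1)))))"

text \<open>Some answer row agrees with \<open>A\<close> before coordinate \<open>j\<close> and has the value \<open>v\<close> there.\<close>

definition ext :: "nat \<Rightarrow> nat list \<Rightarrow> (nat \<Rightarrow> nat) \<Rightarrow> nat \<Rightarrow> nat \<Rightarrow> nat \<Rightarrow> nat \<Rightarrow> bool" where
  "ext n w A k m j v \<longleftrightarrow>
     (j = 0 \<and> v = 1 \<or> 0 < j \<and> (\<exists>z<n. z = 0 \<and> A z = 1) \<and> 1 \<le> v \<and> (\<exists>f<n. \<exists>x<n. outvar n w j f x)) \<and>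
     (\<forall>i<n. 0 < i \<and> i < j \<longrightarrow> 1 \<le> A i) \<and>
     (\<exists>q<n. disjunct n w q \<and> accepted n w A k m j v q)"

abbreviation picks :: "(nat \<Rightarrow> nat) \<Rightarrow> (nat \<Rightarrow> nat) \<Rightarrow> nat \<Rightarrow> nat list" where
  "picks e h l \<equiv> map (\<lambda>i. e (h i)) [0..<l]"

lemma nth_picks: "i < l \<Longrightarrow> map f [0..<l] ! i = f i"
  by simp

lemma D_nxt [dec_intros]:
  "4 \<le> S \<Longrightarrow> i < d \<Longrightarrow> t < d \<Longrightarrow> j < d \<Longrightarrow> j' < d \<Longrightarrow> l < d \<Longrightarrow> l' < d \<Longrightarrow>
     dec S d (\<lambda>st e. nxt (sz st) (wd st) (e i) (e t) (e j) (e j') (e l) (e l'))"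
  unfolding nxt_def by (intro dec_intros; simp)

text \<open>The list is given by environment entries at fixed places and \<open>m\<close> is fixed,
  so each list access becomes a single entry once the index \<open>i\<close> is unrolled.\<close>

lemma D_want [dec_intros]:
  assumes "4 \<le> S" "j < d" "v < d" "g < d" "x < d" "u < d" and h: "\<And>i. i < 5 * m \<Longrightarrow> h i < d"
  shows "dec S d (\<lambda>st e. want (sz st) (wd st) (arr st 2) m (e j) (e v) (picks e h (5 * m)) (e g) (e x) (e u))"
  unfolding want_def
proof (rule D_disj[OF _ D_ex_const], goal_cases)
  case 1
  show ?case by (intro dec_intros; (insert assms(1-6), simp))
next
  case (2 i)
  have p: "picks e h (5 * m) ! (5 * i) = e (h (5 * i))" "picks e h (5 * m) ! (5 * i + 1) = e (h (5 * i + 1))"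
    "picks e h (5 * m) ! (5 * i + 2) = e (h (5 * i + 2))" "picks e h (5 * m) ! (5 * i + 3) = e (h (5 * i + 3))"
    "picks e h (5 * m) ! (5 * i + 4) = e (h (5 * i + 4))" for e :: "nat \<Rightarrow> nat"
    using 2 by (intro nth_picks; simp)+
  have b: "h (5 * i) < d" "h (5 * i + 1) < d" "h (5 * i + 2) < d" "h (5 * i + 3) < d" "h (5 * i + 4) < d"
    using 2 by (intro h; simp)+
  show ?case
    unfolding p by (intro dec_intros; (insert assms(1-6) b, simp))
qed

lemma D_cons:
  assumes "4 \<le> S" "j < d" "v < d" and ha: "\<And>i. i < k \<Longrightarrow> ha i < d" and hu: "\<And>i. i < 5 * m \<Longrightarrow> hu i < d"
    and hx: "\<And>i. i < 2 * k + 1 \<Longrightarrow> hx i < d"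
  shows "dec S d (\<lambda>st e. cons (sz st) (wd st) (arr st 2) k m (e j) (e v) (picks e ha k) (picks e hu (5 * m))
     (picks e hx (2 * k + 1)))"
  unfolding cons_def
proof (intro D_conj D_all_const, goal_cases)
  case (1 i i')
  have p: "picks e ha k ! i = e (ha i)" "picks e ha k ! i' = e (ha i')"
    "picks e hx (2 * k + 1) ! (2 * i + 1) = e (hx (2 * i + 1))" "picks e hx (2 * k + 1) ! (2 * i + 2) = e (hx (2 * i + 2))"
    "picks e hx (2 * k + 1) ! (2 * i' + 1) = e (hx (2 * i' + 1))" "picks e hx (2 * k + 1) ! (2 * i' + 2) = e (hx (2 * i' + 2))"
    for e :: "nat \<Rightarrow> nat"
    using 1 by (intro nth_picks; simp)+
  have b: "ha i < d" "ha i' < d" "hx (2 * i + 1) < d" "hx (2 * i + 2) < d" "hx (2 * i' + 1) < d" "hx (2 * i' + 2) < d"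
    using 1 by (intro ha hx; simp)+
  show ?case
    unfolding p by (intro dec_intros; (insert assms(1-3) b, simp))
next
  case (2 i)
  have p: "picks e ha k ! i = e (ha i)" "picks e hx (2 * k + 1) ! 0 = e (hx 0)"
    "picks e hx (2 * k + 1) ! (2 * i + 1) = e (hx (2 * i + 1))" "picks e hx (2 * k + 1) ! (2 * i + 2) = e (hx (2 * i + 2))"
    for e :: "nat \<Rightarrow> nat"
    using 2 by (intro nth_picks; simp)+
  have b: "ha i < d" "hx (2 * i + 1) < d" "hx (2 * i + 2) < d" "hx 0 < d"
    using 2 by (intro ha hx; simp)+
  show ?case
    unfolding p by (intro dec_intros; (insert assms(1-3) b hu, simp add: trans_less_add1))
qed

lemma D_prod_reach:
  assumes "4 \<le> S" "j < d" "v < d" and ha: "\<And>i. i < k \<Longrightarrow> ha i < d" and hu: "\<And>i. i < 5 * m \<Longrightarrow> hu i < d"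
    and hx: "\<And>i. i < 2 * k + 1 \<Longrightarrow> hx i < d"
  shows "dec S d (\<lambda>st e. prod_reach (sz st) (wd st) (arr st 2) k m (e j) (e v) (picks e ha k) (picks e hu (5 * m))
     (picks e hx (2 * k + 1)))"
proof -
  let ?r = "2 * k + 1"
  let ?I = "\<lambda>st e xs. xs ! 0 = 0 \<and>
     cons (sz st) (wd st) (arr st 2) k m (e j) (e v) (picks e ha k) (picks e hu (5 * m)) xs \<and>
     (\<forall>i<k. \<exists>z<sz st. z = 0 \<and> seg (sz st) (wd st) (picks e ha k ! i) (picks e ha k ! i) z (xs ! (2 * i + 1)) (xs ! (2 * i + 2)))"
  let ?R = "\<lambda>st e ys xs. xs ! 0 = Suc (ys ! 0) \<and>
     cons (sz st) (wd st) (arr st 2) k m (e j) (e v) (picks e ha k) (picks e hu (5 * m)) xs \<and>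
     (\<forall>i<k. nxt (sz st) (wd st) (picks e ha k ! i) (ys ! 0) (ys ! (2 * i + 1)) (ys ! (2 * i + 2)) (xs ! (2 * i + 1)) (xs ! (2 * i + 2)))"
  have args: "args ?r e = picks e (\<lambda>i. 2 * (?r - 1 - i)) ?r" for e
    by (simp add: args_def)
  have args_nth: "args ?r e ! 0 = e (4 * k)" 
    "i < k \<Longrightarrow> args ?r e ! (2 * i + 1) = e (2 * (2 * k - (2 * i + 1)))"
    "i < k \<Longrightarrow> args ?r e ! (2 * i + 2) = e (2 * (2 * k - (2 * i + 2)))" for e i
    by (subst nth_args; simp)+
  have "dec S d (\<lambda>st e. reach (sz st) ?r (?I st e) (?R st e) (map e (map hx [0..<?r])))"
  proof (rule D_reach[where I = ?I and R = ?R], goal_cases)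
    case 5
    show ?case
    proof (intro D_conj D_all_const, goal_cases)
      case 1
      show ?case unfolding args_nth by (intro dec_intros) simp
    next
      case 2
      show ?case
        unfolding args
        by (rule D_cons) (use assms(1-3) ha hu in \<open>auto simp: trans_less_add1\<close>)
    next
      case (3 i)
      show ?case
        unfolding args_nth(2,3)[OF 3] nth_picks[OF 3]
        by (intro dec_intros; (insert assms(1) ha[OF 3], simp))
    qed
  next
    case 6
    show ?case
    proof (intro D_conj D_all_const, goal_cases)
      case 1
      show ?case unfolding args_nth by (intro dec_intros; simp)
    next
      case 2
      show ?case
        unfolding args
        by (rule D_cons) (use assms(1-3) ha hu in \<open>auto simp: trans_less_add1\<close>)
    next
      case (3 i)
      show ?case
        unfolding args_nth(1) args_nth(2,3)[OF 3] nth_picks[OF 3]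
        by (intro dec_intros; (insert assms(1) ha[OF 3], simp))
    qed
  qed (use assms(1) hx in auto)
  then show ?thesis
    unfolding prod_reach_def by (simp add: comp_def)
qed

lemma D_ext:
  assumes "4 \<le> S" "j < d" "v < d"
  shows "dec S d (\<lambda>st e. ext (sz st) (wd st) (arr st 2) k m (e j) (e v))"
  unfolding ext_def accepted_def
proof (intro D_conj, goal_cases)
  case 1
  show ?case by (intro dec_intros; (insert assms, simp))
next
  case 2
  show ?case by (intro dec_intros; (insert assms, simp))
next
  case 3
  show ?case
  proof (rule D_ex, rule D_conj, goal_cases)
    case 1
    show ?case by (intro dec_intros; (insert assms, simp))
  next
    case 2
    show ?case
    proof (rule D_ex_list, intro D_conj, goal_cases)
      case 1
      show ?case
      proof (rule D_all_const)
        fix i assume i: "i < k"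
        show "dec S (d + 3 + 3 * k) (\<lambda>st e. atom (sz st) (wd st) (e (0 + 3 * k)) (map (\<lambda>i. e (3 * (k - 1 - i))) [0..<k] ! i))"
          unfolding nth_picks[OF i] by (intro dec_intros; (insert assms i, simp))
      qed
    next
      case 2
      show ?case
      proof (intro D_all D_imp D_ex_const, goal_cases)
        case 1
        show ?case by (intro dec_intros; (insert assms, simp))
      next
        case (2 i)
        show ?case unfolding nth_picks[OF 2] by (intro dec_intros; (insert assms 2, simp))
      qed
    next
      case 3
      show ?case
      proof (rule D_ex_list, intro D_conj, goal_cases)
        case 1
        show ?case
        proof (rule D_all_const, goal_cases)
          case (1 i)
          then have p: "map f [0..<5 * m] ! (5 * i + 1) = f (5 * i + 1)" "map f [0..<5 * m] ! (5 * i + 2) = f (5 * i + 2)"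
            "map f [0..<5 * m] ! (5 * i + 3) = f (5 * i + 3)" "map f [0..<5 * m] ! (5 * i + 4) = f (5 * i + 4)"
            for f :: "nat \<Rightarrow> nat"
            by (intro nth_picks; simp)+
          show ?case unfolding p by (intro dec_intros; (insert 1, simp))
        qed
      next
        case 2
        show ?case
        proof (intro D_all D_imp D_ex_const, goal_cases)
          case 1
          show ?case by (intro dec_intros; (insert assms, simp))
        next
          case (2 i)
          then have p: "map f [0..<5 * m] ! (5 * i + 1) = f (5 * i + 1)" "map f [0..<5 * m] ! (5 * i + 2) = f (5 * i + 2)"
            "map f [0..<5 * m] ! (5 * i + 3) = f (5 * i + 3)" "map f [0..<5 * m] ! (5 * i + 4) = f (5 * i + 4)"
            "map f [0..<5 * m] ! (5 * i) = f (5 * i)"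
            for f :: "nat \<Rightarrow> nat"
            by (intro nth_picks; simp)+
          show ?case unfolding p by (intro dec_intros; (insert assms 2, simp))
        qed
      next
        case 3
        show ?case
        proof (rule D_ex, rule D_conj, goal_cases)
          case 1
          show ?case by (intro dec_intros; (insert assms, simp))
        next
          case 2
          show ?case
          proof (rule D_ex_list, intro D_conj, goal_cases)
            case 1
            show ?case by (rule D_prod_reach) (use assms in auto)
          next
            case 2
            have p: "map f [0..<2 * k + 1] ! 0 = f 0" for f :: "nat \<Rightarrow> nat"
              by (intro nth_picks) simp
            show ?case unfolding p by (intro dec_intros; simp)
          next
            case 3
            show ?case
            proof (rule D_all_const, goal_cases)
              case (1 i)
              then have p: "map f [0..<2 * k + 1] ! (2 * i + 1) = f (2 * i + 1)" "map f [0..<2 * k + 1] ! (2 * i + 2) = f (2 * i + 2)"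
                for f :: "nat \<Rightarrow> nat"
                by (intro nth_picks; simp)+
              show ?case unfolding p nth_picks[OF 1] by (intro dec_intros; (insert assms 1, simp))
            qed
          qed
        qed
      qed
    qed
  qed
qed

section \<open>The formulas define the intended objects on an encoded input\<close>

section \<open>Meaning of the descriptions\<close>

definition occ :: "nat list \<Rightarrow> nat \<Rightarrow> nat list \<Rightarrow> bool" where
  "occ w p u \<longleftrightarrow> (\<forall>i<length u. W w (p + i) (u ! i))"

lemma occ_Nil [simp]: "occ w p []"
  by (simp add: occ_def)

lemma occ_Cons [simp]: "occ w p (c # u) \<longleftrightarrow> W w p c \<and> occ w (Suc p) u"
  by (auto simp: occ_def nth_Cons less_Suc_eq_0_disj split: nat.splits)

lemma occ_append [simp]: "occ w p (u @ v) \<longleftrightarrow> occ w p u \<and> occ w (p + length u) v"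
  by (induction u arbitrary: p) auto

lemma occ_whole: "occ (u @ w @ v) (length u) w"
  by (auto simp: occ_def W_def nth_append)

lemma occ_length: "occ w p u \<Longrightarrow> u \<noteq> [] \<Longrightarrow> p + length u \<le> length w"
  by (cases u rule: rev_cases) (auto simp: W_def)

lemma W_unique: "W w p c \<Longrightarrow> W w p c' \<Longrightarrow> c = c'"
  by (simp add: W_def)

lemma W_num [simp]:
  "W w p c \<Longrightarrow> W w p c' \<longleftrightarrow> c' = c"
  by (auto simp: W_def)

abbreviation spells :: "nat list \<Rightarrow> nat \<Rightarrow> bool list \<Rightarrow> bool" where
  "spells w p bs \<equiv> occ w p (enc_bits bs)"

lemma enc_bits_simps [simp]:
  "enc_bits [] = [2]" "enc_bits (b # bs) = (if b then 1 else 0) # enc_bits bs"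
  by (simp_all add: enc_bits_def)

text \<open>The end marker 2 makes the code prefix-free.\<close>

lemma spells_unique: "spells w p bs \<Longrightarrow> spells w p bs' \<Longrightarrow> bs = bs'"
proof (induction bs arbitrary: p bs')
  case Nil
  then show ?case by (cases bs') (auto dest: W_unique split: if_splits)
next
  case (Cons b bs)
  then show ?case by (cases bs') (auto dest: W_unique split: if_splits)
qed

lemma spells_pos:
  assumes "spells w p bs"
  shows "i < length bs \<Longrightarrow> W w (p + i) 0 \<or> W w (p + i) 1" "W w (p + length bs) 2"
    "length (enc_bits bs) = Suc (length bs)"
proof -
  show len: "length (enc_bits bs) = Suc (length bs)"
    by (simp add: enc_bits_def)
  show "W w (p + length bs) 2"
    using assms by (simp add: enc_bits_def)
  assume i: "i < length bs"
  then have "W w (p + i) (enc_bits bs ! i)"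
    using assms len by (simp add: occ_def)
  then show "W w (p + i) 0 \<or> W w (p + i) 1"
    using i by (auto simp: enc_bits_def nth_append split: if_splits)
qed

lemma reach2_path:
  assumes "reach2 n I R a b" "\<And>a b. I a b \<Longrightarrow> a = a0 \<and> b = b0"
  shows "(\<lambda>s s'. R (fst s) (snd s) (fst s') (snd s'))\<^sup>*\<^sup>* (a0, b0) (a, b)"
  using assms(1)
proof (induction rule: reach2_induct)
  case (start a b)
  then show ?case using assms(2) by auto
next
  case (step a b a' b')
  then show ?case by (auto intro: rtranclp.rtrancl_into_rtrancl)
qed

text \<open>By determinism the stuck pair \<open>(c, d)\<close> is still ahead of every reached
  pair, so a reached pair that is stuck itself must be equal to it. This makes the end of a scan
  unique.\<close>

lemma reach2_det:
  assumes det: "\<And>a b x y x' y'. R a b x y \<Longrightarrow> R a b x' y' \<Longrightarrow> x = x' \<and> y = y'"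
    and I: "\<And>a b. I a b \<Longrightarrow> a = a0 \<and> b = b0"
    and F: "reach2 n I R c d" "\<And>x y. \<not> R c d x y"
    and r: "reach2 n I R a b" "\<And>x y. \<not> R a b x y"
  shows "a = c \<and> b = d"
proof -
  let ?R = "\<lambda>s s'. R (fst s) (snd s) (fst s') (snd s')"
  have "?R\<^sup>*\<^sup>* (a, b) (c, d)"
    using r(1)
  proof (induction rule: reach2_induct)
    case (start a b)
    then show ?case using reach2_path[of n I R c d a0 b0, OF F(1) I] I[of a b] by simp
  next
    case (step a b a' b')
    from step.IH show ?case
    proof (cases rule: converse_rtranclpE)
      case base
      then show ?thesis using F(2) step.hyps(2) by auto
    next
      case (step s)
      then have "s = (a', b')"
        using det[of a b "fst s" "snd s" a' b'] \<open>R a b a' b'\<close> by (cases s) auto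
      then show ?thesis using step by simp
    qed
  qed
  then show ?thesis
    by (cases rule: converse_rtranclpE) (use r(2) in auto)
qed

lemma delta_iff:
  "(s, l, s') \<in> delta ltr name \<alpha> p \<longleftrightarrow>
    (\<exists>q \<beta>. (q, \<beta>) \<in> nodes ltr name \<alpha> p \<and> (s, l, s') \<in> edges ltr name \<beta> q)"
  unfolding delta_def by blast

lemma vars_nodes: "y \<in> vars \<beta> \<longleftrightarrow> (\<exists>p \<gamma>. (p, Bind y \<gamma>) \<in> nodes ltr name \<beta> b)"
proof (induction \<beta> arbitrary: b)
  case (Alt \<beta> \<gamma>)
  show ?case
    using Alt(1)[of "Suc b"] Alt(2)[of "Suc b + length (enc_rgx ltr name \<beta>)"] by (simp add: ex_disj_distrib)
next
  case (Cat \<beta> \<gamma>)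
  show ?case
    using Cat(1)[of "Suc b"] Cat(2)[of "Suc b + length (enc_rgx ltr name \<beta>)"] by (simp add: ex_disj_distrib)
next
  case (Star \<beta>)
  show ?case
    using Star[of "Suc b"] by simp
next
  case (Bind x \<beta>)
  show ?case
    using Bind[of "Suc b + length (enc_bits (name x))"] by (auto simp: ex_disj_distrib)
qed auto

context
  fixes w :: "nat list" and n :: nat
  assumes n: "length w + 12 \<le> n"
begin

lemma W_n: "W w p c \<Longrightarrow> p < n" "W w p c \<Longrightarrow> Suc p < n"
  using n by (auto simp: W_def)

lemma bitsend_iff:
  assumes "spells w p bs"
  shows "bitsend n w p y \<longleftrightarrow> y = p + length (enc_bits bs)"
proof
  assume "bitsend n w p y"
  then obtain z where z: "y = Suc z" "p \<le> z" "W w z 2" "\<And>u. u < n \<Longrightarrow> p \<le> u \<Longrightarrow> u < z \<Longrightarrow> W w u 0 \<or> W w u 1"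
    unfolding bitsend_def by blast
  have "\<not> z < p + length bs"
  proof
    assume "z < p + length bs"
    then have "W w z 0 \<or> W w z 1"
      using spells_pos(1)[OF assms, of "z - p"] z(2) by simp
    then show False using z(3) by auto
  qed
  moreover have "\<not> p + length bs < z"
  proof
    assume "p + length bs < z"
    then have "W w (p + length bs) 0 \<or> W w (p + length bs) 1"
      using z(4)[of "p + length bs"] W_n[OF spells_pos(2)[OF assms]] by simp
    then show False using spells_pos(2)[OF assms] by auto
  qed
  ultimately show "y = p + length (enc_bits bs)"
    using z(1) spells_pos(3)[OF assms] by simp
next
  assume y: "y = p + length (enc_bits bs)"
  have "W w u 0 \<or> W w u 1" if "p \<le> u" "u < p + length bs" for u
    using spells_pos(1)[OF assms, of "u - p"] that by simp
  then show "bitsend n w p y"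
    unfolding bitsend_def y using W_n[OF spells_pos(2)[OF assms]] spells_pos(2,3)[OF assms]
    by (intro exI[of _ "p + length bs"]) auto
qed

lemma nameq_iff:
  assumes p: "spells w p bs"
  shows "nameq n w p x \<longleftrightarrow> spells w x bs"
proof
  assume "nameq n w p x"
  then obtain a b where ab: "W w a 2" "W w b 2" "reach2 n (\<lambda>a b. a = p \<and> b = x)
       (\<lambda>a b a' b'. (W w a 0 \<and> W w b 0 \<or> W w a 1 \<and> W w b 1) \<and> a' = Suc a \<and> b' = Suc b) a b"
    unfolding nameq_def by blast
  from ab(3) have "\<exists>i. a = p + i \<and> b = x + i \<and>
     (\<forall>i'<i. W w (p + i') 0 \<and> W w (x + i') 0 \<or> W w (p + i') 1 \<and> W w (x + i') 1)"
  proof (induction rule: reach2_induct)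
    case (step a b a' b')
    then obtain i where i: "a = p + i" "b = x + i"
      "\<forall>i'<i. W w (p + i') 0 \<and> W w (x + i') 0 \<or> W w (p + i') 1 \<and> W w (x + i') 1" by blast
    show ?case
      by (rule exI[of _ "Suc i"]) (use i step.hyps in \<open>auto simp: less_Suc_eq\<close>)
  qed auto
  then obtain i where i: "a = p + i" "b = x + i"
    "\<And>i'. i' < i \<Longrightarrow> W w (p + i') 0 \<and> W w (x + i') 0 \<or> W w (p + i') 1 \<and> W w (x + i') 1" by blast
  have "i = length bs"
  proof (rule linorder_cases)
    assume "i < length bs"
    then show ?thesis using spells_pos(1)[OF p, of i] ab(1) i(1) by auto
  next
    assume "length bs < i"
    then show ?thesis using spells_pos(2)[OF p] i(3)[of "length bs"] by auto
  qed
  then show "spells w x bs"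
    using i(2,3) ab(1,2) p spells_pos(3)[OF p] unfolding occ_def
    by (metis W_unique add.commute i(1) less_Suc_eq)
next
  assume x: "spells w x bs"
  let ?R = "reach2 n (\<lambda>a b. a = p \<and> b = x)
       (\<lambda>a b a' b'. (W w a 0 \<and> W w b 0 \<or> W w a 1 \<and> W w b 1) \<and> a' = Suc a \<and> b' = Suc b)"
  have bound: "p + i < n" "x + i < n" if "i \<le> length bs" for i
    using W_n[OF spells_pos(2)[OF p]] W_n[OF spells_pos(2)[OF x]] that by auto
  have "?R (p + i) (x + i)" if "i \<le> length bs" for i
    using that
  proof (induction i)
    case 0
    then show ?case using bound[of 0] by (intro reach2_start) auto
  next
    case (Suc i)
    then have R: "?R (p + i) (x + i)" by simp
    have "W w (p + i) (enc_bits bs ! i)" "W w (x + i) (enc_bits bs ! i)"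
      using p x Suc.prems spells_pos(3)[OF p] by (auto simp: occ_def)
    then have "W w (p + i) 0 \<and> W w (x + i) 0 \<or> W w (p + i) 1 \<and> W w (x + i) 1"
      using spells_pos(1)[OF p, of i] Suc.prems by auto
    then show ?case
      using bound[OF Suc.prems] by (intro reach2_step[OF R]) auto
  qed
  then show "nameq n w p x"
    unfolding nameq_def using bound[of "length bs"] spells_pos(2)[OF p] spells_pos(2)[OF x]
    by blast
qed

lemma nameq_spells:
  assumes "nameq n w p x" "spells w x bs"
  shows "spells w p bs"
proof -
  obtain a b where ab: "W w a 2" "W w b 2" "reach2 n (\<lambda>a b. a = p \<and> b = x)
       (\<lambda>a b a' b'. (W w a 0 \<and> W w b 0 \<or> W w a 1 \<and> W w b 1) \<and> a' = Suc a \<and> b' = Suc b) a b"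
    using assms(1) unfolding nameq_def by blast
  from ab(3) have "reach2 n (\<lambda>a b. a = x \<and> b = p)
       (\<lambda>a b a' b'. (W w a 0 \<and> W w b 0 \<or> W w a 1 \<and> W w b 1) \<and> a' = Suc a \<and> b' = Suc b) b a"
  proof (induction rule: reach2_induct)
    case (start a b)
    then show ?case by (intro reach2_start) auto
  next
    case (step a b a' b')
    show ?case by (rule reach2_step[OF step.IH]) (use step.hyps in auto)
  qed
  then have "nameq n w x p"
    unfolding nameq_def using ab W_n by blast
  then show ?thesis
    using nameq_iff[OF assms(2)] by simp
qed

text \<open>A token raises the count by at most one, so the count stays bounded in terms of the
  position; \<open>c \<le> p\<close> expresses this and keeps the count inside the domain.\<close>

lemma scan_step:
  assumes "scan n w p0 p (Suc c)" "c \<le> p" "rend_step w p (Suc c) (Suc p) c'"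
  shows "scan n w p0 (Suc p) c'"
proof -
  have "p < length w" "c' \<le> Suc (Suc c)"
    using assms(3) by (auto simp: rend_step_def W_def)
  then show ?thesis
    unfolding scan_def
    by (intro reach2_step[OF assms(1)[unfolded scan_def] assms(3)]) (use n assms(2) in auto)
qed

lemma scan_bits: "spells w p bs \<Longrightarrow> c \<le> p \<Longrightarrow> scan n w p0 p (Suc c) \<Longrightarrow> scan n w p0 (p + length (enc_bits bs)) c"
proof (induction bs arbitrary: p)
  case Nil
  then have "scan n w p0 (Suc p) c"
    by (intro scan_step[OF Nil(3,2)]) (auto simp: rend_step_def)
  then show ?case by simp
next
  case (Cons b bs)
  have "scan n w p0 (Suc p) (Suc c)"
    using Cons.prems(1) by (intro scan_step[OF Cons.prems(3,2)]) (auto simp: rend_step_def split: if_splits)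
  then show ?case
    using Cons.IH[of "Suc p"] Cons.prems(1,2) by simp
qed

text \<open>In Polish notation a complete formula pays for exactly one expected item;
  \<open>c\<close> is general because further siblings may be pending.\<close>

lemma scan_rgx: "occ w p (enc_rgx ltr name \<alpha>) \<Longrightarrow> c \<le> p \<Longrightarrow> scan n w p0 p (Suc c) \<Longrightarrow>
    scan n w p0 (p + length (enc_rgx ltr name \<alpha>)) c"
proof (induction \<alpha> arbitrary: p c)
  case Empty
  then have "scan n w p0 (Suc p) c"
    by (intro scan_step[OF Empty(3,2)]) (auto simp: rend_step_def)
  then show ?case by simp
next
  case Eps
  then have "scan n w p0 (Suc p) c"
    by (intro scan_step[OF Eps(3,2)]) (auto simp: rend_step_def)
  then show ?case by simp
next
  case (Sym a)
  then have "scan n w p0 (Suc p) (Suc c)"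
    by (intro scan_step[OF Sym.prems(3,2)]) (auto simp: rend_step_def)
  then show ?case
    using scan_bits[of "Suc p" "ltr a" c p0] Sym.prems(1,2) by simp
next
  case (Alt \<alpha> \<beta>)
  then have "scan n w p0 (Suc p) (Suc (Suc c))"
    by (intro scan_step[OF Alt.prems(3,2)]) (auto simp: rend_step_def)
  then have "scan n w p0 (Suc p + length (enc_rgx ltr name \<alpha>)) (Suc c)"
    using Alt.prems by (intro Alt.IH(1)) auto
  then show ?case
    using Alt.IH(2)[of "Suc p + length (enc_rgx ltr name \<alpha>)" c] Alt.prems(1,2) by (simp add: add.assoc)
next
  case (Cat \<alpha> \<beta>)
  then have "scan n w p0 (Suc p) (Suc (Suc c))"
    by (intro scan_step[OF Cat.prems(3,2)]) (auto simp: rend_step_def)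
  then have "scan n w p0 (Suc p + length (enc_rgx ltr name \<alpha>)) (Suc c)"
    using Cat.prems by (intro Cat.IH(1)) auto
  then show ?case
    using Cat.IH(2)[of "Suc p + length (enc_rgx ltr name \<alpha>)" c] Cat.prems(1,2) by (simp add: add.assoc)
next
  case (Star \<alpha>)
  then have "scan n w p0 (Suc p) (Suc c)"
    by (intro scan_step[OF Star.prems(3,2)]) (auto simp: rend_step_def)
  then show ?case
    using Star.IH[of "Suc p" c] Star.prems(1,2) by simp
next
  case (Bind x \<alpha>)
  then have "scan n w p0 (Suc p) (Suc (Suc c))"
    by (intro scan_step[OF Bind.prems(3,2)]) (auto simp: rend_step_def)
  then have "scan n w p0 (Suc p + length (enc_bits (name x))) (Suc c)"
    using Bind.prems by (intro scan_bits) auto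
  then show ?case
    using Bind.IH[of "Suc p + length (enc_bits (name x))" c] Bind.prems(1,2) by (simp add: add.assoc)
qed

lemma rend_iff:
  assumes p: "occ w p (enc_rgx ltr name \<alpha>)"
  shows "rend n w p y \<longleftrightarrow> y = p + length (enc_rgx ltr name \<alpha>)"
proof -
  have "p < length w"
    using occ_length[OF p] length_enc_rgx_pos[of ltr name \<alpha>] by (cases "enc_rgx ltr name \<alpha>") auto
  then have "scan n w p p 1"
    unfolding scan_def using n by (intro reach2_start) auto
  then have F: "scan n w p (p + length (enc_rgx ltr name \<alpha>)) 0"
    using scan_rgx[OF p, of 0 p] by simp
  have stuck: "\<not> rend_step w a 0 x y" for a x y
    by (simp add: rend_step_def)
  have "y = p + length (enc_rgx ltr name \<alpha>) \<and> (0 :: nat) = 0" if "scan n w p y 0"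
    by (rule reach2_det[where R = "rend_step w" and I = "\<lambda>a c. a = p \<and> c = 1" and b = 0 and n = n])
      (use F that stuck in \<open>auto simp: rend_step_def scan_def\<close>)
  moreover have "0 < n"
    using n by simp
  ultimately show ?thesis
    unfolding rend_def using F by auto
qed


subsection \<open>Automata\<close>

lemma nodes_occ: "(q, \<beta>) \<in> nodes ltr name \<alpha> p \<Longrightarrow> occ w p (enc_rgx ltr name \<alpha>) \<Longrightarrow> occ w q (enc_rgx ltr name \<beta>)"
  by (induction \<alpha> arbitrary: p) (auto simp: add.assoc)

definition head_token :: "nat \<Rightarrow> bool" where
  "head_token p \<longleftrightarrow> (\<exists>c\<in>{5, 6, 7, 8, 9, 10, 11}. W w p c)"

lemma head_token_bits: "spells w p bs \<Longrightarrow> p \<le> q \<Longrightarrow> q < p + length (enc_bits bs) \<Longrightarrow> \<not> head_token q"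
proof -
  assume a: "spells w p bs" "p \<le> q" "q < p + length (enc_bits bs)"
  then have "W w q 0 \<or> W w q 1 \<or> W w q 2"
    using spells_pos(1)[OF a(1), of "q - p"] spells_pos(2,3)[OF a(1)]
    by (cases "q - p < length bs") (auto simp: less_Suc_eq dest!: le_antisym)
  then show ?thesis
    by (auto simp: head_token_def)
qed

text \<open>Names and letters are spelled with the tokens 0, 1 and 2 only, so no head token can hide
  inside them.\<close>

lemma nodes_head_token:
  "occ w p (enc_rgx ltr name \<alpha>) \<Longrightarrow>
    (\<exists>\<beta>. (q, \<beta>) \<in> nodes ltr name \<alpha> p) \<longleftrightarrow> p \<le> q \<and> q < p + length (enc_rgx ltr name \<alpha>) \<and> head_token q"
proof (induction \<alpha> arbitrary: p)
  case (Sym a)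
  then have "\<not> head_token q" if "Suc p \<le> q" "q < Suc p + length (enc_bits (ltr a))"
    using head_token_bits[of "Suc p" "ltr a" q] that by auto
  moreover have "head_token p"
    using Sym by (auto simp: head_token_def)
  ultimately show ?case
    by (cases "q = p") auto
next
  case (Alt \<alpha> \<beta>)
  let ?d = "Suc p + length (enc_rgx ltr name \<alpha>)"
  have h: "head_token p"
    using Alt.prems by (auto simp: head_token_def)
  have a: "occ w (Suc p) (enc_rgx ltr name \<alpha>)" "occ w ?d (enc_rgx ltr name \<beta>)"
    using Alt.prems by auto
  have "(\<exists>\<gamma>. (q, \<gamma>) \<in> nodes ltr name (Alt \<alpha> \<beta>) p) \<longleftrightarrow> q = p \<or>
    (\<exists>\<gamma>. (q, \<gamma>) \<in> nodes ltr name \<alpha> (Suc p)) \<or> (\<exists>\<gamma>. (q, \<gamma>) \<in> nodes ltr name \<beta> ?d)"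
    by auto
  then show ?case
    unfolding Alt.IH(1)[OF a(1)] Alt.IH(2)[OF a(2)] using h by (cases "q = p") auto
next
  case (Cat \<alpha> \<beta>)
  let ?d = "Suc p + length (enc_rgx ltr name \<alpha>)"
  have h: "head_token p"
    using Cat.prems by (auto simp: head_token_def)
  have a: "occ w (Suc p) (enc_rgx ltr name \<alpha>)" "occ w ?d (enc_rgx ltr name \<beta>)"
    using Cat.prems by auto
  have "(\<exists>\<gamma>. (q, \<gamma>) \<in> nodes ltr name (Cat \<alpha> \<beta>) p) \<longleftrightarrow> q = p \<or>
    (\<exists>\<gamma>. (q, \<gamma>) \<in> nodes ltr name \<alpha> (Suc p)) \<or> (\<exists>\<gamma>. (q, \<gamma>) \<in> nodes ltr name \<beta> ?d)"
    by auto
  then show ?case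
    unfolding Cat.IH(1)[OF a(1)] Cat.IH(2)[OF a(2)] using h by (cases "q = p") auto
next
  case (Star \<alpha>)
  have h: "head_token p"
    using Star.prems by (auto simp: head_token_def)
  have a: "occ w (Suc p) (enc_rgx ltr name \<alpha>)"
    using Star.prems by auto
  have "(\<exists>\<gamma>. (q, \<gamma>) \<in> nodes ltr name (Star \<alpha>) p) \<longleftrightarrow> q = p \<or> (\<exists>\<gamma>. (q, \<gamma>) \<in> nodes ltr name \<alpha> (Suc p))"
    by auto
  then show ?case
    unfolding Star.IH[OF a] using h by (cases "q = p") auto
next
  case (Bind x \<alpha>)
  let ?d = "Suc p + length (enc_bits (name x))"
  have h: "head_token p"
    using Bind.prems by (auto simp: head_token_def)
  have a: "spells w (Suc p) (name x)" "occ w ?d (enc_rgx ltr name \<alpha>)"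
    using Bind.prems by auto
  have "(\<exists>\<gamma>. (q, \<gamma>) \<in> nodes ltr name (Bind x \<alpha>) p) \<longleftrightarrow> q = p \<or> (\<exists>\<gamma>. (q, \<gamma>) \<in> nodes ltr name \<alpha> ?d)"
    by auto
  then show ?case
    unfolding Bind.IH[OF a(2)] using h head_token_bits[OF a(1), of q] by (cases "q = p") auto
qed (auto simp: head_token_def)

lemma node_iff:
  assumes a: "occ w a (enc_rgx ltr name \<alpha>)"
  shows "node n w a p \<longleftrightarrow> (\<exists>\<beta>. (p, \<beta>) \<in> nodes ltr name \<alpha> a)"
proof -
  have "a + length (enc_rgx ltr name \<alpha>) < n"
    using occ_length[OF a] length_enc_rgx_pos[of ltr name \<alpha>] n by (cases "enc_rgx ltr name \<alpha>") auto
  then show ?thesis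
    unfolding nodes_head_token[OF a] node_def rend_iff[OF a] by (auto simp: head_token_def)
qed

lemma edge_eps_iff:
  assumes p: "occ w p (enc_rgx ltr name \<beta>)"
  shows "edge_eps n w p q f q' f' \<longleftrightarrow> ((q, f), [], (q', f')) \<in> edges ltr name \<beta> p"
proof -
  have tok: "W w p c' \<longleftrightarrow> c' = c" if "W w p c" for c c'
    using that by (auto simp: W_def)
  show ?thesis
  proof (cases \<beta>)
    case (Alt \<gamma> \<delta>)
    then have c: "W w p 8" "occ w (Suc p) (enc_rgx ltr name \<gamma>)"
      "occ w (Suc p + length (enc_rgx ltr name \<gamma>)) (enc_rgx ltr name \<delta>)"
      using p by auto
    have "Suc p + length (enc_rgx ltr name \<gamma>) < n"
      using occ_length[OF c(3)] length_enc_rgx_pos[of ltr name \<delta>] n by (cases "enc_rgx ltr name \<delta>") auto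
    then show ?thesis
      using W_n[OF c(1)] unfolding edge_eps_def tok[OF c(1)] by (auto simp: Alt Let_def rend_iff[OF c(2)])
  next
    case (Cat \<gamma> \<delta>)
    then have c: "W w p 9" "occ w (Suc p) (enc_rgx ltr name \<gamma>)"
      "occ w (Suc p + length (enc_rgx ltr name \<gamma>)) (enc_rgx ltr name \<delta>)"
      using p by auto
    have "Suc p + length (enc_rgx ltr name \<gamma>) < n"
      using occ_length[OF c(3)] length_enc_rgx_pos[of ltr name \<delta>] n by (cases "enc_rgx ltr name \<delta>") auto
    then show ?thesis
      using W_n[OF c(1)] unfolding edge_eps_def tok[OF c(1)] by (auto simp: Cat Let_def rend_iff[OF c(2)])
  next
    case Empty
    then have c: "W w p 5" using p by auto
    show ?thesis
      unfolding edge_eps_def tok[OF c] by (simp add: Empty)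
  next
    case Eps
    then have c: "W w p 6" using p by auto
    show ?thesis
      using W_n[OF c] unfolding edge_eps_def tok[OF c] by (auto simp: Eps)
  next
    case (Sym a)
    then have c: "W w p 7" using p by auto
    show ?thesis
      unfolding edge_eps_def tok[OF c] by (simp add: Sym)
  next
    case (Star \<gamma>)
    then have c: "W w p 10" using p by auto
    show ?thesis
      using W_n[OF c] unfolding edge_eps_def tok[OF c] by (auto simp: Star)
  next
    case (Bind x \<gamma>)
    then have c: "W w p 11" using p by auto
    show ?thesis
      unfolding edge_eps_def tok[OF c] by (simp add: Bind Let_def)
  qed
qed

lemma edge_op_iff:
  assumes p: "occ w p (enc_rgx ltr name \<beta>)"
  shows "edge_op n w p g q f q' f' \<longleftrightarrow>
    (\<exists>x \<gamma>. \<beta> = Bind x \<gamma> \<and> g \<le> 1 \<and> ((q, f), [opsym g x], (q', f')) \<in> edges ltr name \<beta> p)"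
proof (cases \<beta>)
  case (Bind x \<gamma>)
  then have c: "W w p 11" "spells w (Suc p) (name x)"
    "occ w (Suc p + length (enc_bits (name x))) (enc_rgx ltr name \<gamma>)"
    using p by auto
  have "Suc p + length (enc_bits (name x)) < n"
    using occ_length[OF c(3)] length_enc_rgx_pos[of ltr name \<gamma>] n by (cases "enc_rgx ltr name \<gamma>") auto
  moreover have "opsym g x = Open x \<longleftrightarrow> g = 0" "opsym g x = Close x \<longleftrightarrow> g \<noteq> 0" "g \<le> 1 \<longleftrightarrow> g = 0 \<or> g = 1" for g
    by (auto simp: opsym_def)
  ultimately show ?thesis
    using W_n[OF c(1)] c(1) unfolding edge_op_def by (auto simp: Bind Let_def bitsend_iff[OF c(2)])
qed (use p in \<open>auto simp: edge_op_def W_def\<close>)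

lemma edge_let_iff:
  assumes p: "occ w p (enc_rgx ltr name \<beta>)"
  shows "edge_let w p q f q' f' \<longleftrightarrow>
    (\<exists>\<sigma>. \<beta> = Sym \<sigma> \<and> ((q, f), [Letter \<sigma>], (q', f')) \<in> edges ltr name \<beta> p)"
  using p by (cases \<beta>) (auto simp: edge_let_def W_def)

lemma edges_label:
  "(s, l, s') \<in> edges ltr name \<beta> p \<Longrightarrow>
    l = [] \<or> (\<exists>g\<le>1. \<exists>x \<gamma>. \<beta> = Bind x \<gamma> \<and> l = [opsym g x]) \<or> (\<exists>\<sigma>. \<beta> = Sym \<sigma> \<and> l = [Letter \<sigma>])"
proof (cases \<beta>)
  case (Bind x \<gamma>)
  assume "(s, l, s') \<in> edges ltr name \<beta> p"
  then have "l = [opsym 0 x] \<or> l = [opsym 1 x]"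
    by (auto simp: Bind Let_def opsym_def)
  then show ?thesis
    using Bind by auto
qed (auto simp: Let_def)

context
  fixes ltr :: "'a \<Rightarrow> bool list" and name :: "'v \<Rightarrow> bool list" and \<alpha> :: "('a, 'v) rgx" and a :: nat
  assumes a: "occ w a (enc_rgx ltr name \<alpha>)"
begin

lemma delta_n:
  assumes "((q, f), l, (q', f')) \<in> delta ltr name \<alpha> a"
  shows "q < n" "q' < n" "f \<le> 1" "f' \<le> 1"
proof -
  have "a + length (enc_rgx ltr name \<alpha>) < n"
    using occ_length[OF a] length_enc_rgx_pos[of ltr name \<alpha>] n by (cases "enc_rgx ltr name \<alpha>") auto
  then show "q < n" "q' < n"
    using delta_range[OF assms] by auto
  have "f \<le> 1 \<and> f' \<le> 1" if "((q, f), l, (q', f')) \<in> edges ltr name \<beta> p" for \<beta> p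
    using that by (cases \<beta>) (auto simp: Let_def)
  then show "f \<le> 1" "f' \<le> 1"
    using assms unfolding delta_def by auto
qed

lemma nodes_n:
  assumes "(p, \<beta>) \<in> nodes ltr name \<alpha> a"
  shows "p < n" "occ w p (enc_rgx ltr name \<beta>)"
proof -
  show p: "occ w p (enc_rgx ltr name \<beta>)"
    using nodes_occ[OF assms a] .
  then show "p < n"
    using occ_length[OF p] length_enc_rgx_pos[of ltr name \<beta>] n by (cases "enc_rgx ltr name \<beta>") auto
qed

lemma step_sil_iff:
  "step_sil n w a q f q' f' \<longleftrightarrow> (\<exists>l. ((q, f), l, (q', f')) \<in> delta ltr name \<alpha> a \<and> clr l = [])"
proof
  assume "step_sil n w a q f q' f'"
  then obtain p where p: "node n w a p" "edge_eps n w p q f q' f' \<or> (\<exists>g<n. edge_op n w p g q f q' f')"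
    unfolding step_sil_def by blast
  then obtain \<beta> where \<beta>: "(p, \<beta>) \<in> nodes ltr name \<alpha> a"
    using node_iff[OF a] by blast
  show "\<exists>l. ((q, f), l, (q', f')) \<in> delta ltr name \<alpha> a \<and> clr l = []"
    using p(2)
  proof
    assume "edge_eps n w p q f q' f'"
    then show ?thesis
      using \<beta> unfolding edge_eps_iff[OF nodes_n(2)[OF \<beta>]] delta_def by (intro exI[of _ "[]"]) auto
  next
    assume "\<exists>g<n. edge_op n w p g q f q' f'"
    then obtain g x where "((q, f), [opsym g x], (q', f')) \<in> edges ltr name \<beta> p"
      unfolding edge_op_iff[OF nodes_n(2)[OF \<beta>]] by blast
    then show ?thesis
      using \<beta> unfolding delta_iff by (intro exI[of _ "[opsym g x]"] conjI, blast, simp add: opsym_def)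
  qed
next
  assume "\<exists>l. ((q, f), l, (q', f')) \<in> delta ltr name \<alpha> a \<and> clr l = []"
  then obtain l p \<beta> where l: "((q, f), l, (q', f')) \<in> edges ltr name \<beta> p" "clr l = []"
    "(p, \<beta>) \<in> nodes ltr name \<alpha> a"
    unfolding delta_def by auto
  have "edge_eps n w p q f q' f' \<or> (\<exists>g<n. edge_op n w p g q f q' f')"
    using edges_label[OF l(1)]
  proof (elim disjE exE conjE)
    assume "l = []"
    then show ?thesis
      using l(1) unfolding edge_eps_iff[OF nodes_n(2)[OF l(3)]] by simp
  next
    fix g x \<gamma> assume "g \<le> 1" "\<beta> = Bind x \<gamma>" "l = [opsym g x]"
    then show ?thesis
      using l(1) n unfolding edge_op_iff[OF nodes_n(2)[OF l(3)]] by (intro disjI2 exI[of _ g]) auto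
  next
    fix \<sigma> assume "l = [Letter \<sigma>]"
    then show ?thesis
      using l(2) by simp
  qed
  then show "step_sil n w a q f q' f'"
    unfolding step_sil_def using nodes_n(1)[OF l(3)] node_iff[OF a] l(3) by blast
qed

lemma step_any_iff: "step_any n w a q f q' f' \<longleftrightarrow> (\<exists>l. ((q, f), l, (q', f')) \<in> delta ltr name \<alpha> a)"
proof
  assume "step_any n w a q f q' f'"
  then obtain p where p: "node n w a p" "edge_eps n w p q f q' f' \<or> (\<exists>g<n. edge_op n w p g q f q' f') \<or> edge_let w p q f q' f'"
    unfolding step_any_def by blast
  then obtain \<beta> where \<beta>: "(p, \<beta>) \<in> nodes ltr name \<alpha> a"
    using node_iff[OF a] by blast
  have "\<exists>l. ((q, f), l, (q', f')) \<in> edges ltr name \<beta> p"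
    using p(2) unfolding edge_eps_iff[OF nodes_n(2)[OF \<beta>]] edge_op_iff[OF nodes_n(2)[OF \<beta>]]
      edge_let_iff[OF nodes_n(2)[OF \<beta>]] by blast
  then show "\<exists>l. ((q, f), l, (q', f')) \<in> delta ltr name \<alpha> a"
    using \<beta> unfolding delta_def by blast
next
  assume "\<exists>l. ((q, f), l, (q', f')) \<in> delta ltr name \<alpha> a"
  then obtain l p \<beta> where l: "((q, f), l, (q', f')) \<in> edges ltr name \<beta> p" "(p, \<beta>) \<in> nodes ltr name \<alpha> a"
    unfolding delta_def by auto
  have "edge_eps n w p q f q' f' \<or> (\<exists>g<n. edge_op n w p g q f q' f') \<or> edge_let w p q f q' f'"
    using edges_label[OF l(1)]
  proof (elim disjE exE conjE)
    assume "l = []"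
    then show ?thesis
      using l(1) unfolding edge_eps_iff[OF nodes_n(2)[OF l(2)]] by simp
  next
    fix g x \<gamma> assume "g \<le> 1" "\<beta> = Bind x \<gamma>" "l = [opsym g x]"
    then show ?thesis
      using l(1) n unfolding edge_op_iff[OF nodes_n(2)[OF l(2)]] by (intro disjI2 disjI1 exI[of _ g]) auto
  next
    fix \<sigma> assume "\<beta> = Sym \<sigma>" "l = [Letter \<sigma>]"
    then show ?thesis
      using l(1) unfolding edge_let_iff[OF nodes_n(2)[OF l(2)]] by simp
  qed
  then show "step_any n w a q f q' f'"
    unfolding step_any_def using nodes_n(1)[OF l(2)] node_iff[OF a] l(2) by blast
qed

text \<open>Injectivity of \<open>name\<close> turns equal spelling into equal variables, so
  \<open>x\<close> may be any position at which the name is spelled.\<close>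

lemma step_op_iff:
  assumes name: "inj name" and x: "spells w x (name y)" and g: "g \<le> 1"
  shows "step_op n w a g x q f q' f' \<longleftrightarrow> ((q, f), [opsym g y], (q', f')) \<in> delta ltr name \<alpha> a"
proof
  assume "step_op n w a g x q f q' f'"
  then obtain p where p: "node n w a p" "nameq n w (Suc p) x" "edge_op n w p g q f q' f'"
    unfolding step_op_def by blast
  then obtain \<beta> where \<beta>: "(p, \<beta>) \<in> nodes ltr name \<alpha> a"
    using node_iff[OF a] by blast
  obtain z \<gamma> where z: "\<beta> = Bind z \<gamma>" "((q, f), [opsym g z], (q', f')) \<in> edges ltr name \<beta> p"
    using p(3) unfolding edge_op_iff[OF nodes_n(2)[OF \<beta>]] by blast
  have "spells w (Suc p) (name z)"
    using nodes_n(2)[OF \<beta>] z(1) by simp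
  then have "z = y"
    using nameq_spells[OF p(2) x] spells_unique name by (metis injD)
  then show "((q, f), [opsym g y], (q', f')) \<in> delta ltr name \<alpha> a"
    using z \<beta> unfolding delta_def by blast
next
  assume "((q, f), [opsym g y], (q', f')) \<in> delta ltr name \<alpha> a"
  then obtain p \<beta> where l: "((q, f), [opsym g y], (q', f')) \<in> edges ltr name \<beta> p" "(p, \<beta>) \<in> nodes ltr name \<alpha> a"
    unfolding delta_def by auto
  obtain g' z \<gamma> where z: "\<beta> = Bind z \<gamma>" "opsym g y = (opsym g' z :: ('a, 'v) refsym)"
    using edges_label[OF l(1)] by (auto simp: opsym_def split: if_splits)
  then have "z = y"
    by (auto simp: opsym_def split: if_splits)
  then have "edge_op n w p g q f q' f'"
    unfolding edge_op_iff[OF nodes_n(2)[OF l(2)]] using l(1) z(1) g by blast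
  moreover have occ: "W w p 11" "spells w (Suc p) (name y)"
    using nodes_n(2)[OF l(2)] z(1) \<open>z = y\<close> by auto
  then have "nameq n w (Suc p) x"
    using nameq_iff x by blast
  ultimately show "step_op n w a g x q f q' f'"
    unfolding step_op_def using nodes_n(1)[OF l(2)] node_iff[OF a] l(2) W_n(2)[OF occ(1)] by blast
qed

lemma step_let_iff:
  assumes ltr: "inj ltr" and x: "spells w x (ltr \<sigma>)"
  shows "step_let n w a x q f q' f' \<longleftrightarrow> ((q, f), [Letter \<sigma>], (q', f')) \<in> delta ltr name \<alpha> a"
proof
  assume "step_let n w a x q f q' f'"
  then obtain p where p: "node n w a p" "nameq n w (Suc p) x" "edge_let w p q f q' f'"
    unfolding step_let_def by blast
  then obtain \<beta> where \<beta>: "(p, \<beta>) \<in> nodes ltr name \<alpha> a"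
    using node_iff[OF a] by blast
  obtain z where z: "\<beta> = Sym z" "((q, f), [Letter z], (q', f')) \<in> edges ltr name \<beta> p"
    using p(3) unfolding edge_let_iff[OF nodes_n(2)[OF \<beta>]] by blast
  have "spells w (Suc p) (ltr z)"
    using nodes_n(2)[OF \<beta>] z(1) by simp
  then have "z = \<sigma>"
    using nameq_spells[OF p(2) x] spells_unique ltr by (metis injD)
  then show "((q, f), [Letter \<sigma>], (q', f')) \<in> delta ltr name \<alpha> a"
    using z \<beta> unfolding delta_def by blast
next
  assume "((q, f), [Letter \<sigma>], (q', f')) \<in> delta ltr name \<alpha> a"
  then obtain p \<beta> where l: "((q, f), [Letter \<sigma>], (q', f')) \<in> edges ltr name \<beta> p" "(p, \<beta>) \<in> nodes ltr name \<alpha> a"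
    unfolding delta_def by auto
  have z: "\<beta> = Sym \<sigma>"
    using edges_label[OF l(1)] by (auto simp: opsym_def split: if_splits)
  then have "edge_let w p q f q' f'"
    unfolding edge_let_iff[OF nodes_n(2)[OF l(2)]] using l(1) by blast
  moreover have occ: "W w p 7" "spells w (Suc p) (ltr \<sigma>)"
    using nodes_n(2)[OF l(2)] z by auto
  then have "nameq n w (Suc p) x"
    using nameq_iff x by blast
  ultimately show "step_let n w a x q f q' f'"
    unfolding step_let_def using nodes_n(1)[OF l(2)] node_iff[OF a] l(2) W_n(2)[OF occ(1)] by blast
qed

lemma seg_iff:
  assumes "q < n" "f < n"
  shows "seg n w a q f q' f' \<longleftrightarrow> sil (delta ltr name \<alpha> a) (q, f) (q', f')"
proof
  assume "seg n w a q f q' f'"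
  then show "sil (delta ltr name \<alpha> a) (q, f) (q', f')"
    unfolding seg_def
  proof (induction rule: reach2_induct)
    case (start b g)
    then show ?case by (auto simp: sil_def intro: pth_refl exI[of _ "[]"])
  next
    case (step b g b' g')
    then obtain u l where "pth (delta ltr name \<alpha> a) (q, f) u (b, g)" "clr u = []"
      "((b, g), l, (b', g')) \<in> delta ltr name \<alpha> a" "clr l = []"
      unfolding step_sil_iff sil_def by blast
    then show ?case
      unfolding sil_def by (intro exI[of _ "u @ l"]) (auto intro: pth_append pth_edge)
  qed
next
  assume "sil (delta ltr name \<alpha> a) (q, f) (q', f')"
  then obtain u where u: "pth (delta ltr name \<alpha> a) (q, f) u (q', f')" "clr u = []"
    by (auto simp: sil_def)
  let ?R = "reach2 n (\<lambda>b g. b = q \<and> g = f) (\<lambda>b g b' g'. step_sil n w a b g b' g')"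
  have "clr u = [] \<Longrightarrow> ?R (fst s) (snd s) \<Longrightarrow> ?R (fst s') (snd s')"
    if "pth (delta ltr name \<alpha> a) s u s'" for s u s'
    using that
  proof induction
    case (pth_step s l s1 r s2)
    have e: "((fst s, snd s), l, (fst s1, snd s1)) \<in> delta ltr name \<alpha> a"
      using pth_step.hyps(1) by simp
    have "clr l = []" "clr r = []"
      using pth_step.prems(1) by auto
    then have "step_sil n w a (fst s) (snd s) (fst s1) (snd s1)"
      unfolding step_sil_iff using e by blast
    then have "?R (fst s1) (snd s1)"
      by (rule reach2_step[OF pth_step.prems(2)]) (use delta_n[OF e] n in auto)
    then show ?case
      using pth_step.IH \<open>clr r = []\<close> by blast
  qed simp
  from this[OF u] show "seg n w a q f q' f'"
    using assms by (auto simp: seg_def intro: reach2_start)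
qed

lemma seenp_iff:
  assumes name: "inj name" and x: "spells w x (name y)" and g: "g \<le> 1"
  shows "seenp n w a g x q f \<longleftrightarrow> sees ltr name \<alpha> a (q, f) g y"
proof -
  let ?R = "reach3 n (\<lambda>b f h. b = a \<and> f = 0 \<and> h = 0)
     (\<lambda>b f h b' f' h'. step_any n w a b f b' f' \<and> h' = h \<or> step_op n w a g x b f b' f' \<and> h' = 1)"
  let ?T = "delta ltr name \<alpha> a"
  have 1: "\<exists>u. pth ?T (a, 0) u (q, f) \<and> (h = 0 \<or> opsym g y \<in> set u)" if "?R q f h" for q f h
    using that
  proof (induction rule: reach3_induct)
    case (start b f h)
    then show ?case by (auto intro: pth_refl)
  next
    case (step b f h b' f' h')
    then obtain u where u: "pth ?T (a, 0) u (b, f)" "h = 0 \<or> opsym g y \<in> set u" by blast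
    from step.hyps(2) show ?case
    proof
      assume *: "step_any n w a b f b' f' \<and> h' = h"
      then obtain l where "((b, f), l, (b', f')) \<in> ?T"
        unfolding step_any_iff by blast
      then show ?thesis
        using u * by (intro exI[of _ "u @ l"]) (auto intro: pth_append pth_edge)
    next
      assume "step_op n w a g x b f b' f' \<and> h' = 1"
      then have "((b, f), [opsym g y], (b', f')) \<in> ?T"
        unfolding step_op_iff[OF name x g] by blast
      then show ?thesis
        using u by (intro exI[of _ "u @ [opsym g y]"]) (auto intro: pth_append pth_edge)
    qed
  qed
  \<comment> \<open>The flag \<open>h\<close> is general because in the induction it may already
    have been raised before the rest of the path; a path can always be followed without lowering
    it.\<close>
  have 2: "?R (fst s) (snd s) h \<Longrightarrow> h \<le> 1 \<Longrightarrow>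
     ?R (fst s') (snd s') h \<and> (opsym g y \<in> set u \<longrightarrow> ?R (fst s') (snd s') 1)"
    if "pth ?T s u s'" for s u s' h
    using that
  proof (induction arbitrary: h)
    case (pth_step s l s1 r s2)
    have e: "((fst s, snd s), l, (fst s1, snd s1)) \<in> ?T"
      using pth_step.hyps(1) by simp
    have b: "fst s1 < n" "snd s1 < n" "h < n" "1 < n"
      using delta_n[OF e] n pth_step.prems(2) by auto
    have R: "?R (fst s1) (snd s1) h"
      using e b by (intro reach3_step[OF pth_step.prems(1)]) (auto simp: step_any_iff)
    have len: "length l \<le> 1"
      using delta_label[OF e] .
    have "?R (fst s1) (snd s1) 1" if "opsym g y \<in> set l"
    proof -
      have "l = [opsym g y]"
        using that len by (cases l) auto
      then show ?thesis
        using e b by (intro reach3_step[OF pth_step.prems(1)]) (auto simp: step_op_iff[OF name x g])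
    qed
    then show ?case
      using pth_step.IH[OF R] pth_step.IH[of 1] pth_step.prems(2) by auto
  qed simp
  have "a < n"
    using occ_length[OF a] length_enc_rgx_pos[of ltr name \<alpha>] n by (cases "enc_rgx ltr name \<alpha>") auto
  then have 3: "?R a 0 0"
    using n by (intro reach3_start) auto
  have "?R q f 1 \<longleftrightarrow> sees ltr name \<alpha> a (q, f) g y"
    using 1[of q f 1] 2[of "(a, 0)" _ "(q, f)" 0] 3 unfolding seen_def by auto
  then show ?thesis
    unfolding seenp_def using n by auto
qed

lemma varin_iff: "varin n w a x \<longleftrightarrow> (\<exists>y\<in>vars \<alpha>. spells w x (name y))"
proof -
  show ?thesis
  proof
    assume "varin n w a x"
    then obtain p where p: "node n w a p" "W w p 11" "nameq n w (Suc p) x"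
      unfolding varin_def by blast
    then obtain \<beta> where \<beta>: "(p, \<beta>) \<in> nodes ltr name \<alpha> a"
      using node_iff[OF a] by blast
    obtain z \<gamma> where z: "\<beta> = Bind z \<gamma>"
      using nodes_n(2)[OF \<beta>] p(2) by (cases \<beta>) (auto simp: W_def)
    have "spells w (Suc p) (name z)"
      using nodes_n(2)[OF \<beta>] z by simp
    then have "spells w x (name z)"
      using nameq_iff p(3) by blast
    then show "\<exists>y\<in>vars \<alpha>. spells w x (name y)"
      using vars_nodes[of z \<alpha> ltr name a] z \<beta> by blast
  next
    assume "\<exists>y\<in>vars \<alpha>. spells w x (name y)"
    then obtain y p \<gamma> where y: "spells w x (name y)" "(p, Bind y \<gamma>) \<in> nodes ltr name \<alpha> a"
      using vars_nodes[of _ \<alpha> ltr name a] by metis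
    have occ: "W w p 11" "spells w (Suc p) (name y)"
      using nodes_n(2)[OF y(2)] by auto
    then have "nameq n w (Suc p) x"
      using nameq_iff y(1) by blast
    then show "varin n w a x"
      unfolding varin_def using nodes_n(1)[OF y(2)] node_iff[OF a] y(2) W_n(2)[OF occ(1)] occ(1) by blast
  qed
qed

end

end

subsection \<open>Encoded lists\<close>

text \<open>The position of the separator 3 of item \<open>i\<close>, and for
  \<open>i = length xs\<close> that of the terminator 4.\<close>

definition off :: "('b \<Rightarrow> nat list) \<Rightarrow> nat \<Rightarrow> 'b list \<Rightarrow> nat \<Rightarrow> nat" where
  "off f p xs i = p + length (concat (map (\<lambda>x. 3 # f x) (take i xs)))"

lemma off_0 [simp]: "off f p xs 0 = p"
  by (simp add: off_def)

lemma off_Suc: "i < length xs \<Longrightarrow> off f p xs (Suc i) = Suc (off f p xs i) + length (f (xs ! i))"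
  by (simp add: off_def take_Suc_conv_app_nth)

lemma off_length: "p + length (enc_list f xs) = Suc (off f p xs (length xs))"
  by (simp add: off_def enc_list_def)

lemma off_ge: "i \<le> length xs \<Longrightarrow> p + i \<le> off f p xs i"
  by (induction i) (auto simp: off_Suc)

lemma occ_enc_list:
  assumes "occ w p (enc_list f xs)"
  shows "i < length xs \<Longrightarrow> W w (off f p xs i) 3" "i < length xs \<Longrightarrow> occ w (Suc (off f p xs i)) (f (xs ! i))"
    "W w (off f p xs (length xs)) 4"
proof -
  show "W w (off f p xs (length xs)) 4"
    using assms by (simp add: enc_list_def off_def)
  assume i: "i < length xs"
  have "enc_list f xs = concat (map (\<lambda>x. 3 # f x) (take i xs)) @ 3 # f (xs ! i) @
     concat (map (\<lambda>x. 3 # f x) (drop (Suc i) xs)) @ [4]"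
    by (subst id_take_nth_drop[OF i]) (simp add: enc_list_def)
  then have "W w (off f p xs i) 3 \<and> occ w (Suc (off f p xs i)) (f (xs ! i))"
    using assms by (simp add: off_def)
  then show "W w (off f p xs i) 3" "occ w (Suc (off f p xs i)) (f (xs ! i))"
    by auto
qed

lemma off_strict: "i < j \<Longrightarrow> j \<le> length xs \<Longrightarrow> off f p xs i < off f p xs j"
  by (induction j) (auto simp: off_Suc less_Suc_eq)

lemma off_inj: "i < length xs \<Longrightarrow> j < length xs \<Longrightarrow> off f p xs i = off f p xs j \<Longrightarrow> i = j"
  using off_strict[of i j xs f p] off_strict[of j i xs f p] by (cases i j rule: linorder_cases) auto

lemma off_bound:
  assumes "occ w p (enc_list f xs)" "i \<le> length xs"
  shows "off f p xs i < length w \<and> i < length w"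
proof -
  have "off f p xs i \<le> off f p xs (length xs)"
    using off_strict[of i "length xs" xs f p] assms(2) by (cases "i = length xs") auto
  then show ?thesis
    using occ_enc_list(3)[OF assms(1)] off_ge[OF assms(2), of p f] by (auto simp: W_def)
qed

context
  fixes w :: "nat list" and n :: nat
  assumes n: "length w + 12 \<le> n"
begin

context
  fixes f :: "'b \<Rightarrow> nat list" and p :: nat and xs :: "'b list" and E :: "nat \<Rightarrow> nat \<Rightarrow> bool"
  assumes occ: "occ w p (enc_list f xs)"
    and E: "\<And>x z y. x \<in> set xs \<Longrightarrow> occ w z (f x) \<Longrightarrow> E z y \<longleftrightarrow> y = z + length (f x)"
begin

lemma icell_iff: "icell n w E p i y \<longleftrightarrow> i \<le> length xs \<and> y = off f p xs i"
proof
  assume "icell n w E p i y"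
  then show "i \<le> length xs \<and> y = off f p xs i"
    unfolding icell_def
  proof (induction rule: reach2_induct)
    case (step i y i' y')
    then have *: "i \<le> length xs" "y = off f p xs i" "i' = Suc i" "W w y 3" "E (Suc y) y'"
      by auto
    \<comment> \<open>At index \<open>length xs\<close> stands the terminator 4 and not a separator,
      so the walk cannot leave the list.\<close>
    have "i \<noteq> length xs"
      using *(2,4) occ_enc_list(3)[OF occ] by (auto simp: W_def)
    then have i: "i < length xs"
      using *(1) by simp
    then have "y' = Suc y + length (f (xs ! i))"
      using E[of "xs ! i"] occ_enc_list(2)[OF occ i] *(2,5) by auto
    then show ?case
      using i * off_Suc[OF i] by simp
  qed auto
next
  have "icell n w E p i (off f p xs i)" if "i \<le> length xs" for i
    using that
  proof (induction i)
    case 0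
    then show ?case
      unfolding icell_def using off_bound[OF occ, of 0] n by (intro reach2_start) auto
  next
    case (Suc i)
    then have i: "i < length xs" by simp
    have "E (Suc (off f p xs i)) (off f p xs (Suc i))"
      using E[of "xs ! i"] occ_enc_list(2)[OF occ i] i off_Suc[OF i] by auto
    moreover have "Suc (off f p xs i) < n"
      using off_bound[OF occ, of i] i n by simp
    moreover have "reach2 n (\<lambda>i y. i = 0 \<and> y = p)
      (\<lambda>i y i' y'. i' = Suc i \<and> W w y 3 \<and> (\<exists>z<n. z = Suc y \<and> E z y')) i (off f p xs i)"
      using Suc.IH i unfolding icell_def by simp
    ultimately show ?case
      using occ_enc_list(1)[OF occ i] off_bound[OF occ, of "Suc i"] i n unfolding icell_def
      by (elim reach2_step) auto
  qed
  then show "i \<le> length xs \<and> y = off f p xs i \<Longrightarrow> icell n w E p i y"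
    by auto
qed

lemma item_iff: "item n w E p i x \<longleftrightarrow> i < length xs \<and> x = Suc (off f p xs i)"
proof
  assume "item n w E p i x"
  then have *: "i \<le> length xs" "W w (off f p xs i) 3" "x = Suc (off f p xs i)"
    by (auto simp: item_def icell_iff)
  then have "i \<noteq> length xs"
    using occ_enc_list(3)[OF occ] by (auto simp: W_def)
  then show "i < length xs \<and> x = Suc (off f p xs i)"
    using * by simp
next
  assume "i < length xs \<and> x = Suc (off f p xs i)"
  then show "item n w E p i x"
    using occ_enc_list(1)[OF occ, of i] off_bound[OF occ, of i] n by (auto simp: item_def icell_iff)
qed

lemma item_bound: "item n w E p i x \<Longrightarrow> i < n \<and> x < n"
  using off_bound[OF occ, of i] n by (auto simp: item_iff)

lemma lend_iff: "lend n w E p z \<longleftrightarrow> z = p + length (enc_list f xs)"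
proof
  assume "lend n w E p z"
  then obtain i where *: "i \<le> length xs" "W w (off f p xs i) 4" "z = Suc (off f p xs i)"
    by (auto simp: lend_def icell_iff)
  then have "i = length xs"
    using occ_enc_list(1)[OF occ, of i] by (cases "i < length xs") (auto simp: W_def)
  then show "z = p + length (enc_list f xs)"
    using * by (simp add: off_length)
next
  assume "z = p + length (enc_list f xs)"
  then show "lend n w E p z"
    using occ_enc_list(3)[OF occ] off_bound[OF occ, of "length xs"] n
    unfolding lend_def icell_iff off_length
    by (intro exI[of _ "length xs"] exI[of _ "off f p xs (length xs)"] conjI) auto
qed

end

lemma pairend_iff:
  assumes "occ w p (enc_bits bs @ enc_bits cs)"
  shows "pairend n w p y \<longleftrightarrow> y = p + length (enc_bits bs @ enc_bits cs)"
proof -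
  have o: "spells w p bs" "spells w (p + length (enc_bits bs)) cs"
    using assms by auto
  have "p + length (enc_bits bs) < n"
    using occ_length[OF o(2)] n by (cases "enc_bits cs") (auto simp: enc_bits_def)
  then have "pairend n w p y \<longleftrightarrow> bitsend n w (p + length (enc_bits bs)) y"
    unfolding pairend_def bitsend_iff[OF n o(1)] by blast
  then show ?thesis
    unfolding bitsend_iff[OF n o(2)] by (simp add: add.assoc)
qed

context
  fixes ltr :: "'a \<Rightarrow> bool list" and name :: "'v \<Rightarrow> bool list" and q :: nat and c :: "('a, 'v) cq"
  assumes occ: "occ w q (enc_cq ltr name c)"
begin

abbreviation "pnames \<equiv> (\<lambda>(x, y). enc_bits (name x) @ enc_bits (name y))"

definition "eqs_start = q + length (enc_list (\<lambda>x. enc_bits (name x)) (outs c))"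
definition "atoms_start = eqs_start + length (enc_list pnames (eqs c))"

lemma occ_parts:
  "occ w q (enc_list (\<lambda>x. enc_bits (name x)) (outs c))" "occ w eqs_start (enc_list pnames (eqs c))"
  "occ w atoms_start (enc_list (enc_rgx ltr name) (atoms c))"
  using occ by (auto simp: enc_cq_def eqs_start_def atoms_start_def)

lemma outs_E: "x \<in> set (outs c) \<Longrightarrow> spells w z (name x) \<Longrightarrow> bitsend n w z y \<longleftrightarrow> y = z + length (enc_bits (name x))"
  by (rule bitsend_iff[OF n])

lemma eqs_E: "x \<in> set (eqs c) \<Longrightarrow> occ w z (pnames x) \<Longrightarrow> pairend n w z y \<longleftrightarrow> y = z + length (pnames x)"
  using pairend_iff[of z "name (fst x)" "name (snd x)" y] by (cases x) simp

lemma atoms_E: "x \<in> set (atoms c) \<Longrightarrow> occ w z (enc_rgx ltr name x) \<Longrightarrow> rend n w z y \<longleftrightarrow> y = z + length (enc_rgx ltr name x)"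
  by (rule rend_iff[OF n])

lemmas outs_lend = lend_iff[OF occ_parts(1) outs_E]
  and eqs_lend = lend_iff[OF occ_parts(2) eqs_E]
  and atoms_lend = lend_iff[OF occ_parts(3) atoms_E]

lemma starts_n: "eqs_start < n" "atoms_start < n"
  using occ_length[OF occ_parts(2)] occ_length[OF occ_parts(3)] n by (auto simp: enc_list_def)

lemma cqend_iff: "cqend n w q y \<longleftrightarrow> y = q + length (enc_cq ltr name c)"
proof -
  have "cqend n w q y \<longleftrightarrow> lend n w (rend n w) atoms_start y"
    unfolding cqend_def using outs_lend[folded eqs_start_def] eqs_lend[folded atoms_start_def] starts_n
    by auto
  also have "\<dots> \<longleftrightarrow> y = atoms_start + length (enc_list (enc_rgx ltr name) (atoms c))"
    by (rule atoms_lend)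
  finally show ?thesis
    by (simp add: enc_cq_def eqs_start_def atoms_start_def add.assoc)
qed

definition "eq_pos i = Suc (off pnames eqs_start (eqs c) i)"
definition "atom_pos i = Suc (off (enc_rgx ltr name) atoms_start (atoms c) i)"

lemma eqs_item: "item n w (pairend n w) eqs_start i x \<longleftrightarrow> i < length (eqs c) \<and> x = eq_pos i"
  unfolding eq_pos_def by (rule item_iff[OF occ_parts(2) eqs_E])

lemma atoms_item: "item n w (rend n w) atoms_start i x \<longleftrightarrow> i < length (atoms c) \<and> x = atom_pos i"
  unfolding atom_pos_def by (rule item_iff[OF occ_parts(3) atoms_E])

lemma lengths_n: "length (outs c) < n" "length (eqs c) < n" "length (atoms c) < n"
  using off_bound[OF occ_parts(1), of "length (outs c)"] off_bound[OF occ_parts(2), of "length (eqs c)"]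
    off_bound[OF occ_parts(3), of "length (atoms c)"] n by auto

lemma eqpair_iff: "eqpair n w q x \<longleftrightarrow> (\<exists>i<length (eqs c). x = eq_pos i)"
proof -
  have "eqpair n w q x \<longleftrightarrow> (\<exists>i<n. item n w (pairend n w) eqs_start i x)"
    unfolding eqpair_def using outs_lend[folded eqs_start_def] starts_n by auto
  then show ?thesis
    using lengths_n by (auto simp: eqs_item)
qed

lemma atom_iff: "atom n w q x \<longleftrightarrow> (\<exists>i<length (atoms c). x = atom_pos i)"
proof -
  have "atom n w q x \<longleftrightarrow> (\<exists>i<n. item n w (rend n w) atoms_start i x)"
    unfolding atom_def using outs_lend[folded eqs_start_def] eqs_lend[folded atoms_start_def] starts_n by auto
  then show ?thesis
    using lengths_n by (auto simp: atoms_item)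
qed

lemma eq_pos_occ: "i < length (eqs c) \<Longrightarrow> eqs c ! i = (x, y) \<Longrightarrow> occ w (eq_pos i) (enc_bits (name x) @ enc_bits (name y))"
  using occ_enc_list(2)[OF occ_parts(2)] by (fastforce simp: eq_pos_def)

lemma atom_pos_occ: "i < length (atoms c) \<Longrightarrow> occ w (atom_pos i) (enc_rgx ltr name (atoms c ! i))"
  using occ_enc_list(2)[OF occ_parts(3)] by (simp add: atom_pos_def)

lemma atom_pos_inj: "i < length (atoms c) \<Longrightarrow> j < length (atoms c) \<Longrightarrow> atom_pos i = atom_pos j \<Longrightarrow> i = j"
  by (auto simp: atom_pos_def dest: off_inj)

lemma atom_pos_n: "i < length (atoms c) \<Longrightarrow> atom_pos i < n"
  using off_bound[OF occ_parts(3), of i] n by (simp add: atom_pos_def)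

lemma eq_pos_n: "i < length (eqs c) \<Longrightarrow> eq_pos i < n"
  using off_bound[OF occ_parts(2), of i] n by (simp add: eq_pos_def)

definition "out_pos i = Suc (off (\<lambda>x. enc_bits (name x)) q (outs c) i)"

lemma out_item_iff: "item n w (bitsend n w) q i x \<longleftrightarrow> i < length (outs c) \<and> x = out_pos i"
  unfolding out_pos_def by (rule item_iff[OF occ_parts(1) outs_E])

lemma out_pos_occ: "i < length (outs c) \<Longrightarrow> spells w (out_pos i) (name (outs c ! i))"
  using occ_enc_list(2)[OF occ_parts(1)] by (simp add: out_pos_def)

lemma out_pos_n: "i < length (outs c) \<Longrightarrow> out_pos i < n"
  using off_bound[OF occ_parts(1), of i] n by (simp add: out_pos_def)

text \<open>Every listed variable costs at least a separator and an end marker. Hence all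
  coordinates of a row are elements of the domain.\<close>

lemma outs_length: "2 * length (outs c) < length w"
proof -
  have "2 * length xs \<le> length (concat (map (\<lambda>x. 3 # enc_bits (name x)) xs))" for xs
    by (induction xs) (auto simp: enc_bits_def)
  from this[of "outs c"] show ?thesis
    using occ_length[OF occ_parts(1)] by (simp add: enc_list_def)
qed

end

lemma coord_iff:
  assumes "j < n"
  shows "coord n i f j \<longleftrightarrow> f \<le> 1 \<and> j = 2 * i + f + 1"
proof
  assume "coord n i f j"
  then show "f \<le> 1 \<and> j = 2 * i + f + 1"
    unfolding coord_def by (induction rule: reach3_induct) auto
next
  \<comment> \<open>Coordinate 0 is the dummy, so quotient and remainder of \<open>j\<close> belong
    to coordinate \<open>Suc j\<close>.\<close>
  have "coord n (j div 2) (j mod 2) (Suc j)" if "Suc j < n" for j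
    using that
  proof (induction j)
    case 0
    then show ?case
      unfolding coord_def by (intro reach3_start) auto
  next
    case (Suc j)
    then have "coord n (j div 2) (j mod 2) (Suc j)"
      by simp
    then show ?case
      unfolding coord_def
      by (rule reach3_step) (use Suc.prems in \<open>auto simp: mod_Suc div_Suc mod2_eq_if\<close>)
  qed
  from this[of "j - 1"] show "f \<le> 1 \<and> j = 2 * i + f + 1 \<Longrightarrow> coord n i f j"
    using assms by auto
qed

end


subsection \<open>The encoded input\<close>

locale input =
  fixes ltr :: "'a \<Rightarrow> bool list" and name :: "'v \<Rightarrow> bool list" and Q :: "('a, 'v) ucq" and s :: "'a list"
    and w :: "nat list" and n :: nat
  assumes w: "w = enc_input ltr name Q s" and n: "length w + 12 \<le> n" and ltr: "inj ltr" and name: "inj name"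
begin

definition "str_start = length (enc_list (enc_cq ltr name) Q)"

lemma occ_input: "occ w 0 (enc_list (enc_cq ltr name) Q)" "occ w str_start (enc_list (\<lambda>a. enc_bits (ltr a)) s)"
  using occ_whole[of "[]" w "[]"] by (auto simp: w enc_input_def str_start_def)

lemma cqs_E: "c \<in> set Q \<Longrightarrow> occ w z (enc_cq ltr name c) \<Longrightarrow> cqend n w z y \<longleftrightarrow> y = z + length (enc_cq ltr name c)"
  by (rule cqend_iff[OF n])

lemma str_E: "a \<in> set s \<Longrightarrow> spells w z (ltr a) \<Longrightarrow> bitsend n w z y \<longleftrightarrow> y = z + length (enc_bits (ltr a))"
  by (rule bitsend_iff[OF n])

lemma str_start_n: "str_start < n"
  using occ_length[OF occ_input(2)] n by (simp add: enc_list_def)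

lemma disjunct_iff: "disjunct n w q \<longleftrightarrow> (\<exists>i<length Q. q = Suc (off (enc_cq ltr name) 0 Q i))"
  unfolding disjunct_def
  using item_iff[OF n occ_input(1) cqs_E] item_bound[OF n occ_input(1) cqs_E] n by auto

lemma disjunct_occ:
  "disjunct n w q \<Longrightarrow> \<exists>c\<in>set Q. occ w q (enc_cq ltr name c)"
  "c \<in> set Q \<Longrightarrow> \<exists>q<n. disjunct n w q \<and> occ w q (enc_cq ltr name c)"
proof -
  show "disjunct n w q \<Longrightarrow> \<exists>c\<in>set Q. occ w q (enc_cq ltr name c)"
    using occ_enc_list(2)[OF occ_input(1)] nth_mem by (fastforce simp: disjunct_iff)
  assume "c \<in> set Q"
  then obtain i where i: "i < length Q" "c = Q ! i"
    by (auto simp: in_set_conv_nth)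
  then show "\<exists>q<n. disjunct n w q \<and> occ w q (enc_cq ltr name c)"
    using occ_enc_list(2)[OF occ_input(1) i(1)] off_bound[OF occ_input(1), of i] n
    by (intro exI[of _ "Suc (off (enc_cq ltr name) 0 Q i)"]) (auto simp: disjunct_iff)
qed

definition "let_pos i = Suc (off (\<lambda>a. enc_bits (ltr a)) str_start s i)"

lemma letter_iff: "letter n w i x \<longleftrightarrow> i < length s \<and> x = let_pos i"
proof -
  have "lend n w (cqend n w) 0 y \<longleftrightarrow> y = str_start" for y
    using lend_iff[OF n occ_input(1) cqs_E] by (simp add: str_start_def)
  then have "letter n w i x \<longleftrightarrow> item n w (bitsend n w) str_start i x"
    unfolding letter_def using str_start_n by auto
  then show ?thesis
    using item_iff[OF n occ_input(2) str_E] by (simp add: let_pos_def)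
qed

lemma strend_iff: "strend n w i \<longleftrightarrow> i = length s"
proof -
  have "lend n w (cqend n w) 0 y \<longleftrightarrow> y = str_start" for y
    using lend_iff[OF n occ_input(1) cqs_E] by (simp add: str_start_def)
  then have "strend n w i \<longleftrightarrow> (\<exists>x<n. icell n w (bitsend n w) str_start i x \<and> W w x 4)"
    unfolding strend_def using str_start_n by auto
  also have "\<dots> \<longleftrightarrow> i = length s"
    using icell_iff[OF n occ_input(2) str_E] off_bound[OF occ_input(2), of "length s"] n
      occ_enc_list(1)[OF occ_input(2), of i] occ_enc_list(3)[OF occ_input(2)]
    by (cases "i < length s") (auto simp: W_def)
  finally show ?thesis .
qed

lemma let_pos_occ: "i < length s \<Longrightarrow> spells w (let_pos i) (ltr (s ! i))"
  using occ_enc_list(2)[OF occ_input(2)] by (simp add: let_pos_def)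

lemma let_pos_n: "i < length s \<Longrightarrow> let_pos i < n" "length s < length w"
  using off_bound[OF occ_input(2), of i] off_bound[OF occ_input(2), of "length s"] n by (auto simp: let_pos_def)

lemma nameq_letters: "i < length s \<Longrightarrow> j < length s \<Longrightarrow> nameq n w (let_pos i) (let_pos j) \<longleftrightarrow> s ! i = s ! j"
  using nameq_iff[OF n let_pos_occ[of i]] let_pos_occ[of j] spells_unique ltr by (metis injD)

lemma outvar_iff:
  "\<exists>h. (\<forall>j<n. \<forall>f x. outvar n w j f x \<longleftrightarrow> (\<exists>i<length (header Q). f \<le> 1 \<and> j = 2 * i + f + 1 \<and> x = h i)) \<and>
    (\<forall>i<length (header Q). spells w (h i) (name (header Q ! i)) \<and> h i < n)"
  and header_length: "2 * length (header Q) < length w"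
proof -
  have "0 < n" "1 < n"
    using n by auto
  have *: "(\<exists>h. (\<forall>j<n. \<forall>f x. outvar n w j f x \<longleftrightarrow> (\<exists>i<length (header Q). f \<le> 1 \<and> j = 2 * i + f + 1 \<and> x = h i)) \<and>
    (\<forall>i<length (header Q). spells w (h i) (name (header Q ! i)) \<and> h i < n)) \<and> 2 * length (header Q) < length w"
  proof (cases Q)
    case Nil
    \<comment> \<open>Without disjuncts the input starts with the terminator, so the test for a
      separator in \<open>outvar\<close> fails, in accordance with the empty header.\<close>
    then have "W w 0 4"
      using occ_input(1) by (simp add: enc_list_def)
    then show ?thesis
      unfolding outvar_def using Nil by (auto simp: W_def)
  next
    case (Cons c cs)
    then have c: "W w 0 3" "occ w 1 (enc_cq ltr name c)"
      using occ_input(1) by (auto simp: enc_list_def)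
    have "outvar n w j f x \<longleftrightarrow> (\<exists>i<length (outs c). f \<le> 1 \<and> j = 2 * i + f + 1 \<and> x = out_pos name 1 c i)"
      if j: "j < n" for j f x
    proof -
      have "outvar n w j f x \<longleftrightarrow> (\<exists>i<n. coord n i f j \<and> item n w (bitsend n w) 1 i x)"
        unfolding outvar_def using c(1) \<open>0 < n\<close> \<open>1 < n\<close> by auto
      then show ?thesis
        unfolding coord_iff[OF n j] out_item_iff[OF n c(2)]
        using outs_length[OF n c(2)] n by auto
    qed
    then show ?thesis
      using Cons out_pos_occ[OF n c(2)] out_pos_n[OF n c(2)] outs_length[OF n c(2)]
      by (intro conjI exI[of _ "out_pos name 1 c"]) auto
  qed
  from * show "\<exists>h. (\<forall>j<n. \<forall>f x. outvar n w j f x \<longleftrightarrow> (\<exists>i<length (header Q). f \<le> 1 \<and> j = 2 * i + f + 1 \<and> x = h i)) \<and>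
    (\<forall>i<length (header Q). spells w (h i) (name (header Q ! i)) \<and> h i < n)"
    by (rule conjunct1)
  from * show "2 * length (header Q) < length w"
    by (rule conjunct2)
qed

lemma length_subword: "1 \<le> b \<Longrightarrow> b \<le> c \<Longrightarrow> c \<le> length s + 1 \<Longrightarrow> length (subword s (b, c)) = c - b"
  by (auto simp: subword_def)

lemma nth_subword: "1 \<le> b \<Longrightarrow> c \<le> length s + 1 \<Longrightarrow> i < c - b \<Longrightarrow> subword s (b, c) ! i = s ! (b - 1 + i)"
  by (auto simp: subword_def)

text \<open>Two pointers start at \<open>b\<close> and \<open>b'\<close> and move over equal
  letters; arriving at \<open>c\<close> and \<open>c'\<close> together also forces equal
  lengths.\<close>

lemma subeq_iff:
  assumes "is_span s (b, c)" "is_span s (b', c')"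
  shows "subeq n w b c b' c' \<longleftrightarrow> subword s (b, c) = subword s (b', c')"
proof -
  have sp: "1 \<le> b" "b \<le> c" "c \<le> length s + 1" "1 \<le> b'" "b' \<le> c'" "c' \<le> length s + 1"
    using assms by (auto simp: is_span_def)
  let ?I = "\<lambda>u u'. u = b \<and> u' = b'"
  let ?R = "\<lambda>u u' v v'. v = Suc u \<and> v' = Suc u' \<and> (\<exists>i<n. \<exists>i'<n. u = Suc i \<and> u' = Suc i' \<and>
        (\<exists>x<n. \<exists>x'<n. letter n w i x \<and> letter n w i' x' \<and> nameq n w x x'))"
  have R: "?R u u' v v' \<longleftrightarrow> v = Suc u \<and> v' = Suc u' \<and> 1 \<le> u \<and> 1 \<le> u' \<and> u \<le> length s \<and> u' \<le> length s \<and>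
      s ! (u - 1) = s ! (u' - 1)" for u u' v v'
  proof
    assume "?R u u' v v'"
    then show "v = Suc u \<and> v' = Suc u' \<and> 1 \<le> u \<and> 1 \<le> u' \<and> u \<le> length s \<and> u' \<le> length s \<and>
      s ! (u - 1) = s ! (u' - 1)"
      by (auto simp: letter_iff nameq_letters)
  next
    assume "v = Suc u \<and> v' = Suc u' \<and> 1 \<le> u \<and> 1 \<le> u' \<and> u \<le> length s \<and> u' \<le> length s \<and>
      s ! (u - 1) = s ! (u' - 1)"
    then show "?R u u' v v'"
      using let_pos_n n
      by (intro conjI exI[of _ "u - 1"] exI[of _ "u' - 1"] exI[of _ "let_pos (u - 1)"] exI[of _ "let_pos (u' - 1)"])
        (auto simp: letter_iff nameq_letters)
  qed
  have 1: "\<exists>d. u = b + d \<and> u' = b' + d \<and> (\<forall>i<d. s ! (b - 1 + i) = s ! (b' - 1 + i))" if "reach2 n ?I ?R u u'" for u u'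
    using that
  proof (induction rule: reach2_induct)
    case (step u u' v v')
    then obtain d where d: "u = b + d" "u' = b' + d" "\<forall>i<d. s ! (b - 1 + i) = s ! (b' - 1 + i)" by blast
    show ?case
      by (rule exI[of _ "Suc d"]) (use step.hyps(2) d sp in \<open>auto simp: R less_Suc_eq\<close>)
  qed auto
  have length_s: "length s < length w"
    using off_bound[OF occ_input(2), of "length s"] by simp
  have 2: "reach2 n ?I ?R (b + d) (b' + d)"
    if "d \<le> c - b" "d \<le> c' - b'" "\<forall>i<d. s ! (b - 1 + i) = s ! (b' - 1 + i)" for d
    using that
  proof (induction d)
    case 0
    then show ?case using sp n length_s by (intro reach2_start) auto
  next
    case (Suc d)
    then have IH: "reach2 n ?I ?R (b + d) (b' + d)"
      by simp
    have "?R (b + d) (b' + d) (b + Suc d) (b' + Suc d)"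
      unfolding R using Suc.prems sp by auto
    moreover have "b + Suc d < n" "b' + Suc d < n"
      using Suc.prems sp n length_s by auto
    ultimately show ?case
      by (rule reach2_step[OF IH])
  qed
  show ?thesis
  proof
    assume "subeq n w b c b' c'"
    then obtain d where d: "c = b + d" "c' = b' + d" "\<forall>i<d. s ! (b - 1 + i) = s ! (b' - 1 + i)"
      using 1 unfolding subeq_def by blast
    show "subword s (b, c) = subword s (b', c')"
    proof (rule nth_equalityI)
      show "length (subword s (b, c)) = length (subword s (b', c'))"
        using length_subword[OF sp(1-3)] length_subword[OF sp(4-6)] d by simp
      fix i assume "i < length (subword s (b, c))"
      then have i: "i < d"
        using length_subword[OF sp(1-3)] d by simp
      then show "subword s (b, c) ! i = subword s (b', c') ! i"
        using nth_subword[OF sp(1,3)] nth_subword[OF sp(4,6)] d by simp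
    qed
  next
    assume eq: "subword s (b, c) = subword s (b', c')"
    then have len: "c - b = c' - b'"
      using length_subword[OF sp(1-3)] length_subword[OF sp(4-6)] by simp
    have "\<forall>i<c - b. s ! (b - 1 + i) = s ! (b' - 1 + i)"
      using eq nth_subword[OF sp(1,3)] nth_subword[OF sp(4,6)] len by metis
    moreover have "b + (c - b) = c" "b' + (c - b) = c'"
      using len sp by auto
    ultimately show "subeq n w b c b' c'"
      using 2[of "c - b"] len unfolding subeq_def by simp
  qed
qed

end

section \<open>Product runs correspond to answers with a prescribed prefix\<close>

section \<open>Correctness of the extension predicate\<close>

text \<open>This disposes of dummy blocks: a comparison succeeds only where a bit or an end marker
  stands, whereas position 0 of the input holds a list token.\<close>

lemma nameq_head: "nameq n w p x \<Longrightarrow> W w p 0 \<or> W w p 1 \<or> W w p 2"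
proof -
  assume "nameq n w p x"
  then obtain a b where ab: "W w a 2" "reach2 n (\<lambda>a b. a = p \<and> b = x)
       (\<lambda>a b a' b'. (W w a 0 \<and> W w b 0 \<or> W w a 1 \<and> W w b 1) \<and> a' = Suc a \<and> b' = Suc b) a b"
    unfolding nameq_def by blast
  from ab(2) have "a = p \<or> W w p 0 \<or> W w p 1"
    by (induction rule: reach2_induct) auto
  then show ?thesis
    using ab(1) by auto
qed

lemma bitsend_head: "bitsend n w p y \<Longrightarrow> p < n \<Longrightarrow> W w p 0 \<or> W w p 1 \<or> W w p 2"
  unfolding bitsend_def by (metis le_neq_implies_less order_refl)

text \<open>As coordinate 0 counts the steps, a reachable tuple knows the length of its path, and
  the path can be indexed by time.\<close>

lemma reach_counter:
  assumes r: "0 < r"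
    and I: "\<And>xs. I xs \<Longrightarrow> xs ! 0 = 0" and R: "\<And>ys xs. R ys xs \<Longrightarrow> xs ! 0 = Suc (ys ! 0)"
  shows "reach n r I R xs \<longleftrightarrow> (\<exists>\<Sigma>. \<Sigma> (xs ! 0) = xs \<and> I (\<Sigma> 0) \<and>
     (\<forall>t\<le>xs ! 0. ok n r (\<Sigma> t) \<and> \<Sigma> t ! 0 = t) \<and> (\<forall>t<xs ! 0. R (\<Sigma> t) (\<Sigma> (Suc t))))"
proof
  assume "reach n r I R xs"
  then show "\<exists>\<Sigma>. \<Sigma> (xs ! 0) = xs \<and> I (\<Sigma> 0) \<and>
     (\<forall>t\<le>xs ! 0. ok n r (\<Sigma> t) \<and> \<Sigma> t ! 0 = t) \<and> (\<forall>t<xs ! 0. R (\<Sigma> t) (\<Sigma> (Suc t)))"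
  proof induction
    case (start xs)
    then show ?case
      using I[of xs] by (intro exI[of _ "\<lambda>_. xs"]) auto
  next
    case (step ys xs)
    then obtain \<Sigma> where \<Sigma>: "\<Sigma> (ys ! 0) = ys" "I (\<Sigma> 0)"
      "\<forall>t\<le>ys ! 0. ok n r (\<Sigma> t) \<and> \<Sigma> t ! 0 = t" "\<forall>t<ys ! 0. R (\<Sigma> t) (\<Sigma> (Suc t))"
      by blast
    have xs0: "xs ! 0 = Suc (ys ! 0)"
      using R step.hyps(2) by blast
    show ?case
      unfolding xs0
      by (intro exI[of _ "\<Sigma>(Suc (ys ! 0) := xs)"])
        (use \<Sigma> step.hyps xs0 in \<open>auto simp: le_Suc_eq less_Suc_eq\<close>)
  qed
next
  assume "\<exists>\<Sigma>. \<Sigma> (xs ! 0) = xs \<and> I (\<Sigma> 0) \<and>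
     (\<forall>t\<le>xs ! 0. ok n r (\<Sigma> t) \<and> \<Sigma> t ! 0 = t) \<and> (\<forall>t<xs ! 0. R (\<Sigma> t) (\<Sigma> (Suc t)))"
  then obtain \<Sigma> where \<Sigma>: "\<Sigma> (xs ! 0) = xs" "I (\<Sigma> 0)"
    "\<And>t. t \<le> xs ! 0 \<Longrightarrow> ok n r (\<Sigma> t) \<and> \<Sigma> t ! 0 = t" "\<And>t. t < xs ! 0 \<Longrightarrow> R (\<Sigma> t) (\<Sigma> (Suc t))"
    by blast
  have "reach n r I R (\<Sigma> t)" if "t \<le> xs ! 0" for t
    using that
  proof (induction t)
    case 0
    then show ?case
      using \<Sigma> by (intro reach.start) auto
  next
    case (Suc t)
    then have "reach n r I R (\<Sigma> t)" "R (\<Sigma> t) (\<Sigma> (Suc t))"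
      using \<Sigma>(4)[of t] by auto
    then show ?case
      by (rule reach.step) (use \<Sigma>(3)[of "Suc t"] Suc.prems in simp)
  qed
  then show "reach n r I R xs"
    using \<Sigma>(1) by (metis order_refl)
qed

text \<open>If the numbers differ, \<open>t = min a b - 1\<close> tells them apart. Positivity makes
  this subtraction exact, and as one of the numbers is at most \<open>l + 1\<close>, this
  \<open>t\<close> is in range.\<close>

lemma thresholds_eq:
  assumes "\<forall>t\<le>l. (a \<le> t + 1) = (b \<le> t + 1)" "1 \<le> a" "1 \<le> b" "a \<le> l + 1 \<or> b \<le> l + 1"
  shows "a = (b :: nat)"
proof (rule ccontr)
  assume "a \<noteq> b"
  then have "min a b - 1 \<le> l" "(a \<le> min a b - 1 + 1) \<noteq> (b \<le> min a b - 1 + 1)"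
    using assms(2,3,4) by auto
  then show False
    using assms(1) by blast
qed

definition solution :: "('a, 'v) cq \<Rightarrow> 'a list \<Rightarrow> ('v \<rightharpoonup> span) \<Rightarrow> bool" where
  "solution c s \<mu> \<longleftrightarrow> is_tuple (vars_cq c) s \<mu> \<and> (\<forall>\<alpha>\<in>set (atoms c). \<mu> |` vars \<alpha> \<in> sem_rgx \<alpha> s) \<and>
     (\<forall>(x, y)\<in>set (eqs c). subword s (the (\<mu> x)) = subword s (the (\<mu> y)))"

definition agrees :: "'v list \<Rightarrow> (nat \<Rightarrow> nat) \<Rightarrow> nat \<Rightarrow> nat \<Rightarrow> ('v \<rightharpoonup> span) \<Rightarrow> bool" where
  "agrees hs A j v \<mu> \<longleftrightarrow> (\<forall>i<length hs. \<forall>f\<le>1. 2 * i + f + 1 \<le> j \<longrightarrow>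
     endp f (the (\<mu> (hs ! i))) = (if 2 * i + f + 1 = j then v else A (2 * i + f + 1)))"

lemma is_tuple_defined: "is_tuple U s \<mu> \<Longrightarrow> y \<in> U \<Longrightarrow> \<mu> y \<noteq> None"
  by (metis domIff is_tuple_def)

lemma is_tuple_endp:
  assumes "is_tuple U s \<mu>" "y \<in> U"
  shows "1 \<le> endp f (the (\<mu> y))" "endp f (the (\<mu> y)) \<le> length s + 1" "is_span s (the (\<mu> y))"
proof -
  obtain sp where sp: "\<mu> y = Some sp"
    using assms by (auto simp: is_tuple_def)
  then have "is_span s sp"
    using assms(1) ranI[of \<mu> y sp] by (simp add: is_tuple_def)
  then show "1 \<le> endp f (the (\<mu> y))" "endp f (the (\<mu> y)) \<le> length s + 1" "is_span s (the (\<mu> y))"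
    using sp by (auto simp: is_span_def endp_def)
qed

context input
begin

context
  fixes k m :: nat and A :: "nat \<Rightarrow> nat" and j v :: nat and c :: "('a, 'v) cq" and q :: nat
  assumes q: "occ w q (enc_cq ltr name c)"
    and fn: "\<And>\<alpha>. \<alpha> \<in> set (atoms c) \<Longrightarrow> functional \<alpha>"
    and bnd: "j < n" "v < n" "\<And>i. i < n \<Longrightarrow> A i < n"
begin

text \<open>The product falls apart into \<open>k\<close> separate runs over a common clock, linked
  by \<open>cons\<close> alone.\<close>

lemma prod_reach_runs:
  assumes as: "\<And>i. i < k \<Longrightarrow> occ w (as ! i) (enc_rgx ltr name (\<alpha> i)) \<and> as ! i < n"
  shows "(\<exists>ys. ok n (2 * k + 1) ys \<and> prod_reach n w A k m j v as us ys \<and>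
             ys ! 0 = length s \<and> (\<forall>i<k. ys ! (2 * i + 1) = as ! i \<and> ys ! (2 * i + 2) = 1)) \<longleftrightarrow>
    (\<exists>\<Sigma>. (\<forall>t\<le>length s. ok n (2 * k + 1) (\<Sigma> t) \<and> \<Sigma> t ! 0 = t \<and> cons n w A k m j v as us (\<Sigma> t)) \<and>
      (\<forall>i<k. atom_run ltr name (\<alpha> i) (as ! i) s (\<lambda>t. (\<Sigma> t ! (2 * i + 1), \<Sigma> t ! (2 * i + 2)))))"
proof -
  let ?I = "\<lambda>xs. xs ! 0 = 0 \<and> cons n w A k m j v as us xs \<and>
        (\<forall>i<k. \<exists>z<n. z = 0 \<and> seg n w (as ! i) (as ! i) z (xs ! (2 * i + 1)) (xs ! (2 * i + 2)))"
  let ?R = "\<lambda>ys xs. xs ! 0 = Suc (ys ! 0) \<and> cons n w A k m j v as us xs \<and>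
        (\<forall>i<k. nxt n w (as ! i) (ys ! 0) (ys ! (2 * i + 1)) (ys ! (2 * i + 2)) (xs ! (2 * i + 1)) (xs ! (2 * i + 2)))"
  let ?st = "\<lambda>\<Sigma> i t. (\<Sigma> t ! (2 * i + 1), \<Sigma> t ! (2 * i + 2))"
  let ?T = "\<lambda>i. delta ltr name (\<alpha> i) (as ! i)"
  have n0: "0 < n"
    using n by simp
  have segI: "(\<exists>z<n. z = 0 \<and> seg n w (as ! i) (as ! i) z b g) \<longleftrightarrow> sil (?T i) (as ! i, 0) (b, g)" if "i < k" for i b g
    using seg_iff[OF n, of "as ! i" ltr name "\<alpha> i" "as ! i" 0 b g] as[OF that] n0 by auto
  have nxt: "nxt n w (as ! i) t b g b' g' \<longleftrightarrow>
     (\<exists>p. ((b, g), [Letter (s ! t)], p) \<in> ?T i \<and> sil (?T i) p (b', g'))" if "i < k" "t < length s" for i t b g b' g'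
  proof -
    have o: "occ w (as ! i) (enc_rgx ltr name (\<alpha> i))"
      using as[OF that(1)] by simp
    have "nxt n w (as ! i) t b g b' g' \<longleftrightarrow>
      (\<exists>b1<n. \<exists>g1<n. step_let n w (as ! i) (let_pos t) b g b1 g1 \<and> seg n w (as ! i) b1 g1 b' g')"
      unfolding nxt_def letter_iff using that(2) let_pos_n(1) by auto
    also have "\<dots> \<longleftrightarrow> (\<exists>b1<n. \<exists>g1<n. ((b, g), [Letter (s ! t)], (b1, g1)) \<in> ?T i \<and> sil (?T i) (b1, g1) (b', g'))"
      using step_let_iff[OF n o ltr let_pos_occ[OF that(2)]] seg_iff[OF n o] by blast
    also have "\<dots> \<longleftrightarrow> (\<exists>b1 g1. ((b, g), [Letter (s ! t)], (b1, g1)) \<in> ?T i \<and> sil (?T i) (b1, g1) (b', g'))"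
    proof -
      have "b1 < n \<and> g1 < n" if "((b, g), [Letter (s ! t)], (b1, g1)) \<in> ?T i" for b1 g1
        using delta_n[OF n o that] n by auto
      then show ?thesis by blast
    qed
    finally show ?thesis by simp
  qed
  have cnt: "prod_reach n w A k m j v as us xs \<longleftrightarrow> (\<exists>\<Sigma>. \<Sigma> (xs ! 0) = xs \<and> ?I (\<Sigma> 0) \<and>
     (\<forall>t\<le>xs ! 0. ok n (2 * k + 1) (\<Sigma> t) \<and> \<Sigma> t ! 0 = t) \<and> (\<forall>t<xs ! 0. ?R (\<Sigma> t) (\<Sigma> (Suc t))))" for xs
    unfolding prod_reach_def by (rule reach_counter) auto
  show ?thesis
  proof
    assume "\<exists>ys. ok n (2 * k + 1) ys \<and> prod_reach n w A k m j v as us ys \<and>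
             ys ! 0 = length s \<and> (\<forall>i<k. ys ! (2 * i + 1) = as ! i \<and> ys ! (2 * i + 2) = 1)"
    then obtain ys where ys: "\<forall>i<k. ys ! (2 * i + 1) = as ! i \<and> ys ! (2 * i + 2) = 1"
      "prod_reach n w A k m j v as us ys" "ys ! 0 = length s"
      by (elim exE conjE)
    obtain \<Sigma> where \<Sigma>: "\<Sigma> (length s) = ys" "?I (\<Sigma> 0)" "\<And>t. t \<le> length s \<Longrightarrow> ok n (2 * k + 1) (\<Sigma> t) \<and> \<Sigma> t ! 0 = t"
        "\<And>t. t < length s \<Longrightarrow> ?R (\<Sigma> t) (\<Sigma> (Suc t))"
      using iffD1[OF cnt ys(2)] unfolding ys(3) by (elim exE conjE) simp
    have "cons n w A k m j v as us (\<Sigma> t)" if "t \<le> length s" for t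
      using \<Sigma>(2,4) that by (cases t) auto
    moreover have "atom_run ltr name (\<alpha> i) (as ! i) s (?st \<Sigma> i)" if i: "i < k" for i
      unfolding rn_def
    proof (intro conjI allI impI)
      show "sil (?T i) (as ! i, 0) (?st \<Sigma> i 0)"
        using \<Sigma>(2) segI[OF i] i by blast
      show "?st \<Sigma> i (length s) = (as ! i, 1)"
        using ys \<Sigma>(1) i by simp
      fix t assume t: "t < length s"
      then have "nxt n w (as ! i) (\<Sigma> t ! 0) (\<Sigma> t ! (2 * i + 1)) (\<Sigma> t ! (2 * i + 2))
          (\<Sigma> (Suc t) ! (2 * i + 1)) (\<Sigma> (Suc t) ! (2 * i + 2))"
        using \<Sigma>(4) i by blast
      then show "\<exists>q. (?st \<Sigma> i t, [Letter (s ! t)], q) \<in> ?T i \<and> sil (?T i) q (?st \<Sigma> i (Suc t))"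
        using nxt[OF i t] \<Sigma>(3)[of t] t by simp
    qed
    ultimately show "\<exists>\<Sigma>. (\<forall>t\<le>length s. ok n (2 * k + 1) (\<Sigma> t) \<and> \<Sigma> t ! 0 = t \<and> cons n w A k m j v as us (\<Sigma> t)) \<and>
      (\<forall>i<k. atom_run ltr name (\<alpha> i) (as ! i) s (?st \<Sigma> i))"
      using \<Sigma>(3) by blast
  next
    assume "\<exists>\<Sigma>. (\<forall>t\<le>length s. ok n (2 * k + 1) (\<Sigma> t) \<and> \<Sigma> t ! 0 = t \<and> cons n w A k m j v as us (\<Sigma> t)) \<and>
      (\<forall>i<k. atom_run ltr name (\<alpha> i) (as ! i) s (?st \<Sigma> i))"
    then obtain \<Sigma> where \<Sigma>: "\<And>t. t \<le> length s \<Longrightarrow> ok n (2 * k + 1) (\<Sigma> t) \<and> \<Sigma> t ! 0 = t \<and> cons n w A k m j v as us (\<Sigma> t)"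
      "\<And>i. i < k \<Longrightarrow> atom_run ltr name (\<alpha> i) (as ! i) s (?st \<Sigma> i)"
      by blast
    have I: "?I (\<Sigma> 0)"
      using \<Sigma> segI unfolding rn_def by simp
    have R: "?R (\<Sigma> t) (\<Sigma> (Suc t))" if t: "t < length s" for t
    proof (intro conjI allI impI)
      show "\<Sigma> (Suc t) ! 0 = Suc (\<Sigma> t ! 0)" "cons n w A k m j v as us (\<Sigma> (Suc t))"
        using \<Sigma>(1)[of t] \<Sigma>(1)[of "Suc t"] t by auto
      fix i assume i: "i < k"
      then show "nxt n w (as ! i) (\<Sigma> t ! 0) (\<Sigma> t ! (2 * i + 1)) (\<Sigma> t ! (2 * i + 2))
          (\<Sigma> (Suc t) ! (2 * i + 1)) (\<Sigma> (Suc t) ! (2 * i + 2))"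
        using nxt[OF i t] \<Sigma>(1)[of t] \<Sigma>(2)[OF i] t unfolding rn_def by simp
    qed
    have "\<Sigma> (length s) ! (2 * i + 1) = as ! i \<and> \<Sigma> (length s) ! (2 * i + 2) = 1" if "i < k" for i
      using \<Sigma>(2)[OF that] unfolding rn_def by simp
    moreover have "prod_reach n w A k m j v as us (\<Sigma> (length s))"
      unfolding cnt using \<Sigma>(1) I R by (intro exI[of _ \<Sigma>]) auto
    ultimately show "\<exists>ys. ok n (2 * k + 1) ys \<and> prod_reach n w A k m j v as us ys \<and>
             ys ! 0 = length s \<and> (\<forall>i<k. ys ! (2 * i + 1) = as ! i \<and> ys ! (2 * i + 2) = 1)"
      using \<Sigma>(1) by (intro exI[of _ "\<Sigma> (length s)"]) auto
  qed
qed

lemma want_coord: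
  assumes y: "spells w x (name y)" and i: "i < length (header Q)" "header Q ! i = y" and f: "f \<le> 1"
    and le: "2 * i + f + 1 \<le> j"
  shows "want n w A m j v us f x (if 2 * i + f + 1 = j then v else A (2 * i + f + 1))"
proof -
  obtain h where h: "\<And>j f x. j < n \<Longrightarrow> outvar n w j f x \<longleftrightarrow> (\<exists>i<length (header Q). f \<le> 1 \<and> j = 2 * i + f + 1 \<and> x = h i)"
    "\<And>i. i < length (header Q) \<Longrightarrow> spells w (h i) (name (header Q ! i)) \<and> h i < n"
    using outvar_iff by metis
  have "outvar n w (2 * i + f + 1) f (h i)"
    using h(1) i f le bnd(1) by auto
  moreover have "nameq n w (h i) x"
    using h(2)[OF i(1)] y nameq_iff[OF n] i(2) by blast
  ultimately show ?thesis
    unfolding want_def using h(2)[OF i(1)] le bnd(1)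
    by (intro disjI1 exI[of _ "2 * i + f + 1"] exI[of _ "h i"]) auto
qed

lemma spells_name: "spells w x (name y) \<Longrightarrow> spells w x (name z) \<Longrightarrow> y = z"
  using spells_unique name by (metis injD)

lemma want_cases:
  assumes "want n w A m j v us f x u" "spells w x (name y)" "f \<le> 1"
  obtains i where "i < length (header Q)" "header Q ! i = y" "2 * i + f + 1 \<le> j"
      "u = (if 2 * i + f + 1 = j then v else A (2 * i + f + 1))"
  | i where "i < m" "nameq n w (us ! (5 * i)) x" "u = us ! (5 * i + 1 + f)"
  | i z where "i < m" "bitsend n w (us ! (5 * i)) z" "nameq n w z x" "u = us ! (5 * i + 3 + f)"
proof -
  obtain h where h: "\<And>j f x. j < n \<Longrightarrow> outvar n w j f x \<longleftrightarrow> (\<exists>i<length (header Q). f \<le> 1 \<and> j = 2 * i + f + 1 \<and> x = h i)"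
    "\<And>i. i < length (header Q) \<Longrightarrow> spells w (h i) (name (header Q ! i)) \<and> h i < n"
    using outvar_iff by metis
  from assms(1) consider j' x' where "j' < n" "outvar n w j' f x'" "nameq n w x' x" "j' = j \<and> u = v \<or> j' < j \<and> u = A j'"
    | i where "i < m" "nameq n w (us ! (5 * i)) x" "f = 0 \<and> u = us ! (5 * i + 1) \<or> f = 1 \<and> u = us ! (5 * i + 2)"
    | i z where "i < m" "bitsend n w (us ! (5 * i)) z" "nameq n w z x"
        "f = 0 \<and> u = us ! (5 * i + 3) \<or> f = 1 \<and> u = us ! (5 * i + 4)"
    unfolding want_def by blast
  then show thesis
  proof cases
    case 1
    then obtain i where i: "i < length (header Q)" "j' = 2 * i + f + 1" "x' = h i"
      using h(1) by blast
    then have "header Q ! i = y"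
      using nameq_iff[OF n] h(2)[OF i(1)] 1(3) spells_name[OF _ assms(2)] by blast
    then show thesis
      using that(1)[OF i(1)] 1(4) i(2) by auto
  next
    case 2
    then show thesis
      using that(2)[OF 2(1,2)] by auto
  next
    case 3
    then show thesis
      using that(3)[OF 3(1-3)] by (auto simp: numeral_3_eq_3 eval_nat_numeral)
  qed
qed

text \<open>Each run yields a tuple of its own formula. \<open>cons\<close> compares these at all
  boundaries with each other and with the prescribed endpoints, so by \<open>thresholds_eq\<close>
  they agree on shared variables and glue to one tuple.\<close>

lemma accepted_sound:
  assumes acc: "accepted n w A k m j v q" and hs: "set (header Q) \<subseteq> vars_cq c" and eqs: "\<forall>(x, y)\<in>set (eqs c). x \<in> vars_cq c \<and> y \<in> vars_cq c"
    and pos: "1 \<le> v" "\<And>i. 0 < i \<Longrightarrow> i < j \<Longrightarrow> 1 \<le> A i"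
  shows "\<exists>\<mu>. solution c s \<mu> \<and> agrees (header Q) A j v \<mu>"
proof -
  let ?L = "length s"
  have L: "length s < length w"
    using off_bound[OF occ_input(2), of "length s"] by simp
  obtain as us where as: "ok n k as" "\<And>i. i < k \<Longrightarrow> atom n w q (as ! i)"
      "\<And>a. a < n \<Longrightarrow> atom n w q a \<Longrightarrow> \<exists>i<k. as ! i = a"
    and us: "ok n (5 * m) us"
      "\<And>i. i < m \<Longrightarrow> 1 \<le> us ! (5 * i + 1) \<and> 1 \<le> us ! (5 * i + 2) \<and> 1 \<le> us ! (5 * i + 3) \<and> 1 \<le> us ! (5 * i + 4)"
      "\<And>x. x < n \<Longrightarrow> eqpair n w q x \<Longrightarrow> \<exists>i<m. us ! (5 * i) = x \<and>
             subeq n w (us ! (5 * i + 1)) (us ! (5 * i + 2)) (us ! (5 * i + 3)) (us ! (5 * i + 4))"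
    and run: "\<exists>ys. ok n (2 * k + 1) ys \<and> prod_reach n w A k m j v as us ys \<and>
             ys ! 0 = length s \<and> (\<forall>i<k. ys ! (2 * i + 1) = as ! i \<and> ys ! (2 * i + 2) = 1)"
    using acc unfolding accepted_def strend_iff by blast
  have us_n: "us ! i < n" if "i < 5 * m" for i
    using us(1) that unfolding ok_def by (metis lessThan_iff nth_mem subsetD)
  have "\<forall>i. \<exists>l. i < k \<longrightarrow> l < length (atoms c) \<and> as ! i = atom_pos ltr name q c l"
    using as(2) unfolding atom_iff[OF n q] by blast
  then obtain l where l: "\<And>i. i < k \<Longrightarrow> l i < length (atoms c) \<and> as ! i = atom_pos ltr name q c (l i)"
    by metis
  define \<alpha> where "\<alpha> i = atoms c ! l i" for i
  have \<alpha>: "\<alpha> i \<in> set (atoms c)" "occ w (as ! i) (enc_rgx ltr name (\<alpha> i))" "as ! i < n" if "i < k" for i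
    using l[OF that] atom_pos_occ[OF n q] atom_pos_n[OF n q] by (auto simp: \<alpha>_def)
  \<comment> \<open>The guess must cover the position of every formula of the disjunct, and
    different list indices have different positions.\<close>
  have all: "\<exists>i<k. \<alpha> i = \<beta>" if "\<beta> \<in> set (atoms c)" for \<beta>
  proof -
    obtain b where b: "b < length (atoms c)" "\<beta> = atoms c ! b"
      using \<open>\<beta> \<in> set (atoms c)\<close> by (metis in_set_conv_nth)
    then obtain i where i: "i < k" "as ! i = atom_pos ltr name q c b"
      using as(3)[of "atom_pos ltr name q c b"] atom_pos_n[OF n q b(1)] unfolding atom_iff[OF n q] by blast
    then have "l i = b"
      using atom_pos_inj[OF n q, of "l i" b] l[OF i(1)] b(1) by simp
    then show ?thesis
      using i(1) b(2) by (auto simp: \<alpha>_def)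
  qed
  obtain \<Sigma> where \<Sigma>: "\<And>t. t \<le> ?L \<Longrightarrow> ok n (2 * k + 1) (\<Sigma> t) \<and> \<Sigma> t ! 0 = t \<and> cons n w A k m j v as us (\<Sigma> t)"
    "\<And>i. i < k \<Longrightarrow> atom_run ltr name (\<alpha> i) (as ! i) s (\<lambda>t. (\<Sigma> t ! (2 * i + 1), \<Sigma> t ! (2 * i + 2)))"
    using run prod_reach_runs[of as \<alpha> us] \<alpha> by blast
  have "\<exists>\<nu>. \<nu> \<in> sem_rgx (\<alpha> i) s \<and> is_tuple (vars (\<alpha> i)) s \<nu> \<and> (\<forall>t\<le>?L. \<forall>f. \<forall>x\<in>vars (\<alpha> i).
     sees ltr name (\<alpha> i) (as ! i) (\<Sigma> t ! (2 * i + 1), \<Sigma> t ! (2 * i + 2)) f x \<longleftrightarrow> endp f (the (\<nu> x)) \<le> t + 1)"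
    if "i < k" for i
    using run_sem[OF fn[OF \<alpha>(1)[OF that]] \<Sigma>(2)[OF that]] by blast
  then obtain \<nu> where \<nu>: "\<And>i. i < k \<Longrightarrow> \<nu> i \<in> sem_rgx (\<alpha> i) s" "\<And>i. i < k \<Longrightarrow> is_tuple (vars (\<alpha> i)) s (\<nu> i)"
    "\<And>i t f x. i < k \<Longrightarrow> t \<le> ?L \<Longrightarrow> x \<in> vars (\<alpha> i) \<Longrightarrow>
     sees ltr name (\<alpha> i) (as ! i) (\<Sigma> t ! (2 * i + 1), \<Sigma> t ! (2 * i + 2)) f x \<longleftrightarrow> endp f (the (\<nu> i x)) \<le> t + 1"
    by metis
  \<comment> \<open>The name of \<open>y\<close> is spelled in the formula itself, which provides a
    position to instantiate the quantifiers over \<open>x\<close> in \<open>cons\<close>.\<close>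
  have pos_of: "\<exists>x<n. spells w x (name y) \<and> varin n w (as ! i) x" if iy: "i < k" "y \<in> vars (\<alpha> i)" for i y
  proof -
    obtain p \<gamma> where p: "(p, Bind y \<gamma>) \<in> nodes ltr name (\<alpha> i) (as ! i)"
      using iy(2) vars_nodes[of y "\<alpha> i" ltr name "as ! i"] by blast
    have "W w p 11" "spells w (Suc p) (name y)"
      using nodes_n(2)[OF n \<alpha>(2)[OF iy(1)] p] by auto
    then show ?thesis
      using W_n(2)[OF n] varin_iff[OF n \<alpha>(2)[OF iy(1)]] iy(2) by blast
  qed
  have n1: "f < n" if "f \<le> 1" for f
    using that n by simp
  have seenp: "seenp n w (as ! i) f x b g \<longleftrightarrow> sees ltr name (\<alpha> i) (as ! i) (b, g) f y"
    if "i < k" "spells w x (name y)" "f \<le> 1" for i f x b g y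
    using seenp_iff[OF n \<alpha>(2)[OF that(1)] name that(2,3)] .
  have same: "endp f (the (\<nu> i y)) = endp f (the (\<nu> i' y))"
    if i: "i < k" "i' < k" "y \<in> vars (\<alpha> i)" "y \<in> vars (\<alpha> i')" and f: "f \<le> 1" for i i' y f
  proof -
    obtain x where x: "x < n" "spells w x (name y)" "varin n w (as ! i) x"
      using pos_of[OF i(1,3)] by blast
    have x': "varin n w (as ! i') x"
      using varin_iff[OF n \<alpha>(2)[OF i(2)]] x(2) i(4) by blast
    have "(endp f (the (\<nu> i y)) \<le> t + 1) = (endp f (the (\<nu> i' y)) \<le> t + 1)" if t: "t \<le> ?L" for t
    proof -
      have "seenp n w (as ! i) f x (\<Sigma> t ! (2 * i + 1)) (\<Sigma> t ! (2 * i + 2)) =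
        seenp n w (as ! i') f x (\<Sigma> t ! (2 * i' + 1)) (\<Sigma> t ! (2 * i' + 2))"
        using \<Sigma>(1)[OF t] i(1,2) x x' f n1[OF f] unfolding cons_def by blast
      then show ?thesis
        using seenp[OF i(1) x(2) f] seenp[OF i(2) x(2) f] \<nu>(3)[OF i(1) t i(3)] \<nu>(3)[OF i(2) t i(4)] by simp
    qed
    then show ?thesis
      using is_tuple_endp[OF \<nu>(2)[OF i(1)] i(3)] is_tuple_endp[OF \<nu>(2)[OF i(2)] i(4)]
      by (intro thresholds_eq[of ?L]) auto
  qed
  have wanted: "endp f (the (\<nu> i y)) = u"
    if i: "i < k" "y \<in> vars (\<alpha> i)" and f: "f \<le> 1" and u: "u < n" "1 \<le> u"
      and want: "\<And>x. spells w x (name y) \<Longrightarrow> want n w A m j v us f x u" for i y f u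
  proof -
    obtain x where x: "x < n" "spells w x (name y)" "varin n w (as ! i) x"
      using pos_of[OF i] by blast
    have "(endp f (the (\<nu> i y)) \<le> t + 1) = (u \<le> t + 1)" if t: "t \<le> ?L" for t
    proof -
      have "seenp n w (as ! i) f x (\<Sigma> t ! (2 * i + 1)) (\<Sigma> t ! (2 * i + 2)) = (u \<le> Suc (\<Sigma> t ! 0))"
        using \<Sigma>(1)[OF t] i(1) x f n1[OF f] u(1) want[OF x(2)] unfolding cons_def by blast
      then show ?thesis
        using seenp[OF i(1) x(2) f] \<nu>(3)[OF i(1) t i(2)] \<Sigma>(1)[OF t] by simp
    qed
    then show ?thesis
      using is_tuple_endp[OF \<nu>(2)[OF i(1)] i(2)] u(2)
      by (intro thresholds_eq[of ?L]) auto
  qed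
  \<comment> \<open>Any formula that contains \<open>y\<close> may supply its span; by
    \<open>same\<close> they all supply the same one.\<close>
  define \<mu> where "\<mu> y = (if y \<in> vars_cq c then \<nu> (SOME i. i < k \<and> y \<in> vars (\<alpha> i)) y else None)" for y
  have some: "(SOME i. i < k \<and> y \<in> vars (\<alpha> i)) < k \<and> y \<in> vars (\<alpha> (SOME i. i < k \<and> y \<in> vars (\<alpha> i)))"
    if "y \<in> vars_cq c" for y
  proof -
    have "\<exists>i. i < k \<and> y \<in> vars (\<alpha> i)"
      using that all unfolding vars_cq_def by blast
    then show ?thesis
      by (rule someI_ex)
  qed
  have \<mu>\<nu>: "\<mu> y = \<nu> i y" if i: "i < k" "y \<in> vars (\<alpha> i)" for i y
  proof -
    have y: "y \<in> vars_cq c"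
      using i \<alpha>(1) unfolding vars_cq_def by blast
    let ?i = "SOME i. i < k \<and> y \<in> vars (\<alpha> i)"
    have si: "?i < k" "y \<in> vars (\<alpha> ?i)"
      using some[OF y] by auto
    have "fst (the (\<nu> ?i y)) = fst (the (\<nu> i y))" "snd (the (\<nu> ?i y)) = snd (the (\<nu> i y))"
      using same[OF si(1) i(1) si(2) i(2), of 0] same[OF si(1) i(1) si(2) i(2), of 1] by (simp_all add: endp_def)
    then have "the (\<nu> ?i y) = the (\<nu> i y)"
      by (rule prod_eqI)
    moreover have "\<nu> ?i y \<noteq> None" "\<nu> i y \<noteq> None"
      using is_tuple_defined[OF \<nu>(2)[OF si(1)] si(2)] is_tuple_defined[OF \<nu>(2)[OF i(1)] i(2)] by auto
    ultimately have "\<nu> ?i y = \<nu> i y"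
      by (cases "\<nu> ?i y"; cases "\<nu> i y") simp_all
    moreover have "\<mu> y = \<nu> ?i y"
      unfolding \<mu>_def if_P[OF y] ..
    ultimately show ?thesis by (rule trans[rotated])
  qed
  have in_atom: "\<exists>i<k. y \<in> vars (\<alpha> i)" if "y \<in> vars_cq c" for y
    using some[OF that] by blast
  have tup: "is_tuple (vars_cq c) s \<mu>"
  proof -
    have "\<exists>sp. \<mu> y = Some sp \<and> is_span s sp" if y: "y \<in> vars_cq c" for y
    proof -
      obtain i where i: "i < k" "y \<in> vars (\<alpha> i)"
        using in_atom[OF y] by blast
      have "\<nu> i y \<noteq> None"
        using is_tuple_defined[OF \<nu>(2)[OF i(1)] i(2)] .
      then show ?thesis
        using \<mu>\<nu>[OF i] is_tuple_endp(3)[OF \<nu>(2)[OF i(1)] i(2)] by auto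
    qed
    moreover have "\<mu> y = None" if "y \<notin> vars_cq c" for y
      using that by (simp add: \<mu>_def)
    ultimately show ?thesis
      unfolding is_tuple_def ran_def dom_def by (smt (verit) Collect_cong mem_Collect_eq option.discI option.inject Collect_mem_eq)
  qed
  have sem: "\<mu> |` vars \<beta> \<in> sem_rgx \<beta> s" if \<beta>: "\<beta> \<in> set (atoms c)" for \<beta>
  proof -
    obtain i where i: "i < k" "\<alpha> i = \<beta>"
      using all[OF \<beta>] by blast
    have "\<mu> |` vars \<beta> = \<nu> i"
    proof
      fix y
      show "(\<mu> |` vars \<beta>) y = \<nu> i y"
      proof (cases "y \<in> vars \<beta>")
        case True
        then show ?thesis
          using \<mu>\<nu>[OF i(1), of y] i(2) by simp
      next
        case False
        then have "\<nu> i y = None"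
          using \<nu>(2)[OF i(1)] i(2) by (metis domIff is_tuple_def)
        then show ?thesis
          using False by simp
      qed
    qed
    then show ?thesis
      using \<nu>(1)[OF i(1)] i(2) by simp
  qed
  have endp: "endp f (the (\<mu> y)) = u"
    if y: "y \<in> vars_cq c" and f: "f \<le> 1" and u: "u < n" "1 \<le> u"
      and want: "\<And>x. spells w x (name y) \<Longrightarrow> want n w A m j v us f x u" for y f u
    using in_atom[OF y] wanted[OF _ _ f u want] \<mu>\<nu> by metis
  have agr: "agrees (header Q) A j v \<mu>"
    unfolding agrees_def
  proof (intro allI impI)
    fix i f :: nat assume i: "i < length (header Q)" and f: "f \<le> 1" and le: "2 * i + f + 1 \<le> j"
    let ?u = "if 2 * i + f + 1 = j then v else A (2 * i + f + 1)"
    have "?u < n" "1 \<le> ?u"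
      using bnd le pos by auto
    then show "endp f (the (\<mu> (header Q ! i))) = ?u"
      using hs i f le by (intro endp want_coord) auto
  qed
  have eq: "subword s (the (\<mu> x)) = subword s (the (\<mu> y))" if xy: "(x, y) \<in> set (eqs c)" for x y
  proof -
    obtain b where b: "b < length (eqs c)" "eqs c ! b = (x, y)"
      using xy by (metis in_set_conv_nth)
    let ?p = "eq_pos name q c b"
    have o: "spells w ?p (name x)" "spells w (?p + length (enc_bits (name x))) (name y)"
      using eq_pos_occ[OF n q b] by auto
    have "eqpair n w q ?p"
      unfolding eqpair_iff[OF n q] using b(1) by blast
    then obtain i where i: "i < m" "us ! (5 * i) = ?p"
      "subeq n w (us ! (5 * i + 1)) (us ! (5 * i + 2)) (us ! (5 * i + 3)) (us ! (5 * i + 4))"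
      using us(3)[OF eq_pos_n[OF n q b(1)]] by blast
    have vars: "x \<in> vars_cq c" "y \<in> vars_cq c"
      using eqs xy by auto
    have un: "us ! (5 * i + 1) < n" "us ! (5 * i + 2) < n" "us ! (5 * i + 3) < n" "us ! (5 * i + 4) < n"
      using i(1) by (intro us_n; simp)+
    have "want n w A m j v us 0 z (us ! (5 * i + 1))" "want n w A m j v us 1 z (us ! (5 * i + 2))"
      if "spells w z (name x)" for z
      unfolding want_def using nameq_iff[OF n o(1)] that i(1,2) by auto
    then have ex: "endp 0 (the (\<mu> x)) = us ! (5 * i + 1)" "endp 1 (the (\<mu> x)) = us ! (5 * i + 2)"
      using us(2)[OF i(1)] un vars(1) by (intro endp; simp)+
    have be: "bitsend n w (us ! (5 * i)) (?p + length (enc_bits (name x)))" "?p + length (enc_bits (name x)) < n"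
      using bitsend_iff[OF n o(1)] i(2) occ_length[OF o(2)] n by (auto simp: enc_bits_def)
    have "want n w A m j v us 0 z (us ! (5 * i + 3))" "want n w A m j v us 1 z (us ! (5 * i + 4))"
      if "spells w z (name y)" for z
    proof -
      have "nameq n w (?p + length (enc_bits (name x))) z"
        using nameq_iff[OF n o(2)] that by simp
      then show "want n w A m j v us 0 z (us ! (5 * i + 3))" "want n w A m j v us 1 z (us ! (5 * i + 4))"
        unfolding want_def using i(1) be by blast+
    qed
    then have ey: "endp 0 (the (\<mu> y)) = us ! (5 * i + 3)" "endp 1 (the (\<mu> y)) = us ! (5 * i + 4)"
      using us(2)[OF i(1)] un vars(2) by (intro endp; simp)+
    have "the (\<mu> x) = (us ! (5 * i + 1), us ! (5 * i + 2))" "the (\<mu> y) = (us ! (5 * i + 3), us ! (5 * i + 4))"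
      using ex ey by (auto simp: endp_def prod_eq_iff)
    then show ?thesis
      using i(3) subeq_iff is_tuple_endp(3)[OF tup vars(1)] is_tuple_endp(3)[OF tup vars(2)] by metis
  qed
  then have "solution c s \<mu>"
    unfolding solution_def using tup sem by blast
  then show ?thesis
    using agr by blast
qed

text \<open>Makes the states of an arbitrary run legal entries of the tuples on which the product is
  defined.\<close>

lemma run_bound:
  assumes o: "occ w a (enc_rgx ltr name \<alpha>)" and a: "a < n" and r: "atom_run ltr name \<alpha> a s \<sigma>" and t: "t \<le> length s"
  shows "fst (\<sigma> t) < n \<and> snd (\<sigma> t) < n"
proof -
  let ?T = "delta ltr name \<alpha> a"
  have edge: "fst p < n \<and> snd p < n \<and> fst p' < n \<and> snd p' < n" if "(p, l, p') \<in> ?T" for p l p'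
    using delta_n[OF n o, of "fst p" "snd p" l "fst p'" "snd p'"] that n by simp
  have sil: "fst p' < n \<and> snd p' < n" if pp: "sil ?T p p'" "fst p < n \<and> snd p < n" for p p'
  proof -
    obtain u where "pth ?T p u p'"
      using pp(1) by (auto simp: sil_def)
    then show ?thesis
      using pp(2) by (induction rule: pth.induct) (use edge in blast)+
  qed
  show ?thesis
    using t
  proof (induction t)
    case 0
    have "sil ?T (a, 0) (\<sigma> 0)"
      using r by (simp add: rn_def)
    then show ?case
      using sil[of "(a, 0)" "\<sigma> 0"] a by simp
  next
    case (Suc t)
    then obtain p where "(\<sigma> t, [Letter (s ! t)], p) \<in> ?T" "sil ?T p (\<sigma> (Suc t))"
      using r unfolding rn_def by (metis Suc_le_lessD)
    then show ?case
      using sil edge by blast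
  qed
qed

lemma accepted_complete:
  assumes sol: "solution c s \<mu>" and agr: "agrees (header Q) A j v \<mu>"
    and hs: "set (header Q) \<subseteq> vars_cq c" and eqs: "\<forall>(x, y)\<in>set (eqs c). x \<in> vars_cq c \<and> y \<in> vars_cq c"
    and len: "length (atoms c) \<le> k" "atoms c \<noteq> []" "length (eqs c) \<le> m"
  shows "accepted n w A k m j v q"
proof -
  let ?L = "length s"
  have L: "length s < length w"
    using off_bound[OF occ_input(2), of "length s"] by simp
  have tup: "is_tuple (vars_cq c) s \<mu>"
    using sol by (simp add: solution_def)
  have endp_n: "endp f (the (\<mu> y)) < n" "1 \<le> endp f (the (\<mu> y))" if "y \<in> vars_cq c" for f y
    using is_tuple_endp(1,2)[OF tup that, of f] L n by auto
  \<comment> \<open>Surplus automata repeat the formula with index 0, which exists because the join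
    is not empty.\<close>
  define l where "l i = (if i < length (atoms c) then i else 0)" for i
  have l: "l i < length (atoms c)" for i
    using len(2) by (auto simp: l_def)
  define as where "as = map (\<lambda>i. atom_pos ltr name q c (l i)) [0..<k]"
  define \<alpha> where "\<alpha> i = atoms c ! l i" for i
  have as: "as ! i = atom_pos ltr name q c (l i)" if "i < k" for i
    using that by (simp add: as_def)
  have \<alpha>: "\<alpha> i \<in> set (atoms c)" "occ w (as ! i) (enc_rgx ltr name (\<alpha> i))" "as ! i < n" if "i < k" for i
    using l[of i] as[OF that] atom_pos_occ[OF n q] atom_pos_n[OF n q] by (auto simp: \<alpha>_def)
  \<comment> \<open>A surplus block points to position 0, where no name starts, so it prescribes
    nothing; the span \<open>(1, 1)\<close> meets the positivity condition.\<close>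
  define U where "U i r = (if i < length (eqs c) then
      [eq_pos name q c i, endp 0 (the (\<mu> (fst (eqs c ! i)))), endp 1 (the (\<mu> (fst (eqs c ! i)))),
       endp 0 (the (\<mu> (snd (eqs c ! i)))), endp 1 (the (\<mu> (snd (eqs c ! i))))] ! r
     else [0, 1, 1, 1, 1] ! r)" for i r :: nat
  define us where "us = map (\<lambda>i. U (i div 5) (i mod 5)) [0..<5 * m]"
  have us: "us ! (5 * i + r) = U i r" if "i < m" "r < 5" for i r
  proof -
    have "5 * i + r < 5 * m"
      using that by simp
    then show ?thesis
      using that(2) by (simp add: us_def)
  qed
  have us0: "us ! (5 * i) = U i 0" if "i < m" for i
    using us[OF that, of 0] by simp
  have eqv: "fst (eqs c ! i) \<in> vars_cq c" "snd (eqs c ! i) \<in> vars_cq c" if "i < length (eqs c)" for i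
    using eqs nth_mem[OF that] by (auto simp: case_prod_beta)
  have Ubound: "U i r < n" "r \<noteq> 0 \<Longrightarrow> 1 \<le> U i r" if "r < 5" for i r
  proof -
    have r: "r = 0 \<or> r = 1 \<or> r = 2 \<or> r = 3 \<or> r = 4"
      using that by auto
    show "U i r < n" "r \<noteq> 0 \<Longrightarrow> 1 \<le> U i r"
      using r endp_n eqv[of i] eq_pos_n[OF n q, of i] n by (auto simp: U_def)
  qed
  have "U (i div 5) (i mod 5) < n" for i
    using Ubound(1)[of "i mod 5"] by simp
  then have ok_us: "ok n (5 * m) us"
    by (auto simp: ok_def us_def)
  have ok_as: "ok n k as"
    using \<alpha>(3) as by (auto simp: ok_def as_def)
  \<comment> \<open>The input starts with a separator or a terminator.\<close>
  have W0: "\<not> (W w 0 0 \<or> W w 0 1 \<or> W w 0 2)"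
    using occ_input(1) by (cases Q) (auto simp: enc_list_def W_def)
  \<comment> \<open>Everything prescribed is an endpoint of the given tuple: row coordinates by
    \<open>agr\<close>, guessed spans by the choice of \<open>us\<close>, and dummy blocks prescribe
    nothing by \<open>W0\<close>.\<close>
  have wanted: "u = endp f (the (\<mu> y))"
    if want: "want n w A m j v us f x u" and y: "spells w x (name y)" and f: "f \<le> 1" for f x u y
    using want y f
  proof (cases rule: want_cases)
    case (1 i)
    then show ?thesis
      using agr f unfolding agrees_def by (metis (no_types, lifting))
  next
    case (2 i)
    have "i < length (eqs c)"
    proof (rule ccontr)
      assume "\<not> i < length (eqs c)"
      then have "us ! (5 * i) = 0"
        using us0[OF 2(1)] by (simp add: U_def)
      then show False
        using nameq_head[OF 2(2)] W0 by simp
    qed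
    note i = this
    have "spells w (eq_pos name q c i) (name (fst (eqs c ! i)))"
      using eq_pos_occ[OF n q i, of "fst (eqs c ! i)" "snd (eqs c ! i)"] by simp
    moreover have "us ! (5 * i) = eq_pos name q c i"
      using us0[OF 2(1)] i by (simp add: U_def)
    ultimately have "y = fst (eqs c ! i)"
      using 2(2) nameq_iff[OF n] spells_name[OF y] by metis
    moreover have "us ! (5 * i + 1 + f) = endp f (the (\<mu> (fst (eqs c ! i))))"
    proof -
      have "f = 0 \<or> f = 1"
        using f by auto
      then show ?thesis
        using us[OF 2(1), of "1 + f"] i by (auto simp: U_def)
    qed
    ultimately show ?thesis
      using 2(3) by simp
  next
    case (3 i z)
    have "i < length (eqs c)"
    proof (rule ccontr)
      assume "\<not> i < length (eqs c)"
      then have "us ! (5 * i) = 0"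
        using us0[OF 3(1)] by (simp add: U_def)
      then show False
        using bitsend_head[OF 3(2)] W0 n by simp
    qed
    note i = this
    have o: "spells w (eq_pos name q c i) (name (fst (eqs c ! i)))"
      "spells w (eq_pos name q c i + length (enc_bits (name (fst (eqs c ! i))))) (name (snd (eqs c ! i)))"
      using eq_pos_occ[OF n q i, of "fst (eqs c ! i)" "snd (eqs c ! i)"] by simp_all
    moreover have "us ! (5 * i) = eq_pos name q c i"
      using us0[OF 3(1)] i by (simp add: U_def)
    ultimately have "z = eq_pos name q c i + length (enc_bits (name (fst (eqs c ! i))))"
      using bitsend_iff[OF n o(1)] 3(2) by simp
    then have "y = snd (eqs c ! i)"
      using 3(3) nameq_iff[OF n o(2)] spells_name[OF y] by simp
    moreover have "us ! (5 * i + 3 + f) = endp f (the (\<mu> (snd (eqs c ! i))))"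
    proof -
      have "f = 0 \<or> f = 1"
        using f by auto
      then show ?thesis
        using us[OF 3(1), of "3 + f"] i unfolding add.assoc by (auto simp: U_def)
    qed
    ultimately show ?thesis
      using 3(4) by simp
  qed
  have "\<exists>\<sigma>. atom_run ltr name (\<alpha> i) (as ! i) s \<sigma> \<and> (\<forall>t\<le>?L. \<forall>f. \<forall>x\<in>vars (\<alpha> i).
     sees ltr name (\<alpha> i) (as ! i) (\<sigma> t) f x \<longleftrightarrow> endp f (the (\<mu> x)) \<le> t + 1)" if i: "i < k" for i
  proof -
    have "\<mu> |` vars (\<alpha> i) \<in> sem_rgx (\<alpha> i) s"
      using sol \<alpha>(1)[OF i] by (simp add: solution_def)
    from sem_run[OF fn[OF \<alpha>(1)[OF i]] this] show ?thesis
      by simp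
  qed
  then obtain \<sigma> where \<sigma>: "\<And>i. i < k \<Longrightarrow> atom_run ltr name (\<alpha> i) (as ! i) s (\<sigma> i)"
    "\<And>i t f x. i < k \<Longrightarrow> t \<le> ?L \<Longrightarrow> x \<in> vars (\<alpha> i) \<Longrightarrow>
       sees ltr name (\<alpha> i) (as ! i) (\<sigma> i t) f x \<longleftrightarrow> endp f (the (\<mu> x)) \<le> t + 1"
    by metis
  \<comment> \<open>Behind the clock, odd entries are the positions and even entries the entry or
    exit bits of the \<open>k\<close> states.\<close>
  define \<Sigma> where "\<Sigma> t = map (\<lambda>r. if r = 0 then t else if (r - 1) mod 2 = 0 then fst (\<sigma> ((r - 1) div 2) t)
      else snd (\<sigma> ((r - 1) div 2) t)) [0..<2 * k + 1]" for t
  have \<Sigma>0: "\<Sigma> t ! 0 = t" for t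
    unfolding \<Sigma>_def by (subst nth_picks) auto
  have \<Sigma>1: "\<Sigma> t ! (2 * i + 1) = fst (\<sigma> i t)" "\<Sigma> t ! (2 * i + 2) = snd (\<sigma> i t)" if "i < k" for t i
  proof -
    have "Suc (2 * i) mod 2 = 1" "Suc (2 * i) div 2 = i"
      by presburger+
    then show "\<Sigma> t ! (2 * i + 1) = fst (\<sigma> i t)" "\<Sigma> t ! (2 * i + 2) = snd (\<sigma> i t)"
      unfolding \<Sigma>_def using that by (subst nth_picks; simp)+
  qed
  have ok_\<Sigma>: "ok n (2 * k + 1) (\<Sigma> t)" if t: "t \<le> ?L" for t
  proof -
    have "t < n"
      using t L n by simp
    moreover have "fst (\<sigma> i t) < n \<and> snd (\<sigma> i t) < n" if "i < k" for i
      using run_bound[OF \<alpha>(2,3)[OF that] \<sigma>(1)[OF that] t] .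
    ultimately show ?thesis
      unfolding ok_def \<Sigma>_def by auto
  qed
  have seenp: "seenp n w (as ! i) f x (\<Sigma> t ! (2 * i + 1)) (\<Sigma> t ! (2 * i + 2)) \<longleftrightarrow> endp f (the (\<mu> y)) \<le> t + 1"
    if "i < k" "spells w x (name y)" "f \<le> 1" "t \<le> ?L" "varin n w (as ! i) x" for i f x t y
  proof -
    have "y \<in> vars (\<alpha> i)"
      using varin_iff[OF n \<alpha>(2)[OF that(1)]] that(5) spells_name[OF that(2)] by blast
    then show ?thesis
      using seenp_iff[OF n \<alpha>(2)[OF that(1)] name that(2,3)] \<sigma>(2)[OF that(1,4)] \<Sigma>1[OF that(1)] by simp
  qed
  have spelled: "\<exists>y. spells w x (name y)" if "varin n w (as ! i) x" "i < k" for i x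
    using varin_iff[OF n \<alpha>(2)[OF that(2)]] that(1) by blast
  have "cons n w A k m j v as us (\<Sigma> t)" if t: "t \<le> ?L" for t
    unfolding cons_def
  proof (intro conjI allI impI; (elim conjE)?)
    fix i i' g x :: nat
    assume i: "i < k" "i' < k" and g: "g \<le> 1" and x: "varin n w (as ! i) x" "varin n w (as ! i') x"
    obtain y where y: "spells w x (name y)"
      using spelled[OF x(1) i(1)] by blast
    show "seenp n w (as ! i) g x (\<Sigma> t ! (2 * i + 1)) (\<Sigma> t ! (2 * i + 2)) =
        seenp n w (as ! i') g x (\<Sigma> t ! (2 * i' + 1)) (\<Sigma> t ! (2 * i' + 2))"
      using seenp[OF i(1) y g t x(1)] seenp[OF i(2) y g t x(2)] by simp
  next
    fix i g x u :: nat
    assume i: "i < k" and g: "g \<le> 1" and x: "varin n w (as ! i) x" and want: "want n w A m j v us g x u"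
    obtain y where y: "spells w x (name y)"
      using spelled[OF x(1) i(1)] by blast
    show "seenp n w (as ! i) g x (\<Sigma> t ! (2 * i + 1)) (\<Sigma> t ! (2 * i + 2)) = (u \<le> Suc (\<Sigma> t ! 0))"
      using seenp[OF i y g t x] wanted[OF want y g] \<Sigma>0 by simp
  qed
  moreover have "atom_run ltr name (\<alpha> i) (as ! i) s (\<lambda>t. (\<Sigma> t ! (2 * i + 1), \<Sigma> t ! (2 * i + 2)))" if "i < k" for i
    using \<sigma>(1)[OF that] \<Sigma>1[OF that] by simp
  ultimately have "\<exists>ys. ok n (2 * k + 1) ys \<and> prod_reach n w A k m j v as us ys \<and>
             ys ! 0 = length s \<and> (\<forall>i<k. ys ! (2 * i + 1) = as ! i \<and> ys ! (2 * i + 2) = 1)"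
    using ok_\<Sigma> \<Sigma>0 \<alpha>(2,3) by (subst prod_reach_runs[of as \<alpha> us]) blast+
  then have acc: "\<exists>L<n. strend n w L \<and> (\<exists>ys. ok n (2 * k + 1) ys \<and> prod_reach n w A k m j v as us ys \<and>
             ys ! 0 = L \<and> (\<forall>i<k. ys ! (2 * i + 1) = as ! i \<and> ys ! (2 * i + 2) = 1))"
    unfolding strend_iff using L n by (intro exI[of _ ?L]) auto
  have cover: "\<exists>i<k. as ! i = a" if "atom n w q a" for a
  proof -
    obtain b where b: "b < length (atoms c)" "a = atom_pos ltr name q c b"
      using \<open>atom n w q a\<close> unfolding atom_iff[OF n q] by blast
    then show ?thesis
      using as[of b] len(1) by (intro exI[of _ b]) (auto simp: l_def)
  qed
  have atoms: "atom n w q (as ! i)" if "i < k" for i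
    unfolding atom_iff[OF n q] using as[OF that] l by blast
  have us_e: "us ! (5 * i + 1) = U i 1" "us ! (5 * i + 2) = U i 2" "us ! (5 * i + 3) = U i 3"
    "us ! (5 * i + 4) = U i 4" if "i < m" for i
    by (rule us[OF that], simp)+
  have us1: "1 \<le> us ! (5 * i + 1) \<and> 1 \<le> us ! (5 * i + 2) \<and> 1 \<le> us ! (5 * i + 3) \<and> 1 \<le> us ! (5 * i + 4)"
    if "i < m" for i
    unfolding us_e[OF that] using Ubound(2) by simp
  have eqp: "\<exists>i<m. us ! (5 * i) = x \<and>
             subeq n w (us ! (5 * i + 1)) (us ! (5 * i + 2)) (us ! (5 * i + 3)) (us ! (5 * i + 4))"
    if "eqpair n w q x" for x
  proof -
    obtain b where b: "b < length (eqs c)" "x = eq_pos name q c b"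
      using \<open>eqpair n w q x\<close> unfolding eqpair_iff[OF n q] by blast
    have bm: "b < m"
      using b(1) len(3) by simp
    have "subword s (the (\<mu> (fst (eqs c ! b)))) = subword s (the (\<mu> (snd (eqs c ! b))))"
      using sol nth_mem[OF b(1)] unfolding solution_def by (auto simp: case_prod_beta)
    moreover have "the (\<mu> z) = (endp 0 (the (\<mu> z)), endp 1 (the (\<mu> z)))" for z
      by (simp add: endp_def)
    ultimately have "subeq n w (U b 1) (U b 2) (U b 3) (U b 4)"
      using b(1) is_tuple_endp(3)[OF tup eqv(1)[OF b(1)]] is_tuple_endp(3)[OF tup eqv(2)[OF b(1)]]
      by (simp add: U_def) (metis subeq_iff)
    moreover have "U b 0 = x"
      using b by (simp add: U_def)
    ultimately show ?thesis
      unfolding us_e[OF bm, symmetric] us0[OF bm, symmetric] using bm by blast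
  qed
  show ?thesis
    unfolding accepted_def using ok_as atoms cover ok_us us1 eqp acc by blast
qed

end

text \<open>The leading 1 fills coordinate 0, so that extendability to the value 1 at coordinate 0
  means that there is an answer at all.\<close>

definition rows :: "nat list set" where
  "rows = {1 # row (header Q) \<mu> | \<mu>. \<mu> \<in> sem_ucq Q s}"

end

lemma length_row [simp]: "length (row ys \<mu>) = 2 * length ys"
  by (induction ys) (auto simp: row_def)

lemma nth_row: "i < length ys \<Longrightarrow> f \<le> 1 \<Longrightarrow> row ys \<mu> ! (2 * i + f) = endp f (the (\<mu> (ys ! i)))"
proof (induction ys arbitrary: i)
  case (Cons y ys)
  then have f: "f = 0 \<or> f = 1" by auto
  show ?case
  proof (cases i)
    case 0
    then show ?thesis
      using f by (auto simp: row_def endp_def)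
  next
    case (Suc i')
    then have "row (y # ys) \<mu> ! (2 * i + f) = row ys \<mu> ! (2 * i' + f)"
      by (simp add: row_def)
    then show ?thesis
      using Cons Suc by simp
  qed
qed simp

lemma coordinate:
  assumes "0 < j" "j < 2 * l + 1"
  obtains i f where "j = 2 * i + f + 1" "i < l" "f \<le> (1 :: nat)"
proof
  show "j = 2 * ((j - 1) div 2) + (j - 1) mod 2 + 1" "(j - 1) div 2 < l" "(j - 1) mod 2 \<le> 1"
    using assms by auto
qed

context input
begin

text \<open>All disjuncts lay out their rows by the header, which lists the output variables of each
  of them; the two directions are soundness and completeness of \<open>accepted\<close>. Beyond the
  end of a row there is no output variable, so both sides fail.\<close>

lemma ext_iff:
  assumes wf: "wf_ucq k m Q" and bnd: "j < n" "v < n" "\<And>i. i < n \<Longrightarrow> A i < n"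
  shows "ext n w A k m j v \<longleftrightarrow> (\<exists>r\<in>rows. j < length r \<and> (\<forall>i<j. r ! i = A i) \<and> r ! j = v)"
proof -
  let ?h = "header Q"
  have cq: "wf_cq c" "length (atoms c) \<le> k" "length (eqs c) \<le> m" "set ?h = set (outs c)"
    "\<And>\<alpha>. \<alpha> \<in> set (atoms c) \<Longrightarrow> functional \<alpha>" "set ?h \<subseteq> vars_cq c" "atoms c \<noteq> []"
    "\<forall>(x, y)\<in>set (eqs c). x \<in> vars_cq c \<and> y \<in> vars_cq c" if c: "c \<in> set Q" for c
  proof -
    show *: "wf_cq c" "length (atoms c) \<le> k" "length (eqs c) \<le> m"
      using wf c by (auto simp: wf_ucq_def)
    show 1: "set ?h = set (outs c)"
      using wf c by (cases Q) (auto simp: wf_ucq_def)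
    show "\<And>\<alpha>. \<alpha> \<in> set (atoms c) \<Longrightarrow> functional \<alpha>" "set ?h \<subseteq> vars_cq c" "atoms c \<noteq> []"
      "\<forall>(x, y)\<in>set (eqs c). x \<in> vars_cq c \<and> y \<in> vars_cq c"
      using *(1) 1 by (auto simp: wf_cq_def)
  qed
  obtain h where h: "\<And>j f x. j < n \<Longrightarrow> outvar n w j f x \<longleftrightarrow> (\<exists>i<length ?h. f \<le> 1 \<and> j = 2 * i + f + 1 \<and> x = h i)"
    "\<And>i. i < length ?h \<Longrightarrow> spells w (h i) (name (?h ! i)) \<and> h i < n"
    using outvar_iff by metis
  have nth: "(1 # row ?h \<mu>) ! (2 * i + f + 1) = endp f (the (\<mu> (?h ! i)))" if "i < length ?h" "f \<le> 1" for i f \<mu>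
    using nth_row[OF that] by simp
  show ?thesis
  proof
    assume e: "ext n w A k m j v"
    then have "\<exists>q<n. disjunct n w q \<and> accepted n w A k m j v q"
      unfolding ext_def by (elim conjE)
    then obtain q where q: "disjunct n w q" "accepted n w A k m j v q"
      by blast
    obtain c where c: "c \<in> set Q" "occ w q (enc_cq ltr name c)"
      using disjunct_occ(1)[OF q(1)] by blast
    have pos: "1 \<le> v" "\<And>i. 0 < i \<Longrightarrow> i < j \<Longrightarrow> 1 \<le> A i"
      using e bnd(1) unfolding ext_def by (elim conjE, force)+
    obtain \<mu> where \<mu>: "solution c s \<mu>" "agrees ?h A j v \<mu>"
      using accepted_sound[OF c(2) cq(5)[OF c(1)] bnd q(2) cq(6,8)[OF c(1)] pos] by blast
    let ?\<nu> = "\<mu> |` set (outs c)"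
    have "?\<nu> \<in> sem_ucq Q s"
      using \<mu>(1) c(1) unfolding sem_ucq_def sem_cq_def solution_def by blast
    then have row: "1 # row ?h ?\<nu> \<in> rows"
      by (auto simp: rows_def)
    have eq: "endp f (the (?\<nu> (?h ! i))) = endp f (the (\<mu> (?h ! i)))" if "i < length ?h" for i f
      using nth_mem[OF that] cq(4)[OF c(1)] by simp
    have j: "j < 2 * length ?h + 1"
      using e h(1)[OF bnd(1)] unfolding ext_def by (elim conjE, force)
    have "(1 # row ?h ?\<nu>) ! i = A i" if ij: "i < j" for i
    proof (cases "i = 0")
      case True
      then show ?thesis
        using e ij unfolding ext_def by (elim conjE, force)
    next
      case False
      then obtain i' f where "i = 2 * i' + f + 1" "i' < length ?h" "f \<le> 1"
        using coordinate[of i "length ?h"] ij j by auto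
      then show ?thesis
        using nth eq \<mu>(2) ij unfolding agrees_def by simp
    qed
    moreover have "(1 # row ?h ?\<nu>) ! j = v"
    proof (cases "j = 0")
      case True
      then show ?thesis
        using e unfolding ext_def by (elim conjE, force)
    next
      case False
      then obtain i' f where "j = 2 * i' + f + 1" "i' < length ?h" "f \<le> 1"
        using coordinate[of j "length ?h"] j by auto
      then show ?thesis
        using nth eq \<mu>(2) unfolding agrees_def by simp
    qed
    ultimately show "\<exists>r\<in>rows. j < length r \<and> (\<forall>i<j. r ! i = A i) \<and> r ! j = v"
      using row j by (intro bexI[of _ "1 # row ?h ?\<nu>"]) auto
  next
    assume "\<exists>r\<in>rows. j < length r \<and> (\<forall>i<j. r ! i = A i) \<and> r ! j = v"
    then obtain \<nu> where \<nu>: "\<nu> \<in> sem_ucq Q s" "j < 2 * length ?h + 1" "\<And>i. i < j \<Longrightarrow> (1 # row ?h \<nu>) ! i = A i"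
      "(1 # row ?h \<nu>) ! j = v"
      by (auto simp: rows_def)
    then obtain c \<mu> where c: "c \<in> set Q" and \<mu>: "solution c s \<mu>" "\<nu> = \<mu> |` set (outs c)"
      unfolding sem_ucq_def sem_cq_def solution_def by blast
    obtain q where q: "q < n" "disjunct n w q" "occ w q (enc_cq ltr name c)"
      using disjunct_occ(2)[OF c] by blast
    have eq: "endp f (the (\<nu> (?h ! i))) = endp f (the (\<mu> (?h ! i)))" if "i < length ?h" for i f
      using nth_mem[OF that] cq(4)[OF c] \<mu>(2) by simp
    have val: "endp f (the (\<mu> (?h ! i))) = (if 2 * i + f + 1 = j then v else A (2 * i + f + 1))"
      if "i < length ?h" "f \<le> 1" "2 * i + f + 1 \<le> j" for i f
      using nth[OF that(1,2), of \<nu>] eq[OF that(1)] \<nu>(3)[of "2 * i + f + 1"] \<nu>(4) that(3) by auto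
    then have agr: "agrees ?h A j v \<mu>"
      unfolding agrees_def by blast
    have acc: "accepted n w A k m j v q"
      by (rule accepted_complete[OF q(3) cq(5)[OF c] bnd \<mu>(1) agr cq(6)[OF c] cq(8)[OF c] cq(2)[OF c] cq(7)[OF c] cq(3)[OF c]])
    have tup: "is_tuple (vars_cq c) s \<mu>"
      using \<mu>(1) by (simp add: solution_def)
    \<comment> \<open>Span endpoints are positive, as the guard of \<open>ext\<close> demands of
      \<open>v\<close> and of the entries of \<open>A\<close> before \<open>j\<close>.\<close>
    have ge: "1 \<le> (1 # row ?h \<nu>) ! i" if il: "i < 2 * length ?h + 1" for i
    proof (cases "i = 0")
      case False
      then obtain i' f where i: "i = 2 * i' + f + 1" "i' < length ?h" "f \<le> 1"
        using coordinate[of i "length ?h"] il by auto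
      then have "?h ! i' \<in> vars_cq c"
        using cq(6)[OF c] nth_mem by blast
      then show ?thesis
        using nth[OF i(2,3)] eq[OF i(2)] i(1) is_tuple_endp(1)[OF tup] by simp
    qed simp
    have guard: "j = 0 \<and> v = 1 \<or> 0 < j \<and> (\<exists>z<n. z = 0 \<and> A z = 1) \<and> 1 \<le> v \<and> (\<exists>f<n. \<exists>x<n. outvar n w j f x)"
    proof (cases "j = 0")
      case True
      then show ?thesis using \<nu>(4) by simp
    next
      case False
      then obtain i f where i: "j = 2 * i + f + 1" "i < length ?h" "f \<le> 1"
        using coordinate[of j "length ?h"] \<nu>(2) by auto
      have "outvar n w j f (h i)"
        using h(1)[OF bnd(1)] i by blast
      moreover have "f < n" "0 < n"
        using i(3) n by auto
      moreover have "A 0 = 1"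
        using \<nu>(3)[of 0] False by simp
      ultimately show ?thesis
        using False h(2)[OF i(2)] ge[of j] \<nu>(2,4) by auto
    qed
    moreover have "\<forall>i<n. 0 < i \<and> i < j \<longrightarrow> 1 \<le> A i"
      using ge \<nu>(2,3) by (metis less_trans)
    moreover have "\<exists>q<n. disjunct n w q \<and> accepted n w A k m j v q"
      using q(1,2) acc by blast
    ultimately show "ext n w A k m j v"
      unfolding ext_def by (intro conjI)
  qed
qed

end

section \<open>Lexicographic successors, delay, input and output\<close>

section \<open>Enumeration in lexicographic order\<close>

text \<open>The flag \<open>b\<close> says that the coordinate to be raised is already behind us, so that \<open>j\<close> is only
  completed greedily.\<close>

definition cand :: "nat \<Rightarrow> ((nat \<Rightarrow> nat) \<Rightarrow> nat \<Rightarrow> nat \<Rightarrow> bool) \<Rightarrow> (nat \<Rightarrow> nat) \<Rightarrow> bool \<Rightarrow> nat \<Rightarrow> nat \<Rightarrow> bool" where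
  "cand n E A b j v \<longleftrightarrow> E A j v \<and> (b \<or> A j < v) \<and>
     (b \<or> (\<forall>j'<n. \<forall>v'<n. j < j' \<and> A j' < v' \<longrightarrow> \<not> E A j' v')) \<and>
     (\<forall>v'<n. v' < v \<and> (b \<or> A j < v') \<longrightarrow> \<not> E A j v')"

lemma less_list_iff:
  fixes xs ys :: "nat list"
  assumes "length xs = length ys"
  shows "xs < ys \<longleftrightarrow> (\<exists>i<length xs. (\<forall>i'<i. xs ! i' = ys ! i') \<and> xs ! i < ys ! i)"
proof -
  have "take i xs = take i ys \<longleftrightarrow> (\<forall>i'<i. xs ! i' = ys ! i')" if "i < length xs" for i
    using that assms by (simp add: list_eq_iff_nth_eq)
  then show ?thesis
    using assms unfolding list_less_def lexord_take_index_conv by auto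
qed

text \<open>Isolates the enumeration from queries: it works with any finite set of rows of one
  length and an oracle \<open>E\<close> for extendable prefixes.\<close>

locale lex_enum =
  fixes R :: "nat list set" and l n :: nat and E :: "(nat \<Rightarrow> nat) \<Rightarrow> nat \<Rightarrow> nat \<Rightarrow> bool"
  assumes length_R: "r \<in> R \<Longrightarrow> length r = l" and R_less: "r \<in> R \<Longrightarrow> i < l \<Longrightarrow> r ! i < n"
    and l: "l \<le> n"
    and E: "j < n \<Longrightarrow> v < n \<Longrightarrow> (\<And>i. i < n \<Longrightarrow> A i < n) \<Longrightarrow>
      E A j v \<longleftrightarrow> (\<exists>r\<in>R. j < length r \<and> (\<forall>i<j. r ! i = A i) \<and> r ! j = v)"
begin

abbreviation "cur A \<equiv> map A [0..<l]"

lemma finite_R: "finite R"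
  by (rule finite_subset[OF _ finite_lists_length_eq[of "{..<n}" l]])
    (use length_R R_less in \<open>auto simp: in_set_conv_nth\<close>)

lemma cur_less: "r \<in> R \<Longrightarrow> cur A < r \<longleftrightarrow> (\<exists>i<l. (\<forall>i'<i. r ! i' = A i') \<and> A i < r ! i)"
  using length_R by (subst less_list_iff) auto

lemma E': "j < n \<Longrightarrow> v < n \<Longrightarrow> (\<And>i. i < n \<Longrightarrow> A i < n) \<Longrightarrow>
    E A j v \<longleftrightarrow> (\<exists>r\<in>R. j < l \<and> (\<forall>i<j. r ! i = A i) \<and> r ! j = v)"
  using E length_R by simp

lemma no_cand:
  assumes "\<forall>r\<in>R. \<not> cur A < r" "j < n" "v < n" "\<And>i. i < n \<Longrightarrow> A i < n"
  shows "\<not> cand n E A False j v"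
  using assms cur_less unfolding cand_def by (auto simp: E')

text \<open>While the row is being replaced by the least larger row \<open>q\<close>, which first differs from it at \<open>J\<close>,
  its coordinates before \<open>j\<close> (or up to \<open>j\<close>, if \<open>q ! j < v\<close>) have been updated already.\<close>

lemma cand_iff:
  assumes q: "q \<in> R" "cur A < q" "\<And>r. r \<in> R \<Longrightarrow> cur A < r \<Longrightarrow> q \<le> r"
    and J: "J < l" "\<And>i. i < J \<Longrightarrow> q ! i = A i" "A J < q ! J"
    and A: "\<And>i. i < n \<Longrightarrow> A i < n" and bnd: "j < n" "v < n"
    and A': "A' = (\<lambda>i. if i < l \<and> (i < j \<or> i = j \<and> q ! j < v) then q ! i else A i)"
  shows "cand n E A' (J < j \<or> J = j \<and> q ! J < v) j v \<longleftrightarrow> j < l \<and> J \<le> j \<and> v = q ! j"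
proof -
  have A'n: "A' i < n" if "i < n" for i
    using A that R_less[OF q(1)] by (simp add: A')
  have le: "\<not> (\<exists>i<l. (\<forall>i'<i. r ! i' = q ! i') \<and> r ! i < q ! i)" if "r \<in> R" "cur A < r" for r
    using q(3)[OF that] less_list_iff[of r q] length_R[OF that(1)] length_R[OF q(1)] by (auto simp: not_le)
  have qn: "q ! i < n" if "i < l" for i
    using R_less[OF q(1) that] .
  show ?thesis
  proof (cases "J < j \<or> J = j \<and> q ! J < v")
    case True
    have pre: "A' i = q ! i" if "i < j" "j < l" for i
      using that by (simp add: A')
    have Eq: "E A' j v' \<longleftrightarrow> (\<exists>r\<in>R. j < l \<and> (\<forall>i<j. r ! i = q ! i) \<and> r ! j = v')" if "v' < n" for v'
      using E'[OF bnd(1) that A'n] pre by (auto; metis)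
    have cand: "cand n E A' True j v \<longleftrightarrow> E A' j v \<and> (\<forall>v'<n. v' < v \<longrightarrow> \<not> E A' j v')"
      by (simp add: cand_def)
    show ?thesis
    proof (cases "j = J")
      \<comment> \<open>Coordinate \<open>J\<close> has its final value by now; that value is
        extendable and smaller than \<open>v\<close>, so minimality rejects
        \<open>v\<close>.\<close>
      case j: True
      then have "E A' j (q ! j)" "q ! j < v"
        using Eq[of "q ! j"] qn[OF J(1)] True q(1) J(1) by auto
      then show ?thesis
        using True j cand bnd(2) by auto
    next
      case False
      then have Jj: "J < j"
        using True by simp
      \<comment> \<open>\<open>q\<close> is least among all larger rows, in particular among those
        that share its first \<open>j\<close> coordinates.\<close>
      have ge: "q ! j \<le> r ! j" if "r \<in> R" "j < l" "\<forall>i<j. r ! i = q ! i" for r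
      proof -
        have "cur A < r"
          using cur_less[OF that(1)] J Jj that(3) by auto
        then show ?thesis
          using le[OF that(1)] that(2,3) by (meson not_less)
      qed
      have "E A' j (q ! j)" if "j < l"
        using Eq[OF qn[OF that]] q(1) that by blast
      moreover have "q ! j \<le> v'" if "E A' j v'" "v' < n" for v'
        using Eq[OF that(2)] that(1) ge by blast
      moreover have "j < l" if "E A' j v"
        using Eq[OF bnd(2)] that by blast
      ultimately have "E A' j v \<and> (\<forall>v'<n. v' < v \<longrightarrow> \<not> E A' j v') \<longleftrightarrow> j < l \<and> v = q ! j"
        using qn by (metis bnd(2) le_neq_implies_less not_less)
      then show ?thesis
        using cand True Jj by auto
    qed
  next
    case False
    then have jJ: "j \<le> J" "J = j \<Longrightarrow> v \<le> q ! J"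
      by auto
    \<comment> \<open>Before \<open>J\<close> the old and the new row agree, so writing coordinates
      of \<open>q\<close> has not changed anything yet.\<close>
    have "A' i = A i" for i
      using jJ J(2)[of i] by (cases "i < J") (auto simp: A')
    then have "A' = A" by blast
    have Eq: "E A j' v' \<longleftrightarrow> (\<exists>r\<in>R. j' < l \<and> (\<forall>i<j'. r ! i = A i) \<and> r ! j' = v')" if "j' < n" "v' < n" for j' v'
      using E'[OF that A] by simp
    have Jn: "J < n" "q ! J < n"
      using J(1) l qn by auto
    have EJ: "E A J (q ! J)"
      using Eq[OF Jn] q(1) J by blast
    \<comment> \<open>A raised prefix that is extendable gives a row above the current one, hence
      not below \<open>q\<close>. So \<open>J\<close> is the last coordinate that can be raised, and
      \<open>q ! J\<close> is its least new value.\<close>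
    have above: "j' \<le> J \<and> (j' = J \<longrightarrow> q ! J \<le> v')" if e: "E A j' v'" "A j' < v'" "j' < n" "v' < n" for j' v'
    proof -
      obtain r where r: "r \<in> R" "j' < l" "\<forall>i<j'. r ! i = A i" "r ! j' = v'"
        using Eq e by blast
      have "cur A < r"
        using cur_less[OF r(1)] r e(2) by blast
      then have no: "\<not> (\<exists>i<l. (\<forall>i'<i. r ! i' = q ! i') \<and> r ! i < q ! i)"
        using le r(1) by blast
      have "\<not> J < j'"
      proof
        assume "J < j'"
        then have "(\<forall>i'<J. r ! i' = q ! i') \<and> r ! J < q ! J"
          using J r(3) by auto
        then show False
          using no J(1) by blast
      qed
      moreover have "q ! J \<le> v'" if "j' = J"
      proof (rule ccontr)
        assume "\<not> q ! J \<le> v'"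
        then have "(\<forall>i'<J. r ! i' = q ! i') \<and> r ! J < q ! J"
          using J r(3,4) that by auto
        then show False
          using no J(1) by blast
      qed
      ultimately show ?thesis by simp
    qed
    have c: "cand n E A False j v \<longleftrightarrow> j = J \<and> v = q ! J"
    proof
      assume c: "cand n E A False j v"
      then have 1: "E A j v" "A j < v"
        and 2: "\<And>j' v'. j' < n \<Longrightarrow> v' < n \<Longrightarrow> j < j' \<Longrightarrow> A j' < v' \<Longrightarrow> \<not> E A j' v'"
        and 3: "\<And>v'. v' < n \<Longrightarrow> v' < v \<Longrightarrow> A j < v' \<Longrightarrow> \<not> E A j v'"
        by (simp_all add: cand_def)
      have "\<not> j < J"
        using 2[OF Jn _ J(3)] EJ by blast
      then have j: "j = J"
        using jJ by simp
      then show "j = J \<and> v = q ! J"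
        using above[OF 1 bnd] jJ(2) by simp
    next
      assume jv: "j = J \<and> v = q ! J"
      have "\<not> E A j' v'" if "j' < n" "v' < n" "j < j'" "A j' < v'" for j' v'
        using above[OF _ that(4,1,2)] that(3) jv by auto
      moreover have "\<not> E A j v'" if "v' < n" "v' < v" "A j < v'" for v'
        using above[OF _ that(3) bnd(1) that(1)] that(2) jv by auto
      ultimately show "cand n E A False j v"
        using EJ J(3) jv by (auto simp: cand_def)
    qed
    have f: "(J < j \<or> J = j \<and> q ! J < v) = False"
      using False by simp
    show ?thesis
      unfolding f \<open>A' = A\<close> c using jJ(1) J(1) by auto
  qed
qed

end

text \<open>The flag fills the whole of array 3, so it is set and tested by loops, without access to
  a cell at a constant index.\<close>

definition found :: "st \<Rightarrow> bool" where
  "found st \<longleftrightarrow> (\<exists>z<sz st. arr st 3 z = 1)"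

definition fill :: "nat \<Rightarrow> st \<Rightarrow> st" where
  "fill c st = fold (\<lambda>z. set_arr 3 z c) [0..<sz st] st"

definition improve :: "nat \<Rightarrow> nat \<Rightarrow> nat \<Rightarrow> nat \<Rightarrow> st \<Rightarrow> st" where
  "improve k m j v st =
     (if cand (sz st) (\<lambda>A. ext (sz st) (wd st) A k m) (arr st 2) (found st) j v
      then fill 1 (set_arr 2 j v st) else st)"

text \<open>A single sweep works in place: \<open>ext\<close> at \<open>j\<close> reads only
  coordinates below \<open>j\<close>, which are final by then, and by \<open>cand_iff\<close> every
  coordinate is written at most once.\<close>

definition successor :: "nat \<Rightarrow> nat \<Rightarrow> st \<Rightarrow> st" where
  "successor k m st =
     fold (\<lambda>j st. fold (\<lambda>v. improve k m j v) [0..<sz st] st) [0..<sz st] (fill 0 st)"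

lemma fold_upt_inv:
  assumes "\<And>v st. v < n \<Longrightarrow> I v st \<Longrightarrow> I (Suc v) (f v st)" "I 0 st"
  shows "I n (fold f [0..<n] st)"
  using assms by (induction n) (auto simp: less_Suc_eq)

lemma fill_simps [simp]:
  "sz (fill c st) = sz st" "wd (fill c st) = wd st" "arr (fill c st) 2 = arr st 2"
  "z < sz st \<Longrightarrow> arr (fill c st) 3 z = c"
proof -
  have "sz (fill c st) = sz st \<and> wd (fill c st) = wd st \<and> arr (fill c st) 2 = arr st 2 \<and>
      (\<forall>z<sz st. arr (fill c st) 3 z = c)"
    unfolding fill_def
    by (rule fold_upt_inv[where I = "\<lambda>i st'. sz st' = sz st \<and> wd st' = wd st \<and> arr st' 2 = arr st 2 \<and>
        (\<forall>z<i. arr st' 3 z = c)"]) (auto simp: set_arr_def less_Suc_eq)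
  then show "sz (fill c st) = sz st" "wd (fill c st) = wd st" "arr (fill c st) 2 = arr st 2"
    "z < sz st \<Longrightarrow> arr (fill c st) 3 z = c"
    by auto
qed

lemma found_fill [simp]: "0 < sz st \<Longrightarrow> found (fill c st) \<longleftrightarrow> c = 1"
  by (auto simp: found_def)

lemma set_arr_simps [simp]:
  "sz (set_arr k i v st) = sz st" "wd (set_arr k i v st) = wd st"
  "arr (set_arr k i v st) k = (arr st k)(i := v)"
  by (simp_all add: set_arr_def)

lemma improve_simps [simp]: "sz (improve k m j v st) = sz st" "wd (improve k m j v st) = wd st"
  by (simp_all add: improve_def)

lemma sz_fold: "(\<And>v st. sz (F v st) = sz st) \<Longrightarrow> sz (fold F xs st) = sz st"
  by (induction xs arbitrary: st) auto

lemma sz_successor [simp]: "sz (successor k m st) = sz st"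
  by (simp add: successor_def sz_fold)

lemma cmd_fill:
  assumes "c \<le> 1" "4 \<le> S"
  shows "cmd S d (\<lambda>st e. fill c st)"
  unfolding fill_def
  by (rule cmd_for[where F = "\<lambda>st z e. set_arr 3 z c st"], rule cmd_set_arr)
    (use assms in \<open>auto intro!: val_const dest: repD(2)\<close>)

lemma D_found: "4 \<le> S \<Longrightarrow> dec S d (\<lambda>st e. found st)"
  unfolding found_def by (rule D_ex, rule D_eq, rule val_arr) (auto intro: val_const)

lemma cmd_improve:
  assumes "4 \<le> S" "j < d" "v < d"
  shows "cmd S d (\<lambda>st e. improve k m (e j) (e v) st)"
  unfolding improve_def cand_def
proof (rule cmd_if)
  show "cmd S d (\<lambda>st e. fill 1 (set_arr 2 (e j) (e v) st))"
    by (rule cmd_seq[where F = "\<lambda>st e. set_arr 2 (e j) (e v) st" and G = "\<lambda>st e. fill 1 st"])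
      (use assms in \<open>auto intro!: cmd_set_arr cmd_fill val_var dest: repD(10)\<close>)
qed (intro cmd_skip D_conj D_disj D_all D_imp D_not D_ext D_found D_less val_var val_arr;
    use assms in simp)+

lemma cmd_successor: "cmd 4 0 (\<lambda>st e. successor k m st)"
  unfolding successor_def
proof (rule cmd_seq[where F = "\<lambda>st e. fill 0 st"
      and G = "\<lambda>st e. fold (\<lambda>j st. fold (\<lambda>v. improve k m j v) [0..<sz st] st) [0..<sz st] st", simplified])
  show "cmd 4 0 (\<lambda>st e. fold (\<lambda>j st. fold (\<lambda>v. improve k m j v) [0..<sz st] st) [0..<sz st] st)"
  proof (rule cmd_for[where F = "\<lambda>st j e. fold (\<lambda>v. improve k m j v) [0..<sz st] st"])
    show "cmd 4 (0 + 2) (\<lambda>st e. fold (improve k m (e 0)) [0..<sz st] st)"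
      by (rule cmd_for[where F = "\<lambda>st v e. improve k m (e 0) v st"])
        (use cmd_improve[of 4 2 4 0 k m] in \<open>simp_all add: numeral_eq_Suc\<close>)
  qed (simp add: sz_fold)
qed (simp add: cmd_fill)

context lex_enum
begin

lemma successor_correct:
  assumes st: "sz st = n" and E_ext: "E = (\<lambda>A. ext n (wd st) A k m)"
    and A: "\<And>i. i < n \<Longrightarrow> arr st 2 i < n" and n: "0 < n"
  shows "wd (successor k m st) = wd st" "\<And>i. i < n \<Longrightarrow> arr (successor k m st) 2 i < n"
    and "found (successor k m st) \<longleftrightarrow> (\<exists>r\<in>R. cur (arr st 2) < r)"
    and "found (successor k m st) \<Longrightarrow> cur (arr (successor k m st) 2) = Min {r \<in> R. cur (arr st 2) < r}"
proof -
  let ?A = "arr st 2" and ?st = "successor k m st"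
  let ?c = "\<lambda>st'. sz st' = n \<and> wd st' = wd st"
  have *: "wd ?st = wd st \<and> (\<forall>i<n. arr ?st 2 i < n) \<and> (found ?st \<longleftrightarrow> (\<exists>r\<in>R. cur ?A < r)) \<and>
      (found ?st \<longrightarrow> cur (arr ?st 2) = Min {r \<in> R. cur ?A < r})"
  proof (cases "\<exists>r\<in>R. cur ?A < r")
    case False
    have "?c ?st \<and> arr ?st 2 = ?A \<and> \<not> found ?st"
      unfolding successor_def st fill_simps
    proof (rule fold_upt_inv[where I = "\<lambda>j st'. ?c st' \<and> arr st' 2 = ?A \<and> \<not> found st'"])
      fix j st' assume j: "j < n" and I: "?c st' \<and> arr st' 2 = ?A \<and> \<not> found st'"
      then have sz': "sz st' = n" by simp
      show "?c (fold (improve k m j) [0..<sz st'] st') \<and> arr (fold (improve k m j) [0..<sz st'] st') 2 = ?A \<and>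
          \<not> found (fold (improve k m j) [0..<sz st'] st')"
        unfolding sz'
      proof (rule fold_upt_inv[where I = "\<lambda>v st'. ?c st' \<and> arr st' 2 = ?A \<and> \<not> found st'"])
        fix v st' assume v: "v < n" and I: "?c st' \<and> arr st' 2 = ?A \<and> \<not> found st'"
        have "\<not> cand n E ?A False j v"
          using False by (intro no_cand j v A) auto
        then show "?c (improve k m j v st') \<and> arr (improve k m j v st') 2 = ?A \<and> \<not> found (improve k m j v st')"
          using I by (simp add: improve_def E_ext)
      qed (use I in auto)
    qed (use st n in auto)
    then show ?thesis
      using False A by auto
  next
    case True
    define q where "q = Min {r \<in> R. cur ?A < r}"
    have fin: "finite {r \<in> R. cur ?A < r}"
      using finite_R by simp
    then have q: "q \<in> R" "cur ?A < q"
      using Min_in[OF fin] True unfolding q_def by blast+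
    have least: "q \<le> r" if "r \<in> R" "cur ?A < r" for r
      unfolding q_def using fin that by simp
    obtain J where J: "J < l" "\<And>i. i < J \<Longrightarrow> q ! i = ?A i" "?A J < q ! J"
      using q cur_less by blast
    \<comment> \<open>\<open>P j v i\<close> says that before the pair \<open>(j, v)\<close> the
      sweep has passed the value \<open>q ! i\<close> at coordinate \<open>i\<close>, so that this
      coordinate is final.\<close>
    define P where "P j v i \<longleftrightarrow> i < l \<and> (i < j \<or> i = j \<and> q ! j < v)" for j v i
    define I where "I j v st' \<longleftrightarrow> ?c st' \<and> (found st' \<longleftrightarrow> P j v J) \<and>
      arr st' 2 = (\<lambda>i. if P j v i then q ! i else ?A i)" for j v st'
    have "I n 0 ?st"
      unfolding successor_def st fill_simps
    proof (rule fold_upt_inv[where I = "\<lambda>j. I j 0"])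
      fix j st' assume j: "j < n" and st': "I j 0 st'"
      then have sz': "sz st' = n" by (simp add: I_def)
      have "I j n (fold (improve k m j) [0..<n] st')"
      proof (rule fold_upt_inv[where I = "\<lambda>v. I j v"])
        fix v st' assume v: "v < n" and I: "I j v st'"
        have c: "cand n E (arr st' 2) (found st') j v \<longleftrightarrow> j < l \<and> J \<le> j \<and> v = q ! j"
        proof -
          have f: "found st' \<longleftrightarrow> J < j \<or> J = j \<and> q ! J < v"
            and a: "arr st' 2 = (\<lambda>i. if i < l \<and> (i < j \<or> i = j \<and> q ! j < v) then q ! i else ?A i)"
            using I J(1) by (auto simp: I_def P_def)
          show ?thesis
            unfolding f by (rule cand_iff[OF q least J A j v a])
        qed
        show "I j (Suc v) (improve k m j v st')"
        proof (cases "j < l \<and> J \<le> j \<and> v = q ! j")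
          case True
          then show ?thesis
            using I c n unfolding I_def improve_def P_def by (auto simp: E_ext fun_eq_iff)
        next
          case False
          have "P j (Suc v) J = P j v J"
            using False J(1) by (auto simp: P_def)
          moreover have "(if P j (Suc v) i then q ! i else ?A i) = (if P j v i then q ! i else ?A i)" for i
            using False J(2) by (auto simp: P_def less_Suc_eq not_le)
          ultimately show ?thesis
            using I c False unfolding I_def improve_def by (auto simp: E_ext)
        qed
      qed (rule st')
      \<comment> \<open>Entries of rows are below \<open>n\<close>, so the end of one inner loop is
        the beginning of the next.\<close>
      moreover have "P j n = P (Suc j) 0"
        using R_less[OF q(1)] by (auto simp: P_def less_Suc_eq fun_eq_iff)
      ultimately show "I (Suc j) 0 (fold (improve k m j) [0..<sz st'] st')"
        unfolding I_def sz' by simp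
    qed (use st n in \<open>simp add: I_def P_def\<close>)
    moreover have "cur (\<lambda>i. if P n 0 i then q ! i else ?A i) = q"
      using length_R[OF q(1)] l by (intro nth_equalityI) (auto simp: P_def)
    ultimately show ?thesis
      using True A R_less[OF q(1)] J(1) l unfolding I_def q_def[symmetric] by (auto simp: P_def)
  qed
  then show "wd ?st = wd st" "\<And>i. i < n \<Longrightarrow> arr ?st 2 i < n" "found ?st \<longleftrightarrow> (\<exists>r\<in>R. cur ?A < r)"
    "found ?st \<Longrightarrow> cur (arr ?st 2) = Min {r \<in> R. cur ?A < r}"
    by auto
qed

end


subsection \<open>Delay\<close>

definition zeros :: "nat option list \<Rightarrow> nat list" where
  "zeros tr = map Suc (filter (\<lambda>t. tr ! t = Some 0) [0..<length tr])"

lemma zeros_append: "zeros (tr @ tr') = zeros tr @ map ((+) (length tr)) (zeros tr')"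
proof -
  have "[0..<length tr + length tr'] = [0..<length tr] @ map ((+) (length tr)) [0..<length tr']"
    using upt_add_eq_append[of 0 "length tr" "length tr'"] map_add_upt[of "length tr" "length tr'"]
    by (simp add: add.commute[of _ "length tr"])
  moreover have "filter (\<lambda>t. (tr @ tr') ! t = Some 0) [0..<length tr] = filter (\<lambda>t. tr ! t = Some 0) [0..<length tr]"
    by (rule filter_cong) (auto simp: nth_append)
  ultimately show ?thesis
    by (simp add: zeros_def filter_map comp_def)
qed

lemma zeros_le: "p \<in> set (zeros tr) \<Longrightarrow> p \<le> length tr"
  by (auto simp: zeros_def)

lemma zeros_Cons: "zeros (x # tr) = (if x = Some 0 then [1] else []) @ map Suc (zeros tr)"
proof -
  have "zeros [x] = (if x = Some 0 then [1] else [])"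
    by (simp add: zeros_def)
  moreover have "zeros ([x] @ tr) = zeros [x] @ map Suc (zeros tr)"
    unfolding zeros_append by simp
  ultimately show ?thesis
    by (simp only: append_Cons append_Nil)
qed

lemma length_zeros: "length (zeros tr) = count_list (outputs tr) 0"
proof (induction tr)
  case (Cons x tr)
  then show ?case
    by (cases x) (auto simp: zeros_Cons)
qed (simp add: zeros_def)

text \<open>\<open>a\<close> is the time of the last answer and \<open>c\<close> the start of the
  current block. A block has exactly one end marker, at an unknown place; so consecutive answers are
  separated by at most the rest of one block and the beginning of the next, hence
  \<open>2 * B\<close>.\<close>

lemma delay:
  assumes "\<And>u. u \<in> set us \<Longrightarrow> length u \<le> B \<and> count_list (outputs u) 0 = 1"
    and t: "length t \<le> B" "outputs t = []" and c: "c \<le> a + B"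
  shows "successively (\<lambda>t t'. t' \<le> t + 2 * B)
    (a # map ((+) c) (zeros (concat us @ t)) @ [c + length (concat us @ t)])"
  using assms(1) c
proof (induction us arbitrary: a c)
  case Nil
  have "zeros t = []"
    using length_zeros[of t] t(2) by simp
  then show ?case
    using t(1) Nil by simp
next
  case (Cons u us)
  have "length (zeros u) = 1"
    using Cons.prems(1)[of u] length_zeros[of u] by simp
  then obtain p where p: "zeros u = [p]"
    by (metis One_nat_def length_0_conv length_Suc_conv)
  have "p \<le> length u" "length u \<le> B"
    using zeros_le[of p u] p Cons.prems(1)[of u] by auto
  then have "c + p \<le> a + 2 * B" "c + length u \<le> c + p + B"
    using Cons.prems(2) by auto
  then show ?case
    using Cons.IH[OF Cons.prems(1), of "c + length u" "c + p"] p
    by (simp add: zeros_append add.assoc comp_def)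
qed


subsection \<open>Reading the input\<close>

text \<open>Symbolic execution of loop-free code, so that register contents come out by rewriting;
  loops get a dummy value and are excluded by \<open>plain\<close>.\<close>

primrec steps :: "prog \<Rightarrow> mem \<Rightarrow> mem" where
  "steps (Prim i) r = fst (eff i (r, []))"
| "steps (c ;; d) r = steps d (steps c r)"
| "steps (Cond x c d) r = (if r x > 0 then steps c r else (steps d r)(0 := 1))"
| "steps (Loop x c) r = r"

primrec plain :: "prog \<Rightarrow> bool" where
  "plain (Prim i) \<longleftrightarrow> jump_free i \<and> (\<forall>j. i \<noteq> Read j \<and> i \<noteq> Print j)"
| "plain (c ;; d) \<longleftrightarrow> plain c \<and> plain d"
| "plain (Cond x c d) \<longleftrightarrow> plain c \<and> plain d"
| "plain (Loop x c) \<longleftrightarrow> False"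

lemma does_plain: "plain c \<Longrightarrow> does c r (steps c r) [] (code_len c)"
proof (induction c arbitrary: r)
  case (Prim i)
  then have "outputs [emit i r] = []"
    by (cases i) auto
  then show ?case
    using does_prim[of i r] Prim by simp
next
  case (Seq c d)
  then show ?case
    using does_seq[of c r "steps c r" "[]" "code_len c" d] by simp
next
  case (Cond x c d)
  show ?case
  proof (cases "r x > 0")
    case True
    then show ?thesis
      using Cond does_cond_pos[of r x c "steps c r" "[]" "code_len c" d] by (auto elim: does_mono)
  next
    case False
    then have eq: "steps (Cond x c d) r = (steps d r)(0 := 1)"
      by (simp add: fun_eq_iff)
    show ?thesis
      unfolding eq using Cond False
      by (intro does_mono[OF does_cond_zero[of r x d "steps d r" "[]" "code_len d" c]]) simp_all
  qed
qed simp

text \<open>The number of list terminators 4 still to come, where a separator 3 in the list of disjuncts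
  announces the three lists of a disjunct.\<close>

definition awaited :: "nat \<Rightarrow> nat \<Rightarrow> nat" where
  "awaited D t = (if t = 4 then D - 1 else if t = 3 \<and> D = 2 then 5 else D)"

text \<open>Register 3 holds the token minus 2, truncated, so 1 stands for token 3 and 2 for token
  4. Register 2 holds the count; on a separator, two predecessors on register 5 recognise the count
  2. \<open>Const 5 0\<close> serves as an empty command.\<close>

definition sort_token :: prog where
  "sort_token =
     Cond 3
       (Prim (Pred 3) ;;
        Cond 3
          (Prim (Pred 3) ;; Cond 3 (Prim (Const 5 0)) (Prim (Pred 2)))
          (Prim (Move 5 2) ;; Prim (Pred 5) ;;
           Cond 5 (Prim (Pred 5) ;; Cond 5 (Prim (Const 5 0)) (Prim (Const 2 5))) (Prim (Const 5 0))))
       (Prim (Const 5 0))"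

lemma sort_token:
  assumes "0 < r 2" "r 3 = t - 2"
  shows "steps sort_token r 2 = awaited (r 2) t" "x \<notin> {0, 2, 3, 5} \<Longrightarrow> steps sort_token r x = r x"
  using assms by (auto simp: sort_token_def awaited_def)

text \<open>Register 4 is the next free address, 1 the size and 6 the number of tokens. The three
  predecessors turn the stored \<open>Suc t\<close> into the \<open>t - 2\<close> that
  \<open>sort_token\<close> expects.\<close>

definition store_token :: prog where
  "store_token = Prim (Succ 3) ;; Prim (Store 4 3) ;; Prim (Succ 4) ;; Prim (Succ 1) ;;
     Prim (Succ 6) ;; Prim (Pred 3) ;; Prim (Pred 3) ;; Prim (Pred 3)"

lemma store_token:
  assumes "10 \<le> r 4"
  shows "steps store_token r = r(r 4 := Suc (r 3), 4 := r 4 + 1, 1 := r 1 + 1, 6 := r 6 + 1, 3 := r 3 - 2)"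
  using assms by (simp add: store_token_def fun_eq_iff)

definition read_token :: prog where
  "read_token = Prim (Read 3) ;; store_token ;; sort_token"

lemma read_token:
  assumes "10 \<le> r 4" "0 < r 2"
  shows "\<exists>tr r'. runs read_token (r, t # w) tr (r', w) \<and> outputs tr = [] \<and> length tr \<le> 40 \<and>
    r' 1 = r 1 + 1 \<and> r' 2 = awaited (r 2) t \<and> r' 4 = r 4 + 1 \<and> r' 6 = r 6 + 1 \<and>
    (\<forall>x\<ge>10. r' x = (if x = r 4 then Suc t else r x))"
proof -
  let ?d = "store_token ;; sort_token"
  have d: "plain ?d" "code_len ?d \<le> 39"
    by (simp_all add: store_token_def sort_token_def)
  let ?r1 = "steps store_token (r(3 := t))"
  let ?r = "steps ?d (r(3 := t))"
  obtain tr where tr: "runs ?d (r(3 := t), w) tr (?r, w)" "outputs tr = []" "length tr \<le> code_len ?d"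
    using does_plain[OF d(1), of "r(3 := t)"] unfolding does_def by blast
  have run: "runs read_token (r, t # w) ([None] @ tr) (?r, w)"
    unfolding read_token_def using tr(1) prim[of "Read 3" "(r, t # w)"] by (intro seq) auto
  have r1: "?r1 = r(3 := t, r 4 := Suc t, 4 := r 4 + 1, 1 := r 1 + 1, 6 := r 6 + 1, 3 := t - 2)"
    using assms(1) by (subst store_token) auto
  have "0 < ?r1 2" "?r1 3 = t - 2"
    using assms unfolding r1 by auto
  note sorted = sort_token[OF this]
  have r1': "?r1 1 = r 1 + 1" "?r1 2 = r 2" "?r1 4 = r 4 + 1" "?r1 6 = r 6 + 1"
    "\<forall>x\<ge>10. ?r1 x = (if x = r 4 then Suc t else r x)"
    using assms(1) unfolding r1 by auto
  have "?r x = ?r1 x" if "x \<notin> {0, 2, 3, 5}" for x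
    using sorted(2)[OF that] by (simp only: steps.simps)
  moreover have "?r 2 = awaited (r 2) t"
    using sorted(1) r1'(2) by (simp only: steps.simps)
  ultimately have "?r 1 = r 1 + 1 \<and> ?r 2 = awaited (r 2) t \<and> ?r 4 = r 4 + 1 \<and> ?r 6 = r 6 + 1 \<and>
      (\<forall>x\<ge>10. ?r x = (if x = r 4 then Suc t else r x))"
    using r1' by (simp del: steps.simps)
  with run show ?thesis
    using tr(2,3) d(2) by (intro exI[of _ "[None] @ tr"] exI[of _ ?r]) (simp del: steps.simps)
qed

lemma read_tokens:
  assumes "foldl awaited (r 2) u = 0" "\<And>u' t u''. u = u' @ t # u'' \<Longrightarrow> 0 < foldl awaited (r 2) u'"
    "10 \<le> r 4"
  shows "\<exists>tr r'. iter 2 read_token (r, u @ w) tr (r', w) \<and> outputs tr = [] \<and> length tr \<le> 41 * length u + 1 \<and>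
    r' 1 = r 1 + length u \<and> r' 6 = r 6 + length u \<and>
    (\<forall>x\<ge>10. r' x = (if r 4 \<le> x \<and> x < r 4 + length u then Suc (u ! (x - r 4)) else r x))"
  using assms
proof (induction u arbitrary: r)
  case Nil
  then show ?case
    using iter_end[of r 2 read_token w] by (intro exI[of _ "[None]"] exI[of _ r]) auto
next
  case (Cons t u)
  have pos: "0 < r 2"
    using Cons.prems(2)[of "[]" t u] by simp
  obtain tr r' where tr: "runs read_token (r, t # u @ w) tr (r', u @ w)" "outputs tr = []" "length tr \<le> 40"
    and r': "r' 1 = r 1 + 1" "r' 2 = awaited (r 2) t" "r' 4 = r 4 + 1" "r' 6 = r 6 + 1"
      "\<forall>x\<ge>10. r' x = (if x = r 4 then Suc t else r x)"
    using read_token[OF Cons.prems(3) pos, of t "u @ w"] by blast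
  have pos': "0 < foldl awaited (r' 2) u'" if "u = u' @ t' # u''" for u' t' u''
    using Cons.prems(2)[of "t # u'" t' u''] that r'(2) by simp
  obtain tr' r'' where tr': "iter 2 read_token (r', u @ w) tr' (r'', w)" "outputs tr' = []"
      "length tr' \<le> 41 * length u + 1"
    and r'': "r'' 1 = r' 1 + length u" "r'' 6 = r' 6 + length u"
      "\<forall>x\<ge>10. r'' x = (if r' 4 \<le> x \<and> x < r' 4 + length u then Suc (u ! (x - r' 4)) else r' x)"
    using Cons.IH[of r'] Cons.prems(1,3) r'(2,3) pos' by auto
  have "iter 2 read_token (r, (t # u) @ w) (None # tr @ tr') (r'', w)"
    using iter_step[of r 2 read_token "t # u @ w" tr "(r', u @ w)" tr' "(r'', w)"] pos tr(1) tr'(1) by simp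
  moreover have "r'' x = (if r 4 \<le> x \<and> x < r 4 + length (t # u) then Suc ((t # u) ! (x - r 4)) else r x)"
    if "10 \<le> x" for x
    using that r'' r' by (auto simp: nth_Cons' Suc_diff_Suc)
  ultimately show ?case
    using tr tr' r' r'' by (intro exI[of _ "None # tr @ tr'"] exI[of _ r'']) auto
qed

lemma foldl_awaited_const: "(\<And>t. t \<in> set u \<Longrightarrow> awaited D t = D) \<Longrightarrow> foldl awaited D u = D"
  by (induction u) auto

lemma awaited_separator: "awaited 2 3 = 5"
  by (simp add: awaited_def)

lemma bits_tokens: "t \<in> set (enc_bits bs) \<Longrightarrow> t \<le> 2"
  by (auto simp: enc_bits_def split: if_splits)

lemma rgx_tokens: "t \<in> set (enc_rgx ltr name \<alpha>) \<Longrightarrow> t \<le> 11 \<and> t \<noteq> 3 \<and> t \<noteq> 4"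
  by (induction \<alpha>) (auto dest: bits_tokens)

text \<open>At \<open>D = 2\<close> a separator announces a disjunct, so this case is excluded. The
  three lists of a disjunct are therefore counted at 5, 4 and 3, and the string at 1.\<close>

lemma foldl_awaited_list:
  assumes "\<And>x t. x \<in> set xs \<Longrightarrow> t \<in> set (f x) \<Longrightarrow> t \<noteq> 3 \<and> t \<noteq> 4" "D \<noteq> 2"
  shows "foldl awaited D (enc_list f xs) = D - 1"
proof -
  have "foldl awaited D (concat (map (\<lambda>x. 3 # f x) xs)) = D"
    using assms by (intro foldl_awaited_const) (force simp: awaited_def split: if_splits)
  then show ?thesis
    by (simp add: enc_list_def awaited_def)
qed

lemma foldl_awaited_cq: "foldl awaited 5 (enc_cq ltr name c) = 2"
proof -
  have *: "foldl awaited 5 (enc_list (\<lambda>x. enc_bits (name x)) (outs c)) = 5 - 1"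
    "foldl awaited 4 (enc_list (\<lambda>(x, y). enc_bits (name x) @ enc_bits (name y)) (eqs c)) = 4 - 1"
    "foldl awaited 3 (enc_list (enc_rgx ltr name) (atoms c)) = 3 - 1"
    by (rule foldl_awaited_list; force dest: bits_tokens rgx_tokens)+
  then show ?thesis
    by (simp add: enc_cq_def)
qed

lemma awaited_end: "foldl awaited 2 (enc_input ltr name Q s) = 0"
proof -
  have "foldl awaited 2 (concat (map (\<lambda>c. 3 # enc_cq ltr name c) Q)) = 2"
    by (induction Q) (simp_all add: awaited_separator foldl_awaited_cq)
  then have "foldl awaited 2 (enc_list (enc_cq ltr name) Q) = 1"
    by (simp add: enc_list_def awaited_def)
  moreover have "foldl awaited 1 (enc_list (\<lambda>a. enc_bits (ltr a)) s) = 1 - 1"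
    by (rule foldl_awaited_list) (force dest: bits_tokens)+
  ultimately show ?thesis
    by (simp add: enc_input_def)
qed

text \<open>The count never becomes 0 early: it would stay 0, but the last token has to lower it.\<close>

lemma awaited_pos:
  assumes "enc_input ltr name Q s = u @ t # v"
  shows "0 < foldl awaited 2 u"
proof (rule ccontr)
  let ?D = "foldl awaited 2 (butlast (enc_input ltr name Q s))"
  assume "\<not> 0 < foldl awaited 2 u"
  moreover have "foldl awaited 0 x = 0" for x
    by (induction x) (auto simp: awaited_def)
  ultimately have "?D = 0"
    using assms by (simp add: butlast_append)
  moreover have "?D = 1"
  proof -
    have "foldl awaited 2 (concat (map (\<lambda>c. 3 # enc_cq ltr name c) Q)) = 2"
      by (induction Q) (simp_all add: awaited_separator foldl_awaited_cq)
    moreover have "foldl awaited 1 (concat (map (\<lambda>a. 3 # enc_bits (ltr a)) s)) = 1"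
      by (rule foldl_awaited_const) (auto simp: awaited_def dest: bits_tokens split: if_splits)
    ultimately show ?thesis
      by (simp add: enc_input_def enc_list_def butlast_append awaited_def)
  qed
  ultimately show False by simp
qed

lemma list_tokens:
  "(\<And>x t. x \<in> set xs \<Longrightarrow> t \<in> set (f x) \<Longrightarrow> t \<le> 11) \<Longrightarrow> t \<in> set (enc_list f xs) \<Longrightarrow> t \<le> 11"
  by (auto simp: enc_list_def split: if_splits)

lemma input_tokens: "t \<in> set (enc_input ltr name Q s) \<Longrightarrow> t \<le> 11"
proof -
  have b: "t \<in> set (enc_bits bs) \<Longrightarrow> t \<le> 11" for t bs
    using bits_tokens[of t bs] by simp
  have "t \<le> 11" if "t \<in> set (enc_cq ltr name c)" for t c
    using that unfolding enc_cq_def set_append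
    by (elim UnE) (erule list_tokens[rotated], auto dest: b rgx_tokens)+
  then show "t \<in> set (enc_input ltr name Q s) \<Longrightarrow> t \<le> 11"
    unfolding enc_input_def set_append by (elim UnE) (erule list_tokens[rotated], auto dest: b)+
qed

text \<open>The base \<open>n\<close> of the addresses is known only after the last token. So the
  word is buffered from address 10 on and afterwards moved to array 1, whose cell \<open>i\<close>
  is at \<open>n + i\<close>.\<close>

definition copy_tokens :: prog where
  "copy_tokens = Prim (Const 4 10) ;; Prim (Move 5 1) ;;
     Loop 6 (Prim (Load 3 4) ;; Prim (Store 5 3) ;; Prim (Succ 4) ;; Prim (Succ 5) ;; Prim (Pred 6))"

text \<open>The hypothesis keeps buffer and target apart, so no token is overwritten before it is
  copied.\<close>

lemma copy_tokens:
  assumes "10 + r 6 \<le> r 1"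
  shows "\<exists>r'. does copy_tokens r r' [] (5 + 6 * r 6) \<and> r' 1 = r 1 \<and>
    (\<forall>x\<ge>r 1. r' x = (if x < r 1 + r 6 then r (10 + (x - r 1)) else r x))"
proof -
  let ?N = "r 6" and ?n = "r 1" and ?r = "r(4 := 10, 5 := r 1)"
  let ?c = "Prim (Load 3 4) ;; Prim (Store 5 3) ;; Prim (Succ 4) ;; Prim (Succ 5) ;; Prim (Pred 6)"
  let ?J = "\<lambda>i \<rho>. \<rho> 1 = ?n \<and> \<rho> 4 = 10 + i \<and> \<rho> 5 = ?n + i \<and> \<rho> 6 = ?N - i \<and>
    (\<forall>x. 10 \<le> x \<longrightarrow> \<rho> x = (if ?n \<le> x \<and> x < ?n + i then r (10 + (x - ?n)) else r x))"
  have "\<exists>r'. does (Loop 6 ?c) ?r r' (concat (map (\<lambda>_. []) [0..<?N])) (3 + ?N * (5 + 1)) \<and> ?J ?N r'"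
  proof (rule does_loop_inv[where J = ?J])
    fix i \<rho> assume i: "i < ?N" and J: "?J i \<rho>"
    have "does ?c \<rho> (steps ?c \<rho>) [] 5"
      by (rule does_plain[THEN does_mono]) simp_all
    moreover have "?J (Suc i) (steps ?c \<rho>)"
      using i J assms by (auto simp: less_Suc_eq)
    ultimately show "\<rho> 6 > 0 \<and> (\<exists>r'. does ?c \<rho> r' [] 5 \<and> ?J (Suc i) r')"
      using i J by (intro conjI exI[of _ "steps ?c \<rho>"]) auto
  qed (use assms in auto)
  then obtain r' where r': "does (Loop 6 ?c) ?r r' [] (3 + ?N * 6)" "?J ?N r'"
    by auto
  have "does copy_tokens r r' [] (1 + (1 + (3 + ?N * 6)))"
    unfolding copy_tokens_def using r'(1)
    by (intro does_seq0[OF does_Const] does_seq0[OF does_Move]) simp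
  then have "does copy_tokens r r' [] (5 + 6 * ?N)"
    by (simp add: mult.commute)
  then show ?thesis
    using r'(2) assms by (intro exI[of _ r']) auto
qed

definition read_input :: "nat \<Rightarrow> prog" where
  "read_input C = Prim (Const 1 C) ;; Prim (Const 4 10) ;; Prim (Const 2 2) ;; Loop 2 read_token ;; copy_tokens"

abbreviation start :: "nat \<Rightarrow> nat list \<Rightarrow> st" where
  "start n w \<equiv> \<lparr>sz = n, wd = w, arr = \<lambda>_ _. 0, rel = \<lambda>_ _. False\<rparr>"

lemma read_input:
  assumes C: "12 \<le> C" and w: "w = enc_input ltr name Q s"
  shows "\<exists>tr r'. runs (read_input C) ((\<lambda>_. 0), w) tr (r', []) \<and> outputs tr = [] \<and>
    length tr \<le> 50 * length w + 20 \<and> rep 4 0 (start (length w + C) w) e r'"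
proof -
  let ?n = "length w + C"
  let ?r = "(\<lambda>_. 0)(1 := C, 4 := 10, 2 := 2, 0 := 1) :: mem"
  obtain tr r1 where tr: "iter 2 read_token (?r, w @ []) tr (r1, [])" "outputs tr = []"
      "length tr \<le> 41 * length w + 1"
    and r1: "r1 1 = ?r 1 + length w" "r1 6 = ?r 6 + length w"
      "\<forall>x\<ge>10. r1 x = (if ?r 4 \<le> x \<and> x < ?r 4 + length w then Suc (w ! (x - ?r 4)) else ?r x)"
    using read_tokens[of ?r w "[]"] awaited_end[of ltr name Q s] awaited_pos[of ltr name Q s] w by auto
  have r1': "r1 1 = ?n" "r1 6 = length w"
    using r1 by auto
  obtain r2 where r2: "does copy_tokens r1 r2 [] (5 + 6 * length w)" "r2 1 = ?n"
      "\<And>x. ?n \<le> x \<Longrightarrow> r2 x = (if x < ?n + length w then r1 (10 + (x - ?n)) else r1 x)"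
    using copy_tokens[of r1] C r1' by auto
  obtain tr2 where tr2: "runs copy_tokens (r1, []) tr2 (r2, [])" "outputs tr2 = []" "length tr2 \<le> 5 + 6 * length w"
    using r2(1) by (auto simp: does_def)
  have loop: "runs (Loop 2 read_token) ((\<lambda>_. 0)(1 := C, 4 := 10, 2 := 2), w) (None # None # tr) (r1, [])"
    using tr(1) by (intro runs_iter.loop) simp
  have "runs (read_input C) ((\<lambda>_. 0), w) ([None] @ [None] @ [None] @ (None # None # tr) @ tr2) (r2, [])"
    unfolding read_input_def
  proof (intro seq)
    show "runs (Prim (Const 1 C)) ((\<lambda>_. 0), w) [None] ((\<lambda>_. 0)(1 := C), w)"
      using prim[of "Const 1 C" "((\<lambda>_. 0), w)"] by simp
    show "runs (Prim (Const 4 10)) ((\<lambda>_. 0)(1 := C), w) [None] ((\<lambda>_. 0)(1 := C, 4 := 10), w)"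
      using prim[of "Const 4 10" "((\<lambda>_. 0)(1 := C), w)"] by simp
    show "runs (Prim (Const 2 2)) ((\<lambda>_. 0)(1 := C, 4 := 10), w) [None]
        ((\<lambda>_. 0)(1 := C, 4 := 10, 2 := 2), w)"
      using prim[of "Const 2 2" "((\<lambda>_. 0)(1 := C, 4 := 10), w)"] by simp
  qed (fact loop tr2(1))+
  moreover have "rep 4 0 (start ?n w) e r2"
  proof -
    \<comment> \<open>Tokens are at most 11, so the shifted ones fit because
      \<open>12 \<le> C\<close>; the cells behind the word were never written.\<close>
    have tok: "r2 (?n + i) = tokv w i \<and> tokv w i \<le> ?n" if "i < ?n" for i
    proof (cases "i < length w")
      case True
      then have "w ! i \<le> 11"
        using input_tokens w nth_mem by blast
      then show ?thesis
        using r2(3)[of "?n + i"] r1(3) True C by (auto simp: tokv_def)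
    next
      case False
      then show ?thesis
        using r2(3)[of "?n + i"] r1(3) C by (auto simp: tokv_def)
    qed
    \<comment> \<open>Arrays 2 and 3 start at \<open>2 * n\<close>, beyond everything written, and
      the memory is zero initially, as \<open>start\<close> demands.\<close>
    have zero: "r2 x = 0" if x: "2 * ?n \<le> x" for x
    proof -
      have "r2 x = r1 x"
        using r2(3)[of x] x by simp
      also have "\<dots> = ?r x"
        using r1(3)[rule_format, of x] x C by simp
      finally show ?thesis
        using x C by simp
    qed
    show ?thesis
      using tok zero r2(2) C unfolding rep_def by (auto simp: hor_def)
  qed
  ultimately show ?thesis
    using tr(2,3) tr2(2,3)
    by (intro exI[of _ "[None] @ [None] @ [None] @ (None # None # tr) @ tr2"] exI[of _ r2]) auto
qed


subsection \<open>Printing\<close>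

text \<open>The predicate \<open>ext\<close> fails beyond the end of a row, so its length need not be stored.\<close>

definition printable :: "nat \<Rightarrow> nat \<Rightarrow> st \<Rightarrow> nat \<Rightarrow> bool" where
  "printable k m st j \<longleftrightarrow> 0 < j \<and> (\<exists>u<sz st. u = arr st 2 j \<and> ext (sz st) (wd st) (arr st 2) k m j u)"

lemma D_printable: "dec 4 2 (\<lambda>st e. printable k m st (e 0))"
  unfolding printable_def
  by (intro D_conj D_ex D_less D_eq D_ext val_const val_var val_arr; simp)

lemma print_row:
  obtains c B n0 where "pb B"
    "\<And>st e r. n0 \<le> sz st \<Longrightarrow> rep 4 0 st e r \<Longrightarrow>
      \<exists>r' e'. does c r r' (concat (map (\<lambda>j. if printable k m st j then [arr st 2 j] else []) [0..<sz st])) (B (sz st)) \<and>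
        rep 4 0 st e' r'"
proof -
  obtain c B n0 where P: "pb B" "\<And>st e r. n0 \<le> sz st \<Longrightarrow> rep 4 2 st e r \<Longrightarrow>
      (\<exists>r'. does c r r' [] (B (sz st)) \<and> r' 2 = of_bool (printable k m st (e 0)) \<and> rep 4 2 st e r')"
    using D_printable[of k m] unfolding dec_def by blast
  have "val 2 (\<lambda>st e. arr st 2 (e 0))"
    by (rule val_arr) auto
  then obtain c' B' n0' where V: "pb B'" "\<And>S st e r. n0' \<le> sz st \<Longrightarrow> rep S 2 st e r \<Longrightarrow>
      (\<exists>r'. does c' r r' [] (B' (sz st)) \<and> r' 3 = arr st 2 (e 0) \<and> same_outside {0, 3, 4, 5} r r')"
    unfolding val_def by blast
  let ?c = "c ;; Cond 2 (c' ;; Prim (Print 3)) (Prim (Const 9 0))"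
  let ?B = "\<lambda>n. B n + B' n + 5"
  let ?out = "\<lambda>st j. if printable k m st j then [arr st 2 j] else []"
  have body: "\<exists>r'. does ?c r r' (?out st (e 0)) (?B (sz st)) \<and> rep 4 2 st e r'"
    if n: "n0 + n0' \<le> sz st" and r: "rep 4 2 st e r" for st e r
  proof -
    obtain r1 where r1: "does c r r1 [] (B (sz st))" "r1 2 = of_bool (printable k m st (e 0))" "rep 4 2 st e r1"
      using P(2)[OF _ r] n by auto
    show ?thesis
    proof (cases "printable k m st (e 0)")
      case True
      obtain r2 where r2: "does c' r1 r2 [] (B' (sz st))" "r2 3 = arr st 2 (e 0)" "same_outside {0, 3, 4, 5} r1 r2"
        using V(2)[OF _ r1(3)] n by auto
      have "rep 4 2 st e r2"
        by (rule rep_scratch[OF r1(3) same_outside_mono[OF r2(3)]]) auto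
      moreover have "does ?c r r2 [r2 3] (B (sz st) + (B' (sz st) + 1 + 1))"
        using r1(2) True by (intro does_seq0[OF r1(1)] does_cond_pos does_seq0[OF r2(1)] does_Print) simp
      ultimately show ?thesis
        using r2(2) True by (intro exI[of _ r2]) (auto elim: does_mono)
    next
      case False
      let ?r = "r1(9 := 0, 0 := 1)"
      have "rep 4 2 st e ?r"
        by (rule rep_scratch[OF r1(3)]) (simp add: same_outside_def)
      moreover have "does ?c r ?r [] (B (sz st) + (1 + 3))"
        using r1(2) False by (intro does_seq0[OF r1(1)] does_cond_zero does_Const) simp
      ultimately show ?thesis
        using False by (intro exI[of _ ?r]) (auto elim: does_mono)
    qed
  qed
  show ?thesis
  proof (rule that[of "\<lambda>n. n * (?B n + 3) + 5" "n0 + n0' + 12" "for_prog 0 ?c"])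
    show "pb (\<lambda>n. n * (?B n + 3) + 5)"
      using P(1) V(1) by (intro pb_add pb_mult pb_const pb_id)
    fix st e r assume n: "n0 + n0' + 12 \<le> sz st" and r: "rep 4 0 st e r"
    have "\<exists>r' st' e'. does (for_prog 0 ?c) r r' (concat (map (?out st) [0..<sz st])) (sz st * (?B (sz st) + 3) + 5) \<and>
        rep 4 0 st' e' r' \<and> sz st' = sz st \<and> st' = st"
    proof (rule for_loop[where Inv = "\<lambda>_ st' _. st' = st"])
      fix v st' e r assume *: "st' = st" "rep 4 (Suc (Suc 0)) st' (push v (push (sz st - 1 - v) e)) r"
      let ?e = "push v (push (sz st - 1 - v) e)"
      have "rep 4 2 st ?e r"
        using * by (simp only: numeral_2_eq_2)
      moreover have "n0 + n0' \<le> sz st"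
        using n by simp
      ultimately obtain r' where "does ?c r r' (?out st (?e 0)) (?B (sz st))" "rep 4 2 st ?e r'"
        using body by blast
      then have "does ?c r r' (?out st v) (?B (sz st))" "rep 4 (Suc (Suc 0)) st ?e r'"
        by (simp_all only: numeral_2_eq_2 nat.case)
      then show "\<exists>r' st'' e'. does ?c r r' (?out st v) (?B (sz st)) \<and>
          rep 4 (Suc (Suc 0)) st'' (push v (push (sz st - 1 - v) e')) r' \<and> sz st'' = sz st \<and> st'' = st"
        by blast
    qed (use r n in auto)
    then show "\<exists>r' e'. does (for_prog 0 ?c) r r' (concat (map (?out st) [0..<sz st])) (sz st * (?B (sz st) + 3) + 5) \<and>
        rep 4 0 st e' r'"
      by blast
  qed
qed


lemma concat_if: "concat (map (\<lambda>j. if P j then [f j] else []) xs) = map f (filter P xs)"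
  by (induction xs) auto

context lex_enum
begin

text \<open>A row of \<open>R\<close> extends all its own prefixes, and nothing is extendable at
  \<open>l\<close> or beyond; so the test finds exactly the coordinates of the row apart from the
  dummy.\<close>

lemma printed_row:
  assumes "sz st = n" "E = (\<lambda>A. ext n (wd st) A k m)" "\<And>i. i < n \<Longrightarrow> arr st 2 i < n" "cur (arr st 2) \<in> R"
  shows "concat (map (\<lambda>j. if printable k m st j then [arr st 2 j] else []) [0..<n]) = tl (cur (arr st 2))"
proof -
  have split: "[0..<n] = [0..<l] @ [l..<n]"
    using l upt_add_eq_append[of 0 l "n - l"] by simp
  have "printable k m st j \<longleftrightarrow> 0 < j \<and> j < l" if "j < n" for j
  proof -
    have "E (arr st 2) j (arr st 2 j) \<longleftrightarrow> j < l"
      using E'[OF that assms(3)[OF that] assms(3)] assms(4) by (auto intro!: bexI[OF _ assms(4)])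
    then show ?thesis
      using assms(1,2) assms(3)[OF that] by (auto simp: printable_def)
  qed
  then have "filter (printable k m st) [0..<n] = filter (\<lambda>j. 0 < j \<and> j < l) [0..<n]"
    by (intro filter_cong) auto
  also have "\<dots> = filter (\<lambda>j. 0 < j \<and> j < l) ([0..<l] @ [l..<n])"
    by (simp only: split)
  also have "\<dots> = filter (\<lambda>j. 0 < j \<and> j < l) [0..<l]"
    by (simp add: filter_empty_conv)
  also have "\<dots> = filter (\<lambda>j. 0 < j) [0..<l]"
    by (rule filter_cong) auto
  also have "\<dots> = [1..<l]"
    by (induction l) auto
  finally show ?thesis
    by (simp add: concat_if map_tl[symmetric] tl_upt)
qed

end

lemma row_inj:
  assumes "row ys \<mu> = row ys \<nu>" "dom \<mu> = set ys" "dom \<nu> = set ys"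
  shows "\<mu> = \<nu>"
proof -
  have "the (\<mu> y) = the (\<nu> y)" if "y \<in> set ys" for y
    using assms(1) that by (induction ys) (auto simp: row_def prod_eq_iff)
  moreover have "\<mu> y = None \<and> \<nu> y = None" if "y \<notin> set ys" for y
    using that assms(2,3) domIff[of y \<mu>] domIff[of y \<nu>] by blast
  moreover have "\<mu> y \<noteq> None \<and> \<nu> y \<noteq> None" if "y \<in> set ys" for y
    using that assms(2,3) domIff[of y \<mu>] domIff[of y \<nu>] by blast
  ultimately show ?thesis
    by (metis ext option.expand)
qed

lemma header_outs:
  assumes "wf_ucq k m Q" "c \<in> set Q"
  shows "set (outs c) \<subseteq> vars_cq c" "set (header Q) = set (outs c)"
proof -
  have "wf_cq c" and eq: "\<And>c'. c' \<in> set Q \<Longrightarrow> set (outs c') = set (outs c)"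
    using assms unfolding wf_ucq_def by blast+
  then show "set (outs c) \<subseteq> vars_cq c"
    by (simp add: wf_cq_def)
  show "set (header Q) = set (outs c)"
    using eq[of "hd Q"] assms(2) by (cases Q) auto
qed

lemma dom_sem_ucq:
  assumes "wf_ucq k m Q" "\<mu> \<in> sem_ucq Q s"
  shows "dom \<mu> = set (header Q)"
proof -
  obtain c \<nu> where c: "c \<in> set Q" "dom \<nu> = vars_cq c" "\<mu> = \<nu> |` set (outs c)"
    using assms(2) unfolding sem_ucq_def sem_cq_def is_tuple_def by blast
  note hdr = header_outs[OF assms(1) c(1)]
  have "dom \<mu> = vars_cq c \<inter> set (outs c)"
    unfolding c(3) dom_restrict c(2) ..
  then show ?thesis
    using hdr by blast
qed

lemma endp_sem_ucq:
  assumes "wf_ucq k m Q" "\<mu> \<in> sem_ucq Q s" "y \<in> set (header Q)"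
  shows "1 \<le> endp f (the (\<mu> y))" "endp f (the (\<mu> y)) \<le> length s + 1"
proof -
  obtain c \<nu> where c: "c \<in> set Q" "is_tuple (vars_cq c) s \<nu>" "\<mu> = \<nu> |` set (outs c)"
    using assms(2) unfolding sem_ucq_def sem_cq_def by blast
  note hdr = header_outs[OF assms(1) c(1)]
  have "y \<in> vars_cq c" "\<mu> y = \<nu> y"
    using hdr assms(3) c(3) by auto
  then show "1 \<le> endp f (the (\<mu> y))" "endp f (the (\<mu> y)) \<le> length s + 1"
    using is_tuple_endp(1,2)[OF c(2), of y f] by simp_all
qed

subsection \<open>The main loop\<close>

text \<open>Printing comes first, so that the loop test after the search decides whether there is
  another row to print.\<close>

definition enum_round :: "prog \<Rightarrow> prog \<Rightarrow> prog \<Rightarrow> prog" where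
  "enum_round cn cf cp = cp ;; Prim (Const 9 0) ;; Prim (Print 9) ;; cn ;; cf"

context lex_enum
begin

text \<open>The trace comes as one block per answer, as \<open>delay\<close> requires, followed by
  the failing loop test \<open>t\<close>. The induction is on the number of rows still to be
  printed, which drops because the successor is the least of the strictly larger rows.\<close>

lemma rounds:
  assumes E_ext: "E = (\<lambda>A. ext n w A k m)" and n: "10 \<le> n"
    and cn: "\<And>st e r. sz st = n \<Longrightarrow> rep 4 0 st e r \<Longrightarrow>
      \<exists>r'. does cn r r' [] Bn \<and> rep 4 0 (successor k m st) e r'"
    and cf: "\<And>st e r. sz st = n \<Longrightarrow> rep 4 0 st e r \<Longrightarrow>
      \<exists>r'. does cf r r' [] Bf \<and> r' 2 = of_bool (found st) \<and> rep 4 0 st e r'"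
    and cp: "\<And>st e r. sz st = n \<Longrightarrow> rep 4 0 st e r \<Longrightarrow>
      \<exists>r' e'. does cp r r' (concat (map (\<lambda>j. if printable k m st j then [arr st 2 j] else []) [0..<n])) Bp \<and>
        rep 4 0 st e' r'"
    and st: "sz st = n" "wd st = w" "\<And>i. i < n \<Longrightarrow> arr st 2 i < n" "found st \<Longrightarrow> cur (arr st 2) \<in> R"
    and r: "rep 4 0 st e r" "r 2 = of_bool (found st)"
  shows "\<exists>us t rs S'. iter 2 (enum_round cn cf cp) (r, x) (concat us @ t) S' \<and> outputs t = [] \<and> length t \<le> 1 \<and>
    map outputs us = map (\<lambda>x. tl x @ [0]) rs \<and> (\<forall>u\<in>set us. length u \<le> Bn + Bf + Bp + 3) \<and>
    distinct rs \<and> set rs = (if found st then {x \<in> R. cur (arr st 2) \<le> x} else {})"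
  using st r
proof (induction "if found st then Suc (card {x \<in> R. cur (arr st 2) < x}) else 0" arbitrary: st e r rule: less_induct)
  case less
  show ?case
  proof (cases "found st")
    case False
    then have "iter 2 (enum_round cn cf cp) (r, x) (concat [] @ [None]) (r, x)"
      using less.prems(6) by (auto intro: iter_end)
    then show ?thesis
      using False by (intro exI[of _ "[]"] exI[of _ "[None]"] exI) auto
  next
    case True
    let ?row = "cur (arr st 2)" and ?st = "successor k m st"
    let ?T = "{x \<in> R. ?row < x}"
    have row: "?row \<in> R"
      using less.prems(4) True by blast
    have suc: "wd ?st = w" "\<And>i. i < n \<Longrightarrow> arr ?st 2 i < n" "found ?st \<longleftrightarrow> (\<exists>r\<in>R. ?row < r)"
      "found ?st \<Longrightarrow> cur (arr ?st 2) = Min ?T"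
      using successor_correct[of st k m] less.prems(1-3) E_ext n by auto
    have sz': "sz ?st = n"
      using less.prems(1) by simp
    have fin: "finite ?T"
      using finite_R by simp
    \<comment> \<open>The rows strictly above the current one are those from its successor on, so
      the induction hypothesis covers exactly the remaining answers.\<close>
    have T: "?T = (if found ?st then {x \<in> R. cur (arr ?st 2) \<le> x} else {})"
    proof (cases "found ?st")
      case f: True
      then have "?T \<noteq> {}"
        using suc(3) by blast
      then have "Min ?T \<in> ?T" "\<And>x. x \<in> ?T \<Longrightarrow> Min ?T \<le> x"
        using Min_in[OF fin] Min_le[OF fin] by blast+
      then show ?thesis
        using f suc(4) by auto
    qed (use suc(3) in auto)
    have row': "cur (arr ?st 2) \<in> R" if "found ?st"
      using Min_in[OF fin] suc(3,4) that by auto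
    obtain r1 e1 where r1: "does cp r r1 (tl ?row) Bp" "rep 4 0 st e1 r1"
      using cp[OF less.prems(1,5)] printed_row[of st k m] less.prems(1-3) row E_ext by auto
    let ?r2 = "r1(9 := 0)"
    have "rep 4 0 st e1 ?r2"
      by (rule rep_scratch[OF r1(2)]) (simp add: same_outside_def)
    then obtain r3 where r3: "does cn ?r2 r3 [] Bn" "rep 4 0 ?st e1 r3"
      using cn[OF less.prems(1)] by blast
    obtain r4 where r4: "does cf r3 r4 [] Bf" "r4 2 = of_bool (found ?st)" "rep 4 0 ?st e1 r4"
      using cf[OF _ r3(2)] less.prems(1) by auto
    have "does (enum_round cn cf cp) r r4 (tl ?row @ [] @ [?r2 9] @ [] @ []) (Bp + (1 + (1 + (Bn + Bf))))"
      unfolding enum_round_def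
      by (rule does_seq[OF r1(1) does_seq[OF does_Const does_seq[OF does_Print does_seq[OF r3(1) r4(1)]]]])
    then obtain u where u: "runs (enum_round cn cf cp) (r, x) u (r4, x)" "outputs u = tl ?row @ [0]"
        "length u \<le> Bp + (1 + (1 + (Bn + Bf)))"
      unfolding does_def by auto
    have smaller: "(if found ?st then Suc (card {x \<in> R. cur (arr ?st 2) < x}) else 0)
        < (if found st then Suc (card ?T) else 0)"
    proof (cases "found ?st")
      case f: True
      have "{x \<in> R. y < x} \<subset> {x \<in> R. y \<le> x}" if "y \<in> R" for y
        using that by auto
      then have "{x \<in> R. cur (arr ?st 2) < x} \<subset> ?T"
        unfolding T if_P[OF f] using row'[OF f] by blast
      then show ?thesis
        unfolding if_P[OF f] if_P[OF True] using psubset_card_mono[OF fin] by (simp only: Suc_less_eq)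
    qed (use True in auto)
    obtain us t rs S' where IH: "iter 2 (enum_round cn cf cp) (r4, x) (concat us @ t) S'" "outputs t = []" "length t \<le> 1"
      "map outputs us = map (\<lambda>x. tl x @ [0]) rs" "\<forall>u\<in>set us. length u \<le> Bn + Bf + Bp + 3"
      "distinct rs" "set rs = ?T"
      using less.hyps[OF smaller sz' suc(1,2) row' r4(3,2)] unfolding T[symmetric] by blast
    \<comment> \<open>The loop test is charged to the block that it starts; with the two steps for
      the end marker this gives the constant 3.\<close>
    have "iter 2 (enum_round cn cf cp) (r, x) (concat ((None # u) # us) @ t) S'"
      using iter_step[of r 2 "enum_round cn cf cp" x u "(r4, x)" "concat us @ t" S'] u(1) IH(1) less.prems(6) True by simp
    moreover have "{x \<in> R. y \<le> x} = insert y {x \<in> R. y < x}" if "y \<in> R" for y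
      using that by (auto simp: le_less)
    note this[OF row]
    then have "set (?row # rs) = (if found st then {x \<in> R. ?row \<le> x} else {})"
      unfolding if_P[OF True] by (simp only: list.set IH(7))
    moreover have "map outputs ((None # u) # us) = map (\<lambda>x. tl x @ [0]) (?row # rs)"
      using IH(4) u(2) by (simp only: list.map outputs_simps)
    moreover have "\<forall>u\<in>set ((None # u) # us). length u \<le> Bn + Bf + Bp + 3"
      using IH(5) u(3) by simp
    moreover have "?row \<notin> set rs"
      unfolding IH(7) by blast
    then have "distinct (?row # rs)"
      using IH(6) by (simp only: distinct.simps simp_thms)
    ultimately show ?thesis
      using IH(2,3) by blast
  qed
qed

end

lemma pb_shift:
  assumes "pb f" shows "pb (\<lambda>n. f (n + c))"
proof -
  obtain p where "\<And>n. f n \<le> poly p n"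
    using assms by (auto simp: pb_def)
  then have "f (n + c) \<le> poly (pcompose p [:c, 1:]) n" for n
    by (simp add: poly_pcompose add.commute)
  then show ?thesis
    unfolding pb_def by blast
qed

lemma row_entries:
  assumes "wf_ucq k m Q" "\<mu> \<in> sem_ucq Q s" "x \<in> set (row (header Q) \<mu>)"
  shows "1 \<le> x \<and> x \<le> length s + 1"
  using assms(3) endp_sem_ucq[OF assms(1,2), of _ 0] endp_sem_ucq[OF assms(1,2), of _ 1]
  by (auto simp: row_def endp_def)

definition enum_prog :: "nat \<Rightarrow> prog \<Rightarrow> prog \<Rightarrow> prog \<Rightarrow> prog" where
  "enum_prog C cn cf cp = read_input C ;; cn ;; cf ;; Loop 2 (enum_round cn cf cp)"

lemma (in input) lex_enum_rows:
  assumes wf: "wf_ucq k m Q"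
  shows "lex_enum rows (2 * length (header Q) + 1) n (\<lambda>A. ext n w A k m)"
proof
  have s: "length s < length w"
    using off_bound[OF occ_input(2), of "length s"] by simp
  fix r assume "r \<in> rows"
  then obtain \<mu> where r: "r = 1 # row (header Q) \<mu>" "\<mu> \<in> sem_ucq Q s"
    by (auto simp: rows_def)
  then show len: "length r = 2 * length (header Q) + 1"
    by simp
  fix i assume "i < 2 * length (header Q) + 1"
  then have "r ! i \<in> set r"
    using len by simp
  then show "r ! i < n"
    using row_entries[OF wf r(2)] r(1) s n by fastforce
next
  show "2 * length (header Q) + 1 \<le> n"
    using header_length n by simp
qed (rule ext_iff[OF wf])

lemma (in input) main_enumerates:
  assumes wf: "wf_ucq k m Q" and C: "n = length w + C" "12 \<le> C"
    and cn: "\<And>st e r. sz st = n \<Longrightarrow> rep 4 0 st e r \<Longrightarrow>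
      \<exists>r'. does cn r r' [] Bn \<and> rep 4 0 (successor k m st) e r'"
    and cf: "\<And>st e r. sz st = n \<Longrightarrow> rep 4 0 st e r \<Longrightarrow>
      \<exists>r'. does cf r r' [] Bf \<and> r' 2 = of_bool (found st) \<and> rep 4 0 st e r'"
    and cp: "\<And>st e r. sz st = n \<Longrightarrow> rep 4 0 st e r \<Longrightarrow>
      \<exists>r' e'. does cp r r' (concat (map (\<lambda>j. if printable k m st j then [arr st 2 j] else []) [0..<n])) Bp \<and>
        rep 4 0 st e' r'"
    and B: "50 * length w + 20 + Bn + Bf + Bp + 3 \<le> B"
  shows "enumerates (compile 0 (enum_prog C cn cf cp)) w (row (header Q)) (sem_ucq Q s) (2 * B)"
proof -
  interpret lex_enum rows "2 * length (header Q) + 1" n "\<lambda>A. ext n w A k m"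
    by (rule lex_enum_rows[OF wf])
  \<comment> \<open>The memory after reading represents the all-zero row, and the first answer is
    its successor.\<close>
  let ?st = "successor k m (start n w)"
  have n10: "10 \<le> n"
    using C by simp
  obtain tr0 r0 where r0: "runs (read_input C) ((\<lambda>_. 0), w) tr0 (r0, [])" "outputs tr0 = []"
      "length tr0 \<le> 50 * length w + 20" "rep 4 0 (start n w) (\<lambda>_. 0) r0"
    using read_input[OF C(2) w] unfolding C(1) by blast
  obtain r1 where r1: "does cn r0 r1 [] Bn" "rep 4 0 ?st (\<lambda>_. 0) r1"
    using cn[OF _ r0(4)] by auto
  obtain r2 where r2: "does cf r1 r2 [] Bf" "r2 2 = of_bool (found ?st)" "rep 4 0 ?st (\<lambda>_. 0) r2"
    using cf[OF _ r1(2)] by auto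
  have suc: "wd ?st = w" "\<And>i. i < n \<Longrightarrow> arr ?st 2 i < n" "found ?st \<longleftrightarrow> (\<exists>r\<in>rows. cur (\<lambda>_. 0) < r)"
      "found ?st \<Longrightarrow> cur (arr ?st 2) = Min {r \<in> rows. cur (\<lambda>_. 0) < r}"
    using successor_correct[of "start n w" k m] n10 by auto
  have pos: "cur (\<lambda>_. 0) < r" if "r \<in> rows" for r
    using that cur_less[OF that, of "\<lambda>_. 0"] by (auto simp: rows_def)
  then have all: "{r \<in> rows. cur (\<lambda>_. 0) < r} = rows"
    by blast
  have least: "cur (arr ?st 2) = Min rows" "rows \<noteq> {}" if "found ?st"
    using suc(3,4) all that by auto
  have rows_st: "(if found ?st then {x \<in> rows. cur (arr ?st 2) \<le> x} else {}) = rows"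
    using least finite_R suc(3) pos by auto
  have r2': "rep 4 0 ?st (\<lambda>_. 0) (r2(0 := 1))"
    by (rule rep_scratch[OF r2(3)]) (simp add: same_outside_def)
  have "\<exists>us t rs S'. iter 2 (enum_round cn cf cp) (r2(0 := 1), []) (concat us @ t) S' \<and> outputs t = [] \<and> length t \<le> 1 \<and>
      map outputs us = map (\<lambda>x. tl x @ [0]) rs \<and> (\<forall>u\<in>set us. length u \<le> Bn + Bf + Bp + 3) \<and>
      distinct rs \<and> set rs = (if found ?st then {x \<in> rows. cur (arr ?st 2) \<le> x} else {})"
  proof (rule rounds[OF refl n10])
    show "cur (arr ?st 2) \<in> rows" if "found ?st"
      using least[OF that] Min_in[OF finite_R] by simp
    show "(r2(0 := 1)) 2 = of_bool (found ?st)"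
      using r2(2) by simp
  qed (fact suc(1,2) r2' | erule (1) cn | erule (1) cf | erule (1) cp | simp)+
  then obtain us t rs S' where it: "iter 2 (enum_round cn cf cp) (r2(0 := 1), []) (concat us @ t) S'"
      "outputs t = []" "length t \<le> 1" "map outputs us = map (\<lambda>x. tl x @ [0]) rs"
      "\<forall>u\<in>set us. length u \<le> Bn + Bf + Bp + 3" "distinct rs" "set rs = rows"
    unfolding rows_st by blast
  obtain tr1 where tr1: "runs cn (r0, []) tr1 (r1, [])" "outputs tr1 = []" "length tr1 \<le> Bn"
    using r1(1) by (auto simp: does_def)
  obtain tr2 where tr2: "runs cf (r1, []) tr2 (r2, [])" "outputs tr2 = []" "length tr2 \<le> Bf"
    using r2(1) by (auto simp: does_def)
  \<comment> \<open>Everything before the first loop test, including the two steps of the entry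
    jump; nothing is printed here.\<close>
  define pre where "pre = tr0 @ tr1 @ tr2 @ [None, None]"
  have run: "runs (enum_prog C cn cf cp) ((\<lambda>_. 0), w) (tr0 @ tr1 @ tr2 @ None # None # (concat us @ t)) S'"
    unfolding enum_prog_def
    by (rule seq[OF r0(1) seq[OF tr1(1) seq[OF tr2(1) runs_iter.loop[OF it(1)]]]])
  then have run: "runs (enum_prog C cn cf cp) ((\<lambda>_. 0), w) (pre @ concat us @ t) S'"
    by (simp add: pre_def)
  have pre: "outputs pre = []" "length pre \<le> B"
    using r0(2,3) tr1(2,3) tr2(2,3) B by (auto simp: pre_def)
  let ?g = "\<lambda>\<mu>. 1 # row (header Q) \<mu>"
  have inj: "inj_on ?g (sem_ucq Q s)"
  proof (rule inj_onI)
    fix \<mu> \<nu> assume *: "\<mu> \<in> sem_ucq Q s" "\<nu> \<in> sem_ucq Q s" "?g \<mu> = ?g \<nu>"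
    show "\<mu> = \<nu>"
      by (rule row_inj[OF _ dom_sem_ucq[OF wf *(1)] dom_sem_ucq[OF wf *(2)]]) (use *(3) in simp)
  qed
  have rows_g: "rows = ?g ` sem_ucq Q s"
    unfolding rows_def by blast
  \<comment> \<open>The rows are decoded to tuples. A tuple is determined by its row because its
    domain is the set of header variables, so the list of tuples is free of repetitions as
    well.\<close>
  define as where "as = map (inv_into (sem_ucq Q s) ?g) rs"
  have rs: "map ?g as = rs"
    unfolding as_def map_map comp_def
  proof (rule map_idI)
    fix x assume "x \<in> set rs"
    then have "x \<in> ?g ` sem_ucq Q s"
      unfolding it(7) rows_g .
    then show "?g (inv_into (sem_ucq Q s) ?g x) = x"
      by (rule f_inv_into_f)
  qed
  have as: "set as = sem_ucq Q s"
    unfolding as_def set_map it(7) rows_g by (rule inv_into_image_cancel[OF inj order.refl])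
  have outs: "map outputs us = map (\<lambda>\<mu>. row (header Q) \<mu> @ [0]) as"
    unfolding it(4) rs[symmetric] by simp
  have "outputs (concat us) = concat (map outputs us)"
    by (induction us) simp_all
  then have out: "outputs (pre @ concat us @ t) = concat (map (\<lambda>\<mu>. row (header Q) \<mu> @ [0]) as)"
    using pre(1) it(2) outs by simp
  \<comment> \<open>Endpoints are positive, so the only 0 printed in a block is its end
    marker.\<close>
  have "count_list (outputs u) 0 = 1" if "u \<in> set us" for u
  proof -
    have "outputs u \<in> (\<lambda>\<mu>. row (header Q) \<mu> @ [0]) ` sem_ucq Q s"
      using that outs as by (metis image_eqI image_set)
    then obtain \<mu> where "\<mu> \<in> sem_ucq Q s" "outputs u = row (header Q) \<mu> @ [0]"
      by blast
    moreover from this have "0 \<notin> set (row (header Q) \<mu>)"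
      using row_entries[OF wf, of \<mu> s 0] by auto
    ultimately show ?thesis
      by (simp add: count_list_0_iff)
  qed
  then have "successively (\<lambda>t t'. t' \<le> t + 2 * B)
      (0 # map ((+) (length pre)) (zeros (concat us @ t)) @ [length pre + length (concat us @ t)])"
    using it(2,3,5) B pre(2) by (intro delay) auto
  moreover have "zeros pre = []"
    using length_zeros[of pre] pre(1) by simp
  ultimately have "successively (\<lambda>t t'. t' \<le> t + 2 * B)
      (0 # zeros (pre @ concat us @ t) @ [length (pre @ concat us @ t)])"
    by (simp add: zeros_append[of pre])
  moreover have "distinct as"
    using it(6) unfolding rs[symmetric] by (simp only: distinct_map)
  ultimately show ?thesis
    unfolding enumerates_def using runs_program[OF run] as out
    by (intro exI[of _ "length (pre @ concat us @ t)"] exI[of _ as]) (simp add: zeros_def outputs_def)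
qed

theorem corollary5p5:
  fixes ltr :: "'a::finite \<Rightarrow> bool list"
    and name :: "'v \<Rightarrow> bool list"
  assumes "card (UNIV :: 'a set) \<ge> 2"
    and "infinite (UNIV :: 'v set)"
    and "inj ltr"
    and "inj name"
  shows "\<forall>m k. \<exists>(P :: ram_program) (p :: nat poly).
    \<forall>(Q :: ('a, 'v) ucq) (s :: 'a list).
      wf_ucq k m Q \<longrightarrow>
      enumerates P (enc_input ltr name Q s) (row (header Q)) (sem_ucq Q s)
        (poly p (length (enc_input ltr name Q s)))"
proof (intro allI)
  fix m k
  obtain cn Bn n1 where cn: "pb Bn" "\<And>st e r. n1 \<le> sz st \<Longrightarrow> rep 4 0 st e r \<Longrightarrow>
      \<exists>r'. does cn r r' [] (Bn (sz st)) \<and> rep 4 0 (successor k m st) e r'"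
    using cmd_successor[of k m] unfolding cmd_def by blast
  obtain cf Bf n2 where cf: "pb Bf" "\<And>st e r. n2 \<le> sz st \<Longrightarrow> rep 4 0 st e r \<Longrightarrow>
      \<exists>r'. does cf r r' [] (Bf (sz st)) \<and> r' 2 = of_bool (found st) \<and> rep 4 0 st e r'"
    using D_found[of 4 0, OF order.refl] unfolding dec_def by blast
  obtain cp Bp n3 where cp: "pb Bp" "\<And>st e r. n3 \<le> sz st \<Longrightarrow> rep 4 0 st e r \<Longrightarrow>
      \<exists>r' e'. does cp r r' (concat (map (\<lambda>j. if printable k m st j then [arr st 2 j] else []) [0..<sz st])) (Bp (sz st)) \<and>
        rep 4 0 st e' r'"
    by (rule print_row[of k m]) (rule that)
  \<comment> \<open>Added to the length of the input, this makes the domain large enough for all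
    three programs and for the tokens, even on short inputs.\<close>
  define C where "C = n1 + n2 + n3 + 12"
  \<comment> \<open>The programs see a domain of size \<open>N + C\<close>, so their bounds enter
    with shifted arguments.\<close>
  let ?B = "\<lambda>N. 50 * N + 20 + Bn (N + C) + Bf (N + C) + Bp (N + C) + 3"
  have "pb (\<lambda>N. 2 * ?B N)"
    by (intro pb_mult pb_add pb_const pb_id pb_shift[OF cn(1)] pb_shift[OF cf(1)] pb_shift[OF cp(1)])
  then obtain p where p: "\<And>N. 2 * ?B N \<le> poly p N"
    unfolding pb_def by blast
  have "enumerates (compile 0 (enum_prog C cn cf cp)) (enc_input ltr name Q s) (row (header Q)) (sem_ucq Q s)
      (poly p (length (enc_input ltr name Q s)))" if wf: "wf_ucq k m Q" for Q :: "('a, 'v) ucq" and s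
  proof -
    let ?w = "enc_input ltr name Q s"
    let ?n = "length ?w + C"
    interpret input ltr name Q s ?w ?n
      using assms(3,4) by unfold_locales (auto simp: C_def)
    have le: "n1 \<le> ?n" "n2 \<le> ?n" "n3 \<le> ?n"
      by (simp_all add: C_def)
    have "enumerates (compile 0 (enum_prog C cn cf cp)) ?w (row (header Q)) (sem_ucq Q s) (2 * ?B (length ?w))"
    proof (rule main_enumerates[OF wf refl])
      show "12 \<le> C"
        by (simp add: C_def)
      fix st e r assume sz: "sz st = ?n" and r: "rep 4 0 st e r"
      show "\<exists>r'. does cn r r' [] (Bn ?n) \<and> rep 4 0 (successor k m st) e r'"
        using cn(2)[OF _ r] le(1) unfolding sz by blast
      show "\<exists>r'. does cf r r' [] (Bf ?n) \<and> r' 2 = of_bool (found st) \<and> rep 4 0 st e r'"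
        using cf(2)[OF _ r] le(2) unfolding sz by blast
      show "\<exists>r' e'. does cp r r' (concat (map (\<lambda>j. if printable k m st j then [arr st 2 j] else []) [0..<?n])) (Bp ?n) \<and>
          rep 4 0 st e' r'"
        using cp(2)[OF _ r] le(3) unfolding sz by blast
    qed simp
    then obtain T as where en: "halts_at (compile 0 (enum_prog C cn cf cp)) ?w T" "distinct as" "set as = sem_ucq Q s"
      "output_tape (compile 0 (enum_prog C cn cf cp)) ?w T = concat (map (\<lambda>a. row (header Q) a @ [0]) as)"
      and delay: "successively (\<lambda>t t'. t' \<le> t + 2 * ?B (length ?w)) (0 # answer_times (compile 0 (enum_prog C cn cf cp)) ?w T @ [T])"
      unfolding enumerates_def by blast
    have "successively (\<lambda>t t'. t' \<le> t + poly p (length ?w)) (0 # answer_times (compile 0 (enum_prog C cn cf cp)) ?w T @ [T])"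
      by (rule successively_mono[OF delay]) (use p[of "length ?w"] in linarith)
    then show ?thesis
      unfolding enumerates_def using en by blast
  qed
  then show "\<exists>(P :: ram_program) (p :: nat poly). \<forall>(Q :: ('a, 'v) ucq) (s :: 'a list). wf_ucq k m Q \<longrightarrow>
      enumerates P (enc_input ltr name Q s) (row (header Q)) (sem_ucq Q s) (poly p (length (enc_input ltr name Q s)))"
    by blast
qed

end
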